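(* Let $m\ge 3$, $1\le s\le m-1$ and $k\in\mathbb{N}_0$. For $t\in\{s-1,s\}$ and $l=0,\dots,k$ let $\mathcal{B}_l^{t,m-1}$ be a Gelfand–Tsetlin basis of $\mathcal{H}_l^t(\mathbb{R}^{m-1})$ (empty if the space is zero). Then $\mathcal{B}_k^{s,m}=\mathcal{B}^+\cup\mathcal{B}^-$ is a Gelfand–Tsetlin basis of $\mathcal{H}_k^s(\mathbb{R}^m)$, where $$\mathcal{B}^+=\mathcal{B}_k^{s,m-1}\cup\bigcup_{j=0}^{\lfloor (k-1)/2\rfloor}\hat X_{2j+1}^{s-1,k-2j-1}\mathcal{B}_{k-2j-1}^{s-1,m-1}\cup\bigcup_{j=0}^{\lfloor (k-2)/2\rfloor}\dot Y_{2j+2}^{s,k-2j-2}\mathcal{B}_{k-2j-2}^{s,m-1},$$ $$\mathcal{B}^-=\mathcal{B}_k^{s-1,m-1}e_m\cup\bigcup_{j=0}^{\lfloor (k-1)/2\rfloor}\dot X_{2j+1}^{s,k-2j-1}\mathcal{B}_{k-2j-1}^{s,m-1}e_m\cup\bigcup_{j=0}^{\lfloor (k-2)/2\rfloor}\hat Y_{2j+2}^{s-1,k-2j-2}\mathcal{B}_{k-2j-2}^{s-1,m-1}e_m .$$ Here $T\mathcal B=\{TP:P\in\mathcal B\}$ and $\mathcal Be_m=\{Pe_m:P\in\mathcal B\}$.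
   Context: $\mathcal{C}\ell_m$ denotes either $\mathbb{R}_{0,m}$ or $\mathbb{C}_m$, the Clifford algebra generated by $e_1,\dots,e_m$ with $e_ie_j+e_je_i=-2\delta_{ij}$, graded into $s$-vector spaces $\mathcal C\ell_m^s$. For a 1-vector $u$ and an $s$-vector $v$, $u\bullet v=\frac12(uv-(-1)^svu)$, $u\wedge v=\frac12(uv+(-1)^svu)$, extended linearly. $\mathcal H^s_k(\mathbb R^m)$ is the space of $k$-homogeneous $\mathcal C\ell_m^s$-valued polynomials $P$ on $\mathbb R^m$ with $\sum_{j=1}^me_j\partial_{x_j}P=0$; $\mathcal H^t_l(\mathbb R^{m-1})$ is defined analogously in the variables $x_1,\dots,x_{m-1}$ with values in $t$-vectors of the subalgebra generated by $e_1,\dots,e_{m-1}$. These spaces are irreducible under the H-action $[H(r)P](\mathbf x)=rP(r^{-1}\mathbf xr)r^{-1}$ of $Pin(m)$ (a double cover of $O(m)$). A Gelfand–Tsetlin basis of such a module: restrict successively to $O(m-1)\supset O(m-2)\supset\dots\supset O(2)$ (where $O(m-i)$ fixes $e_{m-i+1},\dots,e_m$); at each step the decomposition into irreducibles is multiplicity free, giving a decomposition into irreducible $O(2)$-modules, each of which is one-dimensional or splits into two one-dimensional $SO(2)$-weight spaces; a GT basis consists of one nonzero vector from each resulting one-dimensional piece. Notation: $\underline{\mathbf{x}}=\sum_{j=1}^{m-1}x_je_j$; $r=|(\underline{\mathbf x},x_m)|$; $\bar e_m=-e_m$; $C_j^\nu(z)=\sum_{i=0}^{\lfloor j/2\rfloor}\frac{(-1)^i(\nu)_{j-i}}{i!(j-2i)!}(2z)^{j-2i}$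 (Gegenbauer), $(\nu)_n=\nu(\nu+1)\cdots(\nu+n-1)$. For $k,j\in\mathbb N_0$: $X_k^0=1$, and for $j\ge1$, $X_k^j=\mu_k^j r^j\big(C_j^{m/2+k-1}(x_m/r)+\frac{m+2k-2}{m+2k+j-2}C_{j-1}^{m/2+k}(x_m/r)\bar e_m\underline{\mathbf{x}}/r\big)\bar e_m^{\,j}$, $\mu_k^{2l}=(C_{2l}^{m/2+k-1}(0))^{-1}$, $\mu_k^{2l+1}=\frac{m+2k+2l-1}{m+2k-2}(C_{2l}^{m/2+k}(0))^{-1}$. With $c=(s+k)(m-1+2k)^{-1}$, define the operators (acting on $P$ from the left, $(\underline{\mathbf x}\wedge)P=\underline{\mathbf x}\wedge P$, $(\underline{\mathbf x}\bullet)P=\underline{\mathbf x}\bullet P$): $\hat X_j^{s,k}=X_{k+1}^{j-1}(\underline{\mathbf{x}}\wedge)+(1-c)(X_k^j-X_{k+1}^{j-1}\underline{\mathbf{x}})$, $\dot X_j^{s,k}=X_{k+1}^{j-1}(\underline{\mathbf{x}}\bullet)+c(X_k^j-X_{k+1}^{j-1}\underline{\mathbf{x}})$, $\dot Y_{2j+2}^{s,k}=(s+k)X_k^{2j+2}+(2j+2)\dot X_{2j+2}^{s,k}$, $\hat Y_{2j+2}^{s,k}=(m-1-s+k)X_k^{2j+2}+(2j+2)\hat X_{2j+2}^{s,k}$.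
   Formalization: Only the complex Clifford algebra C_m is treated: over R_{0,m} the two-dimensional irreducible O(2)-modules, e.g. the span of e_1 and e_2, have no one-dimensional real SO(2)-weight spaces, so no Gelfand–Tsetlin basis in the stated sense exists there. *)

theory Defs
  imports "HOL-Analysis.Analysis" "HOL-Library.Function_Algebras"
begin

text \<open>Complex Clifford algebra C_m: a multivector is a coefficient function on finite
  index sets S (basis blade e_S, S increasing); for C_m only S \<subseteq> {1..m} is used.\<close>

type_synonym mv = "nat set \<Rightarrow> complex"
text \<open>Clifford-valued functions on R^m; the point x is given by coordinates x 1, ..., x m.\<close>
type_synonym pf = "(nat \<Rightarrow> real) \<Rightarrow> mv"

definition cl_sign :: "nat set \<Rightarrow> nat set \<Rightarrow> complex" where
  "cl_sign S S' = (-1) ^ (card {(i,j). i \<in> S \<and> j \<in> S' \<and> j < i} + card (S \<inter> S'))"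

definition cl_mult :: "nat \<Rightarrow> mv \<Rightarrow> mv \<Rightarrow> mv" where
  "cl_mult n A B = (\<lambda>T. \<Sum>S\<in>Pow {1..n}. \<Sum>S'\<in>Pow {1..n}.
      if (S - S') \<union> (S' - S) = T then cl_sign S S' * A S * B S' else 0)"

definition cl_one :: mv where "cl_one = (\<lambda>S. if S = {} then 1 else 0)"

definition cl_smul :: "complex \<Rightarrow> mv \<Rightarrow> mv" where "cl_smul c A = (\<lambda>S. c * A S)"

fun cl_pow :: "nat \<Rightarrow> mv \<Rightarrow> nat \<Rightarrow> mv" where
  "cl_pow n A 0 = cl_one"
| "cl_pow n A (Suc j) = cl_mult n A (cl_pow n A j)"

definition cl_grade :: "nat \<Rightarrow> mv \<Rightarrow> mv" where
  "cl_grade s v = (\<lambda>S. if card S = s then v S else 0)"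

text \<open>u \<wedge> v and u \<bullet> v for a 1-vector u, extended linearly in v over the grades.\<close>
definition cl_wedge :: "nat \<Rightarrow> mv \<Rightarrow> mv \<Rightarrow> mv" where
  "cl_wedge n u v = (\<lambda>T. \<Sum>s\<in>{0..n}. (1/2) * (cl_mult n u (cl_grade s v) T
        + (-1)^s * cl_mult n (cl_grade s v) u T))"

definition cl_dot :: "nat \<Rightarrow> mv \<Rightarrow> mv \<Rightarrow> mv" where
  "cl_dot n u v = (\<lambda>T. \<Sum>s\<in>{0..n}. (1/2) * (cl_mult n u (cl_grade s v) T
        - (-1)^s * cl_mult n (cl_grade s v) u T))"

definition cl_e :: "nat \<Rightarrow> mv" where "cl_e j = (\<lambda>S. if S = {j} then 1 else 0)"

definition cl_vec :: "nat \<Rightarrow> (nat \<Rightarrow> real) \<Rightarrow> mv" where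
  "cl_vec n u = (\<lambda>S. if card S = 1 \<and> S \<subseteq> {1..n} then complex_of_real (u (the_elem S)) else 0)"

definition cl_to_vec :: "mv \<Rightarrow> nat \<Rightarrow> real" where
  "cl_to_vec v = (\<lambda>i. Re (v {i}))"

definition multi_idx :: "nat \<Rightarrow> nat \<Rightarrow> (nat \<Rightarrow> nat) set" where
  "multi_idx n k = {\<alpha>. (\<forall>i. \<alpha> i \<noteq> 0 \<longrightarrow> i \<in> {1..n}) \<and> sum \<alpha> {1..n} = k}"

definition hom_poly :: "nat \<Rightarrow> nat \<Rightarrow> pf \<Rightarrow> bool" where
  "hom_poly n k P \<longleftrightarrow> (\<exists>c :: (nat \<Rightarrow> nat) \<Rightarrow> nat set \<Rightarrow> complex.
     P = (\<lambda>x S. \<Sum>\<alpha>\<in>multi_idx n k. c \<alpha> S * complex_of_real (\<Prod>i\<in>{1..n}. x i ^ \<alpha> i)))"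

definition pd :: "nat \<Rightarrow> pf \<Rightarrow> pf" where
  "pd j P = (\<lambda>x S. vector_derivative (\<lambda>t::real. P (x(j := t)) S) (at (x j)))"

definition dirac :: "nat \<Rightarrow> pf \<Rightarrow> pf" where
  "dirac n P = (\<lambda>x T. \<Sum>j\<in>{1..n}. cl_mult n (cl_e j) (pd j P x) T)"

definition monog :: "nat \<Rightarrow> nat \<Rightarrow> nat \<Rightarrow> pf set" where
  "monog n s k = {P. hom_poly n k P \<and> (\<forall>x S. P x S \<noteq> 0 \<longrightarrow> S \<subseteq> {1..n} \<and> card S = s)
                   \<and> (\<forall>x. dirac n P x = 0)}"

definition unit_vecs :: "nat \<Rightarrow> (nat \<Rightarrow> real) set" where
  "unit_vecs i = {u. (\<forall>j. u j \<noteq> 0 \<longrightarrow> j \<in> {1..i}) \<and> (\<Sum>j\<in>{1..i}. (u j)^2) = 1}"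

text \<open>Pin(i) (resp. Spin(i)) elements given as products of (an even number of) unit vectors
  in span(e_1,...,e_i).\<close>
definition pin_lists :: "nat \<Rightarrow> (nat \<Rightarrow> real) list set" where
  "pin_lists i = lists (unit_vecs i)"

definition spin_lists :: "nat \<Rightarrow> (nat \<Rightarrow> real) list set" where
  "spin_lists i = {us \<in> lists (unit_vecs i). even (length us)}"

definition cl_prod :: "nat \<Rightarrow> (nat \<Rightarrow> real) list \<Rightarrow> mv" where
  "cl_prod n us = foldr (\<lambda>u A. cl_mult n (cl_vec n u) A) us cl_one"

text \<open>[H(r)P](x) = r P(r^{-1} x r) r^{-1} with r = u_1...u_k, r^{-1} = (-u_k)...(-u_1).\<close>
definition H_act :: "nat \<Rightarrow> (nat \<Rightarrow> real) list \<Rightarrow> pf \<Rightarrow> pf" where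
  "H_act n us P = (\<lambda>x. let r = cl_prod n us; ri = cl_prod n (map (\<lambda>u j. - u j) (rev us)) in
      cl_mult n (cl_mult n r (P (cl_to_vec (cl_mult n (cl_mult n ri (cl_vec n x)) r)))) ri)"

definition psubspace :: "pf set \<Rightarrow> bool" where
  "psubspace W \<longleftrightarrow> 0 \<in> W \<and> (\<forall>P\<in>W. \<forall>Q\<in>W. P + Q \<in> W)
       \<and> (\<forall>c::complex. \<forall>P\<in>W. (\<lambda>x S. c * P x S) \<in> W)"

definition pspan1 :: "pf \<Rightarrow> pf set" where
  "pspan1 v = {(\<lambda>x S. c * v x S) | c::complex. True}"

definition pline :: "pf set \<Rightarrow> bool" where
  "pline L \<longleftrightarrow> (\<exists>v. v \<noteq> 0 \<and> L = pspan1 v)"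

definition invariant :: "nat \<Rightarrow> (nat \<Rightarrow> real) list set \<Rightarrow> pf set \<Rightarrow> bool" where
  "invariant n G W \<longleftrightarrow> (\<forall>us\<in>G. \<forall>P\<in>W. H_act n us P \<in> W)"

definition irred :: "nat \<Rightarrow> (nat \<Rightarrow> real) list set \<Rightarrow> pf set \<Rightarrow> bool" where
  "irred n G W \<longleftrightarrow> psubspace W \<and> W \<noteq> {0} \<and> invariant n G W \<and>
     (\<forall>U. psubspace U \<and> invariant n G U \<and> U \<subseteq> W \<longrightarrow> U = {0} \<or> U = W)"

text \<open>gt_pieces n i W: the one-dimensional pieces obtained from the module W (regarded as a
  Pin(i)-module) by successive restriction to Pin(i-1), ..., Pin(2); at level 2 an irreducible
  O(2)-module is either a line or splits into its SO(2)(=Spin(2))-invariant lines.\<close>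
fun gt_pieces :: "nat \<Rightarrow> nat \<Rightarrow> pf set \<Rightarrow> pf set set" where
  "gt_pieces n 0 W = {}"
| "gt_pieces n (Suc 0) W = {}"
| "gt_pieces n (Suc (Suc 0)) W =
     (if pline W then {W} else {L. pline L \<and> L \<subseteq> W \<and> invariant n (spin_lists 2) L})"
| "gt_pieces n (Suc (Suc (Suc i))) W =
     \<Union> {gt_pieces n (Suc (Suc i)) W' | W'. irred n (pin_lists (Suc (Suc i))) W' \<and> W' \<subseteq> W}"

definition gt_basis :: "nat \<Rightarrow> pf set \<Rightarrow> pf set \<Rightarrow> bool" where
  "gt_basis n V B \<longleftrightarrow> (\<forall>b\<in>B. b \<noteq> 0 \<and> pspan1 b \<in> gt_pieces n n V)
      \<and> (\<forall>L\<in>gt_pieces n n V. \<exists>!b. b \<in> B \<and> b \<in> L)"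

definition gegen :: "nat \<Rightarrow> real \<Rightarrow> real \<Rightarrow> real" where
  "gegen j \<nu> z = (\<Sum>i=0..j div 2. (-1)^i * pochhammer \<nu> (j - i) / (fact i * fact (j - 2*i))
                     * (2*z)^(j - 2*i))"

definition mu :: "nat \<Rightarrow> nat \<Rightarrow> nat \<Rightarrow> real" where
  "mu m k j = (if even j then 1 / gegen j (real m / 2 + real k - 1) 0
               else (real m + 2 * real k + real j - 2) / (real m + 2 * real k - 2)
                      / gegen (j - 1) (real m / 2 + real k) 0)"

definition ulx :: "nat \<Rightarrow> (nat \<Rightarrow> real) \<Rightarrow> mv" where "ulx m x = cl_vec (m - 1) x"
definition ebar :: "nat \<Rightarrow> mv" where "ebar m = cl_smul (-1) (cl_e m)"
definition rad :: "nat \<Rightarrow> (nat \<Rightarrow> real) \<Rightarrow> real" where "rad m x = sqrt (\<Sum>j=1..m. (x j)^2)"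

definition Xp :: "nat \<Rightarrow> nat \<Rightarrow> nat \<Rightarrow> (nat \<Rightarrow> real) \<Rightarrow> mv" where
  "Xp m k j x = (if j = 0 then cl_one else
     (let r = rad m x; z = x m / r in
      cl_mult m
        (cl_smul (complex_of_real (mu m k j * r ^ j))
          (cl_smul (complex_of_real (gegen j (real m / 2 + real k - 1) z)) cl_one
           + cl_smul (complex_of_real ((real m + 2 * real k - 2) / (real m + 2 * real k + real j - 2)
                        * gegen (j - 1) (real m / 2 + real k) z / r))
               (cl_mult m (ebar m) (ulx m x))))
        (cl_pow m (ebar m) j)))"

definition cc :: "nat \<Rightarrow> nat \<Rightarrow> nat \<Rightarrow> real" where
  "cc m s k = (real s + real k) / (real m - 1 + 2 * real k)"

definition hatX :: "nat \<Rightarrow> nat \<Rightarrow> nat \<Rightarrow> nat \<Rightarrow> pf \<Rightarrow> pf" where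
  "hatX m s k j P = (\<lambda>x. cl_mult m (Xp m (k+1) (j-1) x) (cl_wedge m (ulx m x) (P x))
      + cl_smul (complex_of_real (1 - cc m s k))
          (cl_mult m (Xp m k j x) (P x) - cl_mult m (Xp m (k+1) (j-1) x) (cl_mult m (ulx m x) (P x))))"

definition dotX :: "nat \<Rightarrow> nat \<Rightarrow> nat \<Rightarrow> nat \<Rightarrow> pf \<Rightarrow> pf" where
  "dotX m s k j P = (\<lambda>x. cl_mult m (Xp m (k+1) (j-1) x) (cl_dot m (ulx m x) (P x))
      + cl_smul (complex_of_real (cc m s k))
          (cl_mult m (Xp m k j x) (P x) - cl_mult m (Xp m (k+1) (j-1) x) (cl_mult m (ulx m x) (P x))))"

text \<open>dotY m s k j and hatY m s k j stand for the operators with subscript j (= 2j'+2).\<close>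
definition dotY :: "nat \<Rightarrow> nat \<Rightarrow> nat \<Rightarrow> nat \<Rightarrow> pf \<Rightarrow> pf" where
  "dotY m s k j P = (\<lambda>x. cl_smul (complex_of_real (real s + real k)) (cl_mult m (Xp m k j x) (P x))
      + cl_smul (of_nat j) (dotX m s k j P x))"

definition hatY :: "nat \<Rightarrow> nat \<Rightarrow> nat \<Rightarrow> nat \<Rightarrow> pf \<Rightarrow> pf" where
  "hatY m s k j P = (\<lambda>x. cl_smul (complex_of_real (real m - 1 - real s + real k)) (cl_mult m (Xp m k j x) (P x))
      + cl_smul (of_nat j) (hatX m s k j P x))"

definition rmul_em :: "nat \<Rightarrow> pf \<Rightarrow> pf" where
  "rmul_em m P = (\<lambda>x. cl_mult m (P x) (cl_e m))"

end

theory Submission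
  imports Defs
begin

text \<open>Differentiating along \<open>x_m\<close> lowers the index of each of the operators by one, up to a nonzero
  factor, and a monogenic function independent of \<open>x_m\<close> has the form \<open>P + Q e_m\<close>; integrating back,
  induction on the degree shows that the monogenic functions are the direct sum of the images of the
  operators. The operators commute with \<open>Pin(m - 1)\<close> up to a sign, so these images are irreducible by
  induction on \<open>m\<close>. They are pairwise inequivalent: weight vectors for the plane spanned by \<open>e_1, e_2\<close>
  distinguish the degrees, and the product of all axis reflections distinguishes grade \<open>s - 1\<close> from
  grade \<open>s\<close>. Hence they are the only irreducible submodules, and the bases of the summands together
  form a basis.

  Irreducibility under \<open>Pin(m)\<close>: if an invariant subspace does not contain the component coming from
  degree \<open>0\<close> and grade \<open>s\<close>, then each of its elements satisfies \<open>e_m F = -(-1)^s F e_m\<close> on the \<open>x_m\<close>-axis,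
  hence by rotation \<open>x F(x) = -(-1)^s F(x) x\<close> everywhere, and applying the Dirac operator gives \<open>F = 0\<close>.
  So two nonzero invariant subspaces always meet, and the orthogonal complement for the Fischer inner
  product of a proper nonzero one cannot exist.\<close>

section \<open>Clifford multiplication\<close>

text \<open>The shape of the operators is forced by the grade. For \<open>P\<close> monogenic in
  dimension m - 1, the product x P splits into wedge and inner product, in general not monogenic; c
  is the constant for which x wedge P - (1 - c) x P and x . P - c x P are monogenic
  (\<open>dirN_vec_part\<close>). Each operator adds a monogenic extension of one of these to one of
  \<open>P\<close>. Both extensions mix grades, and the normalisation of X together with the weights
  of the two summands makes the terms of the wrong grade cancel (\<open>gt_op_odd_form\<close>,
  \<open>gt_op_even_form\<close>). The sign in the commutation with Pin(m - 1) comes from e_m, which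
  unit vectors orthogonal to it conjugate to - e_m. It must be carried along, and it helps: the
  product of n axis reflections acts on neighbouring grades by scalars with quotient (-1)^(n+1), no
  distinction for odd n, but the signs of the components contribute another (-1)^n.
  \<open>gt_pieces\<close> runs over all irreducible submodules, not over a chosen decomposition, so
  a direct sum of irreducibles would not suffice without inequivalence. Group elements are lists of
  unit vectors; nearly everything is checked for a single one.\<close>

definition Cl :: "nat \<Rightarrow> mv set" where "Cl n = {A. \<forall>S. A S \<noteq> 0 \<longrightarrow> S \<subseteq> {1..n}}"
definition Lam :: "nat \<Rightarrow> nat \<Rightarrow> mv set" where
  "Lam n s = {A. \<forall>S. A S \<noteq> 0 \<longrightarrow> S \<subseteq> {1..n} \<and> card S = s}"

text \<open>The factors over \<open>A \<inter> B\<close> occur twice on the right and square to 1.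
  Applied to signs, this makes \<open>cl_sign\<close> multiplicative in each argument with respect
  to symmetric difference.\<close>

lemma prod_sym_diff:
  fixes f :: "'a \<Rightarrow> complex"
  assumes "finite A" "finite B" "\<And>x. f x * f x = 1"
  shows "prod f (sym_diff A B) = prod f A * prod f B"
proof -
  have 1: "prod f A = prod f (A - B) * prod f (A \<inter> B)"
    by (subst prod.union_disjoint[symmetric]) (use assms in \<open>auto intro!: prod.cong\<close>)
  have 2: "prod f B = prod f (B - A) * prod f (A \<inter> B)"
    by (subst prod.union_disjoint[symmetric]) (use assms in \<open>auto intro!: prod.cong\<close>)
  have 3: "prod f (sym_diff A B) = prod f (A - B) * prod f (B - A)"
    by (rule prod.union_disjoint) (use assms in auto)
  have "prod f (A \<inter> B) * prod f (A \<inter> B) = 1"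
    by (simp flip: prod.distrib add: assms)
  then show ?thesis unfolding 1 2 3 by (simp add: mult_ac)
qed

text \<open>A pair with j < i costs a transposition, a pair with i = j the square of a generator,
  which is -1; together these are the pairs with j \<le> i. As a product over pairs the sign can be
  split in either argument.\<close>

lemma cl_sign_prod:
  assumes "finite S" "finite S'"
  shows "cl_sign S S' = (\<Prod>i\<in>S. \<Prod>j\<in>S'. if j \<le> i then -1 else 1)"
proof -
  have "(\<Prod>i\<in>S. \<Prod>j\<in>S'. if j \<le> i then -1 else (1::complex))
      = (\<Prod>p\<in>S\<times>S'. if snd p \<le> fst p then -1 else 1)"
    by (simp add: prod.cartesian_product case_prod_beta)
  also have "\<dots> = (-1) ^ card (S\<times>S' \<inter> {p. snd p \<le> fst p})"
    using assms by (simp add: prod.If_cases)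
  also have "S\<times>S' \<inter> {p. snd p \<le> fst p} =
      {(i,j). i \<in> S \<and> j \<in> S' \<and> j < i} \<union> (\<lambda>i. (i,i)) ` (S \<inter> S')"
    by auto
  also have "card \<dots> = card {(i,j). i \<in> S \<and> j \<in> S' \<and> j < i} + card ((\<lambda>i. (i,i)) ` (S \<inter> S'))"
  proof (rule card_Un_disjoint)
    show "finite {(i,j). i \<in> S \<and> j \<in> S' \<and> j < i}"
      by (rule finite_subset[of _ "S \<times> S'"]) (use assms in auto)
  qed (use assms in auto)
  also have "card ((\<lambda>i. (i,i)) ` (S \<inter> S')) = card (S \<inter> S')"
    by (rule card_image) (auto simp: inj_on_def)
  finally show ?thesis by (simp add: cl_sign_def)
qed

lemma cl_sign_sym_diff_left:
  assumes "finite S" "finite R" "finite T"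
  shows "cl_sign (sym_diff S R) T = cl_sign S T * cl_sign R T"
proof -
  have *: "(\<Prod>j\<in>T. if j \<le> i then -1 else (1::complex)) * (\<Prod>j\<in>T. if j \<le> i then -1 else 1) = 1" for i
    by (simp flip: prod.distrib) (auto intro: prod.neutral)
  have "finite (sym_diff S R)" using assms by auto
  then show ?thesis
    using prod_sym_diff[OF assms(1,2) *] by (simp only: cl_sign_prod assms)
qed

lemma cl_sign_sym_diff_right:
  assumes "finite S" "finite R" "finite T"
  shows "cl_sign T (sym_diff S R) = cl_sign T S * cl_sign T R"
proof -
  have *: "(\<Prod>j\<in>sym_diff S R. if j \<le> i then -1 else (1::complex))
      = (\<Prod>j\<in>S. if j \<le> i then -1 else 1) * (\<Prod>j\<in>R. if j \<le> i then -1 else 1)" for i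
    by (rule prod_sym_diff) (use assms in auto)
  have "finite (sym_diff S R)" using assms by auto
  then show ?thesis
    using assms by (simp only: cl_sign_prod assms * prod.distrib)
qed

text \<open>Given \<open>T\<close> and \<open>S\<close>, only \<open>S' = sym_diff S T\<close>
  contributes to the inner sum, so the double sum becomes a single one.\<close>

lemma cl_mult_apply:
  assumes "T \<subseteq> {1..n}"
  shows "cl_mult n A B T = (\<Sum>S\<in>Pow {1..n}. cl_sign S (sym_diff S T) * A S * B (sym_diff S T))"
  unfolding cl_mult_def
proof (rule sum.cong[OF refl])
  fix S assume S: "S \<in> Pow {1..n}"
  have "(\<Sum>S'\<in>Pow {1..n}. if sym_diff S S' = T then cl_sign S S' * A S * B S' else 0)
      = (\<Sum>S'\<in>Pow {1..n}. if S' = sym_diff S T then cl_sign S S' * A S * B S' else 0)"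
    by (rule sum.cong[OF refl]) (auto intro!: if_cong)
  also have "\<dots> = cl_sign S (sym_diff S T) * A S * B (sym_diff S T)"
    using S assms by (auto simp: sum.delta)
  finally show "(\<Sum>S'\<in>Pow {1..n}. if sym_diff S S' = T then cl_sign S S' * A S * B S' else 0)
     = cl_sign S (sym_diff S T) * A S * B (sym_diff S T)" .
qed

lemma cl_mult_outside: "\<not> T \<subseteq> {1..n} \<Longrightarrow> cl_mult n A B T = 0"
  unfolding cl_mult_def by (intro sum.neutral ballI) auto

lemma cl_mult_in_Cl [simp]: "cl_mult n A B \<in> Cl n"
  unfolding Cl_def using cl_mult_outside[of _ n A B] by blast

lemma sym_diff_cancel: "sym_diff S (sym_diff S T) = T" by auto

lemma sum_sym_diff_reindex:
  assumes "S \<subseteq> X"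
  shows "(\<Sum>R\<in>Pow X. f R) = (\<Sum>Q\<in>Pow X. f (sym_diff S Q))"
  by (rule sum.reindex_bij_witness[where i = "sym_diff S" and j = "sym_diff S"])
    (use assms in \<open>auto simp: sym_diff_cancel\<close>)

text \<open>\<open>cl_sign\<close> is a bicharacter of the group of finite sets under symmetric
  difference, hence a 2-cocycle; this is what associativity of such a twisted product amounts
  to.\<close>

lemma cl_mult_assoc: "cl_mult n (cl_mult n A B) C = cl_mult n A (cl_mult n B C)"
proof
  fix T
  show "cl_mult n (cl_mult n A B) C T = cl_mult n A (cl_mult n B C) T"
  proof (cases "T \<subseteq> {1..n}")
    case T: True
    let ?P = "Pow {1..n}"
    have "cl_mult n (cl_mult n A B) C T
        = (\<Sum>R\<in>?P. \<Sum>S\<in>?P. cl_sign R (sym_diff R T) * (cl_sign S (sym_diff S R) * A S * B (sym_diff S R)) * C (sym_diff R T))"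
      unfolding cl_mult_apply[OF T]
    proof (rule sum.cong[OF refl])
      fix R assume "R \<in> ?P"
      then have R: "R \<subseteq> {1..n}" by blast
      show "cl_sign R (sym_diff R T) * cl_mult n A B R * C (sym_diff R T)
        = (\<Sum>S\<in>?P. cl_sign R (sym_diff R T) * (cl_sign S (sym_diff S R) * A S * B (sym_diff S R)) * C (sym_diff R T))"
        by (simp only: cl_mult_apply[OF R] sum_distrib_left sum_distrib_right)
    qed
    also have "\<dots> = (\<Sum>S\<in>?P. \<Sum>R\<in>?P. cl_sign R (sym_diff R T) * (cl_sign S (sym_diff S R) * A S * B (sym_diff S R)) * C (sym_diff R T))"
      by (rule sum.swap)
    also have "\<dots> = (\<Sum>S\<in>?P. \<Sum>Q\<in>?P. cl_sign S (sym_diff S T) * A S * (cl_sign Q (sym_diff Q (sym_diff S T)) * B Q * C (sym_diff Q (sym_diff S T))))"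
    proof (rule sum.cong[OF refl])
      fix S assume S: "S \<in> ?P"
      show "(\<Sum>R\<in>?P. cl_sign R (sym_diff R T) * (cl_sign S (sym_diff S R) * A S * B (sym_diff S R)) * C (sym_diff R T))
         = (\<Sum>Q\<in>?P. cl_sign S (sym_diff S T) * A S * (cl_sign Q (sym_diff Q (sym_diff S T)) * B Q * C (sym_diff Q (sym_diff S T))))"
      proof (subst sum_sym_diff_reindex[of S], use S in blast, rule sum.cong[OF refl])
        fix Q assume Q: "Q \<in> ?P"
        \<comment> \<open>\<open>U\<close> is the index set contributed by \<open>C\<close>. In
          terms of \<open>S\<close>, \<open>Q\<close> and \<open>U\<close> the signs on both sides
          become the product of the signs of the pairs (S, Q), (S, U) and (Q, U).\<close>
        define U where "U = sym_diff Q (sym_diff S T)"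
        have e: "sym_diff (sym_diff S Q) T = U" "sym_diff S T = sym_diff Q U" "sym_diff S (sym_diff S Q) = Q"
          unfolding U_def by auto
        have fin: "finite S" "finite Q" "finite T"
          by (meson PowD finite_atLeastAtMost finite_subset S Q T)+
        then have fin: "finite S" "finite Q" "finite U" unfolding U_def by auto
        show "cl_sign (sym_diff S Q) (sym_diff (sym_diff S Q) T) * (cl_sign S (sym_diff S (sym_diff S Q)) * A S * B (sym_diff S (sym_diff S Q))) * C (sym_diff (sym_diff S Q) T)
          = cl_sign S (sym_diff S T) * A S * (cl_sign Q (sym_diff Q (sym_diff S T)) * B Q * C (sym_diff Q (sym_diff S T)))"
          unfolding U_def[symmetric] e
          by (simp only: e sym_diff_cancel cl_sign_sym_diff_left[OF fin] cl_sign_sym_diff_right fin mult_ac)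
      qed
    qed
    also have "\<dots> = cl_mult n A (cl_mult n B C) T"
      unfolding cl_mult_apply[OF T]
    proof (rule sum.cong[OF refl])
      fix S assume S: "S \<in> ?P"
      then have "sym_diff S T \<subseteq> {1..n}" using T by auto
      then show "(\<Sum>Q\<in>?P. cl_sign S (sym_diff S T) * A S * (cl_sign Q (sym_diff Q (sym_diff S T)) * B Q * C (sym_diff Q (sym_diff S T))))
         = cl_sign S (sym_diff S T) * A S * cl_mult n B C (sym_diff S T)"
        by (simp only: cl_mult_apply sum_distrib_left)
    qed
    finally show ?thesis .
  qed (simp add: cl_mult_outside)
qed

lemma cl_mult_add_left: "cl_mult n (A + B) C = cl_mult n A C + cl_mult n B C"
  unfolding cl_mult_def plus_fun_def sum.distrib[symmetric]
  by (intro ext sum.cong refl) (simp add: distrib_left distrib_right)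

lemma cl_mult_add_right: "cl_mult n A (B + C) = cl_mult n A B + cl_mult n A C"
  unfolding cl_mult_def plus_fun_def sum.distrib[symmetric]
  by (intro ext sum.cong refl) (simp add: distrib_left distrib_right)

lemma cl_mult_smul_left: "cl_mult n (cl_smul c A) B = cl_smul c (cl_mult n A B)"
  unfolding cl_mult_def cl_smul_def sum_distrib_left
  by (intro ext sum.cong refl) simp

lemma cl_mult_smul_right: "cl_mult n A (cl_smul c B) = cl_smul c (cl_mult n A B)"
  unfolding cl_mult_def cl_smul_def sum_distrib_left
  by (intro ext sum.cong refl) simp

lemma cl_mult_zero_left [simp]: "cl_mult n 0 A = 0"
  by (rule ext) (simp add: cl_mult_def cong: if_cong)
lemma cl_mult_zero_right [simp]: "cl_mult n A 0 = 0"
  by (rule ext) (simp add: cl_mult_def cong: if_cong)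

lemma cl_mult_minus_left: "cl_mult n (- A) B = - cl_mult n A B"
  unfolding cl_mult_def fun_Compl_def sum_negf[symmetric]
  by (intro ext sum.cong refl) simp
lemma cl_mult_minus_right: "cl_mult n A (- B) = - cl_mult n A B"
  unfolding cl_mult_def fun_Compl_def sum_negf[symmetric]
  by (intro ext sum.cong refl) simp
lemma cl_mult_diff_left: "cl_mult n (A - B) C = cl_mult n A C - cl_mult n B C"
  using cl_mult_add_left[of n A "-B" C] by (simp add: cl_mult_minus_left)
lemma cl_mult_diff_right: "cl_mult n A (B - C) = cl_mult n A B - cl_mult n A C"
  using cl_mult_add_right[of n A B "-C"] by (simp add: cl_mult_minus_right)
lemma sum_mv_apply: "sum (f :: 'i \<Rightarrow> mv) I T = (\<Sum>i\<in>I. f i T)"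
  using sum_comp_morphism[of "\<lambda>A::mv. A T" f I] by (simp add: comp_def)
lemma cl_mult_sum_left: "cl_mult n (sum f I) C = (\<Sum>i\<in>I. cl_mult n (f i) C)"
  using sum_comp_morphism[of "\<lambda>A. cl_mult n A C" f I] by (simp add: cl_mult_add_left comp_def)
lemma cl_mult_sum_right: "cl_mult n C (sum f I) = (\<Sum>i\<in>I. cl_mult n C (f i))"
  using sum_comp_morphism[of "cl_mult n C" f I] by (simp add: cl_mult_add_right comp_def)

lemma cl_smul_1 [simp]: "cl_smul 1 A = A" by (simp add: cl_smul_def)
lemma cl_smul_0 [simp]: "cl_smul 0 A = 0" by (rule ext) (simp add: cl_smul_def)
lemma cl_smul_zero [simp]: "cl_smul c 0 = 0" by (rule ext) (simp add: cl_smul_def)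
lemma cl_smul_minus1 [simp]: "cl_smul (-1) A = - A" by (rule ext) (simp add: cl_smul_def)
lemma cl_smul_smul [simp]: "cl_smul c (cl_smul d A) = cl_smul (c * d) A"
  by (rule ext) (simp add: cl_smul_def)
lemma cl_smul_add: "cl_smul c (A + B) = cl_smul c A + cl_smul c B"
  by (rule ext) (simp add: cl_smul_def algebra_simps)
lemma cl_smul_diff: "cl_smul c (A - B) = cl_smul c A - cl_smul c B"
  by (rule ext) (simp add: cl_smul_def algebra_simps)
lemma cl_smul_minus: "cl_smul c (- A) = cl_smul (-c) A"
  by (rule ext) (simp add: cl_smul_def algebra_simps)
lemma cl_smul_sum: "cl_smul c (sum f I) = (\<Sum>i\<in>I. cl_smul c (f i))"
  using sum_comp_morphism[of "cl_smul c" f I] by (simp add: cl_smul_add comp_def)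
lemmas cl_mult_distrib = cl_mult_add_left cl_mult_add_right cl_mult_diff_left cl_mult_diff_right
  cl_mult_minus_left cl_mult_minus_right cl_mult_smul_left cl_mult_smul_right

lemma cl_sign_empty [simp]: "cl_sign {} S = 1" "cl_sign S {} = 1"
  by (simp_all add: cl_sign_def)

lemma cl_mult_one_left: assumes "A \<in> Cl n" shows "cl_mult n cl_one A = A"
proof
  fix T show "cl_mult n cl_one A T = A T"
  proof (cases "T \<subseteq> {1..n}")
    case True
    have "cl_mult n cl_one A T = (\<Sum>S\<in>Pow {1..n}. if S = {} then A T else 0)"
      unfolding cl_mult_apply[OF True] by (rule sum.cong) (auto simp: cl_one_def)
    then show ?thesis by (simp add: sum.delta)
  next
    case False
    then show ?thesis using assms cl_mult_outside by (auto simp: Cl_def)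
  qed
qed

lemma cl_mult_one_right: assumes "A \<in> Cl n" shows "cl_mult n A cl_one = A"
proof
  fix T show "cl_mult n A cl_one T = A T"
  proof (cases "T \<subseteq> {1..n}")
    case True
    have *: "sym_diff S T = {} \<longleftrightarrow> S = T" for S by auto
    have "cl_mult n A cl_one T = (\<Sum>S\<in>Pow {1..n}. if S = T then A T else 0)"
      unfolding cl_mult_apply[OF True] by (rule sum.cong) (use * in \<open>auto simp: cl_one_def\<close>)
    then show ?thesis using True by (simp add: sum.delta)
  next
    case False
    then show ?thesis using assms cl_mult_outside by (auto simp: Cl_def)
  qed
qed

text \<open>Index sets that leave 1..n contribute nothing. This moves products between the algebras
  on m - 1 and on m generators, which share the type \<open>mv\<close>.\<close>

lemma cl_mult_mono:
  assumes "A \<in> Cl n" "B \<in> Cl n" "n \<le> n'"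
  shows "cl_mult n' A B = cl_mult n A B"
proof
  fix T
  have sub: "Pow {1..n} \<subseteq> Pow {1..n'}" using assms(3) by auto
  have z: "A S = 0" "B S = 0" if "S \<notin> Pow {1..n}" for S
    using assms that unfolding Cl_def by auto
  have "cl_mult n' A B T = (\<Sum>S\<in>Pow {1..n'}. \<Sum>S'\<in>Pow {1..n}.
      if sym_diff S S' = T then cl_sign S S' * A S * B S' else 0)"
    unfolding cl_mult_def
  proof (rule sum.cong[OF refl], rule sum.mono_neutral_right)
    fix S assume "S \<in> Pow {1..n'}"
    show "\<forall>S'\<in>Pow {1..n'} - Pow {1..n}. (if sym_diff S S' = T then cl_sign S S' * A S * B S' else 0) = 0"
      using z(2) by (metis DiffD2 mult_zero_right)
  qed (use sub in simp_all)
  also have "\<dots> = cl_mult n A B T"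
    unfolding cl_mult_def
  proof (rule sum.mono_neutral_right)
    show "\<forall>S\<in>Pow {1..n'} - Pow {1..n}. (\<Sum>S'\<in>Pow {1..n}. if sym_diff S S' = T then cl_sign S S' * A S * B S' else 0) = 0"
    proof
      fix S assume "S \<in> Pow {1..n'} - Pow {1..n}"
      then have "A S = 0" using z(1) by blast
      then show "(\<Sum>S'\<in>Pow {1..n}. if sym_diff S S' = T then cl_sign S S' * A S * B S' else 0) = 0"
        by (intro sum.neutral ballI) simp
    qed
  qed (use sub in simp_all)
  finally show "cl_mult n' A B T = cl_mult n A B T" .
qed

lemma Cl_mono: "n \<le> n' \<Longrightarrow> Cl n \<subseteq> Cl n'" by (force simp: Cl_def)
lemma Lam_subset_Cl: "Lam n s \<subseteq> Cl n" by (auto simp: Lam_def Cl_def)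
lemma Lam_mono: "n \<le> n' \<Longrightarrow> Lam n s \<subseteq> Lam n' s" by (force simp: Lam_def)
lemma Cl_add [simp]: "A \<in> Cl n \<Longrightarrow> B \<in> Cl n \<Longrightarrow> A + B \<in> Cl n"
  unfolding Cl_def mem_Collect_eq plus_fun_apply by (metis add.right_neutral)
lemma Cl_smul [simp]: "A \<in> Cl n \<Longrightarrow> cl_smul c A \<in> Cl n" by (auto simp: Cl_def cl_smul_def)
lemma Cl_minus [simp]: "A \<in> Cl n \<Longrightarrow> - A \<in> Cl n" by (auto simp: Cl_def)
lemma Cl_diff [simp]: "A \<in> Cl n \<Longrightarrow> B \<in> Cl n \<Longrightarrow> A - B \<in> Cl n"
  using Cl_add[of A n "-B"] by simp
lemma Cl_zero [simp]: "0 \<in> Cl n" by (auto simp: Cl_def)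
lemma Cl_one [simp]: "cl_one \<in> Cl n" by (auto simp: Cl_def cl_one_def)
lemma Cl_sum [simp]: "(\<And>i. i \<in> I \<Longrightarrow> f i \<in> Cl n) \<Longrightarrow> sum f I \<in> Cl n"
  by (induction I rule: infinite_finite_induct) simp_all

lemma Lam_add [simp]: "A \<in> Lam n s \<Longrightarrow> B \<in> Lam n s \<Longrightarrow> A + B \<in> Lam n s"
  unfolding Lam_def mem_Collect_eq plus_fun_apply by (metis add.right_neutral)
lemma Lam_smul [simp]: "A \<in> Lam n s \<Longrightarrow> cl_smul c A \<in> Lam n s" by (auto simp: Lam_def cl_smul_def)
lemma Lam_minus [simp]: "A \<in> Lam n s \<Longrightarrow> - A \<in> Lam n s" by (auto simp: Lam_def)
lemma Lam_diff [simp]: "A \<in> Lam n s \<Longrightarrow> B \<in> Lam n s \<Longrightarrow> A - B \<in> Lam n s"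
  using Lam_add[of A n s "-B"] by simp
lemma Lam_zero [simp]: "0 \<in> Lam n s" by (auto simp: Lam_def)
lemma Lam_sum [simp]: "(\<And>i. i \<in> I \<Longrightarrow> f i \<in> Lam n s) \<Longrightarrow> sum f I \<in> Lam n s"
  by (induction I rule: infinite_finite_induct) auto

lemma cl_e_in_Cl [simp]: "j \<in> {1..n} \<Longrightarrow> cl_e j \<in> Cl n" by (auto simp: Cl_def cl_e_def split: if_splits)
lemma cl_vec_in_Cl [simp]: "cl_vec n u \<in> Cl n" by (auto simp: Cl_def cl_vec_def split: if_splits)

section \<open>Multiplication by a basis vector\<close>

lemma cl_e_mult_apply:
  assumes "j \<in> {1..n}" "T \<subseteq> {1..n}"
  shows "cl_mult n (cl_e j) A T = cl_sign {j} (sym_diff {j} T) * A (sym_diff {j} T)"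
proof -
  have "cl_mult n (cl_e j) A T
      = (\<Sum>S\<in>Pow {1..n}. if S = {j} then cl_sign {j} (sym_diff {j} T) * A (sym_diff {j} T) else 0)"
    unfolding cl_mult_apply[OF assms(2)] by (rule sum.cong) (auto simp: cl_e_def)
  then show ?thesis using assms by (simp add: sum.delta)
qed

lemma cl_mult_e_apply:
  assumes "j \<in> {1..n}" "T \<subseteq> {1..n}"
  shows "cl_mult n A (cl_e j) T = cl_sign (sym_diff {j} T) {j} * A (sym_diff {j} T)"
proof -
  have *: "sym_diff S T = {j} \<longleftrightarrow> S = sym_diff {j} T" for S by blast
  have **: "sym_diff (sym_diff {j} T) T = {j}" by blast
  have "cl_mult n A (cl_e j) T
      = (\<Sum>S\<in>Pow {1..n}. if S = sym_diff {j} T then cl_sign (sym_diff {j} T) {j} * A (sym_diff {j} T) else 0)"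
    unfolding cl_mult_apply[OF assms(2)] by (rule sum.cong) (simp_all add: cl_e_def * **)
  then show ?thesis using assms by (subst (asm) sum.delta) auto
qed

text \<open>For i different from j exactly one of i \<le> j and j \<le> i holds, so exchanging the
  order costs -1; for i = j both orders have the same factor.\<close>

lemma cl_sign_singleton_swap:
  assumes "finite S"
  shows "cl_sign S {j} = (-1) ^ card (S - {j}) * cl_sign {j} S"
proof -
  have "cl_sign S {j} = (\<Prod>i\<in>S. if j \<le> i then -1 else 1)" using assms by (simp add: cl_sign_prod)
  also have "\<dots> = (\<Prod>i\<in>S. (if i = j then 1 else -1) * (if i \<le> j then -1 else 1))"
    by (rule prod.cong) auto
  also have "\<dots> = (\<Prod>i\<in>S. (if i = j then 1 else -1)) * cl_sign {j} S"
    using assms by (simp add: cl_sign_prod prod.distrib)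
  also have "(\<Prod>i\<in>S. (if i = j then 1 else -1)) = (-1::complex) ^ card (S - {j})"
    using assms by (simp add: prod.If_cases Diff_eq)
  finally show ?thesis .
qed

lemma cl_sign_singleton_self [simp]: "cl_sign {j} {j} = -1"
  by (subst cl_sign_prod) auto

lemma cl_e_square:
  assumes "j \<in> {1..n}" "A \<in> Cl n"
  shows "cl_mult n (cl_e j) (cl_mult n (cl_e j) A) = - A"
proof
  fix T show "cl_mult n (cl_e j) (cl_mult n (cl_e j) A) T = (- A) T"
  proof (cases "T \<subseteq> {1..n}")
    case True
    then have f: "finite T" by (meson finite_atLeastAtMost finite_subset)
    have T': "sym_diff {j} T \<subseteq> {1..n}" using True assms by auto
    have sq: "cl_sign {j} T * cl_sign {j} T = 1"
      by (simp add: cl_sign_def flip: power_add power2_eq_square power_mult)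
    show ?thesis
      by (simp only: cl_e_mult_apply[OF assms(1) True] cl_e_mult_apply[OF assms(1) T'] sym_diff_cancel
          cl_sign_sym_diff_right[OF _ f] cl_sign_singleton_self finite.intros)
        (use sq in \<open>simp add: algebra_simps\<close>)
  next
    case False
    then show ?thesis using assms cl_mult_outside by (auto simp: Cl_def)
  qed
qed

lemma cl_e_anticommute:
  assumes "i \<in> {1..n}" "j \<in> {1..n}" "i \<noteq> j"
  shows "cl_mult n (cl_e i) (cl_e j) = - cl_mult n (cl_e j) (cl_e i)"
proof
  fix T show "cl_mult n (cl_e i) (cl_e j) T = (- cl_mult n (cl_e j) (cl_e i)) T"
  proof (cases "T \<subseteq> {1..n}")
    case True
    have "sym_diff {i} {j} = {i,j}" "sym_diff {j} {i} = {i,j}" using assms by auto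
    then have 1: "sym_diff {i} T = {j} \<longleftrightarrow> T = {i,j}" "sym_diff {j} T = {i} \<longleftrightarrow> T = {i,j}"
      by (metis sym_diff_cancel)+
    have 2: "cl_sign {i} {j} = - cl_sign {j} {i}" using assms by (auto simp: cl_sign_prod)
    show ?thesis
    proof (cases "T = {i,j}")
      case eq: True
      have a: "sym_diff {i} T = {j}" "sym_diff {j} T = {i}"
        by (rule iffD2[OF 1(1) eq], rule iffD2[OF 1(2) eq])
      show ?thesis
        unfolding cl_e_mult_apply[OF assms(1) True] cl_e_mult_apply[OF assms(2) True] fun_Compl_def a
        by (simp add: cl_e_def 2)
    next
      case False
      then have a: "sym_diff {i} T \<noteq> {j}" "sym_diff {j} T \<noteq> {i}"
        by (simp_all only: 1 not_False_eq_True)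
      show ?thesis
        unfolding cl_e_mult_apply[OF assms(1) True] cl_e_mult_apply[OF assms(2) True] fun_Compl_def
        by (simp only: cl_e_def a if_False mult_zero_right minus_zero)
    qed
  qed (simp add: cl_mult_outside)
qed

lemma cl_vec_eq_sum: "cl_vec n u = (\<Sum>j\<in>{1..n}. cl_smul (complex_of_real (u j)) (cl_e j))"
proof
  fix S
  have "(\<Sum>j\<in>{1..n}. cl_smul (complex_of_real (u j)) (cl_e j)) S
      = (\<Sum>j\<in>{1..n}. if S = {j} then complex_of_real (u j) else 0)"
    by (simp add: sum_mv_apply cl_smul_def cl_e_def if_distrib cong: if_cong)
  also have "\<dots> = cl_vec n u S"
  proof (cases "card S = 1 \<and> S \<subseteq> {1..n}")
    case True
    then obtain a where a: "S = {a}" by (auto simp: card_1_singleton_iff)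
    then show ?thesis using True by (auto simp: cl_vec_def sum.delta)
  next
    case False
    then have "(\<Sum>j\<in>{1..n}. if S = {j} then complex_of_real (u j) else 0) = 0"
      by (intro sum.neutral) auto
    then show ?thesis using False by (auto simp: cl_vec_def)
  qed
  finally show "cl_vec n u S = (\<Sum>j\<in>{1..n}. cl_smul (complex_of_real (u j)) (cl_e j)) S" by simp
qed

section \<open>Vectors and the Clifford relation\<close>

definition inner_up :: "nat \<Rightarrow> (nat \<Rightarrow> real) \<Rightarrow> (nat \<Rightarrow> real) \<Rightarrow> real" where
  "inner_up n u v = (\<Sum>i\<in>{1..n}. u i * v i)"

lemma cl_e_sq_one: "j \<in> {1..n} \<Longrightarrow> cl_mult n (cl_e j) (cl_e j) = - cl_one"
  using cl_e_square[of j n cl_one] by (simp add: cl_mult_one_right)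

lemma cl_vec_mult_cl_vec: "cl_mult n (cl_vec n u) (cl_vec n v)
  = (\<Sum>i\<in>{1..n}. \<Sum>j\<in>{1..n}. cl_smul (complex_of_real (u i * v j)) (cl_mult n (cl_e i) (cl_e j)))"
  unfolding cl_vec_eq_sum cl_mult_sum_left
  by (intro sum.cong refl)
    (simp only: cl_mult_smul_left cl_mult_sum_right cl_mult_smul_right cl_smul_sum cl_smul_smul of_real_mult mult.commute)

lemma cl_vec_anticommute:
  "cl_mult n (cl_vec n u) (cl_vec n v) + cl_mult n (cl_vec n v) (cl_vec n u) = cl_smul (complex_of_real (- 2 * inner_up n u v)) cl_one"
proof -
  have *: "cl_mult n (cl_e i) (cl_e j) + cl_mult n (cl_e j) (cl_e i) = (if i = j then cl_smul (-2) cl_one else 0)"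
    if "i \<in> {1..n}" "j \<in> {1..n}" for i j
  proof (cases "i = j")
    case True
    then show ?thesis using cl_e_sq_one[OF that(1)] by (simp add: cl_smul_def fun_eq_iff)
  next
    case False
    then show ?thesis using cl_e_anticommute[OF that False] by simp
  qed
  have "cl_mult n (cl_vec n u) (cl_vec n v) + cl_mult n (cl_vec n v) (cl_vec n u)
      = (\<Sum>i\<in>{1..n}. \<Sum>j\<in>{1..n}. cl_smul (complex_of_real (u i * v j)) (cl_mult n (cl_e i) (cl_e j)))
      + (\<Sum>i\<in>{1..n}. \<Sum>j\<in>{1..n}. cl_smul (complex_of_real (v i * u j)) (cl_mult n (cl_e i) (cl_e j)))"
    unfolding cl_vec_mult_cl_vec ..
  also have "(\<Sum>i\<in>{1..n}. \<Sum>j\<in>{1..n}. cl_smul (complex_of_real (v i * u j)) (cl_mult n (cl_e i) (cl_e j)))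
     = (\<Sum>i\<in>{1..n}. \<Sum>j\<in>{1..n}. cl_smul (complex_of_real (u i * v j)) (cl_mult n (cl_e j) (cl_e i)))"
    by (subst sum.swap) (simp add: mult.commute)
  also have "(\<Sum>i\<in>{1..n}. \<Sum>j\<in>{1..n}. cl_smul (complex_of_real (u i * v j)) (cl_mult n (cl_e i) (cl_e j)))
      + (\<Sum>i\<in>{1..n}. \<Sum>j\<in>{1..n}. cl_smul (complex_of_real (u i * v j)) (cl_mult n (cl_e j) (cl_e i)))
     = (\<Sum>i\<in>{1..n}. \<Sum>j\<in>{1..n}. cl_smul (complex_of_real (u i * v j)) (if i = j then cl_smul (-2) cl_one else 0))"
    unfolding sum.distrib[symmetric] cl_smul_add[symmetric]
    by (intro sum.cong refl) (simp only: *)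
  also have "\<dots> = (\<Sum>i\<in>{1..n}. \<Sum>j\<in>{1..n}. if j = i then cl_smul (complex_of_real (- 2 * (u i * v i))) cl_one else 0)"
    by (intro sum.cong refl) (auto simp: mult.commute)
  also have "\<dots> = (\<Sum>i\<in>{1..n}. cl_smul (complex_of_real (- 2 * (u i * v i))) cl_one)"
    by (intro sum.cong refl) (subst sum.delta, simp_all only: finite_atLeastAtMost if_True)
  also have "\<dots> = cl_smul (complex_of_real (- 2 * inner_up n u v)) cl_one"
    unfolding inner_up_def sum_distrib_left by (rule ext) (simp add: sum_mv_apply cl_smul_def sum_distrib_right)
  finally show ?thesis .
qed

lemma cl_smul_half_double: "cl_smul (1/2) (A + A) = A"
  by (rule ext) (simp add: cl_smul_def)

lemma cl_vec_square: "cl_mult n (cl_vec n u) (cl_vec n u) = cl_smul (complex_of_real (- inner_up n u u)) cl_one"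
proof -
  have "cl_mult n (cl_vec n u) (cl_vec n u) = cl_smul (1/2) (cl_smul (complex_of_real (- 2 * inner_up n u u)) cl_one)"
    using cl_smul_half_double[of "cl_mult n (cl_vec n u) (cl_vec n u)"] cl_vec_anticommute[of n u u] by metis
  then show ?thesis by simp
qed

text \<open>Moving e_j past a blade costs -1 for each index other than j, and whether j is among the
  indices can be read off from the resulting set \<open>T\<close>. Hence e_j A + (-1)^s A e_j keeps
  only the blades containing j, and the difference only the others: twice the wedge and twice the
  inner product.\<close>

lemma mult_e_Lam:
  assumes "A \<in> Lam n s" "j \<in> {1..n}"
  shows "cl_mult n A (cl_e j) T = (-1)^s * (if j \<in> T then 1 else -1) * cl_mult n (cl_e j) A T"
proof (cases "T \<subseteq> {1..n}")
  case True
  define S where "S = sym_diff {j} T"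
  have fT: "finite T" using True by (meson finite_atLeastAtMost finite_subset)
  then have fS: "finite S" by (simp add: S_def)
  show ?thesis
  proof (cases "A S = 0")
    case True': True
    then show ?thesis
      unfolding cl_e_mult_apply[OF assms(2) True] cl_mult_e_apply[OF assms(2) True] S_def[symmetric] by simp
  next
    case False
    then have c: "card S = s" using assms(1) by (simp add: Lam_def)
    have "(-1::complex) ^ card (S - {j}) = (-1)^s * (if j \<in> T then 1 else -1)"
    proof (cases "j \<in> T")
      case True
      then have "S - {j} = S" unfolding S_def by auto
      then show ?thesis using c True by simp
    next
      case False
      then have "j \<in> S" unfolding S_def by auto
      then have "card S = Suc (card (S - {j}))" using fS by (metis card.remove)
      then show ?thesis using c False by auto
    qed
    then show ?thesis
      unfolding cl_e_mult_apply[OF assms(2) True] cl_mult_e_apply[OF assms(2) True] S_def[symmetric]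
        cl_sign_singleton_swap[OF fS] by simp
  qed
qed (simp add: cl_mult_outside)

lemma e_mult_Lam_nonzero:
  assumes "A \<in> Lam n s" "j \<in> {1..n}" "cl_mult n (cl_e j) A T \<noteq> 0"
  shows "T \<subseteq> {1..n}" "if j \<in> T then card T = Suc s else Suc (card T) = s"
proof -
  show T: "T \<subseteq> {1..n}" using assms(3) cl_mult_outside by blast
  have fT: "finite T" using T by (meson finite_atLeastAtMost finite_subset)
  have "A (sym_diff {j} T) \<noteq> 0" using assms(3) unfolding cl_e_mult_apply[OF assms(2) T] by auto
  then have c: "card (sym_diff {j} T) = s" using assms(1) by (simp add: Lam_def)
  show "if j \<in> T then card T = Suc s else Suc (card T) = s"
  proof (cases "j \<in> T")
    case True
    then have "sym_diff {j} T = T - {j}" by auto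
    then show ?thesis using c True fT by (metis card.remove)
  next
    case False
    then have "sym_diff {j} T = insert j T" by auto
    then show ?thesis using c False fT by simp
  qed
qed

lemma e_wedge_Lam:
  assumes "A \<in> Lam n s" "j \<in> {1..n}"
  shows "cl_mult n (cl_e j) A + cl_smul ((-1)^s) (cl_mult n A (cl_e j)) \<in> Lam n (Suc s)"
  unfolding Lam_def
proof (intro CollectI allI impI)
  fix T assume "(cl_mult n (cl_e j) A + cl_smul ((-1)^s) (cl_mult n A (cl_e j))) T \<noteq> 0"
  then have "cl_mult n (cl_e j) A T \<noteq> 0 \<and> j \<in> T"
    unfolding plus_fun_apply cl_smul_def mult_e_Lam[OF assms] by (auto split: if_splits)
  then show "T \<subseteq> {1..n} \<and> card T = Suc s"
    using e_mult_Lam_nonzero[OF assms, of T] by auto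
qed

lemma e_dot_Lam:
  assumes "A \<in> Lam n s" "j \<in> {1..n}"
  shows "cl_mult n (cl_e j) A - cl_smul ((-1)^s) (cl_mult n A (cl_e j)) \<in> Lam n (s - 1)"
    and "s = 0 \<Longrightarrow> cl_mult n (cl_e j) A - cl_smul ((-1)^s) (cl_mult n A (cl_e j)) = 0"
proof -
  have *: "T \<subseteq> {1..n} \<and> Suc (card T) = s" 
    if "(cl_mult n (cl_e j) A - cl_smul ((-1)^s) (cl_mult n A (cl_e j))) T \<noteq> 0" for T
  proof -
    have "cl_mult n (cl_e j) A T \<noteq> 0 \<and> j \<notin> T"
      using that unfolding fun_diff_def cl_smul_def mult_e_Lam[OF assms] by (auto split: if_splits)
    then show "T \<subseteq> {1..n} \<and> Suc (card T) = s"
      using e_mult_Lam_nonzero[OF assms, of T] by auto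
  qed
  then show "cl_mult n (cl_e j) A - cl_smul ((-1)^s) (cl_mult n A (cl_e j)) \<in> Lam n (s - 1)"
    unfolding Lam_def by fastforce
  show "cl_mult n (cl_e j) A - cl_smul ((-1)^s) (cl_mult n A (cl_e j)) = 0" if "s = 0"
    using * that by (metis ext nat.distinct(1) zero_fun_apply)
qed

lemma Cl_wedge_sum:
  "cl_mult n (cl_vec N u) A + cl_smul c (cl_mult n A (cl_vec N u))
    = (\<Sum>j\<in>{1..N}. cl_smul (complex_of_real (u j)) (cl_mult n (cl_e j) A + cl_smul c (cl_mult n A (cl_e j))))"
  unfolding cl_vec_eq_sum cl_mult_sum_left cl_mult_sum_right cl_smul_sum sum.distrib[symmetric]
    cl_mult_smul_left cl_mult_smul_right cl_smul_add cl_smul_smul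
  by (simp add: mult.commute)

lemma cl_smul_neg_left: "cl_smul (- c) A = - cl_smul c A" by (rule ext) (simp add: cl_smul_def)

lemma vec_wedge_Lam:
  assumes "A \<in> Lam n s" "N \<le> n"
  shows "cl_mult n (cl_vec N u) A + cl_smul ((-1)^s) (cl_mult n A (cl_vec N u)) \<in> Lam n (Suc s)"
  unfolding Cl_wedge_sum by (intro Lam_sum Lam_smul e_wedge_Lam assms) (use assms in auto)

lemma vec_dot_Lam:
  assumes "A \<in> Lam n s" "N \<le> n"
  shows "cl_mult n (cl_vec N u) A - cl_smul ((-1)^s) (cl_mult n A (cl_vec N u)) \<in> Lam n (s - 1)"
    and "s = 0 \<Longrightarrow> cl_mult n (cl_vec N u) A - cl_smul ((-1)^s) (cl_mult n A (cl_vec N u)) = 0"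
proof -
  have *: "cl_mult n (cl_vec N u) A - cl_smul ((-1)^s) (cl_mult n A (cl_vec N u))
     = (\<Sum>j\<in>{1..N}. cl_smul (complex_of_real (u j)) (cl_mult n (cl_e j) A - cl_smul ((-1)^s) (cl_mult n A (cl_e j))))"
    using Cl_wedge_sum[of n N u A "- ((-1)^s)"] by (simp add: cl_smul_neg_left)
  have j: "j \<in> {1..n}" if "j \<in> {1..N}" for j using that assms(2) by auto
  show "cl_mult n (cl_vec N u) A - cl_smul ((-1)^s) (cl_mult n A (cl_vec N u)) \<in> Lam n (s - 1)"
    unfolding * by (intro Lam_sum Lam_smul e_dot_Lam(1) assms j)
  show "cl_mult n (cl_vec N u) A - cl_smul ((-1)^s) (cl_mult n A (cl_vec N u)) = 0" if "s = 0"
    unfolding * by (intro sum.neutral ballI) (simp only: e_dot_Lam(2)[OF assms(1) j that] cl_smul_zero)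
qed

lemma cl_grade_Lam: "A \<in> Lam n s \<Longrightarrow> cl_grade t A = (if t = s then A else 0)"
  by (rule ext) (auto simp: cl_grade_def Lam_def)

lemma Lam_large: "A \<in> Lam n s \<Longrightarrow> n < s \<Longrightarrow> A = 0"
proof (rule ext, rule ccontr)
  fix S assume a: "A \<in> Lam n s" "n < s" "A S \<noteq> 0 S"
  then have "S \<subseteq> {1..n}" "card S = s" by (auto simp: Lam_def)
  then show False using card_mono[of "{1..n}" S] a(2) by simp
qed

text \<open>For s > n the sum over the grades 0..n misses s, but then \<open>A\<close> is zero by
  \<open>Lam_large\<close>.\<close>

lemma cl_wedge_Lam:
  assumes "A \<in> Lam n s"
  shows "cl_wedge n u A = cl_smul (1/2) (cl_mult n u A + cl_smul ((-1)^s) (cl_mult n A u))"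
proof (cases "s \<le> n")
  case True
  show ?thesis
  proof
    fix T
    have "cl_wedge n u A T = (\<Sum>t\<in>{0..n}. if t = s then (1/2) * (cl_mult n u A T + (-1)^s * cl_mult n A u T) else 0)"
      unfolding cl_wedge_def by (rule sum.cong) (simp_all add: cl_grade_Lam[OF assms])
    then show "cl_wedge n u A T = cl_smul (1/2) (cl_mult n u A + cl_smul ((-1)^s) (cl_mult n A u)) T"
      using True by (simp add: sum.delta cl_smul_def)
  qed
next
  case False
  then have A: "A = 0" using assms Lam_large by auto
  have g: "cl_grade t 0 = 0" for t by (rule ext) (simp add: cl_grade_def)
  show ?thesis by (rule ext) (simp add: A g cl_wedge_def)
qed

lemma cl_dot_Lam:
  assumes "A \<in> Lam n s"
  shows "cl_dot n u A = cl_smul (1/2) (cl_mult n u A - cl_smul ((-1)^s) (cl_mult n A u))"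
proof (cases "s \<le> n")
  case True
  show ?thesis
  proof
    fix T
    have "cl_dot n u A T = (\<Sum>t\<in>{0..n}. if t = s then (1/2) * (cl_mult n u A T - (-1)^s * cl_mult n A u T) else 0)"
      unfolding cl_dot_def by (rule sum.cong) (simp_all add: cl_grade_Lam[OF assms])
    then show "cl_dot n u A T = cl_smul (1/2) (cl_mult n u A - cl_smul ((-1)^s) (cl_mult n A u)) T"
      using True by (simp add: sum.delta cl_smul_def)
  qed
next
  case False
  then have A: "A = 0" using assms Lam_large by auto
  have g: "cl_grade t 0 = 0" for t by (rule ext) (simp add: cl_grade_def)
  show ?thesis by (rule ext) (simp add: A g cl_dot_def)
qed

text \<open>On a blade with s elements each j inside contributes (-1)^s and each of the n - s others
  the opposite. The factor n - 2 s enters the Dirac operator of P x, and from there the constant c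
  of the operators.\<close>

lemma sum_e_A_e:
  assumes "A \<in> Lam n s"
  shows "(\<Sum>j\<in>{1..n}. cl_mult n (cl_e j) (cl_mult n A (cl_e j)))
    = cl_smul (complex_of_real ((-1)^(Suc s) * (real n - 2 * real s))) A"
proof
  fix T
  show "(\<Sum>j\<in>{1..n}. cl_mult n (cl_e j) (cl_mult n A (cl_e j))) T
    = cl_smul (complex_of_real ((-1)^(Suc s) * (real n - 2 * real s))) A T"
  proof (cases "T \<subseteq> {1..n}")
    case True
    have fT: "finite T" using True by (meson finite_atLeastAtMost finite_subset)
    have *: "cl_mult n (cl_e j) (cl_mult n A (cl_e j)) T = (-1)^s * (if j \<in> T then 1 else -1) * A T"
      if j: "j \<in> {1..n}" for j
    proof -
      have "A \<in> Cl n" using assms Lam_subset_Cl by blast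
      then have 1: "cl_mult n (cl_e j) (cl_mult n (cl_e j) A) T = - A T"
        using cl_e_square[OF j] by simp
      have jT: "j \<in> sym_diff {j} T \<longleftrightarrow> j \<notin> T" by auto
      show ?thesis
        using 1 unfolding cl_e_mult_apply[OF j True] mult_e_Lam[OF assms j] jT
        by (auto simp: algebra_simps)
    qed
    have "(\<Sum>j\<in>{1..n}. cl_mult n (cl_e j) (cl_mult n A (cl_e j))) T
      = (\<Sum>j\<in>{1..n}. (-1)^s * (if j \<in> T then 1 else -1) * A T)"
      unfolding sum_mv_apply by (rule sum.cong) (simp_all only: *)
    also have "\<dots> = (-1)^s * (\<Sum>j\<in>{1..n}. if j \<in> T then 1 else -1) * A T"
      by (simp only: sum_distrib_left sum_distrib_right)
    also have "(\<Sum>j\<in>{1..n}. if j \<in> T then 1 else (-1::complex)) = of_nat (card T) - of_nat (n - card T)"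
    proof -
      have "{1..n} \<inter> {j. j \<in> T} = T" "{1..n} \<inter> - {j. j \<in> T} = {1..n} - T" using True by auto
      moreover have "card ({1..n} - T) = n - card T" using True fT by (simp add: card_Diff_subset)
      ultimately show ?thesis by (simp add: sum.If_cases del: One_nat_def)
    qed
    also have "\<dots> = 2 * of_nat (card T) - of_nat n"
      using card_mono[OF _ True] by (simp add: of_nat_diff)
    finally have r: "(\<Sum>j\<in>{1..n}. cl_mult n (cl_e j) (cl_mult n A (cl_e j))) T
       = (-1)^s * (2 * of_nat (card T) - of_nat n) * A T" .
    show ?thesis
    proof (cases "A T = 0")
      case False
      then have "card T = s" using assms by (auto simp: Lam_def)
      then show ?thesis using r by (simp add: cl_smul_def algebra_simps)
    qed (use r in \<open>simp add: cl_smul_def\<close>)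
  next
    case False
    then have "A T = 0" using assms by (auto simp: Lam_def)
    then show ?thesis using False by (simp add: sum_mv_apply cl_smul_def cl_mult_outside)
  qed
qed

text \<open>No blade of \<open>A\<close> contains j, so the inner product with e_j vanishes and the
  product is a pure wedge.\<close>

lemma e_new_commute:
  assumes "A \<in> Lam N s" "N < j" "j \<le> n"
  shows "cl_mult n (cl_e j) A = cl_smul ((-1)^s) (cl_mult n A (cl_e j))"
    and "cl_mult n A (cl_e j) \<in> Lam n (Suc s)"
proof -
  have A: "A \<in> Lam n s" using assms Lam_mono[of N n s] by auto
  have j: "j \<in> {1..n}" using assms by auto
  have *: "j \<in> T" if "cl_mult n (cl_e j) A T \<noteq> 0" for T
  proof (rule ccontr)
    assume jT: "j \<notin> T"
    have T: "T \<subseteq> {1..n}" using that cl_mult_outside by blast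
    have "A (sym_diff {j} T) \<noteq> 0" using that unfolding cl_e_mult_apply[OF j T] by auto
    then have "sym_diff {j} T \<subseteq> {1..N}" using assms(1) by (auto simp: Lam_def)
    then show False using jT assms by auto
  qed
  show 1: "cl_mult n (cl_e j) A = cl_smul ((-1)^s) (cl_mult n A (cl_e j))"
  proof
    fix T show "cl_mult n (cl_e j) A T = cl_smul ((-1)^s) (cl_mult n A (cl_e j)) T"
      using *[of T] unfolding cl_smul_def mult_e_Lam[OF A j] by auto
  qed
  have "cl_smul ((-1)^s) (cl_mult n A (cl_e j)) = cl_smul (1/2) (cl_mult n (cl_e j) A + cl_smul ((-1)^s) (cl_mult n A (cl_e j)))"
    unfolding 1 cl_smul_half_double ..
  also have "\<dots> \<in> Lam n (Suc s)" by (intro Lam_smul e_wedge_Lam A j)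
  finally have "cl_smul ((-1)^s) (cl_smul ((-1)^s) (cl_mult n A (cl_e j))) \<in> Lam n (Suc s)" by (rule Lam_smul)
  then show "cl_mult n A (cl_e j) \<in> Lam n (Suc s)" by (simp flip: power_add)
qed

lemma cl_vec_extend: "N \<le> n \<Longrightarrow> cl_vec N u = cl_vec n (\<lambda>i. if i \<le> N then u i else 0)"
proof (rule ext)
  fix S assume "N \<le> n"
  show "cl_vec N u S = cl_vec n (\<lambda>i. if i \<le> N then u i else 0) S"
  proof (cases "card S = 1")
    case True
    then obtain a where "S = {a}" by (auto simp: card_1_singleton_iff)
    then show ?thesis using \<open>N \<le> n\<close> by (auto simp: cl_vec_def)
  qed (simp add: cl_vec_def)
qed

lemma cl_vec_square':
  assumes "N \<le> n"
  shows "cl_mult n (cl_vec N u) (cl_vec N u) = cl_smul (complex_of_real (- inner_up N u u)) cl_one"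
  by (simp only: cl_mult_mono[OF cl_vec_in_Cl cl_vec_in_Cl assms] cl_vec_square)

lemma vec_vec_mult:
  assumes "N \<le> n" "A \<in> Cl n"
  shows "cl_mult n (cl_vec N u) (cl_mult n (cl_vec N u) A) = cl_smul (complex_of_real (- inner_up N u u)) A"
  unfolding cl_mult_assoc[symmetric] cl_vec_square'[OF assms(1)] cl_mult_smul_left
  by (simp add: cl_mult_one_left assms)

lemma mult_vec_vec:
  assumes "N \<le> n" "A \<in> Cl n"
  shows "cl_mult n A (cl_mult n (cl_vec N u) (cl_vec N u)) = cl_smul (complex_of_real (- inner_up N u u)) A"
  unfolding cl_vec_square'[OF assms(1)] cl_mult_smul_right
  by (simp add: cl_mult_one_right assms)

text \<open>\<open>Q\<close> is twice the wedge of u with A. Another wedge with u gives 0, so u Q is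
  the inner product alone and the grade falls back from Suc s to s. \<open>vec_mult_dot_Lam\<close>
  is the same argument with the two products exchanged.\<close>

lemma vec_mult_wedge_Lam:
  fixes u :: "nat \<Rightarrow> real"
  assumes "A \<in> Lam n s" "N \<le> n"
  defines "Q \<equiv> cl_mult n (cl_vec N u) A + cl_smul ((-1)^s) (cl_mult n A (cl_vec N u))"
  shows "cl_mult n (cl_vec N u) Q \<in> Lam n s"
proof -
  have A: "A \<in> Cl n" using assms(1) Lam_subset_Cl by blast
  have Q: "Q \<in> Lam n (Suc s)" unfolding Q_def by (rule vec_wedge_Lam[OF assms(1,2)])
  have "cl_mult n (cl_vec N u) Q - cl_smul ((-1)^Suc s) (cl_mult n Q (cl_vec N u)) = cl_mult n (cl_vec N u) Q + cl_mult n (cl_vec N u) Q"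
    unfolding Q_def cl_mult_distrib cl_mult_assoc cl_smul_add vec_vec_mult[OF assms(2) A] mult_vec_vec[OF assms(2) A]
    by (rule ext) (simp add: cl_smul_def algebra_simps flip: power_add mult_2)
  then have "cl_mult n (cl_vec N u) Q = cl_smul (1/2) (cl_mult n (cl_vec N u) Q - cl_smul ((-1)^Suc s) (cl_mult n Q (cl_vec N u)))"
    by (simp only: cl_smul_half_double)
  also have "\<dots> \<in> Lam n (Suc s - 1)" by (intro Lam_smul vec_dot_Lam(1) Q assms)
  finally show ?thesis by simp
qed

lemma vec_mult_dot_Lam:
  fixes u :: "nat \<Rightarrow> real"
  assumes "A \<in> Lam n s" "N \<le> n"
  defines "Q \<equiv> cl_mult n (cl_vec N u) A - cl_smul ((-1)^s) (cl_mult n A (cl_vec N u))"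
  shows "cl_mult n (cl_vec N u) Q \<in> Lam n s"
proof (cases "s = 0")
  case True
  then have "Q = 0" unfolding Q_def using vec_dot_Lam(2)[OF assms(1,2)] by blast
  then show ?thesis by simp
next
  case False
  then obtain t where s: "s = Suc t" by (auto simp: gr0_conv_Suc)
  have A: "A \<in> Cl n" using assms(1) Lam_subset_Cl by blast
  have Q: "Q \<in> Lam n t" unfolding Q_def using vec_dot_Lam(1)[OF assms(1,2)] s by simp
  have "cl_mult n (cl_vec N u) Q + cl_smul ((-1)^t) (cl_mult n Q (cl_vec N u)) = cl_mult n (cl_vec N u) Q + cl_mult n (cl_vec N u) Q"
    unfolding Q_def cl_mult_distrib cl_mult_assoc cl_smul_diff vec_vec_mult[OF assms(2) A] mult_vec_vec[OF assms(2) A] s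
    by (rule ext) (simp add: cl_smul_def algebra_simps flip: power_add mult_2)
  then have "cl_mult n (cl_vec N u) Q = cl_smul (1/2) (cl_mult n (cl_vec N u) Q + cl_smul ((-1)^t) (cl_mult n Q (cl_vec N u)))"
    by (simp only: cl_smul_half_double)
  also have "\<dots> \<in> Lam n (Suc t)" by (intro Lam_smul vec_wedge_Lam Q assms)
  finally show ?thesis by (simp add: s)
qed

section \<open>Homogeneous polynomials and partial derivatives\<close>

text \<open>The inductive form of scalar homogeneous polynomials; it spares arguments about multi-indices.\<close>
inductive spoly :: "nat \<Rightarrow> nat \<Rightarrow> ((nat \<Rightarrow> real) \<Rightarrow> complex) \<Rightarrow> bool" for n where
  spoly_const: "spoly n 0 (\<lambda>x. c)"
| spoly_zero: "spoly n k (\<lambda>x. 0)"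
| spoly_coord: "spoly n k f \<Longrightarrow> i \<in> {1..n} \<Longrightarrow> spoly n (Suc k) (\<lambda>x. complex_of_real (x i) * f x)"
| spoly_add: "spoly n k f \<Longrightarrow> spoly n k g \<Longrightarrow> spoly n k (\<lambda>x. f x + g x)"

lemma spoly_smul: "spoly n k f \<Longrightarrow> spoly n k (\<lambda>x. c * f x)"
proof (induction rule: spoly.induct)
  case (spoly_coord k f i)
  show ?case using spoly.spoly_coord[OF spoly_coord(3,2)] by (simp add: mult.left_commute)
next
  case (spoly_add k f g)
  then show ?case using spoly.spoly_add[OF spoly_add(3,4)] by (simp add: distrib_left)
qed (auto intro: spoly.intros)

lemma spoly_sum: "(\<And>i. i \<in> I \<Longrightarrow> spoly n k (f i)) \<Longrightarrow> spoly n k (\<lambda>x. \<Sum>i\<in>I. f i x)"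
  by (induction I rule: infinite_finite_induct) (auto intro: spoly.intros)

lemma spoly_diff: "spoly n k f \<Longrightarrow> spoly n k g \<Longrightarrow> spoly n k (\<lambda>x. f x - g x)"
  using spoly_add[of n k f "\<lambda>x. (-1) * g x"] spoly_smul[of n k g "-1"] by simp

lemma spoly_mult: "spoly n k f \<Longrightarrow> spoly n l g \<Longrightarrow> spoly n (k + l) (\<lambda>x. f x * g x)"
proof (induction rule: spoly.induct)
  case (spoly_coord k f i)
  show ?case using spoly.spoly_coord[OF spoly_coord(3)[OF spoly_coord(4)] spoly_coord(2)] by (simp add: mult.assoc)
next
  case (spoly_add k f g)
  then show ?case using spoly.spoly_add[of n "k+l"] by (simp add: distrib_right)
qed (auto intro: spoly.intros spoly_smul)

lemma spoly_coordinate: "i \<in> {1..n} \<Longrightarrow> spoly n (Suc 0) (\<lambda>x. complex_of_real (x i))"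
  using spoly_coord[OF spoly_const[of n 1], of i] by simp

lemma spoly_power: "spoly n k f \<Longrightarrow> spoly n (k * p) (\<lambda>x. f x ^ p)"
proof (induction p)
  case (Suc p)
  then show ?case using spoly_mult[of n k f "k * p" "\<lambda>x. f x ^ p"] by simp
qed (auto intro: spoly.intros)

lemma spoly_mono: "spoly n k f \<Longrightarrow> n \<le> n' \<Longrightarrow> spoly n' k f"
  by (induction rule: spoly.induct) (auto intro: spoly.intros)

lemma spoly_compose:
  "spoly n k f \<Longrightarrow> (\<And>i. i \<in> {1..n} \<Longrightarrow> spoly n' (Suc 0) (\<lambda>x. complex_of_real (L x i))) \<Longrightarrow> spoly n' k (\<lambda>x. f (L x))"
proof (induction rule: spoly.induct)
  case (spoly_coord k f i)
  show ?case using spoly_mult[OF spoly_coord(4)[OF spoly_coord(2)] spoly_coord(3)[OF spoly_coord(4)]] by simp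
qed (auto intro: spoly.intros)

lemma spoly_cong_coords: "spoly n k f \<Longrightarrow> (\<And>i. i \<in> {1..n} \<Longrightarrow> x i = y i) \<Longrightarrow> f x = f y"
  by (induction rule: spoly.induct) auto

lemma spoly_scale: "spoly n k f \<Longrightarrow> f (\<lambda>i. c * x i) = complex_of_real c ^ k * f x"
  by (induction rule: spoly.induct) (auto simp: algebra_simps)

section \<open>Partial derivatives of homogeneous polynomials\<close>

definition pds :: "nat \<Rightarrow> ((nat \<Rightarrow> real) \<Rightarrow> complex) \<Rightarrow> (nat \<Rightarrow> real) \<Rightarrow> complex" where
  "pds j f = (\<lambda>x. vector_derivative (\<lambda>t::real. f (x(j := t))) (at (x j)))"

text \<open>\<open>pds\<close> is total and returns some value even where no derivative exists. The
  calculus rules are therefore proved for this relation, and \<open>has_pds_pds\<close> transfers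
  them.\<close>

definition has_pds :: "nat \<Rightarrow> ((nat \<Rightarrow> real) \<Rightarrow> complex) \<Rightarrow> ((nat \<Rightarrow> real) \<Rightarrow> complex) \<Rightarrow> bool" where
  "has_pds j f f' \<longleftrightarrow> (\<forall>x. ((\<lambda>t::real. f (x(j := t))) has_vector_derivative f' x) (at (x j)))"

lemma has_pds_pds: "has_pds j f f' \<Longrightarrow> pds j f = f'"
  unfolding has_pds_def pds_def by (auto intro!: ext vector_derivative_at)

lemma has_pds_const: "has_pds j (\<lambda>x. c) (\<lambda>x. 0)" by (simp add: has_pds_def)

lemma has_pds_add: "has_pds j f f' \<Longrightarrow> has_pds j g g' \<Longrightarrow> has_pds j (\<lambda>x. f x + g x) (\<lambda>x. f' x + g' x)"
  unfolding has_pds_def by (auto intro!: has_vector_derivative_add)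

lemma has_pds_mult:
  assumes "has_pds j f f'" "has_pds j g g'"
  shows "has_pds j (\<lambda>x. f x * g x) (\<lambda>x. f x * g' x + f' x * g x)"
  unfolding has_pds_def
proof
  fix x :: "nat \<Rightarrow> real"
  show "((\<lambda>t. f (x(j := t)) * g (x(j := t))) has_vector_derivative f x * g' x + f' x * g x) (at (x j))"
    using has_vector_derivative_mult[of "\<lambda>t. f (x(j:=t))" "f' x" "x j" UNIV "\<lambda>t. g (x(j:=t))" "g' x"]
      assms unfolding has_pds_def by simp
qed

lemma has_pds_sum: "(\<And>i. i \<in> I \<Longrightarrow> has_pds j (f i) (f' i)) \<Longrightarrow> has_pds j (\<lambda>x. \<Sum>i\<in>I. f i x) (\<lambda>x. \<Sum>i\<in>I. f' i x)"
  by (induction I rule: infinite_finite_induct) (auto intro: has_pds_add has_pds_const)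

lemma has_pds_coord: "has_pds j (\<lambda>x. complex_of_real (x i)) (\<lambda>x. if i = j then 1 else 0)"
  unfolding has_pds_def
proof
  fix x :: "nat \<Rightarrow> real"
  have "((\<lambda>t. complex_of_real t) has_vector_derivative 1) (at (x j))"
    using has_vector_derivative_of_real[OF DERIV_ident, of "at (x j)"] by simp
  then show "((\<lambda>t. complex_of_real ((x(j := t)) i)) has_vector_derivative (if i = j then 1 else 0)) (at (x j))"
    by (cases "i = j") auto
qed

lemma spoly_has_pds_ex: "spoly n k f \<Longrightarrow> \<exists>f'. has_pds j f f' \<and> spoly n (k - 1) f' \<and> (k = 0 \<longrightarrow> f' = (\<lambda>x. 0))"
proof (induction rule: spoly.induct)
  case (spoly_const c)
  then show ?case by (intro exI[of _ "\<lambda>x. 0"]) (auto intro: has_pds_const spoly.intros)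
next
  case (spoly_zero k)
  then show ?case by (intro exI[of _ "\<lambda>x. 0"]) (auto intro: has_pds_const spoly.intros)
next
  case (spoly_coord k f i)
  then obtain f' where f': "has_pds j f f'" "spoly n (k - 1) f'" "k = 0 \<longrightarrow> f' = (\<lambda>x. 0)" by blast
  have 1: "spoly n k (\<lambda>x. complex_of_real (x i) * f' x)"
  proof (cases k)
    case 0
    then show ?thesis using f' by (auto intro: spoly.intros)
  next
    case (Suc l)
    then show ?thesis using f' spoly.spoly_coord[OF _ spoly_coord(2)] by auto
  qed
  have 2: "spoly n k (\<lambda>x. (if i = j then 1 else 0) * f x)" by (rule spoly_smul[OF spoly_coord(1)])
  show ?case using has_pds_mult[OF has_pds_coord[of j i] f'(1)] spoly.spoly_add[OF 1 2] by auto
next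
  case (spoly_add k f g)
  then obtain f' g' where "has_pds j f f'" "spoly n (k - 1) f'" "k = 0 \<longrightarrow> f' = (\<lambda>x. 0)"
    "has_pds j g g'" "spoly n (k - 1) g'" "k = 0 \<longrightarrow> g' = (\<lambda>x. 0)" by blast
  then show ?case by (intro exI[of _ "\<lambda>x. f' x + g' x"]) (auto intro: has_pds_add spoly.spoly_add)
qed

lemma spoly_has_pds: "spoly n k f \<Longrightarrow> has_pds j f (pds j f)"
  by (metis spoly_has_pds_ex has_pds_pds)
lemma spoly_pds: "spoly n k f \<Longrightarrow> spoly n (k - 1) (pds j f)"
  by (metis spoly_has_pds_ex has_pds_pds)
lemma spoly_pds_0: "spoly n 0 f \<Longrightarrow> pds j f = (\<lambda>x. 0)"
  using spoly_has_pds_ex[of n 0 f j] has_pds_pds by blast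

lemma spoly_Euler: "spoly n k f \<Longrightarrow> (\<Sum>j\<in>{1..n}. complex_of_real (x j) * pds j f x) = of_nat k * f x"
proof (induction rule: spoly.induct)
  case (spoly_const c)
  then show ?case using has_pds_pds[OF has_pds_const] by simp
next
  case (spoly_zero k)
  then show ?case using has_pds_pds[OF has_pds_const] by simp
next
  case (spoly_coord k f i)
  have p: "pds j (\<lambda>x. complex_of_real (x i) * f x) x = complex_of_real (x i) * pds j f x + (if i = j then 1 else 0) * f x" for j
    using has_pds_pds[OF has_pds_mult[OF has_pds_coord[of j i] spoly_has_pds[OF spoly_coord(1)]]] by simp
  have "(\<Sum>j\<in>{1..n}. complex_of_real (x j) * pds j (\<lambda>x. complex_of_real (x i) * f x) x)
     = complex_of_real (x i) * (\<Sum>j\<in>{1..n}. complex_of_real (x j) * pds j f x) + (\<Sum>j\<in>{1..n}. if j = i then complex_of_real (x i) * f x else 0)"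
    unfolding p sum_distrib_left sum.distrib[symmetric] by (intro sum.cong refl) (auto simp: algebra_simps)
  also have "(\<Sum>j\<in>{1..n}. if j = i then complex_of_real (x i) * f x else 0) = complex_of_real (x i) * f x"
    using spoly_coord(2) by simp
  finally show ?case using spoly_coord(3) by (simp add: algebra_simps)
next
  case (spoly_add k f g)
  have p: "pds j (\<lambda>x. f x + g x) x = pds j f x + pds j g x" for j
    using has_pds_pds[OF has_pds_add[OF spoly_has_pds[OF spoly_add(1)] spoly_has_pds[OF spoly_add(2)]]] by simp
  show ?case using spoly_add(3,4) by (simp add: p distrib_left sum.distrib)
qed

lemma finite_multi_idx: "finite (multi_idx n k)"
proof (rule finite_subset)
  show "multi_idx n k \<subseteq> {f. \<forall>x. (x \<in> {1..n} \<longrightarrow> f x \<in> {..k}) \<and> (x \<notin> {1..n} \<longrightarrow> f x = 0)}"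
  proof
    fix \<alpha> assume a: "\<alpha> \<in> multi_idx n k"
    have "\<alpha> i \<le> k" if "i \<in> {1..n}" for i
      using member_le_sum[of i "{1..n}" \<alpha>] that a by (simp add: multi_idx_def)
    then show "\<alpha> \<in> {f. \<forall>x. (x \<in> {1..n} \<longrightarrow> f x \<in> {..k}) \<and> (x \<notin> {1..n} \<longrightarrow> f x = 0)}"
      using a unfolding multi_idx_def by blast
  qed
qed (rule finite_set_of_finite_funs; simp)

lemma spoly_monomial:
  assumes "finite I" "I \<subseteq> {1..n}"
  shows "spoly n (sum \<alpha> I) (\<lambda>x. complex_of_real (\<Prod>i\<in>I. x i ^ \<alpha> i))"
  using assms
proof (induction I rule: finite_induct)
  case empty
  show ?case using spoly_const[of n 1] by simp
next
  case (insert a F)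
  then have "spoly n (sum \<alpha> F) (\<lambda>x. complex_of_real (\<Prod>i\<in>F. x i ^ \<alpha> i))" by simp
  from spoly_mult[OF spoly_power[OF spoly_coordinate[of a n], of "\<alpha> a"] this]
  show ?case using insert by simp
qed

text \<open>The way back from the inductive form to coefficients, as \<open>hom_poly\<close>
  demands. Only multiplication by a coordinate needs work, since it shifts the
  multi-indices.\<close>

lemma spoly_monomials:
  "spoly n k f \<Longrightarrow> \<exists>c. f = (\<lambda>x. \<Sum>\<alpha>\<in>multi_idx n k. c \<alpha> * complex_of_real (\<Prod>i\<in>{1..n}. x i ^ \<alpha> i))"
proof (induction rule: spoly.induct)
  case (spoly_const c)
  have A: "\<alpha> = (\<lambda>i. 0)" if "\<alpha> \<in> multi_idx n 0" for \<alpha>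
  proof
    fix i show "\<alpha> i = 0"
      using that unfolding multi_idx_def mem_Collect_eq
      by (metis finite_atLeastAtMost sum_eq_0_iff)
  qed
  have "multi_idx n 0 = {\<lambda>i. 0}"
  proof (rule equalityI)
    show "multi_idx n 0 \<subseteq> {\<lambda>i. 0}"
    proof
      fix \<alpha> assume "\<alpha> \<in> multi_idx n 0"
      from A[OF this] show "\<alpha> \<in> {\<lambda>i. 0}" by (rule ssubst) simp
    qed
  qed (simp add: multi_idx_def)
  then show ?case by (intro exI[of _ "\<lambda>_. c"]) simp
next
  case (spoly_zero k)
  show ?case by (intro exI[of _ "\<lambda>_. 0"]) simp
next
  case (spoly_coord k f i)
  from spoly_coord(3) obtain c where c: "f = (\<lambda>x. \<Sum>\<alpha>\<in>multi_idx n k. c \<alpha> * complex_of_real (\<Prod>i\<in>{1..n}. x i ^ \<alpha> i))"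
    by (rule exE)
  \<comment> \<open>\<open>up\<close> raises the exponent of x_i; \<open>d\<close> carries
    \<open>c\<close> along it and is 0 on the multi-indices that are not raised ones.\<close>
  define up where "up = (\<lambda>\<alpha>::nat\<Rightarrow>nat. \<alpha>(i := Suc (\<alpha> i)))"
  define d where "d = (\<lambda>\<beta>::nat\<Rightarrow>nat. if \<beta> i = 0 then 0 else c (\<beta>(i := \<beta> i - 1)))"
  have i: "i \<in> {1..n}" by (rule spoly_coord(2))
  have inj: "inj_on up (multi_idx n k)"
  proof (rule inj_onI)
    fix \<alpha> \<beta> assume "up \<alpha> = up \<beta>"
    then have "\<And>j. up \<alpha> j = up \<beta> j" by simp
    then show "\<alpha> = \<beta>" unfolding up_def by (metis fun_upd_apply nat.inject ext)
  qed
  have s1: "sum (\<alpha>(i := v)) {1..n} + \<alpha> i = sum \<alpha> {1..n} + v" for \<alpha> :: "nat \<Rightarrow> nat" and v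
    using i by (simp add: sum.remove[of _ i])
  have sub: "up ` multi_idx n k \<subseteq> multi_idx n (Suc k)"
  proof (rule image_subsetI)
    fix \<alpha> assume a: "\<alpha> \<in> multi_idx n k"
    then show "up \<alpha> \<in> multi_idx n (Suc k)"
      using s1[of \<alpha> "Suc (\<alpha> i)"] i unfolding multi_idx_def up_def by auto
  qed
  have d0: "d \<beta> = 0" if b: "\<beta> \<in> multi_idx n (Suc k) - up ` multi_idx n k" for \<beta>
  proof (rule ccontr)
    assume "d \<beta> \<noteq> 0"
    then have p: "\<beta> i \<noteq> 0" unfolding d_def by metis
    have "\<beta>(i := \<beta> i - 1) \<in> multi_idx n k"
      using b p s1[of \<beta> "\<beta> i - 1"] i unfolding multi_idx_def by auto
    moreover have "up (\<beta>(i := \<beta> i - 1)) = \<beta>" using p unfolding up_def by auto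
    ultimately show False using b by (metis DiffD2 imageI)
  qed
  have mon: "(\<Prod>j\<in>{1..n}. x j ^ up \<alpha> j) = x i * (\<Prod>j\<in>{1..n}. x j ^ \<alpha> j)" for x :: "nat \<Rightarrow> real" and \<alpha>
    using i unfolding up_def by (subst (1 2) prod.remove[of _ i]) (auto intro!: prod.cong)
  have dup: "d (up \<alpha>) = c \<alpha>" for \<alpha> unfolding d_def up_def by simp
  show ?case
  proof (intro exI[of _ d] ext)
    fix x
    have "(\<Sum>\<beta>\<in>multi_idx n (Suc k). d \<beta> * complex_of_real (\<Prod>j\<in>{1..n}. x j ^ \<beta> j))
       = (\<Sum>\<beta>\<in>up ` multi_idx n k. d \<beta> * complex_of_real (\<Prod>j\<in>{1..n}. x j ^ \<beta> j))"
      by (rule sum.mono_neutral_right) (use sub d0 finite_multi_idx in auto)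
    also have "\<dots> = (\<Sum>\<alpha>\<in>multi_idx n k. d (up \<alpha>) * complex_of_real (\<Prod>j\<in>{1..n}. x j ^ up \<alpha> j))"
      by (subst sum.reindex[OF inj]) simp
    also have "\<dots> = complex_of_real (x i) * f x"
      unfolding mon dup c by (simp add: sum_distrib_left mult_ac)
    finally show "complex_of_real (x i) * f x = (\<Sum>\<beta>\<in>multi_idx n (Suc k). d \<beta> * complex_of_real (\<Prod>j\<in>{1..n}. x j ^ \<beta> j))" ..
  qed
next
  case (spoly_add k f g)
  from spoly_add(3) obtain c where c: "f = (\<lambda>x. \<Sum>\<alpha>\<in>multi_idx n k. c \<alpha> * complex_of_real (\<Prod>i\<in>{1..n}. x i ^ \<alpha> i))"
    by (rule exE)
  from spoly_add(4) obtain d where d: "g = (\<lambda>x. \<Sum>\<alpha>\<in>multi_idx n k. d \<alpha> * complex_of_real (\<Prod>i\<in>{1..n}. x i ^ \<alpha> i))"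
    by (rule exE)
  show ?case unfolding c d by (intro exI[of _ "\<lambda>\<alpha>. c \<alpha> + d \<alpha>"]) (simp add: distrib_right sum.distrib)
qed

lemma hom_poly_iff_spoly: "hom_poly n k P \<longleftrightarrow> (\<forall>S. spoly n k (\<lambda>x. P x S))"
proof
  assume "hom_poly n k P"
  then obtain c where P: "P = (\<lambda>x S. \<Sum>\<alpha>\<in>multi_idx n k. c \<alpha> S * complex_of_real (\<Prod>i\<in>{1..n}. x i ^ \<alpha> i))"
    unfolding hom_poly_def by (rule exE)
  show "\<forall>S. spoly n k (\<lambda>x. P x S)"
  proof
    fix S
    have "spoly n k (\<lambda>x. c \<alpha> S * complex_of_real (\<Prod>i\<in>{1..n}. x i ^ \<alpha> i))" if "\<alpha> \<in> multi_idx n k" for \<alpha>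
      using spoly_smul[OF spoly_monomial[of "{1..n}" n \<alpha>]] that by (simp add: multi_idx_def)
    then show "spoly n k (\<lambda>x. P x S)" unfolding P by (rule spoly_sum)
  qed
next
  assume "\<forall>S. spoly n k (\<lambda>x. P x S)"
  then have "\<forall>S. \<exists>c. (\<lambda>x. P x S) = (\<lambda>x. \<Sum>\<alpha>\<in>multi_idx n k. c \<alpha> * complex_of_real (\<Prod>i\<in>{1..n}. x i ^ \<alpha> i))"
    using spoly_monomials by blast
  then obtain c where c: "\<And>S. (\<lambda>x. P x S) = (\<lambda>x. \<Sum>\<alpha>\<in>multi_idx n k. c S \<alpha> * complex_of_real (\<Prod>i\<in>{1..n}. x i ^ \<alpha> i))"
    by metis
  have "P = (\<lambda>x S. \<Sum>\<alpha>\<in>multi_idx n k. c S \<alpha> * complex_of_real (\<Prod>i\<in>{1..n}. x i ^ \<alpha> i))"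
    using fun_cong[OF c] by (intro ext) simp
  then show "hom_poly n k P"
    unfolding hom_poly_def by (intro exI[of _ "\<lambda>\<alpha> S. c S \<alpha>"]) simp
qed

lemma hom_polyD: "hom_poly n k P \<Longrightarrow> spoly n k (\<lambda>x. P x S)" by (simp add: hom_poly_iff_spoly)

section \<open>Clifford-valued polynomials\<close>

definition dif :: "nat \<Rightarrow> pf \<Rightarrow> pf \<Rightarrow> bool" where
  "dif j P P' \<longleftrightarrow> (\<forall>S. has_pds j (\<lambda>x. P x S) (\<lambda>x. P' x S))"

lemma dif_pd: "dif j P P' \<Longrightarrow> pd j P = P'"
proof (intro ext)
  fix x S assume "dif j P P'"
  then have "pds j (\<lambda>x. P x S) = (\<lambda>x. P' x S)" unfolding dif_def by (blast intro: has_pds_pds)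
  from fun_cong[OF this, of x] show "pd j P x S = P' x S" by (simp add: pd_def pds_def)
qed

lemma pd_pds: "pd j P x S = pds j (\<lambda>x. P x S) x" by (simp add: pd_def pds_def)

lemma hom_poly_dif: "hom_poly n k P \<Longrightarrow> dif j P (pd j P)"
  unfolding dif_def pd_pds by (blast intro: spoly_has_pds hom_polyD)

lemma hom_poly_pd: "hom_poly n k P \<Longrightarrow> hom_poly n (k - 1) (pd j P)"
  unfolding hom_poly_iff_spoly pd_pds by (metis (no_types, lifting) spoly_pds ext)

lemma hom_poly_0_pd: "hom_poly n 0 P \<Longrightarrow> pd j P = 0"
  by (intro ext) (simp add: pd_pds spoly_pds_0[OF hom_polyD])

lemma dif_const: "dif j (\<lambda>x. A) (\<lambda>x. 0)" by (simp add: dif_def has_pds_const)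
lemma dif_add: "dif j P P' \<Longrightarrow> dif j Q Q' \<Longrightarrow> dif j (\<lambda>x. P x + Q x) (\<lambda>x. P' x + Q' x)"
  by (simp add: dif_def has_pds_add)
lemma dif_sum: "(\<And>i. i \<in> I \<Longrightarrow> dif j (P i) (P' i)) \<Longrightarrow> dif j (\<lambda>x. \<Sum>i\<in>I. P i x) (\<lambda>x. \<Sum>i\<in>I. P' i x)"
  unfolding dif_def sum_mv_apply by (auto intro: has_pds_sum)

lemma dif_scal: "has_pds j f f' \<Longrightarrow> dif j P P' \<Longrightarrow>
    dif j (\<lambda>x. cl_smul (f x) (P x)) (\<lambda>x. cl_smul (f x) (P' x) + cl_smul (f' x) (P x))"
  unfolding dif_def cl_smul_def plus_fun_apply by (auto intro: has_pds_mult)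

lemma dif_smul: "dif j P P' \<Longrightarrow> dif j (\<lambda>x. cl_smul c (P x)) (\<lambda>x. cl_smul c (P' x))"
  using dif_scal[OF has_pds_const, of j P P' c] by simp

lemma dif_cl_mult:
  assumes "dif j P P'" "dif j Q Q'"
  shows "dif j (\<lambda>x. cl_mult n (P x) (Q x)) (\<lambda>x. cl_mult n (P x) (Q' x) + cl_mult n (P' x) (Q x))"
  unfolding dif_def
proof
  fix T
  have *: "has_pds j (\<lambda>x. if sym_diff S S' = T then cl_sign S S' * P x S * Q x S' else 0)
     (\<lambda>x. if sym_diff S S' = T then cl_sign S S' * P x S * Q' x S' + cl_sign S S' * P' x S * Q x S' else 0)" for S S'
  proof (cases "sym_diff S S' = T")
    case True
    have d: "has_pds j (\<lambda>x. cl_sign S S' * P x S) (\<lambda>x. cl_sign S S' * P' x S + 0 * P x S)"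
      by (rule has_pds_mult[OF has_pds_const]) (use assms(1) in \<open>simp add: dif_def\<close>)
    have "has_pds j (\<lambda>x. (cl_sign S S' * P x S) * Q x S') (\<lambda>x. (cl_sign S S' * P x S) * Q' x S' + (cl_sign S S' * P' x S + 0 * P x S) * Q x S')"
      by (rule has_pds_mult[OF d]) (use assms(2) in \<open>simp add: dif_def\<close>)
    then show ?thesis by (simp only: True if_True) simp
  next
    case False
    then show ?thesis by (simp only: if_False has_pds_const)
  qed
  have e: "(\<lambda>x. (cl_mult n (P x) (Q' x) + cl_mult n (P' x) (Q x)) T)
    = (\<lambda>x. \<Sum>S\<in>Pow {1..n}. \<Sum>S'\<in>Pow {1..n}. if sym_diff S S' = T then cl_sign S S' * P x S * Q' x S' + cl_sign S S' * P' x S * Q x S' else 0)"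
    unfolding cl_mult_def plus_fun_apply sum.distrib[symmetric] by (intro ext sum.cong refl) (simp only: split: if_split, simp)
  show "has_pds j (\<lambda>x. cl_mult n (P x) (Q x) T) (\<lambda>x. (cl_mult n (P x) (Q' x) + cl_mult n (P' x) (Q x)) T)"
    unfolding e unfolding cl_mult_def by (intro has_pds_sum *)
qed

lemma hom_poly_add: "hom_poly n k P \<Longrightarrow> hom_poly n k Q \<Longrightarrow> hom_poly n k (\<lambda>x. P x + Q x)"
  unfolding hom_poly_iff_spoly plus_fun_apply by (auto intro: spoly_add)
lemma hom_poly_zero: "hom_poly n k (\<lambda>x. 0)"
  unfolding hom_poly_iff_spoly zero_fun_apply by (auto intro: spoly_zero)
lemma hom_poly_const: "hom_poly n 0 (\<lambda>x. A)"
  unfolding hom_poly_iff_spoly by (auto intro: spoly_const)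
lemma hom_poly_smul: "hom_poly n k P \<Longrightarrow> hom_poly n k (\<lambda>x. cl_smul c (P x))"
  unfolding hom_poly_iff_spoly cl_smul_def by (auto intro: spoly_smul)
lemma hom_poly_scal: "spoly n k f \<Longrightarrow> hom_poly n l P \<Longrightarrow> hom_poly n (k + l) (\<lambda>x. cl_smul (f x) (P x))"
  unfolding hom_poly_iff_spoly cl_smul_def by (auto intro: spoly_mult)
lemma hom_poly_sum: "(\<And>i. i \<in> I \<Longrightarrow> hom_poly n k (P i)) \<Longrightarrow> hom_poly n k (\<lambda>x. \<Sum>i\<in>I. P i x)"
  unfolding hom_poly_iff_spoly sum_mv_apply by (auto intro: spoly_sum)
lemma hom_poly_cl_mult:
  assumes "hom_poly n k P" "hom_poly n l Q"
  shows "hom_poly n (k + l) (\<lambda>x. cl_mult a (P x) (Q x))"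
  unfolding hom_poly_iff_spoly cl_mult_def
proof (intro allI spoly_sum)
  fix T S S'
  show "spoly n (k + l) (\<lambda>x. if sym_diff S S' = T then cl_sign S S' * P x S * Q x S' else 0)"
  proof (cases "sym_diff S S' = T")
    case True
    have "spoly n (k + l) (\<lambda>x. (cl_sign S S' * P x S) * Q x S')"
      by (rule spoly_mult[OF spoly_smul[OF hom_polyD[OF assms(1)]] hom_polyD[OF assms(2)]])
    then show ?thesis by (simp only: True simp_thms if_True)
  qed (simp only: if_False spoly_zero)
qed
lemma hom_poly_mono: "hom_poly n k P \<Longrightarrow> n \<le> n' \<Longrightarrow> hom_poly n' k P"
  unfolding hom_poly_iff_spoly by (auto intro: spoly_mono)

lemma hom_poly_Euler:
  "hom_poly n k P \<Longrightarrow> (\<Sum>j\<in>{1..n}. cl_smul (complex_of_real (x j)) (pd j P x)) = cl_smul (of_nat k) (P x)"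
  by (rule ext) (simp only: sum_mv_apply cl_smul_def pd_pds spoly_Euler[OF hom_polyD])

lemma hom_poly_scale: "hom_poly n k P \<Longrightarrow> P (\<lambda>i. c * x i) = cl_smul (complex_of_real c ^ k) (P x)"
  by (rule ext) (simp only: cl_smul_def spoly_scale[OF hom_polyD])

lemma hom_poly_cong: "hom_poly n k P \<Longrightarrow> (\<And>i. i \<in> {1..n} \<Longrightarrow> x i = y i) \<Longrightarrow> P x = P y"
  by (rule ext) (rule spoly_cong_coords[OF hom_polyD])

lemma dif_cl_vec: "dif j (\<lambda>x. cl_vec n x) (\<lambda>x. if j \<in> {1..n} then cl_e j else 0)"
proof -
  have "dif j (\<lambda>x. \<Sum>i\<in>{1..n}. cl_smul (complex_of_real (x i)) (cl_e i))
     (\<lambda>x. \<Sum>i\<in>{1..n}. (cl_smul (complex_of_real (x i)) 0 + cl_smul (if i = j then 1 else 0) (cl_e i)))"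
    by (intro dif_sum dif_scal has_pds_coord dif_const)
  moreover have "(\<Sum>i\<in>{1..n}. (cl_smul (complex_of_real (x i)) 0 + cl_smul (if i = j then 1 else 0) (cl_e i)))
     = (if j \<in> {1..n} then cl_e j else 0)" for x :: "nat \<Rightarrow> real"
  proof -
    have "(\<Sum>i\<in>{1..n}. (cl_smul (complex_of_real (x i)) 0 + cl_smul (if i = j then 1 else 0) (cl_e i)))
       = (\<Sum>i\<in>{1..n}. if i = j then cl_e j else 0)"
      by (intro sum.cong refl) auto
    then show ?thesis by (simp only: sum.delta finite_atLeastAtMost)
  qed
  ultimately show ?thesis unfolding cl_vec_eq_sum by simp
qed

lemma hom_poly_cl_vec: "hom_poly n (Suc 0) (\<lambda>x. cl_vec n x)"
proof -
  have "hom_poly n (Suc 0 + 0) (\<lambda>x. cl_smul (complex_of_real (x i)) (cl_e i))" if "i \<in> {1..n}" for i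
    using that by (intro hom_poly_scal spoly_coordinate hom_poly_const)
  then show ?thesis unfolding cl_vec_eq_sum by (intro hom_poly_sum) simp
qed

lemma dirac_eq_sum: "dirac n P x = (\<Sum>j\<in>{1..n}. cl_mult n (cl_e j) (pd j P x))"
  by (rule ext) (simp only: dirac_def sum_mv_apply)

section \<open>The action of unit vectors\<close>

lemma cl_vec_minus: "cl_vec n (\<lambda>i. - u i) = - cl_vec n u"
  by (rule ext) (simp add: cl_vec_def)

lemma cl_vec_cong: "(\<And>i. i \<in> {1..n} \<Longrightarrow> u i = v i) \<Longrightarrow> cl_vec n u = cl_vec n v"
  unfolding cl_vec_eq_sum by (intro sum.cong refl) simp

lemma cl_e_eq_vec: "j \<in> {1..n} \<Longrightarrow> cl_e j = cl_vec n (\<lambda>i. if i = j then 1 else 0)"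
proof -
  assume j: "j \<in> {1..n}"
  have "cl_vec n (\<lambda>i. if i = j then 1 else 0) = (\<Sum>i\<in>{1..n}. if i = j then cl_e j else 0)"
    unfolding cl_vec_eq_sum by (intro sum.cong refl) auto
  then show ?thesis using j by (simp only: sum.delta finite_atLeastAtMost if_True)
qed

lemma e_vec_anticommute:
  assumes "j \<in> {1..N}" "N \<le> n"
  shows "cl_mult n (cl_e j) (cl_vec N x) = cl_smul (complex_of_real (- 2 * x j)) cl_one - cl_mult n (cl_vec N x) (cl_e j)"
proof -
  have j: "j \<in> {1..n}" using assms by auto
  have inner_up: "inner_up n (\<lambda>i. if i = j then 1 else 0) (\<lambda>i. if i \<le> N then x i else 0) = x j"
  proof -
    have "inner_up n (\<lambda>i. if i = j then 1 else 0) (\<lambda>i. if i \<le> N then x i else 0) = (\<Sum>i\<in>{1..n}. if i = j then x j else 0)"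
      unfolding inner_up_def using assms by (intro sum.cong refl) auto
    then show ?thesis using j by simp
  qed
  show ?thesis
    using cl_vec_anticommute[of n "\<lambda>i. if i = j then 1 else 0" "\<lambda>i. if i \<le> N then x i else 0"]
    unfolding inner_up cl_e_eq_vec[OF j, symmetric] cl_vec_extend[OF assms(2), symmetric]
    by (simp add: algebra_simps)
qed

lemma unit_vecs_mono: "i \<le> n \<Longrightarrow> unit_vecs i \<subseteq> unit_vecs n"
proof
  fix u assume a: "i \<le> n" "u \<in> unit_vecs i"
  have "(\<Sum>j\<in>{1..n}. (u j)^2) = (\<Sum>j\<in>{1..i}. (u j)^2)"
    by (rule sum.mono_neutral_right) (use a in \<open>auto simp: unit_vecs_def\<close>)
  moreover have "\<forall>j. u j \<noteq> 0 \<longrightarrow> j \<in> {1..n}" using a by (force simp: unit_vecs_def)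
  ultimately show "u \<in> unit_vecs n" using a by (simp add: unit_vecs_def)
qed

lemma unit_vecs_inner_up: "u \<in> unit_vecs n \<Longrightarrow> inner_up n u u = 1"
  by (simp add: unit_vecs_def inner_up_def power2_eq_square)

lemma unit_vecs_zero: "u \<in> unit_vecs n \<Longrightarrow> j \<notin> {1..n} \<Longrightarrow> u j = 0"
  unfolding unit_vecs_def by blast

lemma inner_up_unit_vecs:
  assumes "u \<in> unit_vecs N" "N \<le> n"
  shows "inner_up n u x = inner_up N u x"
  unfolding inner_up_def by (rule sum.mono_neutral_right) (use assms unit_vecs_zero[OF assms(1)] in auto)

lemma cl_vec_unit_vecs: "u \<in> unit_vecs N \<Longrightarrow> N \<le> n \<Longrightarrow> cl_vec n u = cl_vec N u"
  unfolding cl_vec_extend[of N n u] by (rule cl_vec_cong) (auto intro: unit_vecs_zero)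

text \<open>For a unit vector \<open>u\<close>, \<open>conjug n u A\<close> is \<open>u A u^{-1}\<close> (as \<open>u^{-1} = -u\<close>), and \<open>reflect n u x\<close> is the
  vector \<open>u^{-1} x u\<close>: the negative of the reflection in the hyperplane orthogonal to \<open>u\<close>.\<close>
definition conjug :: "nat \<Rightarrow> (nat \<Rightarrow> real) \<Rightarrow> mv \<Rightarrow> mv" where
  "conjug n u A = - cl_mult n (cl_vec n u) (cl_mult n A (cl_vec n u))"

definition reflect :: "nat \<Rightarrow> (nat \<Rightarrow> real) \<Rightarrow> (nat \<Rightarrow> real) \<Rightarrow> nat \<Rightarrow> real" where
  "reflect n u x = (\<lambda>i. if i \<in> {1..n} then 2 * inner_up n u x * u i - x i else 0)"

lemma conjug_add: "conjug n u (A + B) = conjug n u A + conjug n u B"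
  by (simp add: conjug_def cl_mult_distrib)
lemma conjug_diff: "conjug n u (A - B) = conjug n u A - conjug n u B"
  by (simp add: conjug_def cl_mult_distrib)
lemma conjug_smul: "conjug n u (cl_smul c A) = cl_smul c (conjug n u A)"
  by (simp add: conjug_def cl_mult_distrib cl_smul_minus cl_smul_neg_left)
lemma conjug_zero [simp]: "conjug n u 0 = 0" by (simp add: conjug_def)
lemma conjug_minus: "conjug n u (- A) = - conjug n u A" using conjug_diff[of n u 0 A] by simp
lemma conjug_sum: "conjug n u (sum f I) = (\<Sum>i\<in>I. conjug n u (f i))"
  using sum_comp_morphism[of "conjug n u" f I] by (simp add: conjug_add comp_def)
lemma conjug_in_Cl [simp]: "conjug n u A \<in> Cl n" by (simp add: conjug_def)

lemma unit_vec_mult: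
  assumes "u \<in> unit_vecs n" "A \<in> Cl n"
  shows "cl_mult n (cl_vec n u) (cl_mult n (cl_vec n u) A) = - A"
  using vec_vec_mult[OF order.refl assms(2), of u] unit_vecs_inner_up[OF assms(1)] by simp

lemma conjug_mult:
  assumes "u \<in> unit_vecs n"
  shows "cl_mult n (conjug n u A) (conjug n u B) = conjug n u (cl_mult n A B)"
  by (simp add: conjug_def cl_mult_minus_left cl_mult_minus_right cl_mult_assoc unit_vec_mult[OF assms])

lemma conjug_one: "u \<in> unit_vecs n \<Longrightarrow> conjug n u cl_one = cl_one"
  unfolding conjug_def using cl_vec_square[of n u] unit_vecs_inner_up[of u n] by (simp add: cl_mult_one_left)

lemma conjug_conjug:
  assumes "u \<in> unit_vecs n" "A \<in> Cl n"
  shows "conjug n u (conjug n u A) = A"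
proof -
  have "cl_mult n A (cl_mult n (cl_vec n u) (cl_vec n u)) = - A"
    using mult_vec_vec[OF order.refl assms(2), of u] unit_vecs_inner_up[OF assms(1)] by simp
  then show ?thesis
    by (simp add: conjug_def cl_mult_minus_left cl_mult_minus_right cl_mult_assoc unit_vec_mult[OF assms(1)])
      (simp add: unit_vec_mult[OF assms(1)] assms(2))
qed

lemma conjug_vec:
  assumes "u \<in> unit_vecs n"
  shows "conjug n u (cl_vec n x) = cl_vec n (reflect n u x)"
proof -
  have 1: "cl_mult n (cl_vec n x) (cl_vec n u) = cl_smul (complex_of_real (- 2 * inner_up n u x)) cl_one - cl_mult n (cl_vec n u) (cl_vec n x)"
    using cl_vec_anticommute[of n u x] by (simp add: algebra_simps)
  have 2: "conjug n u (cl_vec n x) = cl_smul (complex_of_real (2 * inner_up n u x)) (cl_vec n u) - cl_vec n x"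
    unfolding conjug_def 1 cl_mult_diff_right cl_mult_smul_right
    by (simp add: cl_mult_one_right unit_vec_mult[OF assms]) (rule ext, simp add: cl_smul_def)
  have 3: "cl_vec n (reflect n u x) = cl_vec n (\<lambda>i. 2 * inner_up n u x * u i - x i)"
    by (rule cl_vec_cong) (simp add: reflect_def)
  show ?thesis
    unfolding 2 3 by (rule ext) (simp add: cl_vec_def cl_smul_def)
qed

lemma reflect_lower:
  assumes "u \<in> unit_vecs N" "N \<le> n"
  shows "reflect n u x i = (if i \<in> {1..N} then reflect N u x i else if i \<in> {1..n} then - x i else 0)"
  using inner_up_unit_vecs[OF assms, of x] unit_vecs_zero[OF assms(1), of i] assms(2) by (auto simp: reflect_def)

lemma conjug_vec_lower:
  assumes "u \<in> unit_vecs N" "N \<le> n"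
  shows "conjug n u (cl_vec N x) = cl_vec N (reflect N u x)"
proof -
  have u: "u \<in> unit_vecs n" using assms unit_vecs_mono by blast
  have i: "inner_up N u (\<lambda>i. if i \<le> N then x i else 0) = inner_up N u x" unfolding inner_up_def by (intro sum.cong) auto
  have "conjug n u (cl_vec N x) = cl_vec n (reflect n u (\<lambda>i. if i \<le> N then x i else 0))"
    unfolding cl_vec_extend[OF assms(2), of x] conjug_vec[OF u] ..
  also have "\<dots> = cl_vec n (\<lambda>i. if i \<le> N then reflect N u x i else 0)"
    by (rule cl_vec_cong) (simp add: reflect_lower[OF assms], auto simp: reflect_def i)
  also have "\<dots> = cl_vec N (reflect N u x)" unfolding cl_vec_extend[OF assms(2), of "reflect N u x"] ..
  finally show ?thesis .
qed

text \<open>A vector orthogonal to u anticommutes with u, so - u e_j u = u u e_j = - e_j. All signs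
  in the commutation of the operators with Pin(m - 1) come from here.\<close>

lemma conjug_e_new:
  assumes "u \<in> unit_vecs N" "N < j" "j \<le> n"
  shows "conjug n u (cl_e j) = - cl_e j"
proof -
  have N: "N \<le> n" using assms by simp
  have u: "u \<in> unit_vecs n" using assms(1) N unit_vecs_mono by blast
  have j: "j \<in> {1..n}" using assms by auto
  have i: "inner_up N u (\<lambda>i. if i = j then 1 else 0) = 0" unfolding inner_up_def using assms by (intro sum.neutral) auto
  have "conjug n u (cl_e j) = cl_vec n (reflect n u (\<lambda>i. if i = j then 1 else 0))"
    unfolding cl_e_eq_vec[OF j] conjug_vec[OF u] ..
  also have "\<dots> = cl_vec n (\<lambda>i. - (if i = j then 1 else 0))"
    by (rule cl_vec_cong) (simp add: reflect_lower[OF assms(1) N], use assms unit_vecs_zero[OF assms(1)] in \<open>auto simp: reflect_def i\<close>)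
  finally show ?thesis unfolding cl_vec_minus cl_e_eq_vec[OF j] .
qed

text \<open>A u is (-1)^s times half of \<open>?a - ?b\<close>, twice the wedge minus twice the
  inner product. Left multiplication by u brings both of them back to grade s.\<close>

lemma conjug_Lam:
  assumes "A \<in> Lam n s"
  shows "conjug n u A \<in> Lam n s"
proof -
  let ?u = "cl_vec n u"
  let ?a = "cl_mult n ?u A + cl_smul ((-1)^s) (cl_mult n A ?u)"
  let ?b = "cl_mult n ?u A - cl_smul ((-1)^s) (cl_mult n A ?u)"
  have "conjug n u A = cl_smul (-(1/2) * (-1)^s) (cl_mult n ?u ?a - cl_mult n ?u ?b)"
    unfolding conjug_def cl_mult_distrib cl_mult_assoc
    by (rule ext) (simp add: cl_smul_def algebra_simps flip: power_add mult_2)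
  also have "\<dots> \<in> Lam n s"
    by (intro Lam_smul Lam_diff vec_mult_wedge_Lam vec_mult_dot_Lam assms order.refl)
  finally show ?thesis .
qed

lemma conjug_mono:
  assumes "u \<in> unit_vecs N" "N \<le> n" "A \<in> Cl N"
  shows "conjug n u A = conjug N u A"
  unfolding conjug_def cl_vec_unit_vecs[OF assms(1,2)]
  by (simp add: cl_mult_mono[OF _ _ assms(2)] assms(3))

section \<open>The action of a list of unit vectors\<close>

lemma cl_prod_in_Cl: "cl_prod n us \<in> Cl n" by (cases us) (auto simp: cl_prod_def)

lemma cl_prod_Cons: "cl_prod n (u # us) = cl_mult n (cl_vec n u) (cl_prod n us)"
  by (simp add: cl_prod_def)

lemma cl_prod_append: "cl_prod n (us @ vs) = cl_mult n (cl_prod n us) (cl_prod n vs)"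
  by (induction us) (simp_all add: cl_prod_Cons cl_mult_assoc cl_mult_one_left cl_prod_in_Cl, simp add: cl_prod_def cl_mult_one_left cl_prod_in_Cl[unfolded cl_prod_def])

lemma cl_prod_single: "cl_prod n [u] = cl_vec n u"
  by (simp add: cl_prod_def cl_mult_one_right)

lemma cl_to_vec_cl_vec: "cl_to_vec (cl_vec n x) = (\<lambda>i. if i \<in> {1..n} then x i else 0)"
  by (rule ext) (auto simp: cl_to_vec_def cl_vec_def)

lemma neg_conj_vec:
  assumes "u \<in> unit_vecs n"
  shows "cl_mult n (cl_mult n (cl_vec n (\<lambda>j. - u j)) (cl_vec n x)) (cl_vec n u) = cl_vec n (reflect n u x)"
  unfolding conjug_vec[OF assms, symmetric] conjug_def cl_vec_minus cl_mult_minus_left cl_mult_assoc ..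

lemma cl_to_vec_reflect: "cl_to_vec (cl_vec n (reflect n u x)) = reflect n u x"
  unfolding cl_to_vec_cl_vec by (rule ext) (simp add: reflect_def)

lemma H_act_single:
  assumes "u \<in> unit_vecs n"
  shows "H_act n [u] P x = conjug n u (P (reflect n u x))"
  unfolding H_act_def Let_def
  by (simp add: cl_prod_single neg_conj_vec[OF assms] cl_to_vec_reflect)
    (simp add: conjug_def cl_vec_minus cl_mult_minus_right cl_mult_minus_left cl_mult_assoc)

text \<open>The inverse is formed from the reversed list, so the first vector u stands next to x
  inside the argument and outermost around the value. This reduces the Pin action to single unit
  vectors.\<close>

lemma H_act_Cons:
  assumes "u \<in> unit_vecs n"
  shows "H_act n (u # us) P = H_act n [u] (H_act n us P)"
proof
  fix x
  let ?r = "cl_prod n us" and ?ri = "cl_prod n (map (\<lambda>u j. - u j) (rev us))"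
  have ri: "cl_prod n (map (\<lambda>u j. - u j) (rev (u # us))) = cl_mult n ?ri (cl_vec n (\<lambda>j. - u j))"
    by (simp add: cl_prod_append cl_prod_single)
  have y: "cl_mult n (cl_mult n (cl_mult n ?ri (cl_vec n (\<lambda>j. - u j))) (cl_vec n x)) (cl_mult n (cl_vec n u) ?r)
     = cl_mult n (cl_mult n ?ri (cl_vec n (reflect n u x))) ?r"
    unfolding neg_conj_vec[OF assms, symmetric] cl_mult_assoc ..
  show "H_act n (u # us) P x = H_act n [u] (H_act n us P) x"
    unfolding H_act_single[OF assms]
    unfolding H_act_def Let_def ri cl_prod_Cons y
    by (simp add: conjug_def cl_vec_minus cl_mult_minus_right cl_mult_minus_left cl_mult_assoc)
qed

text \<open>Passing through \<open>cl_to_vec (cl_vec n x)\<close> sets the coordinates outside 1..n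
  to 0, and multiplication by 1 cuts off the coefficients outside the algebra. A homogeneous
  polynomial with values in \<open>Cl n\<close> notices neither.\<close>

lemma H_act_Nil:
  assumes "hom_poly n k P" "\<And>x. P x \<in> Cl n"
  shows "H_act n [] P = P"
proof
  fix x
  have 1: "P (\<lambda>i. if i \<in> {1..n} then x i else 0) = P x"
    by (rule hom_poly_cong[OF assms(1)]) simp
  have 0: "cl_prod n [] = cl_one" by (simp add: cl_prod_def)
  show "H_act n [] P x = P x"
    unfolding H_act_def Let_def
    by (simp only: rev.simps list.map 0 cl_mult_one_left cl_mult_one_right cl_vec_in_Cl cl_to_vec_cl_vec 1 assms(2))
qed

lemma monog_iff: "P \<in> monog n s k \<longleftrightarrow> hom_poly n k P \<and> (\<forall>x. P x \<in> Lam n s) \<and> (\<forall>x. dirac n P x = 0)"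
  by (auto simp: monog_def Lam_def)

lemma monogD:
  assumes "P \<in> monog n s k"
  shows "hom_poly n k P" "P x \<in> Lam n s" "P x \<in> Cl n" "dirac n P x = 0"
  using assms Lam_subset_Cl[of n s] by (auto simp: monog_iff)

text \<open>The chain rule for a substitution with constant partial derivatives \<open>a\<close>, by
  induction over the polynomial; only one variable moves at a time, so no total derivative
  enters.\<close>

lemma has_pds_linear_compose:
  assumes "\<And>i. i \<in> {1..n} \<Longrightarrow> has_pds j (\<lambda>x. complex_of_real (L x i)) (\<lambda>x. complex_of_real (a i))"
  shows "spoly n k f \<Longrightarrow> has_pds j (\<lambda>x. f (L x)) (\<lambda>x. \<Sum>l\<in>{1..n}. complex_of_real (a l) * pds l f (L x))"
proof (induction rule: spoly.induct)
  case (spoly_const c)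
  then show ?case using has_pds_pds[OF has_pds_const] has_pds_const by simp
next
  case (spoly_zero k)
  then show ?case using has_pds_pds[OF has_pds_const] has_pds_const by simp
next
  case (spoly_coord k f i)
  have p: "pds l (\<lambda>x. complex_of_real (x i) * f x) x = complex_of_real (x i) * pds l f x + (if i = l then 1 else 0) * f x" for l x
    using has_pds_pds[OF has_pds_mult[OF has_pds_coord[of l i] spoly_has_pds[OF spoly_coord(1)]]] by simp
  have "(\<Sum>l\<in>{1..n}. complex_of_real (a l) * pds l (\<lambda>x. complex_of_real (x i) * f x) (L x))
     = complex_of_real (L x i) * (\<Sum>l\<in>{1..n}. complex_of_real (a l) * pds l f (L x)) + complex_of_real (a i) * f (L x)" for x
  proof -
    have "(\<Sum>l\<in>{1..n}. complex_of_real (a l) * pds l (\<lambda>x. complex_of_real (x i) * f x) (L x))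
      = (\<Sum>l\<in>{1..n}. complex_of_real (L x i) * (complex_of_real (a l) * pds l f (L x)))
       + (\<Sum>l\<in>{1..n}. if l = i then complex_of_real (a i) * f (L x) else 0)"
      unfolding p sum.distrib[symmetric] by (intro sum.cong refl) (auto simp: algebra_simps)
    then show ?thesis using spoly_coord(2) by (simp add: sum_distrib_left)
  qed
  then show ?case
    using has_pds_mult[OF assms[OF spoly_coord(2)] spoly_coord(3)] by simp
next
  case (spoly_add k f g)
  have p: "pds l (\<lambda>x. f x + g x) x = pds l f x + pds l g x" for l x
    using has_pds_pds[OF has_pds_add[OF spoly_has_pds[OF spoly_add(1)] spoly_has_pds[OF spoly_add(2)]]] by simp
  show ?case using has_pds_add[OF spoly_add(3,4)] by (simp add: p distrib_left sum.distrib)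
qed

lemma has_pds_cmult: "has_pds j f f' \<Longrightarrow> has_pds j (\<lambda>x. c * f x) (\<lambda>x. c * f' x)"
  using has_pds_mult[OF has_pds_const, of j f f' c] by simp

definition reflect_mat :: "(nat \<Rightarrow> real) \<Rightarrow> nat \<Rightarrow> nat \<Rightarrow> real" where
  "reflect_mat u i j = 2 * u i * u j - (if i = j then 1 else 0)"

lemma has_pds_reflect:
  assumes "i \<in> {1..n}" "j \<in> {1..n}"
  shows "has_pds j (\<lambda>x. complex_of_real (reflect n u x i)) (\<lambda>x. complex_of_real (reflect_mat u i j))"
proof -
  have inner_up: "complex_of_real (inner_up n u x) = (\<Sum>l\<in>{1..n}. complex_of_real (u l) * complex_of_real (x l))" for x
    by (simp add: inner_up_def)
  have "has_pds j (\<lambda>x. complex_of_real (2 * u i) * (\<Sum>l\<in>{1..n}. complex_of_real (u l) * complex_of_real (x l)) + (-1) * complex_of_real (x i))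
     (\<lambda>x. complex_of_real (2 * u i) * (\<Sum>l\<in>{1..n}. complex_of_real (u l) * (if l = j then 1 else 0)) + (-1) * (if i = j then 1 else 0))"
    by (intro has_pds_add has_pds_cmult has_pds_sum has_pds_coord)
  moreover have "(\<Sum>l\<in>{1..n}. complex_of_real (u l) * (if l = j then 1 else 0)) = complex_of_real (u j)"
    using assms(2) by (simp add: if_distrib cong: if_cong)
  moreover have "complex_of_real (reflect n u x i) = complex_of_real (2 * u i) * (\<Sum>l\<in>{1..n}. complex_of_real (u l) * complex_of_real (x l)) + (-1) * complex_of_real (x i)" for x
    unfolding inner_up[symmetric] using assms(1) by (simp add: reflect_def)
  moreover have "complex_of_real (reflect_mat u i j) = complex_of_real (2 * u i) * complex_of_real (u j) + (-1) * (if i = j then 1 else 0)"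
    by (simp add: reflect_mat_def)
  ultimately show ?thesis by (simp only:)
qed

lemma dif_reflect:
  assumes "hom_poly n k P" "j \<in> {1..n}"
  shows "dif j (\<lambda>x. P (reflect n u x)) (\<lambda>x. \<Sum>l\<in>{1..n}. cl_smul (complex_of_real (reflect_mat u l j)) (pd l P (reflect n u x)))"
  unfolding dif_def sum_mv_apply cl_smul_def pd_pds
  by (intro allI has_pds_linear_compose[OF _ hom_polyD[OF assms(1)]] has_pds_reflect assms(2))

lemma dif_conjug: "dif j P P' \<Longrightarrow> dif j (\<lambda>x. conjug n u (P x)) (\<lambda>x. conjug n u (P' x))"
proof -
  assume P: "dif j P P'"
  have "dif j (\<lambda>x. cl_smul (-1) (cl_mult n (cl_vec n u) (cl_mult n (P x) (cl_vec n u))))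
     (\<lambda>x. cl_smul (-1) (cl_mult n (cl_vec n u) (cl_mult n (P x) 0 + cl_mult n (P' x) (cl_vec n u)) + cl_mult n 0 (cl_mult n (P x) (cl_vec n u))))"
    by (intro dif_smul dif_cl_mult dif_const P)
  then show ?thesis by (simp add: conjug_def)
qed

lemma conjug_e:
  assumes "u \<in> unit_vecs n" "l \<in> {1..n}"
  shows "conjug n u (cl_e l) = (\<Sum>j\<in>{1..n}. cl_smul (complex_of_real (reflect_mat u l j)) (cl_e j))"
proof -
  have i: "inner_up n u (\<lambda>i. if i = l then 1 else 0) = u l"
    using assms(2) by (simp add: inner_up_def if_distrib cong: if_cong)
  have "conjug n u (cl_e l) = cl_vec n (reflect n u (\<lambda>i. if i = l then 1 else 0))"
    unfolding cl_e_eq_vec[OF assms(2)] conjug_vec[OF assms(1)] ..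
  also have "\<dots> = cl_vec n (reflect_mat u l)"
    by (rule cl_vec_cong) (auto simp: reflect_def reflect_mat_def i)
  finally show ?thesis unfolding cl_vec_eq_sum .
qed

lemma pd_H_act:
  assumes "hom_poly n k P" "u \<in> unit_vecs n" "j \<in> {1..n}"
  shows "pd j (H_act n [u] P) x = (\<Sum>l\<in>{1..n}. cl_smul (complex_of_real (reflect_mat u l j)) (H_act n [u] (pd l P) x))"
proof -
  have "H_act n [u] P = (\<lambda>x. conjug n u (P (reflect n u x)))" by (rule ext) (rule H_act_single[OF assms(2)])
  then show ?thesis
    using dif_pd[OF dif_conjug[OF dif_reflect[OF assms(1,3), of u], of n u]]
    by (simp only: conjug_sum conjug_smul H_act_single[OF assms(2)])
qed

text \<open>The derivatives of P turn with the matrix \<open>reflect_mat\<close>; summed against e_j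
  this matrix gives \<open>conjug\<close> of e_l, and \<open>conjug\<close> is
  multiplicative.\<close>

lemma dirac_H_act:
  assumes "hom_poly n k P" "u \<in> unit_vecs n"
  shows "dirac n (H_act n [u] P) x = conjug n u (dirac n P (reflect n u x))"
proof -
  have "dirac n (H_act n [u] P) x
     = (\<Sum>j\<in>{1..n}. \<Sum>l\<in>{1..n}. cl_smul (complex_of_real (reflect_mat u l j)) (cl_mult n (cl_e j) (conjug n u (pd l P (reflect n u x)))))"
    unfolding dirac_eq_sum
    by (intro sum.cong refl) (simp only: pd_H_act[OF assms] cl_mult_sum_right cl_mult_smul_right H_act_single[OF assms(2)])
  also have "\<dots> = (\<Sum>l\<in>{1..n}. \<Sum>j\<in>{1..n}. cl_smul (complex_of_real (reflect_mat u l j)) (cl_mult n (cl_e j) (conjug n u (pd l P (reflect n u x)))))"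
    by (rule sum.swap)
  also have "\<dots> = (\<Sum>l\<in>{1..n}. cl_mult n (conjug n u (cl_e l)) (conjug n u (pd l P (reflect n u x))))"
    by (intro sum.cong refl) (simp only: conjug_e[OF assms(2)] cl_mult_sum_left cl_mult_smul_left)
  also have "\<dots> = conjug n u (dirac n P (reflect n u x))"
    unfolding dirac_eq_sum conjug_sum conjug_mult[OF assms(2)] ..
  finally show ?thesis .
qed

lemma spoly_reflect: "i \<in> {1..n} \<Longrightarrow> spoly n (Suc 0) (\<lambda>x. complex_of_real (reflect n u x i))"
proof -
  assume i: "i \<in> {1..n}"
  have "spoly n (Suc 0) (\<lambda>x. complex_of_real (2 * u i) * (\<Sum>l\<in>{1..n}. complex_of_real (u l) * complex_of_real (x l)) - complex_of_real (x i))"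
    by (intro spoly_diff spoly_smul spoly_sum spoly_coordinate i)
  then show ?thesis using i by (simp add: reflect_def inner_up_def mult_ac)
qed

lemma hom_poly_reflect: "hom_poly n k P \<Longrightarrow> hom_poly n k (\<lambda>x. P (reflect n u x))"
  unfolding hom_poly_iff_spoly by (auto intro: spoly_compose spoly_reflect)

lemma hom_poly_conjug: "hom_poly n k P \<Longrightarrow> hom_poly n k (\<lambda>x. conjug a u (P x))"
proof -
  assume P: "hom_poly n k P"
  have "hom_poly n (0 + (k + 0)) (\<lambda>x. cl_mult a (cl_vec a u) (cl_mult a (P x) (cl_vec a u)))"
    by (intro hom_poly_cl_mult hom_poly_const P)
  then show ?thesis using hom_poly_smul[of n k _ "-1"] by (simp add: conjug_def)
qed

lemma hom_poly_H_act: "hom_poly n k P \<Longrightarrow> u \<in> unit_vecs n \<Longrightarrow> hom_poly n k (H_act n [u] P)"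
proof -
  assume a: "hom_poly n k P" "u \<in> unit_vecs n"
  have "H_act n [u] P = (\<lambda>x. conjug n u (P (reflect n u x)))" by (rule ext) (rule H_act_single[OF a(2)])
  then show ?thesis using hom_poly_conjug[OF hom_poly_reflect[OF a(1)]] by simp
qed

lemma monog_H_act: "P \<in> monog n s k \<Longrightarrow> u \<in> unit_vecs n \<Longrightarrow> H_act n [u] P \<in> monog n s k"
  unfolding monog_iff by (auto intro: hom_poly_H_act simp: H_act_single conjug_Lam dirac_H_act)

text \<open>The Dirac operator in the first \<open>N\<close> variables, with values in the Clifford algebra on \<open>a\<close> generators.\<close>
definition dirN :: "nat \<Rightarrow> nat \<Rightarrow> pf \<Rightarrow> pf" where
  "dirN a N P x = (\<Sum>j\<in>{1..N}. cl_mult a (cl_e j) (pd j P x))"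

lemma dirac_dirN: "dirac n P x = dirN n n P x" by (simp only: dirac_eq_sum dirN_def)

text \<open>Moving e_j past x produces -2 x_j, which Euler's identity sums to -2 k, and the squares
  of the N generators add -N.\<close>

lemma dirN_vec_mult:
  assumes P: "hom_poly N k P" "\<And>x. P x \<in> Cl a" and N: "N \<le> a"
  shows "dirN a N (\<lambda>x. cl_mult a (cl_vec N x) (P x)) x
     = cl_smul (complex_of_real (- (real N + 2 * real k))) (P x) - cl_mult a (cl_vec N x) (dirN a N P x)"
proof -
  have pdCl: "pd j P x \<in> Cl a" for j
  proof -
    have "pd j P x S = 0" if "\<not> S \<subseteq> {1..a}" for S
    proof -
      have "P x S = 0" for x using P(2)[of x] that unfolding Cl_def by blast
      then have "(\<lambda>x. P x S) = (\<lambda>x. 0)" by simp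
      then show ?thesis unfolding pd_pds using has_pds_pds[OF has_pds_const] by simp
    qed
    then show ?thesis by (auto simp: Cl_def)
  qed
  have d: "pd j (\<lambda>x. cl_mult a (cl_vec N x) (P x)) x
     = cl_mult a (cl_vec N x) (pd j P x) + cl_mult a (cl_e j) (P x)" if "j \<in> {1..N}" for j
    using dif_pd[OF dif_cl_mult[OF dif_cl_vec[of j N] hom_poly_dif[OF P(1)], of a]] that by simp
  have t: "cl_mult a (cl_e j) (pd j (\<lambda>x. cl_mult a (cl_vec N x) (P x)) x)
     = cl_smul (-2) (cl_smul (complex_of_real (x j)) (pd j P x)) - cl_mult a (cl_vec N x) (cl_mult a (cl_e j) (pd j P x)) - P x"
    if j: "j \<in> {1..N}" for j
  proof -
    have ja: "j \<in> {1..a}" using j N by auto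
    have "cl_mult a (cl_e j) (cl_mult a (cl_vec N x) (pd j P x))
       = cl_mult a (cl_smul (complex_of_real (- 2 * x j)) cl_one - cl_mult a (cl_vec N x) (cl_e j)) (pd j P x)"
      unfolding e_vec_anticommute[OF j N, symmetric] cl_mult_assoc ..
    also have "\<dots> = cl_smul (-2) (cl_smul (complex_of_real (x j)) (pd j P x)) - cl_mult a (cl_vec N x) (cl_mult a (cl_e j) (pd j P x))"
      by (simp add: cl_mult_distrib cl_mult_one_left pdCl cl_mult_assoc)
    finally show ?thesis
      unfolding d[OF j] cl_mult_add_right using cl_e_square[OF ja P(2)] by simp
  qed
  have "dirN a N (\<lambda>x. cl_mult a (cl_vec N x) (P x)) x
    = cl_smul (-2) (\<Sum>j\<in>{1..N}. cl_smul (complex_of_real (x j)) (pd j P x)) - cl_mult a (cl_vec N x) (dirN a N P x) - (\<Sum>j\<in>{1..N}. P x)"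
    unfolding dirN_def cl_mult_sum_right cl_smul_sum sum_subtractf[symmetric] by (intro sum.cong refl t)
  also have "(\<Sum>j\<in>{1..N}. P x) = cl_smul (of_nat N) (P x)"
    by (rule ext) (simp add: sum_mv_apply cl_smul_def)
  finally show ?thesis
    unfolding hom_poly_Euler[OF P(1)] by (simp only: cl_smul_smul, intro ext) (simp add: cl_smul_def algebra_simps)
qed

text \<open>The product rule leaves the sum of all e_j P e_j, which \<open>sum_e_A_e\<close>
  evaluates on a fixed grade.\<close>

lemma dirN_mult_vec:
  assumes P: "hom_poly N k P" "\<And>x. P x \<in> Lam N s" and N: "N \<le> a"
  shows "dirN a N (\<lambda>x. cl_mult a (P x) (cl_vec N x)) x
     = cl_smul (complex_of_real ((-1)^(Suc s) * (real N - 2 * real s))) (P x) + cl_mult a (dirN a N P x) (cl_vec N x)"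
proof -
  have d: "pd j (\<lambda>x. cl_mult a (P x) (cl_vec N x)) x
     = cl_mult a (P x) (cl_e j) + cl_mult a (pd j P x) (cl_vec N x)" if "j \<in> {1..N}" for j
    using dif_pd[OF dif_cl_mult[OF hom_poly_dif[OF P(1)] dif_cl_vec[of j N], of a]] that by simp
  have PC: "P x \<in> Cl N" using P(2) Lam_subset_Cl by blast
  have e: "cl_mult a (cl_e j) (cl_mult a (P x) (cl_e j)) = cl_mult N (cl_e j) (cl_mult N (P x) (cl_e j))"
    if "j \<in> {1..N}" for j
    using that PC by (simp add: cl_mult_mono[OF _ _ N] del: atLeastAtMost_iff)
  have "dirN a N (\<lambda>x. cl_mult a (P x) (cl_vec N x)) x
    = (\<Sum>j\<in>{1..N}. cl_mult N (cl_e j) (cl_mult N (P x) (cl_e j))) + cl_mult a (dirN a N P x) (cl_vec N x)"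
    unfolding dirN_def cl_mult_sum_left sum.distrib[symmetric]
    by (intro sum.cong refl) (simp only: d cl_mult_add_right e cl_mult_assoc)
  then show ?thesis unfolding sum_e_A_e[OF P(2)] .
qed

text \<open>The Dirac operator applied to the hypothesis \<open>c\<close> gives - (n + 2 k) P on the
  left and - c (n - 2 s) P on the right. It is used with c = 1 in grade 0, and with c = -1 in the
  top grade and for the argument on the axis.\<close>

lemma monog_vanishing:
  assumes P: "P \<in> monog n s k"
    and c: "\<And>x. cl_mult n (cl_vec n x) (P x) = cl_smul (complex_of_real (c * (-1)^s)) (cl_mult n (P x) (cl_vec n x))"
    and nz: "real n + 2 * real k - c * (real n - 2 * real s) \<noteq> 0"
  shows "P = 0"
proof
  fix x
  note Pm = monogD[OF P]
  have PL: "\<And>x. P x \<in> Lam n s" by (rule Pm)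
  have PC: "\<And>x. P x \<in> Cl n" by (rule Pm)
  have d0: "dirN n n P x = 0" using Pm(4)[of x] unfolding dirac_dirN .
  have hv: "hom_poly n (k + Suc 0) (\<lambda>x. cl_mult n (P x) (cl_vec n x))"
    by (intro hom_poly_cl_mult Pm hom_poly_cl_vec)
  have "cl_smul (complex_of_real (- (real n + 2 * real k))) (P x) = dirN n n (\<lambda>x. cl_mult n (cl_vec n x) (P x)) x"
    using dirN_vec_mult[OF Pm(1) PC order.refl, of x] d0 by simp
  also have "\<dots> = dirN n n (\<lambda>x. cl_smul (complex_of_real (c * (-1)^s)) (cl_mult n (P x) (cl_vec n x))) x"
    unfolding c ..
  also have "\<dots> = cl_smul (complex_of_real (c * (-1)^s)) (dirN n n (\<lambda>x. cl_mult n (P x) (cl_vec n x)) x)"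
    unfolding dirN_def dif_pd[OF dif_smul[OF hom_poly_dif[OF hv]]] by (simp only: cl_mult_smul_right cl_smul_sum)
  also have "\<dots> = cl_smul (complex_of_real (c * (-1)^s)) (cl_smul (complex_of_real ((-1)^(Suc s) * (real n - 2 * real s))) (P x))"
    using dirN_mult_vec[OF Pm(1) PL order.refl, of x] d0 by simp
  finally have e: "cl_smul (complex_of_real (- (real n + 2 * real k))) (P x)
     = cl_smul (complex_of_real (c * (-1)^s * ((-1)^(Suc s) * (real n - 2 * real s)))) (P x)"
    by (simp only: cl_smul_smul of_real_mult)
  have s: "c * (-1)^s * ((-1)^(Suc s) * (real n - 2 * real s)) = - c * (real n - 2 * real s)"
    by (simp flip: power_add mult_2 add: mult.assoc[symmetric])
  have "complex_of_real (real n + 2 * real k - c * (real n - 2 * real s)) * P x T = 0" for T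
    using fun_cong[OF e, of T] unfolding s cl_smul_def by (simp add: algebra_simps)
  then show "P x = 0 x" using nz by (intro ext) (metis mult_eq_0_iff of_real_eq_0_iff zero_fun_apply)
qed

section \<open>Homogenised Gegenbauer polynomials\<close>

text \<open>The i-th term of a homogenised Gegenbauer polynomial. The exponent p = j - 2 i is an
  argument of its own, so that the recurrences can shift p and i separately without
  subtraction.\<close>

definition gterm :: "real \<Rightarrow> nat \<Rightarrow> nat \<Rightarrow> real \<Rightarrow> real \<Rightarrow> real" where
  "gterm \<nu> p i t \<rho> = (-1)^i * pochhammer \<nu> (p + i) / (fact i * fact p) * (2*t)^p * \<rho>^i"

text \<open>\<open>r^j C_j^\<nu>(t/r)\<close> as a polynomial in \<open>t\<close> and \<open>\<rho> = r^2\<close>, which is also correct at \<open>r = 0\<close>. The index is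
  an integer so that the recurrences need no case distinction at \<open>j = 0\<close>.\<close>
definition hgegen :: "real \<Rightarrow> int \<Rightarrow> real \<Rightarrow> real \<Rightarrow> real" where
  "hgegen \<nu> j t \<rho> = (\<Sum>i\<le>nat j. if 2 * int i \<le> j then gterm \<nu> (nat (j - 2 * int i)) i t \<rho> else 0)"

lemma hgegen_neg [simp]: "j < 0 \<Longrightarrow> hgegen \<nu> j t \<rho> = 0" by (simp add: hgegen_def)

lemma hgegen_upto:
  assumes "nat j \<le> M"
  shows "hgegen \<nu> j t \<rho> = (\<Sum>i\<le>M. if 2 * int i \<le> j then gterm \<nu> (nat (j - 2 * int i)) i t \<rho> else 0)"
  unfolding hgegen_def by (rule sum.mono_neutral_left) (use assms in auto)

lemma gterm_t: "real (Suc p) * gterm \<nu> (Suc p) i t \<rho> = 2 * \<nu> * t * gterm (\<nu> + 1) p i t \<rho>"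
proof -
  have p1: "pochhammer \<nu> (Suc p + i) = \<nu> * pochhammer (\<nu> + 1) (p + i)" by (simp add: pochhammer_rec)
  have f: "fact (Suc p) = real (Suc p) * fact p" by simp
  have n: "real (Suc p) \<noteq> 0" "(fact p :: real) \<noteq> 0" "(fact i :: real) \<noteq> 0" by auto
  have "gterm \<nu> (Suc p) i t \<rho> = \<nu> * 2 * t * gterm (\<nu> + 1) p i t \<rho> / real (Suc p)"
    unfolding gterm_def p1 f using n by (simp add: divide_simps)
  then show ?thesis using n by simp
qed

lemma gterm_rad2: "real (Suc i) * gterm \<nu> p (Suc i) t \<rho> = - \<nu> * \<rho> * gterm (\<nu> + 1) p i t \<rho>"
proof -
  have p1: "pochhammer \<nu> (p + Suc i) = \<nu> * pochhammer (\<nu> + 1) (p + i)" by (simp add: pochhammer_rec)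
  have f: "fact (Suc i) = real (Suc i) * fact i" by simp
  have n: "real (Suc i) \<noteq> 0" "(fact p :: real) \<noteq> 0" "(fact i :: real) \<noteq> 0" by auto
  have "gterm \<nu> p (Suc i) t \<rho> = - \<nu> * \<rho> * gterm (\<nu> + 1) p i t \<rho> / real (Suc i)"
    unfolding gterm_def p1 f using n by (simp add: divide_simps)
  then show ?thesis using n by simp
qed

lemma gterm_Suc: "(2 * \<nu> + real (Suc p + 2 * i)) * gterm \<nu> (Suc p) i t \<rho>
    = 2 * \<nu> * (gterm (\<nu> + 1) (Suc p) i t \<rho> - t * gterm (\<nu> + 1) p i t \<rho>)"
proof -
  define A where "A = (-1)^i / (fact i * fact p) * (2*t)^p * \<rho>^i * pochhammer (\<nu> + 1) (p + i)"
  have p1: "pochhammer \<nu> (Suc p + i) = \<nu> * pochhammer (\<nu> + 1) (p + i)" by (simp add: pochhammer_rec)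
  have p2: "pochhammer (\<nu> + 1) (Suc p + i) = pochhammer (\<nu> + 1) (p + i) * (\<nu> + 1 + real (p + i))"
    by (simp add: pochhammer_Suc)
  have f: "fact (Suc p) = real (Suc p) * fact p" by simp
  have n: "real (Suc p) \<noteq> 0" "(fact p :: real) \<noteq> 0" "(fact i :: real) \<noteq> 0" by auto
  have 1: "gterm \<nu> (Suc p) i t \<rho> = \<nu> * 2 * t * A / real (Suc p)"
    unfolding gterm_def p1 f A_def using n by (simp add: field_simps)
  have 2: "gterm (\<nu> + 1) (Suc p) i t \<rho> = (\<nu> + 1 + real (p + i)) * 2 * t * A / real (Suc p)"
    unfolding gterm_def p2 f A_def using n by (simp add: field_simps)
  have 3: "gterm (\<nu> + 1) p i t \<rho> = A" unfolding gterm_def A_def by simp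
  show ?thesis unfolding 1 2 3 using n(1) by (simp add: field_simps)
qed

lemma gterm_0: "(2 * \<nu> + real (2 * i)) * gterm \<nu> 0 i t \<rho> = 2 * \<nu> * gterm (\<nu> + 1) 0 i t \<rho>"
proof (cases i)
  case (Suc a)
  have p1: "pochhammer \<nu> (Suc a) = \<nu> * pochhammer (\<nu> + 1) a" by (simp add: pochhammer_rec)
  have p2: "pochhammer (\<nu> + 1) (Suc a) = pochhammer (\<nu> + 1) a * (\<nu> + 1 + real a)"
    by (simp add: pochhammer_Suc)
  define C where "C = (-1)^Suc a * pochhammer (\<nu> + 1) a / (fact (Suc a) * fact 0) * (2 * t)^0 * \<rho>^Suc a"
  have 1: "gterm \<nu> 0 i t \<rho> = \<nu> * C"
    unfolding gterm_def Suc add_0 p1 C_def by simp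
  have 2: "gterm (\<nu> + 1) 0 i t \<rho> = (\<nu> + 1 + real a) * C"
    unfolding gterm_def Suc add_0 p2 C_def by simp
  show ?thesis unfolding 1 2 by (simp add: Suc algebra_simps)
qed (simp add: gterm_def)

text \<open>A contiguous relation of Gegenbauer polynomials that holds term by term:
  \<open>gterm_Suc\<close> for 2 i < j, and \<open>gterm_0\<close> for the last term 2 i = j, which
  has no partner of index j - 1.\<close>

lemma hgegen_step: "(2 * \<nu> + of_int j) * hgegen \<nu> j t \<rho> = 2 * \<nu> * (hgegen (\<nu> + 1) j t \<rho> - t * hgegen (\<nu> + 1) (j - 1) t \<rho>)"
proof -
  have g: "hgegen (\<nu> + 1) (j - 1) t \<rho> = (\<Sum>i\<le>nat j. if 2 * int i \<le> j - 1 then gterm (\<nu> + 1) (nat (j - 1 - 2 * int i)) i t \<rho> else 0)"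
    by (rule hgegen_upto) simp
  show ?thesis
    unfolding g unfolding hgegen_def sum_distrib_left sum_subtractf[symmetric]
  proof (rule sum.cong[OF refl])
    fix i
    consider "j < 2 * int i" | "j = 2 * int i" | p where "j = int (Suc p + 2 * i)"
    proof -
      have "j = int (Suc (nat (j - 2 * int i - 1)) + 2 * i)" if "2 * int i < j" using that by simp
      then show ?thesis using that by (metis linorder_less_linear)
    qed
    then show "(2 * \<nu> + of_int j) * (if 2 * int i \<le> j then gterm \<nu> (nat (j - 2 * int i)) i t \<rho> else 0)
      = 2 * \<nu> * ((if 2 * int i \<le> j then gterm (\<nu> + 1) (nat (j - 2 * int i)) i t \<rho> else 0) - t * (if 2 * int i \<le> j - 1 then gterm (\<nu> + 1) (nat (j - 1 - 2 * int i)) i t \<rho> else 0))"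
    proof cases
      case 2
      then show ?thesis using gterm_0[of \<nu> i t \<rho>] by simp
    next
      case (3 p)
      have "nat (j - 2 * int i) = Suc p" "nat (j - 1 - 2 * int i) = p" "2 * int i \<le> j" "2 * int i \<le> j - 1"
        using 3 by auto
      moreover have "real_of_int j = real (Suc p + 2 * i)" using 3 by simp
      ultimately show ?thesis using gterm_Suc[of \<nu> p i t \<rho>] by simp
    qed simp
  qed
qed

text \<open>The sum for index j - 2 is padded with a zero term, so that its terms line up with those
  for index j: same exponent of t, exponent of \<rho> lower by one.\<close>

lemma hgegen_shift:
  "hgegen \<nu> (j - 2) t \<rho> = (\<Sum>i\<le>nat j. case i of 0 \<Rightarrow> 0 | Suc a \<Rightarrow> if 2 * int i \<le> j then gterm \<nu> (nat (j - 2 * int i)) a t \<rho> else 0)"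
proof (cases "j \<le> 0")
  case True
  then show ?thesis by simp
next
  case False
  then obtain n where n: "nat j = Suc n" by (metis not0_implies_Suc not_le zero_less_nat_eq nat_0_iff)
  have "hgegen \<nu> (j - 2) t \<rho> = (\<Sum>i\<le>n. if 2 * int i \<le> j - 2 then gterm \<nu> (nat (j - 2 - 2 * int i)) i t \<rho> else 0)"
    by (rule hgegen_upto) (use n in simp)
  also have "\<dots> = (\<Sum>i\<le>n. if 2 * int (Suc i) \<le> j then gterm \<nu> (nat (j - 2 * int (Suc i))) i t \<rho> else 0)"
    by (intro sum.cong refl) (auto simp: algebra_simps)
  finally show ?thesis unfolding n by (subst sum.atMost_Suc_shift) simp
qed

text \<open>Euler's identity for a polynomial of weight j, where t has weight 1 and \<rho> weight 2.
  The derivatives in t and \<rho> are 2 \<nu> and - \<nu> times the polynomials of index j - 1 and j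
  - 2 with parameter \<nu> + 1, as in \<open>DERIV_hgegen\<close>.\<close>

lemma hgegen_Euler: "of_int j * hgegen \<nu> j t \<rho> = 2 * \<nu> * (t * hgegen (\<nu> + 1) (j - 1) t \<rho> - \<rho> * hgegen (\<nu> + 1) (j - 2) t \<rho>)"
proof -
  have g: "hgegen (\<nu> + 1) (j - 1) t \<rho> = (\<Sum>i\<le>nat j. if 2 * int i \<le> j - 1 then gterm (\<nu> + 1) (nat (j - 1 - 2 * int i)) i t \<rho> else 0)"
    by (rule hgegen_upto) simp
  show ?thesis
    unfolding g hgegen_shift unfolding hgegen_def sum_distrib_left sum_subtractf[symmetric]
  proof (rule sum.cong[OF refl])
    fix i
    have t: "real (nat (j - 2 * int i)) * gterm \<nu> (nat (j - 2 * int i)) i t \<rho>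
      = 2 * \<nu> * (t * (if 2 * int i \<le> j - 1 then gterm (\<nu> + 1) (nat (j - 1 - 2 * int i)) i t \<rho> else 0))"
      if "2 * int i \<le> j"
    proof (cases "2 * int i \<le> j - 1")
      case True
      then have "nat (j - 2 * int i) = Suc (nat (j - 1 - 2 * int i))" by simp
      then show ?thesis using gterm_t[of "nat (j - 1 - 2 * int i)" \<nu> i t \<rho>] True by simp
    qed (use that in simp)
    have r: "2 * real i * gterm \<nu> p i t \<rho> = - 2 * \<nu> * (\<rho> * (case i of 0 \<Rightarrow> 0 | Suc a \<Rightarrow> gterm (\<nu> + 1) p a t \<rho>))" for p
    proof (cases i)
      case (Suc a)
      then show ?thesis using arg_cong[OF gterm_rad2[of a \<nu> p t \<rho>], of "\<lambda>x. 2 * x"] by (simp add: algebra_simps)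
    qed simp
    show "of_int j * (if 2 * int i \<le> j then gterm \<nu> (nat (j - 2 * int i)) i t \<rho> else 0)
      = 2 * \<nu> * (t * (if 2 * int i \<le> j - 1 then gterm (\<nu> + 1) (nat (j - 1 - 2 * int i)) i t \<rho> else 0)
        - \<rho> * (case i of 0 \<Rightarrow> 0 | Suc a \<Rightarrow> if 2 * int i \<le> j then gterm (\<nu> + 1) (nat (j - 2 * int i)) a t \<rho> else 0))"
    proof (cases "2 * int i \<le> j")
      case True
      then have "real_of_int j = real (nat (j - 2 * int i)) + 2 * real i" by simp
      then have "of_int j * gterm \<nu> (nat (j - 2 * int i)) i t \<rho>
        = real (nat (j - 2 * int i)) * gterm \<nu> (nat (j - 2 * int i)) i t \<rho> + 2 * real i * gterm \<nu> (nat (j - 2 * int i)) i t \<rho>"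
        by (simp only: distrib_right)
      then show ?thesis unfolding t[OF True] r using True by (cases i) (simp_all add: right_diff_distrib)
    next
      case False
      then show ?thesis by (cases i) simp_all
    qed
  qed
qed

lemma DERIV_gterm:
  assumes "(f has_real_derivative f') (at s)" "(g has_real_derivative g') (at s)"
  shows "((\<lambda>s. gterm \<nu> p i (f s) (g s)) has_real_derivative
     2 * \<nu> * (if p = 0 then 0 else gterm (\<nu> + 1) (p - 1) i (f s) (g s)) * f'
     - \<nu> * (if i = 0 then 0 else gterm (\<nu> + 1) p (i - 1) (f s) (g s)) * g') (at s)"
proof -
  define C where "C = (-1)^i * pochhammer \<nu> (p + i) / (fact i * fact p)"
  have d: "((\<lambda>s. C * (2 * f s)^p * g s ^ i) has_real_derivative
     C * (real p * (2 * f s)^(p-1) * (2 * f')) * g s ^ i + C * (2 * f s)^p * (real i * g s ^ (i-1) * g')) (at s)"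
  proof -
    have h: "((\<lambda>s. 2 * f s) has_real_derivative 2 * f') (at s)" by (rule DERIV_cmult[OF assms(1)])
    show ?thesis
      by (rule DERIV_cong[OF DERIV_mult[OF DERIV_cmult[OF DERIV_power[OF h]] DERIV_power[OF assms(2)]]])
        (simp only: One_nat_def mult_ac)
  qed
  have 1: "C * real p * (2 * f s)^(p-1) * g s ^ i = \<nu> * (if p = 0 then 0 else gterm (\<nu> + 1) (p - 1) i (f s) (g s))"
  proof (cases p)
    case (Suc q)
    have p1: "pochhammer \<nu> (Suc q + i) = \<nu> * pochhammer (\<nu> + 1) (q + i)" by (simp add: pochhammer_rec)
    have f: "fact (Suc q) = real (Suc q) * fact q" by simp
    show ?thesis unfolding C_def gterm_def Suc p1 f by (simp add: field_simps del: of_nat_Suc)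
  qed simp
  have 2: "C * (2 * f s)^p * real i * g s ^ (i-1) = - \<nu> * (if i = 0 then 0 else gterm (\<nu> + 1) p (i - 1) (f s) (g s))"
  proof (cases i)
    case (Suc q)
    have p1: "pochhammer \<nu> (p + Suc q) = \<nu> * pochhammer (\<nu> + 1) (p + q)" by (simp add: pochhammer_rec)
    have f: "fact (Suc q) = real (Suc q) * fact q" by simp
    show ?thesis unfolding C_def gterm_def Suc p1 f by (simp add: field_simps del: of_nat_Suc)
  qed simp
  have "C * (real p * (2 * f s)^(p-1) * (2 * f')) * g s ^ i + C * (2 * f s)^p * (real i * g s ^ (i-1) * g')
     = 2 * (C * real p * (2 * f s)^(p-1) * g s ^ i) * f' + (C * (2 * f s)^p * real i * g s ^ (i-1)) * g'"
    by (simp add: algebra_simps)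
  also have "\<dots> = 2 * \<nu> * (if p = 0 then 0 else gterm (\<nu> + 1) (p - 1) i (f s) (g s)) * f'
     - \<nu> * (if i = 0 then 0 else gterm (\<nu> + 1) p (i - 1) (f s) (g s)) * g'"
    unfolding 1 2 by simp
  finally have e: "C * (real p * (2 * f s)^(p-1) * (2 * f')) * g s ^ i + C * (2 * f s)^p * (real i * g s ^ (i-1) * g')
    = 2 * \<nu> * (if p = 0 then 0 else gterm (\<nu> + 1) (p - 1) i (f s) (g s)) * f'
     - \<nu> * (if i = 0 then 0 else gterm (\<nu> + 1) p (i - 1) (f s) (g s)) * g'" .
  have "(\<lambda>s. gterm \<nu> p i (f s) (g s)) = (\<lambda>s. C * (2 * f s)^p * g s ^ i)"
    unfolding gterm_def C_def ..
  then show ?thesis using DERIV_cong[OF d e] by (simp only:)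
qed

lemma DERIV_hgegen:
  assumes "(f has_real_derivative f') (at s)" "(g has_real_derivative g') (at s)"
  shows "((\<lambda>s. hgegen \<nu> j (f s) (g s)) has_real_derivative
     2 * \<nu> * hgegen (\<nu> + 1) (j - 1) (f s) (g s) * f' - \<nu> * hgegen (\<nu> + 1) (j - 2) (f s) (g s) * g') (at s)"
proof -
  have g: "hgegen (\<nu> + 1) (j - 1) (f s) (g s) = (\<Sum>i\<le>nat j. if 2 * int i \<le> j - 1 then gterm (\<nu> + 1) (nat (j - 1 - 2 * int i)) i (f s) (g s) else 0)"
    by (rule hgegen_upto) simp
  have "((\<lambda>s. \<Sum>i\<le>nat j. if 2 * int i \<le> j then gterm \<nu> (nat (j - 2 * int i)) i (f s) (g s) else 0) has_real_derivative
    (\<Sum>i\<le>nat j. 2 * \<nu> * (if 2 * int i \<le> j - 1 then gterm (\<nu> + 1) (nat (j - 1 - 2 * int i)) i (f s) (g s) else 0) * f'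
     - \<nu> * (case i of 0 \<Rightarrow> 0 | Suc a \<Rightarrow> if 2 * int i \<le> j then gterm (\<nu> + 1) (nat (j - 2 * int i)) a (f s) (g s) else 0) * g')) (at s)"
  proof (rule DERIV_sum)
    fix i
    show "((\<lambda>s. if 2 * int i \<le> j then gterm \<nu> (nat (j - 2 * int i)) i (f s) (g s) else 0) has_real_derivative
     2 * \<nu> * (if 2 * int i \<le> j - 1 then gterm (\<nu> + 1) (nat (j - 1 - 2 * int i)) i (f s) (g s) else 0) * f'
     - \<nu> * (case i of 0 \<Rightarrow> 0 | Suc a \<Rightarrow> if 2 * int i \<le> j then gterm (\<nu> + 1) (nat (j - 2 * int i)) a (f s) (g s) else 0) * g') (at s)"
    proof (cases "2 * int i \<le> j")
      case True
      have a: "nat (j - 2 * int i) - 1 = nat (j - 1 - 2 * int i)" by simp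
      have b: "nat (j - 2 * int i) = 0 \<longleftrightarrow> \<not> 2 * int i \<le> j - 1" using True by auto
      show ?thesis using DERIV_gterm[OF assms, of \<nu> "nat (j - 2 * int i)" i] True unfolding a b
        by (cases i) auto
    next
      case False
      then show ?thesis by (cases i) simp_all
    qed
  qed
  then show ?thesis
    unfolding g hgegen_shift unfolding hgegen_def
    by (simp add: sum_distrib_left sum_distrib_right sum_subtractf)
qed

text \<open>The left side is the derivative along x_m, where \<rho> has derivative 2 t.
  Differentiation in x_m thus keeps the parameter \<nu> and lowers the index.\<close>

lemma hgegen_D: "2 * \<nu> * (hgegen (\<nu> + 1) (j - 1) t \<rho> - t * hgegen (\<nu> + 1) (j - 2) t \<rho>) = (2 * \<nu> + of_int j - 1) * hgegen \<nu> (j - 1) t \<rho>"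
  using hgegen_step[of \<nu> "j - 1" t \<rho>] by (simp add: algebra_simps)

text \<open>Combines \<open>hgegen_step\<close> for \<nu> and \<nu> + 1 with
  \<open>hgegen_Euler\<close> for \<nu> + 1. With \<rho> - t^2 the squared norm of the first m - 1
  coordinates, this is the coefficient identity that makes \<open>gegen_ext\<close>
  monogenic.\<close>

lemma hgegen_monogenic:
  "(2 * \<nu> + of_int j) * (2 * \<nu> + of_int j + 1) * hgegen \<nu> j t \<rho>
   = 2 * \<nu> * ((2 * \<nu> + 1) * hgegen (\<nu> + 1) j t \<rho> - 2 * (\<nu> + 1) * (\<rho> - t^2) * hgegen (\<nu> + 2) (j - 2) t \<rho>)"
proof -
  have 1: "(2 * \<nu> + of_int j) * hgegen \<nu> j t \<rho> = 2 * \<nu> * (hgegen (\<nu> + 1) j t \<rho> - t * hgegen (\<nu> + 1) (j - 1) t \<rho>)"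
    by (rule hgegen_step)
  have 2: "(2 * \<nu> + 1 + of_int j) * hgegen (\<nu> + 1) (j - 1) t \<rho> = 2 * (\<nu> + 1) * (hgegen (\<nu> + 2) (j - 1) t \<rho> - t * hgegen (\<nu> + 2) (j - 2) t \<rho>)"
    using hgegen_step[of "\<nu> + 1" "j - 1" t \<rho>] by (simp add: algebra_simps)
  have 3: "of_int j * hgegen (\<nu> + 1) j t \<rho> = 2 * (\<nu> + 1) * (t * hgegen (\<nu> + 2) (j - 1) t \<rho> - \<rho> * hgegen (\<nu> + 2) (j - 2) t \<rho>)"
    using hgegen_Euler[of j "\<nu> + 1" t \<rho>] by (simp add: algebra_simps)
  have "(2 * \<nu> + of_int j) * (2 * \<nu> + of_int j + 1) * hgegen \<nu> j t \<rho>
     = (2 * \<nu> + of_int j + 1) * (2 * \<nu> * (hgegen (\<nu> + 1) j t \<rho> - t * hgegen (\<nu> + 1) (j - 1) t \<rho>))"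
    using 1 by (metis mult.assoc mult.commute)
  also have "\<dots> = 2 * \<nu> * ((2 * \<nu> + 1) * hgegen (\<nu> + 1) j t \<rho> + of_int j * hgegen (\<nu> + 1) j t \<rho> - t * ((2 * \<nu> + 1 + of_int j) * hgegen (\<nu> + 1) (j - 1) t \<rho>))"
    by (simp add: algebra_simps)
  finally show ?thesis unfolding 2 3 by (simp add: algebra_simps power2_eq_square)
qed

lemma gegen_hgegen:
  assumes "r \<noteq> 0"
  shows "r ^ j * gegen j \<nu> (t / r) = hgegen \<nu> (int j) t (r^2)"
proof -
  have "hgegen \<nu> (int j) t (r^2) = (\<Sum>i\<le>j. if 2 * i \<le> j then gterm \<nu> (j - 2 * i) i t (r^2) else 0)"
  proof -
    have n: "nat (int j - 2 * int i) = j - 2 * i" for i by arith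
    show ?thesis unfolding hgegen_def n by (intro sum.cong) auto
  qed
  also have "\<dots> = (\<Sum>i\<in>{0..j div 2}. gterm \<nu> (j - 2 * i) i t (r^2))"
    by (rule sum.mono_neutral_cong_right) auto
  also have "\<dots> = r ^ j * gegen j \<nu> (t / r)"
    unfolding gegen_def sum_distrib_left
  proof (rule sum.cong[OF refl])
    fix i assume "i \<in> {0..j div 2}"
    then have i: "2 * i \<le> j" by auto
    have r: "r ^ j * (2 * (t / r))^(j - 2*i) = (2 * t)^(j - 2*i) * (r^2)^i"
    proof -
      have "r ^ j = r^(j - 2*i) * (r^2)^i" using i by (simp flip: power_mult power_add)
      moreover have "r^(j - 2*i) * (2 * (t / r))^(j - 2*i) = (2*t)^(j - 2*i)"
        unfolding power_mult_distrib[symmetric] using assms by simp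
      ultimately show ?thesis by (simp add: mult.assoc mult.left_commute)
    qed
    have ji: "j - 2 * i + i = j - i" using i by simp
    show "gterm \<nu> (j - 2*i) i t (r^2) = r ^ j * ((-1)^i * pochhammer \<nu> (j - i) / (fact i * fact (j - 2*i)) * (2 * (t / r))^(j - 2*i))"
    proof -
      have "c * X * Y = Z * (c * W)" if "Z * W = X * Y" for c X Y Z W :: real
        using that by (simp add: mult.assoc mult.left_commute)
      from this[OF r] show ?thesis unfolding gterm_def ji .
    qed
  qed
  finally show ?thesis ..
qed

section \<open>Values at 0 and the normalising constants\<close>

lemma gegen_even_0: "gegen (2 * i) \<nu> 0 = (-1)^i * pochhammer \<nu> i / fact i"
proof -
  have "gegen (2 * i) \<nu> 0 = (\<Sum>a\<in>{0..i}. if a = i then (-1)^i * pochhammer \<nu> i / fact i else 0)"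
    unfolding gegen_def by (intro sum.cong) (auto simp: power_0_left)
  then show ?thesis by simp
qed

lemma gegen_minus: "gegen j \<nu> (- z) = (-1)^j * gegen j \<nu> z"
  unfolding gegen_def sum_distrib_left
proof (rule sum.cong[OF refl])
  fix i assume "i \<in> {0..j div 2}"
  then have i: "2 * i \<le> j" by auto
  have "(-1::real)^j = (-1)^(j - 2*i) * (-1)^(2*i)" unfolding power_add[symmetric] using i by simp
  then have "(-1::real)^j = (-1)^(j - 2*i)" by simp
  moreover have "(2 * - z)^(j - 2*i) = (-1)^(j - 2*i) * (2*z)^(j - 2*i)" unfolding power_mult_distrib[symmetric] by simp
  ultimately show "(-1)^i * pochhammer \<nu> (j - i) / (fact i * fact (j - 2*i)) * (2 * - z)^(j - 2*i)
     = (-1)^j * ((-1)^i * pochhammer \<nu> (j - i) / (fact i * fact (j - 2*i)) * (2 * z)^(j - 2*i))"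
    by (simp only: mult_ac)
qed

text \<open>The parameter of the first Gegenbauer polynomial in X; the second has parameter one
  larger. It is positive for m \<ge> 3, which keeps the denominators built from it nonzero.\<close>

definition gegen_idx :: "nat \<Rightarrow> nat \<Rightarrow> real" where "gegen_idx m k = real m / 2 + real k - 1"

lemma gegen_idx_Suc: "gegen_idx m (k + 1) = gegen_idx m k + 1" by (simp add: gegen_idx_def)
lemma gegen_idx_pos: "3 \<le> m \<Longrightarrow> 0 < gegen_idx m k" by (simp add: gegen_idx_def field_simps)

lemma mu_even: "mu m k (2 * i) = (-1)^i * fact i / pochhammer (gegen_idx m k) i"
  unfolding mu_def gegen_idx_def[symmetric] gegen_even_0 by (cases "even i") simp_all

lemma mu_odd: "mu m k (Suc (2 * i)) = (2 * gegen_idx m k + real (Suc (2 * i))) / (2 * gegen_idx m k) * ((-1)^i * fact i / pochhammer (gegen_idx m k + 1) i)"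
proof -
  have a: "real m + 2 * real k + real (Suc (2 * i)) - 2 = 2 * gegen_idx m k + real (Suc (2 * i))" "real m + 2 * real k - 2 = 2 * gegen_idx m k"
    by (simp_all add: gegen_idx_def)
  have b: "real m / 2 + real k = gegen_idx m k + 1" by (simp add: gegen_idx_def)
  show ?thesis unfolding mu_def a b by (cases "even i") (simp_all add: gegen_even_0)
qed

text \<open>Compares the constants of the two extensions in an operator of odd index 2 i + 1. Their
  quotient is the coefficient of the second term of X, and this makes the terms of mixed grade
  cancel in \<open>gt_op_odd_form\<close>.\<close>

lemma mu_lower_even:
  assumes "3 \<le> m"
  shows "mu m (k + 1) (2 * i) = mu m k (Suc (2 * i)) * (2 * gegen_idx m k / (2 * gegen_idx m k + real (Suc (2 * i))))"
proof -
  have n: "2 * gegen_idx m k \<noteq> 0" "2 * gegen_idx m k + real (Suc (2 * i)) \<noteq> 0" using gegen_idx_pos[OF assms, of k] by linarith+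
  have "K = b / a * K * (a / b)" if "a \<noteq> 0" "b \<noteq> 0" for a b K :: real using that by simp
  from this[OF n] show ?thesis unfolding mu_even mu_odd gegen_idx_Suc .
qed

text \<open>The analogue for the even index 2 i + 2. The factors 2 i + 2 and 2 \<nu> + 1 + (2 i + 2)
  are the weights of the two summands of \<open>gt_op\<close>, chosen so that the terms of mixed
  grade cancel in \<open>gt_op_even_form\<close>.\<close>

lemma mu_lower_odd:
  assumes "3 \<le> m"
  shows "real (2 * i + 2) * mu m (k + 1) (Suc (2 * i))
    = - (2 * gegen_idx m k + 1 + real (2 * i + 2)) * (2 * gegen_idx m k / (2 * gegen_idx m k + real (2 * i + 2))) * mu m k (2 * i + 2)"
proof -
  let ?\<nu> = "gegen_idx m k"
  have p: "?\<nu> > 0" using gegen_idx_pos[OF assms] .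
  have e: "2 * i + 2 = 2 * Suc i" by simp
  have q0: "pochhammer (?\<nu> + 2) i > 0" using p by (intro pochhammer_pos) simp
  have 1: "pochhammer (?\<nu> + 1) (Suc i) = (?\<nu> + 1) * pochhammer (?\<nu> + 2) i"
    by (simp add: pochhammer_rec add.assoc)
  have 2: "pochhammer (?\<nu> + 1) (Suc i) = pochhammer (?\<nu> + 1) i * (?\<nu> + 1 + real i)" by (simp add: pochhammer_Suc)
  have q1: "pochhammer (?\<nu> + 1) i > 0" using p by (intro pochhammer_pos) simp
  have 3: "pochhammer ?\<nu> (Suc i) = ?\<nu> * pochhammer (?\<nu> + 1) i" by (simp add: pochhammer_rec)
  have eq: "(?\<nu> + 1) * pochhammer (?\<nu> + 2) i = pochhammer (?\<nu> + 1) i * (?\<nu> + 1 + real i)" using 1 2 by simp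
  have f: "fact (Suc i) = real (Suc i) * fact i" by simp
  define F where "F = (fact i :: real)"
  have L: "real (2 * i + 2) * mu m (k + 1) (Suc (2 * i))
     = (-1)^i * (2 * real (Suc i)) * F * (2 * (?\<nu> + 1) + real (Suc (2 * i))) / (2 * (pochhammer (?\<nu> + 1) i * (?\<nu> + 1 + real i)))"
    unfolding mu_odd gegen_idx_Suc eq[symmetric] F_def by (simp add: field_simps add.assoc)
  have R: "mu m k (2 * i + 2) = - ((-1)^i * real (Suc i) * F / (?\<nu> * pochhammer (?\<nu> + 1) i))"
    unfolding e mu_even 3 f F_def by (simp add: mult.assoc)
  have n: "?\<nu> \<noteq> 0" "pochhammer (?\<nu> + 1) i \<noteq> 0" "?\<nu> + 1 + real i \<noteq> 0" "2 * ?\<nu> + real (2 * i + 2) \<noteq> 0" using p q1 by auto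
  have h: "2 * ?\<nu> + real (2 * i + 2) = 2 * (?\<nu> + 1 + real i)" by simp
  show ?thesis unfolding L R h using n by (simp add: divide_simps, (simp add: algebra_simps)?)
qed

text \<open>Differentiating the extension without its constant in x_m gives 2 \<nu> + j - 1
  (\<open>gegen_ext_pd_top\<close>). With the constants taken into account this becomes - j or 2
  \<nu> + j, the factors in \<open>Xp_mult_pd\<close>.\<close>

lemma mu_ratio:
  assumes "3 \<le> m" "0 < j"
  shows "mu m k j * (2 * gegen_idx m k + real j - 1) = (if even j then - real j else 2 * gegen_idx m k + real j) * mu m k (j - 1)"
proof (cases "even j")
  case True
  let ?\<nu> = "gegen_idx m k"
  have p: "?\<nu> > 0" using gegen_idx_pos[OF assms(1)] .
  obtain i where j: "j = 2 * Suc i" using True assms(2) by (metis dvdE gr0_conv_Suc mult_0_right not_gr_zero)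
  have j1: "j - 1 = Suc (2 * i)" using j by simp
  have 3: "pochhammer ?\<nu> (Suc i) = ?\<nu> * pochhammer (?\<nu> + 1) i" by (simp add: pochhammer_rec)
  have q1: "pochhammer (?\<nu> + 1) i > 0" using p by (intro pochhammer_pos) simp
  have f: "fact (Suc i) = real (Suc i) * fact i" by simp
  have n: "?\<nu> \<noteq> 0" "pochhammer (?\<nu> + 1) i \<noteq> 0" using p q1 by auto
  have t: "even j \<longleftrightarrow> True" using True by simp
  show ?thesis unfolding t if_True j1 mu_odd unfolding j mu_even 3 f
    using n by (simp add: divide_simps, (simp add: algebra_simps)?)
next
  case False
  let ?\<nu> = "gegen_idx m k"
  have p: "?\<nu> > 0" using gegen_idx_pos[OF assms(1)] .
  obtain i where j: "j = Suc (2 * i)" using False by (metis oddE Suc_eq_plus1)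
  have j1: "j - 1 = 2 * i" using j by simp
  have a: "pochhammer ?\<nu> (Suc i) = ?\<nu> * pochhammer (?\<nu> + 1) i" by (simp add: pochhammer_rec)
  have b: "pochhammer ?\<nu> (Suc i) = pochhammer ?\<nu> i * (?\<nu> + real i)" by (simp add: pochhammer_Suc)
  have q: "pochhammer ?\<nu> i > 0" using p by (intro pochhammer_pos) simp
  have n: "?\<nu> \<noteq> 0" "pochhammer ?\<nu> i \<noteq> 0" "?\<nu> + real i \<noteq> 0" using p q by auto
  have c: "pochhammer (?\<nu> + 1) i = pochhammer ?\<nu> i * (?\<nu> + real i) / ?\<nu>" using a b n by (simp add: field_simps)
  have t: "even j \<longleftrightarrow> False" using False by simp
  show ?thesis unfolding t if_False j1 mu_even unfolding j mu_odd c
    using n by (simp add: divide_simps, (simp add: algebra_simps)?)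
qed

section \<open>Monogenic extension in the direction x_m\<close>

definition rad2 :: "nat \<Rightarrow> (nat \<Rightarrow> real) \<Rightarrow> real" where "rad2 m x = (\<Sum>i\<in>{1..m}. (x i)^2)"

lemma rad_sq: "(rad m x)^2 = rad2 m x"
  unfolding rad_def rad2_def by (intro real_sqrt_pow2 sum_nonneg) simp

lemma rad2_split: "1 \<le> m \<Longrightarrow> rad2 m x = inner_up (m - 1) x x + (x m)^2"
proof -
  assume "1 \<le> m"
  then obtain N where m: "m = Suc N" using Suc_le_D by auto
  show ?thesis unfolding m rad2_def inner_up_def by (simp add: power2_eq_square)
qed

lemma has_pds_hgegen:
  assumes "i \<in> {1..m}"
  shows "has_pds i (\<lambda>x. complex_of_real (hgegen \<nu> j (x m) (rad2 m x)))
    (\<lambda>x. complex_of_real (2 * \<nu> * hgegen (\<nu> + 1) (j - 1) (x m) (rad2 m x) * (if i = m then 1 else 0)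
       - \<nu> * hgegen (\<nu> + 1) (j - 2) (x m) (rad2 m x) * (2 * x i)))"
  unfolding has_pds_def
proof
  fix x :: "nat \<Rightarrow> real"
  have f: "((\<lambda>s. (x(i := s)) m) has_real_derivative (if i = m then 1 else 0)) (at (x i))"
    by (cases "i = m") auto
  have r: "rad2 m (x(i := s)) = s^2 + (\<Sum>l\<in>{1..m} - {i}. (x l)^2)" for s
    unfolding rad2_def using assms by (subst sum.remove[of _ i]) (auto intro!: sum.cong)
  have g: "((\<lambda>s. rad2 m (x(i := s))) has_real_derivative 2 * x i) (at (x i))"
    unfolding r by (auto intro!: derivative_eq_intros)
  show "((\<lambda>t. complex_of_real (hgegen \<nu> j ((x(i := t)) m) (rad2 m (x(i := t))))) has_vector_derivative
     complex_of_real (2 * \<nu> * hgegen (\<nu> + 1) (j - 1) (x m) (rad2 m x) * (if i = m then 1 else 0)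
       - \<nu> * hgegen (\<nu> + 1) (j - 2) (x m) (rad2 m x) * (2 * x i))) (at (x i))"
    using has_vector_derivative_of_real[OF DERIV_hgegen[OF f g, of \<nu> j]] by (simp only: fun_upd_triv)
qed

lemma spoly_rad2: "spoly m 2 (\<lambda>x. complex_of_real (rad2 m x))"
proof -
  have "spoly m (Suc 0 * 2) (\<lambda>x. complex_of_real (x i) ^ 2)" if "i \<in> {1..m}" for i
    by (rule spoly_power[OF spoly_coordinate[OF that]])
  then have "spoly m 2 (\<lambda>x. \<Sum>i\<in>{1..m}. complex_of_real (x i) ^ 2)" by (intro spoly_sum) simp
  then show ?thesis by (simp add: rad2_def)
qed

lemma spoly_hgegen:
  assumes "1 \<le> m"
  shows "spoly m d (\<lambda>x. complex_of_real (hgegen \<nu> (int d) (x m) (rad2 m x)))"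
proof -
  have "spoly m d (\<lambda>x. complex_of_real (if 2 * int i \<le> int d then gterm \<nu> (nat (int d - 2 * int i)) i (x m) (rad2 m x) else 0))" for i
  proof (cases "2 * int i \<le> int d")
    case True
    let ?p = "nat (int d - 2 * int i)"
    have m: "m \<in> {1..m}" using assms by simp
    have d: "Suc 0 * ?p + 2 * i = d" using True by arith
    have "spoly m (Suc 0 * ?p + 2 * i) (\<lambda>x. complex_of_real ((-1)^i * pochhammer \<nu> (?p + i) / (fact i * fact ?p) * 2 ^ ?p)
       * (complex_of_real (x m) ^ ?p * complex_of_real (rad2 m x) ^ i))"
      by (intro spoly_smul spoly_mult spoly_power spoly_coordinate spoly_rad2 m)
    then show ?thesis using True unfolding d gterm_def by (simp add: power_mult_distrib mult.assoc)
  qed (auto intro: spoly_zero)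
  then show ?thesis unfolding hgegen_def of_real_sum by (intro spoly_sum)
qed

lemma pd_independent:
  assumes "hom_poly n k P" "j \<notin> {1..n}"
  shows "pd j P = 0"
proof (intro ext)
  fix x S
  have "(\<lambda>t. P (x(j := t)) S) = (\<lambda>t. P x S)"
    using hom_poly_cong[OF assms(1)] assms(2) by (metis fun_upd_other)
  then show "pd j P x S = 0 x S" unfolding pd_def by simp
qed

lemma pd_in_Cl:
  assumes "\<And>x. P x \<in> Cl a"
  shows "pd j P x \<in> Cl a"
proof -
  have "pd j P x S = 0" if "\<not> S \<subseteq> {1..a}" for S
  proof -
    have "P x S = 0" for x using assms[of x] that unfolding Cl_def by blast
    then have "(\<lambda>x. P x S) = (\<lambda>x. 0)" by simp
    then show ?thesis unfolding pd_pds using has_pds_pds[OF has_pds_const] by simp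
  qed
  then show ?thesis by (auto simp: Cl_def)
qed

lemma dirN_add:
  assumes "\<And>j. j \<in> {1..N} \<Longrightarrow> dif j P (pd j P)" "\<And>j. j \<in> {1..N} \<Longrightarrow> dif j Q (pd j Q)"
  shows "dirN a N (\<lambda>x. P x + Q x) x = dirN a N P x + dirN a N Q x"
  unfolding dirN_def sum.distrib[symmetric]
  by (intro sum.cong refl) (simp only: dif_pd[OF dif_add[OF assms]] cl_mult_add_right)

lemma dirN_smul:
  assumes "\<And>j. j \<in> {1..N} \<Longrightarrow> dif j P (pd j P)"
  shows "dirN a N (\<lambda>x. cl_smul c (P x)) x = cl_smul c (dirN a N P x)"
  unfolding dirN_def cl_smul_sum
  by (intro sum.cong refl) (simp only: dif_pd[OF dif_smul[OF assms]] cl_mult_smul_right)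

lemma dirN_radial:
  assumes f: "\<And>i. i \<in> {1..N} \<Longrightarrow> has_pds i f (\<lambda>x. complex_of_real (c x * x i))"
    and M: "hom_poly n k M"
  shows "dirN a N (\<lambda>x. cl_smul (f x) (M x)) x
    = cl_smul (f x) (dirN a N M x) + cl_smul (complex_of_real (c x)) (cl_mult a (cl_vec N x) (M x))"
proof -
  have "dirN a N (\<lambda>x. cl_smul (f x) (M x)) x
    = (\<Sum>j\<in>{1..N}. cl_smul (f x) (cl_mult a (cl_e j) (pd j M x)) + cl_smul (complex_of_real (c x)) (cl_mult a (cl_smul (complex_of_real (x j)) (cl_e j)) (M x)))"
    unfolding dirN_def
    by (intro sum.cong refl) (simp add: dif_pd[OF dif_scal[OF f hom_poly_dif[OF M]]] cl_mult_distrib)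
  then show ?thesis
    unfolding dirN_def sum.distrib cl_smul_sum cl_vec_eq_sum cl_mult_sum_left .
qed

text \<open>Values are allowed in the algebra on m generators because powers of
  \<open>ebar m\<close> are multiplied in; only the variables and the derivatives are restricted to
  1..m - 1.\<close>

definition monog_below :: "nat \<Rightarrow> nat \<Rightarrow> pf \<Rightarrow> bool" where
  "monog_below m l M \<longleftrightarrow> hom_poly (m - 1) l M \<and> (\<forall>x. M x \<in> Cl m) \<and> (\<forall>x. dirN m (m - 1) M x = 0)"

text \<open>r^j times the bracket in the definition of X, applied to \<open>M\<close> and written as
  a polynomial. \<open>Xp_mult_eq_gegen_ext\<close> makes the connection.\<close>

definition gegen_ext :: "nat \<Rightarrow> real \<Rightarrow> int \<Rightarrow> pf \<Rightarrow> pf" where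
  "gegen_ext m \<nu> j M x = cl_smul (complex_of_real (hgegen \<nu> j (x m) (rad2 m x))) (M x)
     + cl_smul (complex_of_real (2 * \<nu> / (2 * \<nu> + of_int j)) * complex_of_real (hgegen (\<nu> + 1) (j - 1) (x m) (rad2 m x)))
         (cl_mult m (ebar m) (cl_mult m (ulx m x) (M x)))"

lemma ebar_eq: "ebar m = - cl_e m" by (simp add: ebar_def)

lemma ebar_in_Cl [simp]: "1 \<le> m \<Longrightarrow> ebar m \<in> Cl m" by (simp add: ebar_eq)

lemma ulx_in_Cl [simp]: "1 \<le> m \<Longrightarrow> ulx m x \<in> Cl m"
  unfolding ulx_def using Cl_mono[of "m - 1" m] cl_vec_in_Cl[of "m - 1" x] by auto

lemma cl_vec_Lam: "cl_vec n u \<in> Lam n 1" by (auto simp: Lam_def cl_vec_def)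

lemma e_ulx: "1 \<le> m \<Longrightarrow> cl_mult m (cl_e m) (ulx m x) = - cl_mult m (ulx m x) (cl_e m)"
  unfolding ulx_def using e_new_commute(1)[OF cl_vec_Lam, of "m - 1" m m x] by simp

lemma ebar_ulx: "1 \<le> m \<Longrightarrow> cl_mult m (ulx m x) (cl_mult m (ebar m) A) = - cl_mult m (ebar m) (cl_mult m (ulx m x) A)"
  unfolding cl_mult_assoc[symmetric] ebar_eq cl_mult_minus_left cl_mult_minus_right e_ulx by (simp add: cl_mult_minus_left)

lemma ebar_ebar: "1 \<le> m \<Longrightarrow> A \<in> Cl m \<Longrightarrow> cl_mult m (ebar m) (cl_mult m (ebar m) A) = - A"
  unfolding ebar_eq cl_mult_minus_left cl_mult_minus_right by (simp add: cl_e_square)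

lemma ulx_ulx: "1 \<le> m \<Longrightarrow> A \<in> Cl m \<Longrightarrow> cl_mult m (ulx m x) (cl_mult m (ulx m x) A) = cl_smul (complex_of_real (- inner_up (m - 1) x x)) A"
  unfolding ulx_def by (rule vec_vec_mult) auto

lemma monog_below_ebar:
  assumes "1 \<le> m" "hom_poly (m - 1) l M"
  shows "dirN m (m - 1) (\<lambda>x. cl_mult m (ebar m) (M x)) x = - cl_mult m (ebar m) (dirN m (m - 1) M x)"
    and "hom_poly (m - 1) l (\<lambda>x. cl_mult m (ebar m) (M x))"
proof -
  have anti: "cl_mult m (cl_e j) (cl_mult m (ebar m) A) = - cl_mult m (ebar m) (cl_mult m (cl_e j) A)" if "j \<in> {1..m-1}" for j A
  proof -
    have "j \<in> {1..m}" "m \<in> {1..m}" "j \<noteq> m" using that assms(1) by auto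
    from cl_e_anticommute[OF this]
    show ?thesis unfolding cl_mult_assoc[symmetric] ebar_eq cl_mult_minus_left cl_mult_minus_right
      by (simp add: cl_mult_minus_left)
  qed
  have "pd j (\<lambda>x. cl_mult m (ebar m) (M x)) x = cl_mult m (ebar m) (pd j M x)" for j
    using dif_pd[OF dif_cl_mult[OF dif_const hom_poly_dif[OF assms(2)], of j m "ebar m"]] by simp
  then show "dirN m (m - 1) (\<lambda>x. cl_mult m (ebar m) (M x)) x = - cl_mult m (ebar m) (dirN m (m - 1) M x)"
    unfolding dirN_def cl_mult_sum_right sum_negf[symmetric] by (intro sum.cong refl) (simp only: anti)
  show "hom_poly (m - 1) l (\<lambda>x. cl_mult m (ebar m) (M x))"
    using hom_poly_cl_mult[OF hom_poly_const assms(2)] by simp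
qed

lemma monog_below_ebar_mult: "1 \<le> m \<Longrightarrow> monog_below m l M \<Longrightarrow> monog_below m l (\<lambda>x. cl_mult m (ebar m) (M x))"
proof -
  assume a: "1 \<le> m" "monog_below m l M"
  then have M: "hom_poly (m - 1) l M" "\<And>x. dirN m (m - 1) M x = 0" by (auto simp: monog_below_def)
  show ?thesis unfolding monog_below_def using monog_below_ebar(1)[OF a(1) M(1)] monog_below_ebar(2)[OF a(1) M(1)] M(2) by simp
qed

lemma hom_poly_ulx: "hom_poly (m - 1) (Suc 0) (ulx m)"
  unfolding ulx_def[abs_def] by (rule hom_poly_cl_vec)

definition ebar_vec :: "nat \<Rightarrow> pf \<Rightarrow> pf" where
  "ebar_vec m M x = cl_mult m (ebar m) (cl_mult m (ulx m x) (M x))"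

lemma hom_poly_ebar_vec:
  assumes "hom_poly (m - 1) l M"
  shows "hom_poly (m - 1) (Suc l) (ebar_vec m M)"
proof -
  have h: "hom_poly (m - 1) (Suc 0 + l) (\<lambda>x. cl_mult m (ulx m x) (M x))"
    by (rule hom_poly_cl_mult[OF hom_poly_ulx assms])
  from hom_poly_cl_mult[OF hom_poly_const[of _ "ebar m"] h, of m]
  show ?thesis unfolding ebar_vec_def[abs_def] by simp
qed

lemma dirN_ebar_vec:
  assumes "1 \<le> m" "monog_below m l M"
  shows "dirN m (m - 1) (ebar_vec m M) x = cl_smul (complex_of_real (real m - 1 + 2 * real l)) (cl_mult m (ebar m) (M x))"
proof -
  have M: "hom_poly (m - 1) l M" "\<And>x. M x \<in> Cl m" "dirN m (m - 1) M x = 0" using assms(2) by (auto simp: monog_below_def)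
  have h: "hom_poly (m - 1) (Suc 0 + l) (\<lambda>x. cl_mult m (ulx m x) (M x))"
    by (rule hom_poly_cl_mult[OF hom_poly_ulx M(1)])
  have "dirN m (m - 1) (ebar_vec m M) x = - cl_mult m (ebar m) (dirN m (m - 1) (\<lambda>x. cl_mult m (ulx m x) (M x)) x)"
    unfolding ebar_vec_def[abs_def] by (rule monog_below_ebar(1)[OF assms(1) h])
  also have "dirN m (m - 1) (\<lambda>x. cl_mult m (ulx m x) (M x)) x = cl_smul (complex_of_real (- (real (m - 1) + 2 * real l))) (M x)"
    using dirN_vec_mult[OF M(1,2), of x] M(3) unfolding ulx_def by simp
  finally have e: "dirN m (m - 1) (ebar_vec m M) x = - cl_mult m (ebar m) (cl_smul (complex_of_real (- (real (m - 1) + 2 * real l))) (M x))" .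
  show ?thesis unfolding e cl_mult_smul_right using assms(1)
    by (intro ext) (simp add: cl_smul_def of_nat_diff algebra_simps)
qed

lemma gegen_ext_alt: "gegen_ext m \<nu> j M = (\<lambda>x. cl_smul (complex_of_real (hgegen \<nu> j (x m) (rad2 m x))) (M x)
   + cl_smul (complex_of_real (2 * \<nu> / (2 * \<nu> + of_int j)) * complex_of_real (hgegen (\<nu> + 1) (j - 1) (x m) (rad2 m x))) (ebar_vec m M x))"
  by (rule ext) (simp add: gegen_ext_def ebar_vec_def)

lemma gegen_ext_parts_dif:
  assumes "hom_poly n k M" "i \<in> {1..m}"
  shows "\<exists>F. dif i (\<lambda>x. cl_smul (complex_of_real c * complex_of_real (hgegen \<nu> j (x m) (rad2 m x))) (M x)) F"
  using dif_scal[OF has_pds_cmult[OF has_pds_hgegen[OF assms(2), of \<nu> j], of "complex_of_real c"] hom_poly_dif[OF assms(1)]] by blast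

text \<open>\<open>M\<close> and \<open>ebar_vec m M\<close> do not contain x_m, so only the
  coefficients are differentiated, by \<open>hgegen_D\<close> for \<nu> and for \<nu> + 1. The
  coefficient 2 \<nu> / (2 \<nu> + j) is the one for which both terms acquire the same
  factor.\<close>

lemma gegen_ext_pd_top:
  assumes "1 \<le> m" "monog_below m l M" "0 < \<nu>" "1 \<le> j"
  shows "pd m (gegen_ext m \<nu> j M) x = cl_smul (complex_of_real (2 * \<nu> + of_int j - 1)) (gegen_ext m \<nu> (j - 1) M x)"
proof -
  have M: "hom_poly (m - 1) l M" using assms(2) by (auto simp: monog_below_def)
  have mm: "m \<in> {1..m}" "m \<notin> {1..m-1}" using assms(1) by auto
  let ?G = "\<lambda>\<nu> j. hgegen \<nu> j (x m) (rad2 m x)"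
  have pM: "pd m M = 0" "pd m (ebar_vec m M) = 0"
    using pd_independent[OF M mm(2)] pd_independent[OF hom_poly_ebar_vec[OF M] mm(2)] by auto
  note d = dif_pd[OF dif_add[OF dif_scal[OF has_pds_hgegen[OF mm(1), of \<nu> j] hom_poly_dif[OF M]]
      dif_scal[OF has_pds_cmult[OF has_pds_hgegen[OF mm(1), of "\<nu> + 1" "j - 1"], of "complex_of_real (2 * \<nu> / (2 * \<nu> + of_int j))"] hom_poly_dif[OF hom_poly_ebar_vec[OF M]]]]]
  have 1: "2 * \<nu> * ?G (\<nu> + 1) (j - 1) * (if m = m then 1 else 0) - \<nu> * ?G (\<nu> + 1) (j - 2) * (2 * x m) = (2 * \<nu> + of_int j - 1) * ?G \<nu> (j - 1)"
    using hgegen_D[of \<nu> j "x m" "rad2 m x"] by (simp add: algebra_simps)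
  have 2: "2 * (\<nu> + 1) * ?G (\<nu> + 1 + 1) (j - 1 - 1) * (if m = m then 1 else 0) - (\<nu> + 1) * ?G (\<nu> + 1 + 1) (j - 1 - 2) * (2 * x m) = (2 * \<nu> + of_int j) * ?G (\<nu> + 1) (j - 1 - 1)"
    using hgegen_D[of "\<nu> + 1" "j - 1" "x m" "rad2 m x"] by (simp add: algebra_simps)
  have j: "2 * \<nu> + real_of_int j \<noteq> 0" "2 * \<nu> + real_of_int j - 1 \<noteq> 0" using assms by auto
  have p: "pd m (gegen_ext m \<nu> j M) x = cl_smul (complex_of_real ((2 * \<nu> + of_int j - 1) * ?G \<nu> (j - 1))) (M x)
     + cl_smul (complex_of_real (2 * \<nu> / (2 * \<nu> + of_int j)) * complex_of_real ((2 * \<nu> + of_int j) * ?G (\<nu> + 1) (j - 1 - 1))) (ebar_vec m M x)"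
    unfolding gegen_ext_alt d pM 1 2 by simp
  have c: "complex_of_real (2 * \<nu> / (2 * \<nu> + of_int j)) * complex_of_real ((2 * \<nu> + of_int j) * ?G (\<nu> + 1) (j - 1 - 1))
     = complex_of_real (2 * \<nu> + of_int j - 1) * (complex_of_real (2 * \<nu> / (2 * \<nu> + of_int (j - 1))) * complex_of_real (?G (\<nu> + 1) (j - 1 - 1)))"
  proof -
    have h: "2 * \<nu> + real_of_int (j - 1) = 2 * \<nu> + of_int j - 1" by simp
    show ?thesis unfolding of_real_mult[symmetric] of_real_eq_iff h using j by simp
  qed
  show ?thesis unfolding p c unfolding gegen_ext_alt cl_smul_add cl_smul_smul of_real_mult ..
qed

text \<open>The Dirac operator is split into the directions below m and e_m times the derivative in
  x_m, and only multiples of x M and of ebar M arise. The former cancel directly, the latter by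
  \<open>hgegen_monogenic\<close>. The condition on \<nu> matches the factor m - 1 + 2 l in
  \<open>dirN_ebar_vec\<close>.\<close>

lemma gegen_ext_dirac:
  assumes "1 \<le> m" "monog_below m l M" "0 < \<nu>" "0 \<le> j" "2 * \<nu> + 1 = real m - 1 + 2 * real l"
  shows "dirac m (gegen_ext m \<nu> j M) x = 0"
proof -
  have M: "hom_poly (m - 1) l M" "\<And>x. M x \<in> Cl m" "dirN m (m - 1) M x = 0" using assms(2) by (auto simp: monog_below_def)
  obtain N where N: "m = Suc N" using assms(1) Suc_le_D by auto
  let ?G = "\<lambda>\<nu> j. hgegen \<nu> j (x m) (rad2 m x)"
  define \<beta> where "\<beta> = 2 * \<nu> / (2 * \<nu> + of_int j)"
  have j: "2 * \<nu> + real_of_int j \<noteq> 0" using assms(3,4) by (metis add_pos_nonneg less_irrefl mult_pos_pos of_int_0_le_iff zero_less_numeral)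
  have i: "has_pds i (\<lambda>x. complex_of_real (hgegen \<nu> j (x m) (rad2 m x))) (\<lambda>x. complex_of_real (- 2 * \<nu> * hgegen (\<nu> + 1) (j - 2) (x m) (rad2 m x) * x i))"
    if "i \<in> {1..m-1}" for i \<nu> j
  proof -
    have "i \<in> {1..m}" "i \<noteq> m" using that by auto
    then show ?thesis using has_pds_hgegen[of i m \<nu> j] by (simp add: mult_ac)
  qed
  have i2: "has_pds i (\<lambda>x. complex_of_real \<beta> * complex_of_real (hgegen (\<nu> + 1) (j - 1) (x m) (rad2 m x))) (\<lambda>x. complex_of_real (- 2 * \<beta> * (\<nu> + 1) * hgegen (\<nu> + 2) (j - 3) (x m) (rad2 m x) * x i))"
    if "i \<in> {1..m-1}" for i
  proof -
    have e: "\<nu> + 1 + 1 = \<nu> + 2" "j - 1 - 2 = j - 3" by simp_all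
    have "complex_of_real \<beta> * complex_of_real (- 2 * (\<nu> + 1) * hgegen (\<nu> + 1 + 1) (j - 1 - 2) (x m) (rad2 m x) * x i)
      = complex_of_real (- 2 * \<beta> * (\<nu> + 1) * hgegen (\<nu> + 2) (j - 3) (x m) (rad2 m x) * x i)" for x :: "nat \<Rightarrow> real"
      by (simp only: e of_real_mult[symmetric] of_real_eq_iff, simp?)
    then show ?thesis
      using has_pds_cmult[OF i[OF that, of "\<nu> + 1" "j - 1"], of "complex_of_real \<beta>"] by (simp only:)
  qed
  have im: "i \<in> {1..m}" if "i \<in> {1..m-1}" for i using that by auto
  have axis_vec: "dirN m (m - 1) (gegen_ext m \<nu> j M) x
    = (cl_smul (complex_of_real (?G \<nu> j)) 0 + cl_smul (complex_of_real (- 2 * \<nu> * ?G (\<nu> + 1) (j - 2))) (cl_mult m (ulx m x) (M x)))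
    + (cl_smul (complex_of_real \<beta> * complex_of_real (?G (\<nu> + 1) (j - 1))) (dirN m (m - 1) (ebar_vec m M) x)
     + cl_smul (complex_of_real (- 2 * \<beta> * (\<nu> + 1) * ?G (\<nu> + 2) (j - 3))) (cl_mult m (ulx m x) (ebar_vec m M x)))"
    unfolding gegen_ext_alt \<beta>_def[symmetric]
  proof (subst dirN_add)
    fix a assume a: "a \<in> {1..m-1}"
    show "dif a (\<lambda>x. cl_smul (complex_of_real (hgegen \<nu> j (x m) (rad2 m x))) (M x)) (pd a (\<lambda>x. cl_smul (complex_of_real (hgegen \<nu> j (x m) (rad2 m x))) (M x)))"
      using gegen_ext_parts_dif[OF M(1) im[OF a], of 1 \<nu> j] dif_pd by auto
    show "dif a (\<lambda>x. cl_smul (complex_of_real \<beta> * complex_of_real (hgegen (\<nu> + 1) (j - 1) (x m) (rad2 m x))) (ebar_vec m M x)) (pd a (\<lambda>x. cl_smul (complex_of_real \<beta> * complex_of_real (hgegen (\<nu> + 1) (j - 1) (x m) (rad2 m x))) (ebar_vec m M x)))"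
      using gegen_ext_parts_dif[OF hom_poly_ebar_vec[OF M(1)] im[OF a], of \<beta> "\<nu> + 1" "j - 1"] dif_pd by auto
  qed (simp only: dirN_radial[OF i M(1)] dirN_radial[OF i2 hom_poly_ebar_vec[OF M(1)]] M(3) ulx_def)
  have xW: "cl_mult m (ulx m x) (ebar_vec m M x) = cl_smul (complex_of_real (inner_up (m - 1) x x)) (cl_mult m (ebar m) (M x))"
    unfolding ebar_vec_def ebar_ulx[OF assms(1)] ulx_ulx[OF assms(1) M(2)] cl_mult_smul_right
    by (rule ext) (simp add: cl_smul_def)
  have eM: "cl_mult m (cl_e m) (M x) = - cl_mult m (ebar m) (M x)" by (simp add: ebar_eq cl_mult_minus_left)
  have eW: "cl_mult m (cl_e m) (ebar_vec m M x) = cl_mult m (ulx m x) (M x)"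
    unfolding ebar_vec_def ebar_eq cl_mult_minus_left cl_mult_minus_right using assms(1) by (simp add: cl_e_square)
  have top: "cl_mult m (cl_e m) (pd m (gegen_ext m \<nu> j M) x)
     = cl_smul (complex_of_real (- ((2 * \<nu> + of_int j - 1) * ?G \<nu> (j - 1)))) (cl_mult m (ebar m) (M x))
      + cl_smul (complex_of_real (2 * \<nu> * ?G (\<nu> + 1) (j - 2))) (cl_mult m (ulx m x) (M x))"
  \<comment> \<open>In degree 0 the coefficient is constant and the second term is absent, so
    nothing depends on x_m; \<open>gegen_ext_pd_top\<close> starts only at index 1.\<close>
  proof (cases "j = 0")
    case True
    have mm: "m \<in> {1..m}" "m \<notin> {1..m-1}" using assms(1) by auto
    have "pd m (gegen_ext m \<nu> j M) = 0"
    proof -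
      have "gegen_ext m \<nu> j M = (\<lambda>x. cl_smul (complex_of_real (hgegen \<nu> 0 0 0)) (M x))"
        unfolding gegen_ext_alt True by (rule ext) (simp add: hgegen_def gterm_def)
      then show ?thesis using pd_independent[OF hom_poly_smul[OF M(1)] mm(2)] by simp
    qed
    then show ?thesis using True by simp
  next
    case False
    then have j1: "1 \<le> j" using assms(4) by simp
    have "(2 * \<nu> + of_int j - 1) * (2 * \<nu> / (2 * \<nu> + of_int (j - 1)) * ?G (\<nu> + 1) (j - 1 - 1)) = 2 * \<nu> * ?G (\<nu> + 1) (j - 2)"
    proof -
      have "2 * \<nu> + real_of_int j - 1 \<noteq> 0" using j1 assms(3) by auto
      then show ?thesis by (simp add: add_diff_eq)
    qed
    then have c: "complex_of_real (2 * \<nu> + of_int j - 1) * (complex_of_real (2 * \<nu> / (2 * \<nu> + of_int (j - 1))) * complex_of_real (?G (\<nu> + 1) (j - 1 - 1))) = complex_of_real (2 * \<nu> * ?G (\<nu> + 1) (j - 2))"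
      unfolding of_real_mult[symmetric] by (simp only:)
    show ?thesis
      unfolding gegen_ext_pd_top[OF assms(1,2,3) j1] unfolding gegen_ext_alt cl_mult_distrib cl_smul_add cl_smul_smul eM eW c
      by (rule ext) (simp add: cl_smul_def)
  qed
  have split: "dirac m (gegen_ext m \<nu> j M) x = dirN m (m - 1) (gegen_ext m \<nu> j M) x + cl_mult m (cl_e m) (pd m (gegen_ext m \<nu> j M) x)"
    unfolding dirac_dirN dirN_def N by simp
  have r: "rad2 m x - (x m)^2 = inner_up (m - 1) x x" using rad2_split[OF assms(1), of x] by simp
  \<comment> \<open>\<open>hgegen_monogenic\<close> at index j - 1: the cancellation of the
    multiples of ebar M.\<close>
  have F: "(2 * \<nu> + of_int j - 1) * ?G \<nu> (j - 1) = \<beta> * ((2 * \<nu> + 1) * ?G (\<nu> + 1) (j - 1) - 2 * (\<nu> + 1) * inner_up (m - 1) x x * ?G (\<nu> + 2) (j - 3))"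
  proof -
    have "(2 * \<nu> + of_int j) * ((2 * \<nu> + of_int j - 1) * ?G \<nu> (j - 1))
      = 2 * \<nu> * ((2 * \<nu> + 1) * ?G (\<nu> + 1) (j - 1) - 2 * (\<nu> + 1) * inner_up (m - 1) x x * ?G (\<nu> + 2) (j - 3))"
      using hgegen_monogenic[of \<nu> "j - 1" "x m" "rad2 m x"] unfolding r by (simp add: algebra_simps)
    then show ?thesis unfolding \<beta>_def using j by (simp add: field_simps)
  qed
  show ?thesis
    unfolding split axis_vec top F dirN_ebar_vec[OF assms(1,2)] assms(5)[symmetric] xW
    by (intro ext) (simp add: cl_smul_def algebra_simps)
qed

lemma hom_poly_gegen_ext:
  assumes "1 \<le> m" "hom_poly (m - 1) l M"
  shows "hom_poly m (j + l) (gegen_ext m \<nu> (int j) M)"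
  unfolding gegen_ext_alt
proof (rule hom_poly_add)
  have up: "hom_poly (m - 1) k P \<Longrightarrow> hom_poly m k P" for k P by (rule hom_poly_mono) auto
  show "hom_poly m (j + l) (\<lambda>x. cl_smul (complex_of_real (hgegen \<nu> (int j) (x m) (rad2 m x))) (M x))"
    by (intro hom_poly_scal spoly_hgegen assms up)
  show "hom_poly m (j + l) (\<lambda>x. cl_smul (complex_of_real (2 * \<nu> / (2 * \<nu> + real_of_int (int j))) * complex_of_real (hgegen (\<nu> + 1) (int j - 1) (x m) (rad2 m x))) (ebar_vec m M x))"
  proof (cases j)
    case 0
    then show ?thesis by (simp add: hom_poly_zero)
  next
    case (Suc i)
    have "hom_poly m (i + Suc l) (\<lambda>x. cl_smul (complex_of_real (2 * \<nu> / (2 * \<nu> + real_of_int (int j))) * complex_of_real (hgegen (\<nu> + 1) (int i) (x m) (rad2 m x))) (ebar_vec m M x))"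
      by (intro hom_poly_scal spoly_smul spoly_hgegen assms up hom_poly_ebar_vec)
    then show ?thesis by (simp add: Suc)
  qed
qed

text \<open>For x_m = 0 the element X_k^j is the j-th power of the vector x; this is what the
  constants \<open>mu\<close> are normalised for. So for \<open>M\<close> monogenic of degree k in
  dimension m - 1 this function is the Cauchy-Kovalevskaya extension of x^j M.\<close>

definition Xp_mult :: "nat \<Rightarrow> nat \<Rightarrow> nat \<Rightarrow> pf \<Rightarrow> pf" where
  "Xp_mult m k j M x = cl_mult m (Xp m k j x) (M x)"

lemma cl_pow_in_Cl: "cl_pow m A j \<in> Cl m" by (cases j) auto

text \<open>\<open>Xp\<close> divides by r, the quotient being 0 at r = 0, whereas
  \<open>gegen_ext\<close> is polynomial. The formula holds at r = 0 too: for j > 0 both sides are 0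
  there.\<close>

lemma Xp_mult_eq_gegen_ext:
  assumes "3 \<le> m" "\<And>x. M x \<in> Cl m"
  shows "Xp_mult m k j M = (\<lambda>x. cl_smul (complex_of_real (mu m k j)) (gegen_ext m (gegen_idx m k) (int j) (\<lambda>y. cl_mult m (cl_pow m (ebar m) j) (M y)) x))"
proof
  fix x
  show "Xp_mult m k j M x = cl_smul (complex_of_real (mu m k j)) (gegen_ext m (gegen_idx m k) (int j) (\<lambda>y. cl_mult m (cl_pow m (ebar m) j) (M y)) x)"
  proof (cases "j = 0")
    case True
    have "mu m k 0 = 1" using mu_even[of m k 0] by simp
    then show ?thesis unfolding True Xp_mult_def Xp_def gegen_ext_def
      by (simp add: cl_mult_one_left assms hgegen_def gterm_def)
  next
    case False
    let ?M = "cl_mult m (cl_pow m (ebar m) j) (M x)"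
    have n: "real m / 2 + real k - 1 = gegen_idx m k" "real m / 2 + real k = gegen_idx m k + 1" "real m + 2 * real k - 2 = 2 * gegen_idx m k"
      "real m + 2 * real k + real j - 2 = 2 * gegen_idx m k + real_of_int (int j)"
      by (simp_all add: gegen_idx_def)
    obtain i where ji: "j = Suc i" using False by (cases j) auto
    have c1: "rad m x ^ j * gegen j (gegen_idx m k) (x m / rad m x) = hgegen (gegen_idx m k) (int j) (x m) (rad2 m x)"
    proof (cases "rad m x = 0")
      case True
      then have r: "rad2 m x = 0" using rad_sq[of m x] by simp
      have xm: "x m = 0"
        using r assms(1) unfolding rad2_def by (subst (asm) sum_nonneg_eq_0_iff) auto
      have "gterm (gegen_idx m k) (nat (int j - 2 * int a)) a 0 0 = 0" if "2 * int a \<le> int j" for a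
        using that False by (cases "a = 0") (auto simp: gterm_def)
      then have "hgegen (gegen_idx m k) (int j) (x m) (rad2 m x) = 0"
        unfolding hgegen_def r xm by (intro sum.neutral) auto
      then show ?thesis using True False by simp
    next
      case nz: False
      show ?thesis using gegen_hgegen[OF nz, of j "gegen_idx m k" "x m"] unfolding rad_sq .
    qed
    \<comment> \<open>At r = 0 and j = 1 the two scalars differ, being 0 and 1. The equality is
      therefore stated after multiplication by \<open>ulx m x\<close>, which is 0 there.\<close>
    have c2: "cl_smul (complex_of_real (rad m x ^ j * (gegen (j - 1) (gegen_idx m k + 1) (x m / rad m x) / rad m x))) (ulx m x)
        = cl_smul (complex_of_real (hgegen (gegen_idx m k + 1) (int j - 1) (x m) (rad2 m x))) (ulx m x)"
    proof (cases "rad m x = 0")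
      case True
      then have r: "rad2 m x = 0" using rad_sq[of m x] by simp
      have x0: "x i = 0" if "i \<in> {1..m}" for i
        using r that unfolding rad2_def by (subst (asm) sum_nonneg_eq_0_iff) auto
      have "ulx m x = 0" unfolding ulx_def cl_vec_eq_sum by (intro sum.neutral) (auto simp: x0)
      then show ?thesis by simp
    next
      case nz: False
      have "rad m x ^ j * (gegen (j - 1) (gegen_idx m k + 1) (x m / rad m x) / rad m x) = rad m x ^ i * gegen i (gegen_idx m k + 1) (x m / rad m x)"
        using nz by (simp add: ji)
      then show ?thesis using gegen_hgegen[OF nz, of i "gegen_idx m k + 1" "x m"] unfolding rad_sq by (simp add: ji)
    qed
    have "Xp_mult m k j M x = cl_smul (complex_of_real (mu m k j))
        (cl_smul (complex_of_real (rad m x ^ j * gegen j (gegen_idx m k) (x m / rad m x))) ?M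
         + cl_smul (complex_of_real (2 * gegen_idx m k / (2 * gegen_idx m k + real_of_int (int j))))
            (cl_mult m (ebar m) (cl_mult m (cl_smul (complex_of_real (rad m x ^ j * (gegen (j - 1) (gegen_idx m k + 1) (x m / rad m x) / rad m x))) (ulx m x)) ?M)))"
      unfolding Xp_mult_def Xp_def Let_def n using False
      by (simp add: cl_mult_distrib cl_mult_assoc cl_mult_one_left cl_smul_add cl_pow_in_Cl mult_ac)
    then show ?thesis unfolding c1 c2 gegen_ext_def cl_mult_smul_left cl_mult_smul_right cl_smul_smul .
  qed
qed

lemma monog_below_cl_pow: "1 \<le> m \<Longrightarrow> monog_below m l M \<Longrightarrow> monog_below m l (\<lambda>x. cl_mult m (cl_pow m (ebar m) j) (M x))"
proof (induction j)
  case 0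
  then show ?case by (simp add: monog_below_def cl_mult_one_left)
next
  case (Suc j)
  then show ?case using monog_below_ebar_mult[OF Suc(2) Suc(1)[OF Suc(2,3)]] by (simp add: cl_mult_assoc)
qed

lemma monog_belowD: "monog_below m l M \<Longrightarrow> hom_poly (m - 1) l M" "monog_below m l M \<Longrightarrow> M x \<in> Cl m" "monog_below m l M \<Longrightarrow> dirN m (m - 1) M x = 0"
  by (auto simp: monog_below_def)

lemma hom_poly_Xp_mult: "3 \<le> m \<Longrightarrow> monog_below m l M \<Longrightarrow> hom_poly m (l + j) (Xp_mult m k j M)"
proof -
  assume a: "3 \<le> m" "monog_below m l M"
  have m: "1 \<le> m" using a by simp
  have MC: "\<And>x. M x \<in> Cl m" using a(2) by (rule monog_belowD)
  show ?thesis unfolding Xp_mult_eq_gegen_ext[OF a(1) MC]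
    using hom_poly_smul[OF hom_poly_gegen_ext[OF m monog_belowD(1)[OF monog_below_cl_pow[OF m a(2), of j]], of j "gegen_idx m k"]] by (simp add: add.commute)
qed

lemma gegen_idx_shift: "2 * gegen_idx m l + 1 = real m - 1 + 2 * real l" by (simp add: gegen_idx_def)

lemma dirac_smul:
  assumes "hom_poly m k F"
  shows "dirac m (\<lambda>x. cl_smul c (F x)) x = cl_smul c (dirac m F x)"
  unfolding dirac_dirN by (rule dirN_smul) (rule hom_poly_dif[OF assms])

lemma Xp_mult_dirac: "3 \<le> m \<Longrightarrow> monog_below m l M \<Longrightarrow> dirac m (Xp_mult m l j M) x = 0"
proof -
  assume a: "3 \<le> m" "monog_below m l M"
  have m: "1 \<le> m" using a by simp
  have MC: "\<And>x. M x \<in> Cl m" using a(2) by (rule monog_belowD)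
  note L = monog_below_cl_pow[OF m a(2), of j]
  have "dirac m (gegen_ext m (gegen_idx m l) (int j) (\<lambda>y. cl_mult m (cl_pow m (ebar m) j) (M y))) x = 0"
    by (rule gegen_ext_dirac[OF m L gegen_idx_pos[OF a(1)] _ gegen_idx_shift]) simp
  then show ?thesis unfolding Xp_mult_eq_gegen_ext[OF a(1) MC] dirac_smul[OF hom_poly_gegen_ext[OF m monog_belowD(1)[OF L]]] by simp
qed

lemma cl_pow_Suc_right:
  assumes "1 \<le> m" "A \<in> Cl m"
  shows "cl_mult m (cl_pow m (ebar m) (Suc j)) A = cl_mult m (cl_pow m (ebar m) j) (cl_mult m (ebar m) A)"
  by (induction j) (simp_all add: cl_mult_assoc cl_mult_one_left cl_mult_one_right assms)

lemma Xp_mult_pd: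
  assumes "3 \<le> m" "monog_below m l M"
  shows "pd m (Xp_mult m l (Suc j) M) x = cl_smul (complex_of_real (if even (Suc j) then - real (Suc j) else 2 * gegen_idx m l + real (Suc j)))
     (Xp_mult m l j (\<lambda>y. cl_mult m (ebar m) (M y)) x)"
proof -
  have m: "1 \<le> m" using assms by simp
  have MC: "\<And>x. M x \<in> Cl m" using assms(2) by (rule monog_belowD)
  note L = monog_below_cl_pow[OF m assms(2), of "Suc j"]
  let ?c = "if even (Suc j) then - real (Suc j) else 2 * gegen_idx m l + real (Suc j)"
  have "pd m (Xp_mult m l (Suc j) M) x = cl_smul (complex_of_real (mu m l (Suc j))) (pd m (gegen_ext m (gegen_idx m l) (int (Suc j)) (\<lambda>y. cl_mult m (cl_pow m (ebar m) (Suc j)) (M y))) x)"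
    unfolding Xp_mult_eq_gegen_ext[OF assms(1) MC] dif_pd[OF dif_smul[OF hom_poly_dif[OF hom_poly_gegen_ext[OF m monog_belowD(1)[OF L]]]]] ..
  also have "\<dots> = cl_smul (complex_of_real (mu m l (Suc j))) (cl_smul (complex_of_real (2 * gegen_idx m l + of_int (int (Suc j)) - 1)) (gegen_ext m (gegen_idx m l) (int (Suc j) - 1) (\<lambda>y. cl_mult m (cl_pow m (ebar m) (Suc j)) (M y)) x))"
    by (subst gegen_ext_pd_top[OF m L gegen_idx_pos[OF assms(1)]]) simp_all
  also have "\<dots> = cl_smul (complex_of_real (?c * mu m l j)) (gegen_ext m (gegen_idx m l) (int j) (\<lambda>y. cl_mult m (cl_pow m (ebar m) j) (cl_mult m (ebar m) (M y))) x)"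
    unfolding cl_pow_Suc_right[OF m MC] cl_smul_smul of_real_mult[symmetric]
    using mu_ratio[OF assms(1), of "Suc j" l] by (simp add: add.commute)
  finally show ?thesis unfolding Xp_mult_eq_gegen_ext[OF assms(1) cl_mult_in_Cl] cl_smul_smul of_real_mult .
qed

lemma Xp_mult_0: "M x \<in> Cl m \<Longrightarrow> Xp_mult m k 0 M x = M x"
  by (simp add: Xp_mult_def Xp_def cl_mult_one_left)

section \<open>The embedding operators\<close>

definition vec_part :: "bool \<Rightarrow> nat \<Rightarrow> pf \<Rightarrow> pf" where
  "vec_part b m P x = (if b then cl_wedge m (ulx m x) (P x) else cl_dot m (ulx m x) (P x))"

definition op_scale :: "bool \<Rightarrow> nat \<Rightarrow> nat \<Rightarrow> nat \<Rightarrow> real" where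
  "op_scale b m t l = (if b then 1 - cc m t l else cc m t l)"

text \<open>The monogenic part in the decomposition of the wedge or inner product into a monogenic
  function and x times a monogenic one. \<open>op_scale\<close> is the coefficient of the second
  part, by \<open>dirN_vec_part\<close>.\<close>

definition shifted_part :: "bool \<Rightarrow> nat \<Rightarrow> nat \<Rightarrow> nat \<Rightarrow> pf \<Rightarrow> pf" where
  "shifted_part b m t l P x = vec_part b m P x - cl_smul (complex_of_real (op_scale b m t l)) (cl_mult m (ulx m x) (P x))"

text \<open>One formula for all operators of the theorem: \<open>b\<close> selects the hatted (wedge) or dotted (inner product)
  family, and \<open>i\<close> is the subscript, odd for \<open>X\<close> and even for \<open>Y\<close>. The even case uses
  \<open>c (m - 1 + 2 l) = t + l\<close>.\<close>
definition gt_op :: "bool \<Rightarrow> nat \<Rightarrow> nat \<Rightarrow> nat \<Rightarrow> nat \<Rightarrow> pf \<Rightarrow> pf" where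
  "gt_op b m t l i P = (if i = 0 then P else (\<lambda>x.
     cl_smul (complex_of_real (if odd i then 1 else real i)) (Xp_mult m (l + 1) (i - 1) (shifted_part b m t l P) x)
     + cl_smul (complex_of_real (op_scale b m t l * (if odd i then 1 else real m - 1 + 2 * real l + real i))) (Xp_mult m l i P x)))"

text \<open>The factor \<open>e_m\<close> is present exactly when it is needed to reach the grade \<open>s\<close>.\<close>
definition gt_map :: "bool \<Rightarrow> nat \<Rightarrow> nat \<Rightarrow> nat \<Rightarrow> nat \<Rightarrow> pf \<Rightarrow> pf" where
  "gt_map b m t l i P = (if b = even i then rmul_em m (gt_op b m t l i P) else gt_op b m t l i P)"

lemma hatX_eq_gt_op: "odd i \<Longrightarrow> hatX m t l i P = gt_op True m t l i P"
proof -
  assume i: "odd i"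
  then have "i \<noteq> 0" by presburger
  then show ?thesis using i
    by (intro ext) (simp add: hatX_def gt_op_def Xp_mult_def shifted_part_def vec_part_def op_scale_def cl_mult_distrib, simp add: cl_smul_def algebra_simps)
qed

lemma dotX_eq_gt_op: "odd i \<Longrightarrow> dotX m t l i P = gt_op False m t l i P"
proof -
  assume i: "odd i"
  then have "i \<noteq> 0" by presburger
  then show ?thesis using i
    by (intro ext) (simp add: dotX_def gt_op_def Xp_mult_def shifted_part_def vec_part_def op_scale_def cl_mult_distrib, simp add: cl_smul_def algebra_simps)
qed

lemma cc_mult: "3 \<le> m \<Longrightarrow> cc m t l * (real m - 1 + 2 * real l) = real t + real l"
  unfolding cc_def by (simp add: field_simps)

lemma hatY_eq_gt_op:
  assumes "3 \<le> m" "even i" "i \<noteq> 0"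
  shows "hatY m t l i P = gt_op True m t l i P"
proof -
  have c: "real m - 1 - real t + real l = (1 - cc m t l) * (real m - 1 + 2 * real l)"
    using cc_mult[OF assms(1), of t l] by (simp add: algebra_simps)
  show ?thesis
    unfolding hatY_def c using assms(2,3)
    by (intro ext) (simp add: hatX_def gt_op_def Xp_mult_def shifted_part_def vec_part_def op_scale_def cl_mult_distrib, simp add: cl_smul_def algebra_simps)
qed

lemma dotY_eq_gt_op:
  assumes "3 \<le> m" "even i" "i \<noteq> 0"
  shows "dotY m t l i P = gt_op False m t l i P"
  unfolding dotY_def cc_mult[OF assms(1), of t l, symmetric] using assms(2,3)
  by (intro ext) (simp add: dotX_def gt_op_def Xp_mult_def shifted_part_def vec_part_def op_scale_def cl_mult_distrib, simp add: cl_smul_def algebra_simps)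

text \<open>The factor with which differentiation in x_m takes index i to i - 1, with e_m on the
  right. At i = 1 the first summand of \<open>gt_op\<close> does not contain x_m and contributes
  nothing, which makes this case exceptional.\<close>

definition op_coeff :: "nat \<Rightarrow> nat \<Rightarrow> nat \<Rightarrow> bool \<Rightarrow> nat \<Rightarrow> real" where
  "op_coeff m t l b i = (if i = 1 then - ((-1)^t * op_scale b m t l * (real m - 1 + 2 * real l))
     else if odd i then - ((-1)^t) else (-1)^t * real i * (real m - 1 + 2 * real l + real i))"

definition op_sign :: "bool \<Rightarrow> real" where "op_sign b = (if b then 1 else -1)"

lemma vec_part_eq:
  assumes "P x \<in> Lam (m - 1) t"
  shows "vec_part b m P x = cl_smul (1/2) (cl_mult m (ulx m x) (P x) + cl_smul (complex_of_real (op_sign b * (-1)^t)) (cl_mult m (P x) (ulx m x)))"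
proof -
  have L: "P x \<in> Lam m t" using assms Lam_mono[of "m - 1" m t] by auto
  show ?thesis unfolding vec_part_def op_sign_def cl_wedge_Lam[OF L] cl_dot_Lam[OF L]
    by (cases b) (auto simp: cl_smul_neg_left)
qed

context
  fixes m t l :: nat and P :: pf
  assumes m3: "3 \<le> m" and P: "P \<in> monog (m - 1) t l"
begin

lemma PL: "P x \<in> Lam (m - 1) t" using monogD(2)[OF P] .
lemma Phom: "hom_poly (m - 1) l P" using monogD(1)[OF P] .
lemma PC: "P x \<in> Cl m" using monogD(3)[OF P] Cl_mono[of "m - 1" m] by auto

lemma dirN_P: "dirN m (m - 1) P x = 0"
proof -
  have "dirN m (m - 1) P x = dirac (m - 1) P x"
    unfolding dirac_dirN dirN_def
  proof (rule sum.cong[OF refl])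
    fix j assume "j \<in> {1..m-1}"
    then show "cl_mult m (cl_e j) (pd j P x) = cl_mult (m - 1) (cl_e j) (pd j P x)"
      by (intro cl_mult_mono pd_in_Cl monogD(3)[OF P] cl_e_in_Cl) auto
  qed
  then show ?thesis using monogD(4)[OF P] by simp
qed

lemma monog_below_P: "monog_below m l P" unfolding monog_below_def using Phom PC dirN_P by simp

lemma hom_xP: "hom_poly (m - 1) (Suc l) (\<lambda>x. cl_mult m (ulx m x) (P x))"
  using hom_poly_cl_mult[OF hom_poly_ulx Phom] by simp

lemma hom_Px: "hom_poly (m - 1) (Suc l) (\<lambda>x. cl_mult m (P x) (ulx m x))"
  using hom_poly_cl_mult[OF Phom hom_poly_ulx] by simp

lemma vec_part_alt: "vec_part b m P = (\<lambda>x. cl_smul (1/2) (cl_mult m (ulx m x) (P x) + cl_smul (complex_of_real (op_sign b * (-1)^t)) (cl_mult m (P x) (ulx m x))))"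
  by (rule ext) (rule vec_part_eq[OF PL])

lemma hom_vec_part: "hom_poly (m - 1) (Suc l) (vec_part b m P)"
  unfolding vec_part_alt by (intro hom_poly_smul hom_poly_add hom_xP hom_Px)

text \<open>The half sum or half difference of the Dirac operators of x P and P x. For the inner
  product it is - (t + l) P, while x P alone gives - (m - 1 + 2 l) P; the quotient is the constant
  c.\<close>

lemma dirN_vec_part: "dirN m (m - 1) (vec_part b m P) x = cl_smul (complex_of_real (- (op_scale b m t l * (real m - 1 + 2 * real l)))) (P x)"
proof -
  have m1: "real (m - 1) = real m - 1" using m3 by (simp add: of_nat_diff)
  have 1: "dirN m (m - 1) (\<lambda>x. cl_mult m (ulx m x) (P x)) x = cl_smul (complex_of_real (- (real m - 1 + 2 * real l))) (P x)"
    using dirN_vec_mult[OF Phom PC, of x] dirN_P unfolding ulx_def m1 by simp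
  have 2: "dirN m (m - 1) (\<lambda>x. cl_mult m (P x) (ulx m x)) x = cl_smul (complex_of_real ((-1)^(Suc t) * (real m - 1 - 2 * real t))) (P x)"
    using dirN_mult_vec[OF Phom PL, of m x] dirN_P unfolding ulx_def m1 by simp
  have "dirN m (m - 1) (vec_part b m P) x = cl_smul (1/2) (dirN m (m - 1) (\<lambda>x. cl_mult m (ulx m x) (P x)) x
     + cl_smul (complex_of_real (op_sign b * (-1)^t)) (dirN m (m - 1) (\<lambda>x. cl_mult m (P x) (ulx m x)) x))"
  proof -
    let ?c = "complex_of_real (op_sign b * (-1)^t)"
    have 1: "dirN m (m - 1) (vec_part b m P) x = cl_smul (1/2) (dirN m (m - 1) (\<lambda>x. cl_mult m (ulx m x) (P x) + cl_smul ?c (cl_mult m (P x) (ulx m x))) x)"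
      unfolding vec_part_alt by (rule dirN_smul, rule hom_poly_dif, rule hom_poly_add[OF hom_xP hom_poly_smul[OF hom_Px]])
    have 2: "dirN m (m - 1) (\<lambda>x. cl_mult m (ulx m x) (P x) + cl_smul ?c (cl_mult m (P x) (ulx m x))) x
      = dirN m (m - 1) (\<lambda>x. cl_mult m (ulx m x) (P x)) x + dirN m (m - 1) (\<lambda>x. cl_smul ?c (cl_mult m (P x) (ulx m x))) x"
      by (rule dirN_add[OF hom_poly_dif[OF hom_xP] hom_poly_dif[OF hom_poly_smul[OF hom_Px]]])
    have 3: "dirN m (m - 1) (\<lambda>x. cl_smul ?c (cl_mult m (P x) (ulx m x))) x = cl_smul ?c (dirN m (m - 1) (\<lambda>x. cl_mult m (P x) (ulx m x)) x)"
      by (rule dirN_smul[OF hom_poly_dif[OF hom_Px]])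
    show ?thesis unfolding 1 2 3 ..
  qed
  moreover have "op_sign b * (-1)^t * ((-1)^(Suc t) * (real m - 1 - 2 * real t)) = - op_sign b * (real m - 1 - 2 * real t)"
    by (simp add: mult.assoc[symmetric] flip: power_add mult_2)
  moreover have "(- (real m - 1 + 2 * real l) - op_sign b * (real m - 1 - 2 * real t)) / 2 = - (op_scale b m t l * (real m - 1 + 2 * real l))"
    using cc_mult[OF m3, of t l] by (cases b) (simp_all add: op_sign_def op_scale_def field_simps)
  ultimately have "dirN m (m - 1) (vec_part b m P) x = cl_smul (1/2) (cl_smul (complex_of_real (- (real m - 1 + 2 * real l))) (P x)
     + cl_smul (complex_of_real (- op_sign b * (real m - 1 - 2 * real t))) (P x))"
    unfolding 1 2 cl_smul_smul of_real_mult[symmetric] by (simp only:)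
  also have "\<dots> = cl_smul (complex_of_real ((- (real m - 1 + 2 * real l) - op_sign b * (real m - 1 - 2 * real t)) / 2)) (P x)"
    by (rule ext) (simp add: cl_smul_def algebra_simps)
  finally show ?thesis
    using \<open>(- (real m - 1 + 2 * real l) - op_sign b * (real m - 1 - 2 * real t)) / 2 = - (op_scale b m t l * (real m - 1 + 2 * real l))\<close> by (simp only:)
qed

lemma monog_below_shifted_part: "monog_below m (l + 1) (shifted_part b m t l P)"
proof -
  have m1: "real (m - 1) = real m - 1" using m3 by (simp add: of_nat_diff)
  have e: "shifted_part b m t l P = (\<lambda>x. vec_part b m P x + cl_smul (complex_of_real (- op_scale b m t l)) (cl_mult m (ulx m x) (P x)))"
    by (rule ext) (simp add: shifted_part_def cl_smul_neg_left)
  have h: "hom_poly (m - 1) (l + 1) (shifted_part b m t l P)"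
    unfolding e using hom_poly_add[OF hom_vec_part hom_poly_smul[OF hom_xP]] by simp
  have C: "shifted_part b m t l P x \<in> Cl m" for x
    unfolding shifted_part_def vec_part_eq[OF PL] by (intro Cl_diff Cl_smul Cl_add cl_mult_in_Cl)
  have 1: "dirN m (m - 1) (\<lambda>x. cl_mult m (ulx m x) (P x)) x = cl_smul (complex_of_real (- (real m - 1 + 2 * real l))) (P x)" for x
    using dirN_vec_mult[OF Phom PC, of x] dirN_P unfolding ulx_def m1 by simp
  have "dirN m (m - 1) (shifted_part b m t l P) x = dirN m (m - 1) (vec_part b m P) x + cl_smul (complex_of_real (- op_scale b m t l)) (dirN m (m - 1) (\<lambda>x. cl_mult m (ulx m x) (P x)) x)" for x
    unfolding e dirN_add[OF hom_poly_dif[OF hom_vec_part] hom_poly_dif[OF hom_poly_smul[OF hom_xP]]]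
      dirN_smul[OF hom_poly_dif[OF hom_xP]] ..
  then have "dirN m (m - 1) (shifted_part b m t l P) x = 0" for x
    unfolding dirN_vec_part 1 by (intro ext) (simp add: cl_smul_def algebra_simps)
  with h C show ?thesis by (simp add: monog_below_def)
qed

lemma e_P: "cl_mult m (cl_e m) (P x) = cl_smul ((-1)^t) (cl_mult m (P x) (cl_e m))"
  by (rule e_new_commute(1)[OF PL]) (use m3 in auto)

lemma ebar_P: "cl_mult m (ebar m) (P x) = cl_smul (complex_of_real (- ((-1)^t))) (cl_mult m (P x) (cl_e m))"
  unfolding ebar_eq cl_mult_minus_left e_P by (simp add: cl_smul_neg_left)

text \<open>x anticommutes with e_m, so the sign is opposite to that of \<open>ebar_P\<close>. Both
  rules turn the left factor \<open>ebar m\<close> produced by differentiation into a right factor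
  e_m.\<close>

lemma ebar_shifted_part: "cl_mult m (ebar m) (shifted_part b m t l P x) = cl_smul (complex_of_real ((-1)^t)) (cl_mult m (shifted_part b m t l P x) (cl_e m))"
proof -
  have m1: "1 \<le> m" using m3 by simp
  let ?e = "cl_e m" and ?x = "ulx m x"
  have a: "cl_mult m ?e (cl_mult m ?x (P x)) = cl_smul (- ((-1)^t)) (cl_mult m ?x (cl_mult m (P x) ?e))"
    unfolding cl_mult_assoc[symmetric] e_ulx[OF m1] cl_mult_minus_left
    unfolding cl_mult_assoc e_P cl_mult_smul_right by (simp add: cl_smul_neg_left)
  have b: "cl_mult m ?e (cl_mult m (P x) ?x) = cl_smul (- ((-1)^t)) (cl_mult m (P x) (cl_mult m ?x ?e))"
    unfolding cl_mult_assoc[symmetric] e_P cl_mult_smul_left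
    unfolding cl_mult_assoc e_ulx[OF m1] cl_mult_minus_right by (simp add: cl_smul_neg_left cl_smul_minus)
  show ?thesis
    unfolding shifted_part_def vec_part_eq[OF PL] ebar_eq cl_mult_distrib cl_mult_assoc a b
    by (rule ext) (simp add: cl_smul_def algebra_simps)
qed

lemma Xp_mult_right: "Xp_mult m k j (\<lambda>y. cl_smul c (cl_mult m (M y) A)) x = cl_smul c (cl_mult m (Xp_mult m k j M x) A)"
  unfolding Xp_mult_def cl_mult_smul_right cl_mult_assoc ..

lemma hom_gt_op: "hom_poly m (l + i) (gt_op b m t l i P)"
proof (cases i)
  case 0
  then show ?thesis using hom_poly_mono[OF Phom, of m] by (simp add: gt_op_def)
next
  case (Suc j)
  show ?thesis unfolding gt_op_def using Suc hom_poly_Xp_mult[OF m3 monog_below_shifted_part[of b], of j "l + 1"] hom_poly_Xp_mult[OF m3 monog_below_P, of "Suc j" l]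
    by (auto intro!: hom_poly_add hom_poly_smul)
qed

text \<open>Each summand is lowered by \<open>Xp_mult_pd\<close> with its own factor. For i > 1 the
  weights in \<open>gt_op\<close> are such that the two results stand in the ratio prescribed for
  index i - 1, so one common factor remains.\<close>

lemma gt_op_pd: "0 < i \<Longrightarrow> pd m (gt_op b m t l i P) x = cl_smul (complex_of_real (op_coeff m t l b i)) (cl_mult m (gt_op b m t l (i - 1) P x) (cl_e m))"
proof -
  assume "0 < i"
  then obtain j where i: "i = Suc j" by (cases i) auto
  let ?d = "op_scale b m t l" and ?M = "shifted_part b m t l P"
  have mm: "m \<notin> {1..m-1}" using m3 by auto
  have MC: "?M x \<in> Cl m" for x using monog_belowD(2)[OF monog_below_shifted_part] .
  note h = hom_poly_dif[OF hom_poly_Xp_mult[OF m3 monog_below_shifted_part[of b], of j "l + 1"]] hom_poly_dif[OF hom_poly_Xp_mult[OF m3 monog_below_P, of "Suc j" l]]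
  have d: "pd m (gt_op b m t l i P) x = cl_smul (complex_of_real (if odd i then 1 else real i)) (pd m (Xp_mult m (l + 1) j ?M) x)
    + cl_smul (complex_of_real (?d * (if odd i then 1 else real m - 1 + 2 * real l + real i))) (pd m (Xp_mult m l (Suc j) P) x)"
    unfolding gt_op_def using dif_pd[OF dif_add[OF dif_smul[OF h(1)] dif_smul[OF h(2)]]] i by simp
  have eP: "Xp_mult m l j (\<lambda>y. cl_mult m (ebar m) (P y)) x = cl_smul (complex_of_real (- ((-1)^t))) (cl_mult m (Xp_mult m l j P x) (cl_e m))"
    unfolding ebar_P by (rule Xp_mult_right)
  have eM: "Xp_mult m (l + 1) j' (\<lambda>y. cl_mult m (ebar m) (?M y)) x = cl_smul (complex_of_real ((-1)^t)) (cl_mult m (Xp_mult m (l + 1) j' ?M x) (cl_e m))" for j'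
    unfolding ebar_shifted_part by (rule Xp_mult_right)
  have nus: "2 * gegen_idx m l = real m + 2 * real l - 2" "2 * gegen_idx m (l + 1) = real m + 2 * real l" by (simp_all add: gegen_idx_def)
  show ?thesis
  proof (cases j)
    case 0
    have "Xp_mult m (l + 1) 0 ?M = ?M" by (rule ext) (rule Xp_mult_0[OF MC])
    then have 1: "pd m (Xp_mult m (l + 1) j ?M) x = 0" using pd_independent[OF monog_belowD(1)[OF monog_below_shifted_part] mm] 0 by simp
    have 2: "Xp_mult m l j P x = P x" unfolding 0 by (rule Xp_mult_0[OF PC])
    show ?thesis unfolding d 1 Xp_mult_pd[OF m3 monog_below_P] eP 2 unfolding i 0 gt_op_def op_coeff_def nus
      by (rule ext) (simp add: cl_smul_def algebra_simps)
  next
    case (Suc j')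
    have c1: "i \<noteq> 1" "i - 1 = j" "j \<noteq> 0" using i Suc by auto
    show ?thesis
    proof (cases "even i")
      case True
      then have j: "odd j" using i by simp
      have "cl_smul (complex_of_real (real i)) (pd m (Xp_mult m (l + 1) j ?M) x) + cl_smul (complex_of_real (?d * (real m - 1 + 2 * real l + real i))) (pd m (Xp_mult m l (Suc j) P) x)
        = cl_smul (complex_of_real ((-1)^t * real i * (real m - 1 + 2 * real l + real i))) (cl_mult m (cl_smul (complex_of_real 1) (Xp_mult m (l + 1) j' ?M x) + cl_smul (complex_of_real (?d * 1)) (Xp_mult m l j P x)) (cl_e m))"
        unfolding Xp_mult_pd[OF m3 monog_below_P] eP unfolding Suc Xp_mult_pd[OF m3 monog_below_shifted_part] eM nus cl_mult_distrib
        using j True Suc i by (intro ext) (simp add: cl_smul_def algebra_simps)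
      then show ?thesis unfolding d unfolding gt_op_def op_coeff_def c1 using True j c1 Suc by simp
    next
      case False
      then have j: "even j" using i by simp
      have "cl_smul (complex_of_real 1) (pd m (Xp_mult m (l + 1) j ?M) x) + cl_smul (complex_of_real (?d * 1)) (pd m (Xp_mult m l (Suc j) P) x)
        = cl_smul (complex_of_real (- ((-1)^t))) (cl_mult m (cl_smul (complex_of_real (real j)) (Xp_mult m (l + 1) j' ?M x) + cl_smul (complex_of_real (?d * (real m - 1 + 2 * real l + real j))) (Xp_mult m l j P x)) (cl_e m))"
        unfolding Xp_mult_pd[OF m3 monog_below_P] eP unfolding Suc Xp_mult_pd[OF m3 monog_below_shifted_part] eM nus cl_mult_distrib
        using j False Suc i by (intro ext) (simp add: cl_smul_def algebra_simps)
      then show ?thesis unfolding d unfolding gt_op_def op_coeff_def c1 using False j c1 Suc by simp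
    qed
  qed
qed

lemma cl_pow_even_mult: "A \<in> Cl m \<Longrightarrow> cl_mult m (cl_pow m (ebar m) (2 * a)) A = cl_smul (complex_of_real ((-1)^a)) A"
proof (induction a)
  case 0
  then show ?case by (simp add: cl_mult_one_left)
next
  case (Suc a)
  have "cl_mult m (cl_pow m (ebar m) (2 * Suc a)) A = cl_mult m (ebar m) (cl_mult m (ebar m) (cl_mult m (cl_pow m (ebar m) (2 * a)) A))"
    by (simp add: cl_mult_assoc)
  also have "\<dots> = - cl_mult m (cl_pow m (ebar m) (2 * a)) A" by (rule ebar_ebar) (use m3 in auto)
  finally show ?case using Suc by (simp add: cl_smul_neg_left)
qed

lemma cl_pow_odd_mult: "A \<in> Cl m \<Longrightarrow> cl_mult m (cl_pow m (ebar m) (Suc (2 * a))) A = cl_smul (complex_of_real ((-1)^a)) (cl_mult m (ebar m) A)"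
  by (simp add: cl_mult_assoc cl_pow_even_mult cl_mult_smul_right)

lemma x_shifted_part: "cl_mult m (ulx m x) (shifted_part b m t l P x) = cl_mult m (ulx m x) (vec_part b m P x) + cl_smul (complex_of_real (op_scale b m t l * inner_up (m - 1) x x)) (P x)"
proof -
  have xx: "cl_mult m (ulx m x) (cl_mult m (ulx m x) (P x)) = cl_smul (complex_of_real (- inner_up (m - 1) x x)) (P x)"
    by (rule ulx_ulx[OF _ PC]) (use m3 in simp)
  show ?thesis unfolding shifted_part_def cl_mult_distrib xx by (rule ext) (simp add: cl_smul_def)
qed

lemma ebar_x_ebar: "A \<in> Cl m \<Longrightarrow> cl_mult m (ebar m) (cl_mult m (ulx m x) (cl_mult m (ebar m) A)) = cl_mult m (ulx m x) A"
  using m3 by (simp add: ebar_ulx cl_mult_minus_right ebar_ebar)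

text \<open>The normal form shows the grades. The one term of mixed grade, a multiple of x P, comes
  once from \<open>shifted_part\<close> and once from the second term of X, and cancels by
  \<open>mu_lower_even\<close>.\<close>

lemma gt_op_odd_form:
  assumes "odd i"
  shows "\<exists>a1 a2 a3. gt_op b m t l i P x = cl_smul (complex_of_real a1) (vec_part b m P x) + cl_smul (complex_of_real a2) (cl_mult m (ebar m) (P x))
     + cl_smul (complex_of_real a3) (cl_mult m (ebar m) (cl_mult m (ulx m x) (vec_part b m P x)))"
proof -
  obtain a where i: "i = Suc (2 * a)" using assms by (metis oddE Suc_eq_plus1)
  have MC: "shifted_part b m t l P x \<in> Cl m" for x using monog_belowD(2)[OF monog_below_shifted_part] .
  define \<nu> where "\<nu> = gegen_idx m l"
  define \<mu> where "\<mu> = mu m l i"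
  define \<beta> where "\<beta> = 2 * \<nu> / (2 * \<nu> + real_of_int (int i))"
  define g2 where "g2 = 2 * (\<nu> + 1) / (2 * (\<nu> + 1) + real_of_int (int (2 * a))) * hgegen (\<nu> + 1 + 1) (int (2 * a) - 1) (x m) (rad2 m x)"
  define G where "G = hgegen (\<nu> + 1) (int (2 * a)) (x m) (rad2 m x)"
  define G0 where "G0 = hgegen \<nu> (int i) (x m) (rad2 m x)"
  define r where "r = inner_up (m - 1) x x"
  define d where "d = op_scale b m t l"
  define s where "s = (-1 :: real)^a"
  have mu': "mu m (l + 1) (2 * a) = \<mu> * \<beta>"
    using mu_lower_even[OF m3, of l a] unfolding \<mu>_def \<beta>_def \<nu>_def i by simp
  have ii: "int i - 1 = int (2 * a)" using i by simp
  have X1: "Xp_mult m (l + 1) (2 * a) (shifted_part b m t l P) x = cl_smul (complex_of_real (\<mu> * \<beta> * s)) (cl_smul (complex_of_real G) (shifted_part b m t l P x)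
     + cl_smul (complex_of_real g2) (cl_mult m (ebar m) (cl_mult m (ulx m x) (shifted_part b m t l P x))))"
    unfolding Xp_mult_eq_gegen_ext[OF m3 MC] mu' gegen_idx_Suc gegen_ext_def cl_pow_even_mult[OF MC] \<nu>_def[symmetric] s_def[symmetric] G_def[symmetric]
      of_real_mult[symmetric] g2_def[symmetric] cl_mult_smul_right
    by (rule ext) (simp add: cl_smul_def algebra_simps)
  have X2: "Xp_mult m l i P x = cl_smul (complex_of_real (\<mu> * s)) (cl_smul (complex_of_real G0) (cl_mult m (ebar m) (P x))
     + cl_smul (complex_of_real (\<beta> * G)) (cl_mult m (ulx m x) (P x)))"
    unfolding Xp_mult_eq_gegen_ext[OF m3 PC] gegen_ext_def ii \<mu>_def[symmetric] \<nu>_def[symmetric] \<beta>_def[symmetric] G_def[symmetric] G0_def[symmetric]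
    unfolding i cl_pow_odd_mult[OF PC] s_def[symmetric] cl_mult_smul_right ebar_x_ebar[OF PC]
    by (rule ext) (simp add: cl_smul_def algebra_simps)
  have "gt_op b m t l i P x = cl_smul (complex_of_real (\<mu> * \<beta> * s * G)) (vec_part b m P x)
      + cl_smul (complex_of_real (\<mu> * \<beta> * s * g2 * d * r + d * \<mu> * s * G0)) (cl_mult m (ebar m) (P x))
     + cl_smul (complex_of_real (\<mu> * \<beta> * s * g2)) (cl_mult m (ebar m) (cl_mult m (ulx m x) (vec_part b m P x)))"
  proof -
    have "gt_op b m t l i P x = Xp_mult m (l + 1) (2 * a) (shifted_part b m t l P) x + cl_smul (complex_of_real d) (Xp_mult m l i P x)"
      unfolding gt_op_def using i by (simp add: d_def)
    then show ?thesis
      unfolding X1 X2 x_shifted_part cl_mult_distrib unfolding shifted_part_def d_def[symmetric] r_def[symmetric]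
      by (intro ext) (simp add: cl_smul_def algebra_simps)
  qed
  then show ?thesis by blast
qed

text \<open>As in the odd case, with ebar x P as the term of mixed grade. Its two contributions
  cancel by \<open>mu_lower_odd\<close>, which is where the weights i and m - 1 + 2 l + i are
  used.\<close>

lemma gt_op_even_form:
  assumes "even i" "i \<noteq> 0"
  shows "\<exists>a1 a2 a3. gt_op b m t l i P x = cl_smul (complex_of_real a1) (cl_mult m (ebar m) (vec_part b m P x)) + cl_smul (complex_of_real a2) (P x)
     + cl_smul (complex_of_real a3) (cl_mult m (ulx m x) (vec_part b m P x))"
proof -
  obtain a where i: "i = 2 * a + 2" using assms by (metis dvdE add_2_eq_Suc' mult_Suc_right mult_0_right old.nat.exhaust add.commute)
  have MC: "shifted_part b m t l P x \<in> Cl m" for x using monog_belowD(2)[OF monog_below_shifted_part] .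
  define \<nu> where "\<nu> = gegen_idx m l"
  define \<mu> where "\<mu> = mu m l i"
  define \<mu>' where "\<mu>' = mu m (l + 1) (Suc (2 * a))"
  define \<beta> where "\<beta> = 2 * \<nu> / (2 * \<nu> + real_of_int (int i))"
  define g2 where "g2 = 2 * (\<nu> + 1) / (2 * (\<nu> + 1) + real_of_int (int (Suc (2 * a)))) * hgegen (\<nu> + 1 + 1) (int (Suc (2 * a)) - 1) (x m) (rad2 m x)"
  define G where "G = hgegen (\<nu> + 1) (int (Suc (2 * a))) (x m) (rad2 m x)"
  define G0 where "G0 = hgegen \<nu> (int i) (x m) (rad2 m x)"
  define r where "r = inner_up (m - 1) x x"
  define d where "d = op_scale b m t l"
  define s where "s = (-1 :: real)^a"
  define K where "K = real m - 1 + 2 * real l + real i"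
  have mu': "real i * \<mu>' = - K * \<beta> * \<mu>"
    using mu_lower_odd[OF m3, of a l] unfolding \<mu>_def \<mu>'_def \<beta>_def \<nu>_def i K_def by (simp add: gegen_idx_def algebra_simps)
  have ii: "int i - 1 = int (Suc (2 * a))" "i = 2 * Suc a" using i by simp_all
  have X1: "Xp_mult m (l + 1) (Suc (2 * a)) (shifted_part b m t l P) x = cl_smul (complex_of_real (\<mu>' * s)) (cl_smul (complex_of_real G) (cl_mult m (ebar m) (shifted_part b m t l P x))
     + cl_smul (complex_of_real g2) (cl_mult m (ulx m x) (shifted_part b m t l P x)))"
    unfolding Xp_mult_eq_gegen_ext[OF m3 MC] \<mu>'_def[symmetric] gegen_idx_Suc gegen_ext_def cl_pow_odd_mult[OF MC] \<nu>_def[symmetric] s_def[symmetric] G_def[symmetric]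
      of_real_mult[symmetric] g2_def[symmetric] cl_mult_smul_right ebar_x_ebar[OF MC]
    by (rule ext) (simp add: cl_smul_def algebra_simps)
  have sS: "(-1 :: real)^(Suc a) = - s" by (simp add: s_def)
  have X2: "Xp_mult m l i P x = cl_smul (complex_of_real (- \<mu> * s)) (cl_smul (complex_of_real G0) (P x)
     + cl_smul (complex_of_real (\<beta> * G)) (cl_mult m (ebar m) (cl_mult m (ulx m x) (P x))))"
    unfolding Xp_mult_eq_gegen_ext[OF m3 PC] gegen_ext_def ii(1) \<mu>_def[symmetric] \<nu>_def[symmetric] \<beta>_def[symmetric] G_def[symmetric] G0_def[symmetric]
    unfolding ii(2) cl_pow_even_mult[OF PC] sS cl_mult_smul_right
    by (rule ext) (simp add: cl_smul_def algebra_simps)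
  have "gt_op b m t l i P x = cl_smul (complex_of_real (real i * \<mu>' * s * G)) (cl_mult m (ebar m) (vec_part b m P x))
      + cl_smul (complex_of_real (real i * \<mu>' * s * g2 * d * r - d * K * \<mu> * s * G0)) (P x)
     + cl_smul (complex_of_real (real i * \<mu>' * s * g2)) (cl_mult m (ulx m x) (vec_part b m P x))"
  proof -
    have o: "gt_op b m t l i P x = cl_smul (complex_of_real (real i)) (Xp_mult m (l + 1) (Suc (2 * a)) (shifted_part b m t l P) x) + cl_smul (complex_of_real (d * K)) (Xp_mult m l i P x)"
      unfolding gt_op_def K_def using i by (simp add: d_def)
    have e: "gt_op b m t l i P x = cl_smul (complex_of_real (real i * \<mu>' * s * G)) (cl_mult m (ebar m) (shifted_part b m t l P x))
       + cl_smul (complex_of_real (real i * \<mu>' * s * g2)) (cl_mult m (ulx m x) (shifted_part b m t l P x))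
       - cl_smul (complex_of_real (d * K * \<mu> * s * G0)) (P x)
       - cl_smul (complex_of_real (d * K * \<beta> * \<mu> * s * G)) (cl_mult m (ebar m) (cl_mult m (ulx m x) (P x)))"
      unfolding o X1 X2 by (intro ext) (simp add: cl_smul_def algebra_simps)
    show ?thesis
      unfolding e x_shifted_part unfolding shifted_part_def cl_mult_distrib d_def[symmetric] r_def[symmetric] mu'
      by (intro ext) (simp add: cl_smul_def algebra_simps)
  qed
  then show ?thesis by blast
qed

end

section \<open>Grade and equivariance of the embeddings\<close>

lemma mult_e_e: "1 \<le> m \<Longrightarrow> A \<in> Cl m \<Longrightarrow> cl_mult m (cl_mult m A (cl_e m)) (cl_e m) = - A"
  using cl_e_sq_one[of m m] by (simp add: cl_mult_assoc cl_mult_minus_right cl_mult_one_right)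

lemma Lam_e:
  assumes "1 \<le> m" "A \<in> Lam (m - 1) s"
  shows "cl_mult m A (cl_e m) \<in> Lam m (Suc s)" "cl_mult m (ebar m) A \<in> Lam m (Suc s)"
    "cl_mult m (cl_mult m (ebar m) A) (cl_e m) \<in> Lam m s" "A \<in> Lam m s" "A \<in> Cl m"
proof -
  have l: "m - 1 < m" using assms by simp
  show A: "A \<in> Lam m s" using assms Lam_mono[of "m - 1" m s] by auto
  then show C: "A \<in> Cl m" using Lam_subset_Cl by blast
  show 1: "cl_mult m A (cl_e m) \<in> Lam m (Suc s)" by (rule e_new_commute(2)[OF assms(2) l order.refl])
  have e: "cl_mult m (ebar m) A = cl_smul (- ((-1)^s)) (cl_mult m A (cl_e m))"
    unfolding ebar_eq cl_mult_minus_left e_new_commute(1)[OF assms(2) l order.refl] by (simp add: cl_smul_neg_left)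
  show "cl_mult m (ebar m) A \<in> Lam m (Suc s)" unfolding e using 1 by simp
  show "cl_mult m (cl_mult m (ebar m) A) (cl_e m) \<in> Lam m s"
    unfolding e cl_mult_smul_left mult_e_e[OF assms(1) C] using A by simp
qed

lemma hom_poly_rmul_em: "hom_poly m k F \<Longrightarrow> hom_poly m k (rmul_em m F)"
  unfolding rmul_em_def using hom_poly_cl_mult[OF _ hom_poly_const[of m "cl_e m"], of k F m] by simp

lemma pd_rmul_em: "hom_poly m k F \<Longrightarrow> pd j (rmul_em m F) x = cl_mult m (pd j F x) (cl_e m)"
  unfolding rmul_em_def using dif_pd[OF dif_cl_mult[OF hom_poly_dif dif_const], of m k F j m "cl_e m"] by simp

lemma dirac_rmul_em: "hom_poly m k F \<Longrightarrow> dirac m (rmul_em m F) x = cl_mult m (dirac m F x) (cl_e m)"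
  unfolding dirac_eq_sum cl_mult_sum_left by (intro sum.cong refl) (simp add: pd_rmul_em cl_mult_assoc)

lemma dirac_split: "1 \<le> m \<Longrightarrow> dirac m F x = dirN m (m - 1) F x + cl_mult m (cl_e m) (pd m F x)"
proof -
  assume "1 \<le> m"
  then obtain N where N: "m = Suc N" using Suc_le_D by auto
  show ?thesis unfolding dirac_dirN dirN_def N by simp
qed

lemma Xp_mult_add: "Xp_mult m k j (\<lambda>x. A x + B x) x = Xp_mult m k j A x + Xp_mult m k j B x"
  by (simp add: Xp_mult_def cl_mult_add_right)
lemma Xp_mult_smul: "Xp_mult m k j (\<lambda>x. cl_smul c (A x)) x = cl_smul c (Xp_mult m k j A x)"
  by (simp add: Xp_mult_def cl_mult_smul_right)

lemma conjug_cl_pow_ebar: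
  assumes "1 \<le> m" "u \<in> unit_vecs (m - 1)"
  shows "conjug m u (cl_pow m (ebar m) j) = cl_smul ((-1)^j) (cl_pow m (ebar m) j)"
proof -
  have u: "u \<in> unit_vecs m" using assms unit_vecs_mono[of "m - 1" m] by auto
  have e: "conjug m u (ebar m) = - ebar m" unfolding ebar_eq conjug_minus conjug_e_new[OF assms(2), of m m, OF _ order.refl] using assms conjug_e_new[OF assms(2), of m m] by simp
  show ?thesis
  proof (induction j)
    case 0
    then show ?case by (simp add: conjug_one[OF u])
  next
    case (Suc j)
    then show ?case by (simp add: conjug_mult[OF u, symmetric] e cl_mult_minus_left cl_mult_smul_right cl_smul_minus cl_smul_neg_left)
  qed
qed

lemma inner_up_reflect: "u \<in> unit_vecs n \<Longrightarrow> inner_up n (reflect n u x) (reflect n u x) = inner_up n x x"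
proof -
  assume u: "u \<in> unit_vecs n"
  have "inner_up n (reflect n u x) (reflect n u x) = (\<Sum>i\<in>{1..n}. 4 * (inner_up n u x)^2 * (u i * u i) - 4 * inner_up n u x * (u i * x i) + x i * x i)"
    unfolding inner_up_def[of n "reflect n u x"] by (intro sum.cong refl) (simp add: reflect_def algebra_simps power2_eq_square)
  also have "\<dots> = 4 * (inner_up n u x)^2 * inner_up n u u - 4 * inner_up n u x * inner_up n u x + inner_up n x x"
    by (simp add: sum.distrib sum_subtractf sum_distrib_left[symmetric] inner_up_def del: One_nat_def)
  finally show ?thesis using unit_vecs_inner_up[OF u] by (simp add: power2_eq_square)
qed

lemma reflect_reflect: "u \<in> unit_vecs n \<Longrightarrow> i \<in> {1..n} \<Longrightarrow> reflect n u (reflect n u x) i = x i"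
proof -
  assume u: "u \<in> unit_vecs n" and i: "i \<in> {1..n}"
  have "inner_up n u (reflect n u x) = (\<Sum>i\<in>{1..n}. 2 * inner_up n u x * (u i * u i) - u i * x i)"
    unfolding inner_up_def[of n u "reflect n u x"] by (intro sum.cong refl) (simp add: reflect_def algebra_simps)
  also have "\<dots> = 2 * inner_up n u x * inner_up n u u - inner_up n u x"
    by (simp add: sum_subtractf sum_distrib_left[symmetric] inner_up_def del: One_nat_def)
  finally have "inner_up n u (reflect n u x) = inner_up n u x" using unit_vecs_inner_up[OF u] by simp
  then show ?thesis using i by (simp add: reflect_def)
qed

text \<open>As u is orthogonal to e_m, x_m and \<open>ebar m\<close> change sign together, while r
  is kept and the vector x below m is restored. The parity (-1)^j of the Gegenbauer polynomial
  cancels that of the j-th power of \<open>ebar m\<close>; in the second term the index j - 1 is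
  made up for by the extra \<open>ebar m\<close>.\<close>

lemma conjug_Xp:
  assumes m: "1 \<le> m" and u: "u \<in> unit_vecs (m - 1)"
  shows "conjug m u (Xp m k j (reflect m u x)) = Xp m k j x"
proof -
  have um: "u \<in> unit_vecs m" using assms unit_vecs_mono[of "m - 1" m] by auto
  have N: "m - 1 \<le> m" by simp
  have mm: "m \<notin> {1..m-1}" "m \<in> {1..m}" using m by auto
  have xm: "reflect m u x m = - x m" by (simp only: reflect_lower[OF u N] mm if_True if_False)
  have "rad2 m (reflect m u x) = rad2 m x" using inner_up_reflect[OF um, of x] by (simp add: rad2_def inner_up_def power2_eq_square)
  then have r: "rad m (reflect m u x) = rad m x" unfolding rad_def rad2_def by simp
  have e: "conjug m u (ebar m) = - ebar m" unfolding ebar_eq conjug_minus using conjug_e_new[OF u, of m m] m by simp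
  have "ulx m (reflect m u x) = cl_vec (m - 1) (reflect (m - 1) u x)"
    unfolding ulx_def by (rule cl_vec_cong) (simp add: reflect_lower[OF u N])
  then have "conjug m u (ulx m (reflect m u x)) = cl_vec (m - 1) (reflect (m - 1) u (reflect (m - 1) u x))"
    using conjug_vec_lower[OF u N] by simp
  also have "\<dots> = ulx m x" unfolding ulx_def by (rule cl_vec_cong) (rule reflect_reflect[OF u])
  finally have x': "conjug m u (ulx m (reflect m u x)) = ulx m x" .
  show ?thesis
  proof (cases j)
    case 0
    then show ?thesis by (simp add: Xp_def conjug_one[OF um])
  next
    case (Suc i)
    have z: "- x m / rad m x = - (x m / rad m x)" by simp
    define \<gamma> where "\<gamma> = (real m + 2 * real k - 2) / (real m + 2 * real k + real (Suc i) - 2)"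
    define K where "K = mu m k (Suc i) * rad m x ^ Suc i"
    have Xe: "Xp m k (Suc i) y = cl_mult m
        (cl_smul (complex_of_real (mu m k (Suc i) * rad m y ^ Suc i))
          (cl_smul (complex_of_real (gegen (Suc i) (real m / 2 + real k - 1) (y m / rad m y))) cl_one
           + cl_smul (complex_of_real (\<gamma> * gegen i (real m / 2 + real k) (y m / rad m y) / rad m y))
               (cl_mult m (ebar m) (ulx m y))))
        (cl_pow m (ebar m) (Suc i))" for y
      unfolding Xp_def Let_def \<gamma>_def by (simp only: diff_Suc_1 nat.simps if_False)
    have sgn: "(-1)^Suc i = - ((-1)^i :: real)" "(-1)^Suc i = - ((-1)^i :: complex)" by simp_all
    \<comment> \<open>The real sign from the Gegenbauer polynomial and the complex one from the
      power of \<open>ebar m\<close> are decided together by the parity of i.\<close>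
    have sq: "(-1)^i = (1::real) \<and> (-1)^i = (1::complex) \<or> (-1)^i = (-1::real) \<and> (-1)^i = (-1::complex)"
      by (cases "even i") auto
    show ?thesis
      unfolding Suc Xe r xm z gegen_minus K_def[symmetric]
      unfolding conjug_mult[OF um, symmetric] conjug_add conjug_smul conjug_one[OF um] e x' conjug_cl_pow_ebar[OF m u] sgn
      using sq by (elim disjE conjE; intro ext) (simp_all del: cl_pow.simps add: cl_mult_minus_left cl_mult_minus_right cl_mult_smul_left cl_mult_smul_right cl_smul_minus cl_smul_neg_left cl_smul_add cl_smul_diff cl_mult_add_left cl_mult_diff_left)
  qed
qed

lemma conjug_ulx:
  assumes m: "1 \<le> m" and u: "u \<in> unit_vecs (m - 1)"
  shows "conjug m u (ulx m (reflect m u x)) = ulx m x"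
proof -
  have N: "m - 1 \<le> m" by simp
  have "ulx m (reflect m u x) = cl_vec (m - 1) (reflect (m - 1) u x)"
    unfolding ulx_def by (rule cl_vec_cong) (simp add: reflect_lower[OF u N])
  then have "conjug m u (ulx m (reflect m u x)) = cl_vec (m - 1) (reflect (m - 1) u (reflect (m - 1) u x))"
    using conjug_vec_lower[OF u N] by simp
  also have "\<dots> = ulx m x" unfolding ulx_def by (rule cl_vec_cong) (rule reflect_reflect[OF u])
  finally show ?thesis .
qed

text \<open>Where \<open>gt_map\<close> carries e_m, the e_m produced by differentiation meets it,
  and e_m e_m = -1; hence the change of sign.\<close>

definition gt_coeff :: "bool \<Rightarrow> nat \<Rightarrow> nat \<Rightarrow> nat \<Rightarrow> nat \<Rightarrow> real" where
  "gt_coeff b m t l i = (if b = even i then - op_coeff m t l b i else op_coeff m t l b i)"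

text \<open>\<open>op_scale\<close> times m - 1 + 2 l is m - 1 - t + l for \<open>b\<close> and t +
  l otherwise. The bounds on t make this positive even for l = 0.\<close>

lemma gt_coeff_nonzero:
  assumes "3 \<le> m" "0 < i" "if b then t < m - 1 else 0 < t"
  shows "gt_coeff b m t l i \<noteq> 0"
proof -
  have d: "op_scale b m t l * (real m - 1 + 2 * real l) > 0"
  proof (cases b)
    case True
    then have "real t < real m - 1" using assms by simp
    then show ?thesis using True cc_mult[OF assms(1), of t l] by (simp add: op_scale_def left_diff_distrib)
  next
    case False
    then show ?thesis using assms cc_mult[OF assms(1), of t l] by (simp add: op_scale_def)
  qed
  have p: "real i * (real m - 1 + 2 * real l + real i) > 0" using assms by (intro mult_pos_pos) auto
  have "op_coeff m t l b i \<noteq> 0"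
    unfolding op_coeff_def using d p assms(2) by (auto simp: mult.assoc)
  moreover have "gt_coeff b m t l i = - op_coeff m t l b i \<or> gt_coeff b m t l i = op_coeff m t l b i"
    by (simp only: gt_coeff_def split: if_split) blast
  ultimately show ?thesis by auto
qed

context
  fixes m t l :: nat and P :: pf
  assumes m3: "3 \<le> m" and P: "P \<in> monog (m - 1) t l"
begin

lemma m1: "1 \<le> m" using m3 by simp

lemmas PL' = PL[OF m3 P] and PC' = PC[OF m3 P]

lemma vec_part_Lam: "vec_part b m P x \<in> Lam (m - 1) (if b then Suc t else t - 1)"
  "cl_mult m (ulx m x) (vec_part b m P x) \<in> Lam (m - 1) t"
proof -
  let ?n = "m - 1"
  have n: "?n \<le> m" by simp
  have C: "P x \<in> Cl ?n" using monogD(3)[OF P] .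
  have q: "vec_part b m P x = cl_smul (1/2) (cl_mult ?n (cl_vec ?n x) (P x) + cl_smul (complex_of_real (op_sign b * (-1)^t)) (cl_mult ?n (P x) (cl_vec ?n x)))"
    unfolding vec_part_eq[of P x m t, OF PL'] ulx_def by (simp only: cl_mult_mono[OF cl_vec_in_Cl C n] cl_mult_mono[OF C cl_vec_in_Cl n])
  have qc: "vec_part b m P x \<in> Cl ?n" unfolding q by simp
  have x: "cl_mult m (ulx m x) (vec_part b m P x) = cl_mult ?n (cl_vec ?n x) (vec_part b m P x)"
    unfolding ulx_def by (rule cl_mult_mono[OF cl_vec_in_Cl qc n])
  show "vec_part b m P x \<in> Lam ?n (if b then Suc t else t - 1)"
    unfolding q op_sign_def using vec_wedge_Lam[OF PL' order.refl] vec_dot_Lam(1)[OF PL' order.refl]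
    by (auto simp: cl_smul_neg_left)
  show "cl_mult m (ulx m x) (vec_part b m P x) \<in> Lam ?n t"
    unfolding x unfolding q op_sign_def cl_mult_smul_right
    using vec_mult_wedge_Lam[OF PL' order.refl] vec_mult_dot_Lam[OF PL' order.refl]
    by (auto simp: cl_smul_neg_left)
qed

text \<open>In the normal forms either all terms already have the wanted grade, or each is one step
  above it with a left factor \<open>ebar m\<close> or one step below it without; then right
  multiplication by e_m moves all of them to it.\<close>

lemma gt_map_Lam:
  assumes "b \<or> 0 < t"
  shows "gt_map b m t l i P x \<in> Lam m (if b then Suc t else t)"
proof -
  note LQ = Lam_e[OF m1 vec_part_Lam(1)[of b x]] and LX = Lam_e[OF m1 vec_part_Lam(2)[of x b]] and LP = Lam_e[OF m1 PL'[of x]]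
  consider "i = 0" | "odd i" | "even i" "i \<noteq> 0" by blast
  then show ?thesis
  proof cases
    case 1
    then show ?thesis using LP by (auto simp: gt_map_def gt_op_def rmul_em_def)
  next
    case 2
    then obtain a1 a2 a3 where o: "gt_op b m t l i P x = cl_smul (complex_of_real a1) (vec_part b m P x) + cl_smul (complex_of_real a2) (cl_mult m (ebar m) (P x))
     + cl_smul (complex_of_real a3) (cl_mult m (ebar m) (cl_mult m (ulx m x) (vec_part b m P x)))" using gt_op_odd_form[OF m3 P] by blast
    show ?thesis
    proof (cases b)
      case True
      then have "gt_map b m t l i P x = gt_op b m t l i P x" using 2 by (simp add: gt_map_def)
      then show ?thesis unfolding o using LQ LX LP True by simp
    next
      case False
      then have "Suc (t - 1) = t" using assms by simp
      moreover have "gt_map b m t l i P x = cl_mult m (gt_op b m t l i P x) (cl_e m)" using 2 False by (simp add: gt_map_def rmul_em_def)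
      ultimately show ?thesis unfolding o using LQ LX LP False by (simp add: cl_mult_add_left cl_mult_smul_left)
    qed
  next
    case 3
    then obtain a1 a2 a3 where o: "gt_op b m t l i P x = cl_smul (complex_of_real a1) (cl_mult m (ebar m) (vec_part b m P x)) + cl_smul (complex_of_real a2) (P x)
     + cl_smul (complex_of_real a3) (cl_mult m (ulx m x) (vec_part b m P x))" using gt_op_even_form[OF m3 P] by blast
    show ?thesis
    proof (cases b)
      case True
      then have "gt_map b m t l i P x = cl_mult m (gt_op b m t l i P x) (cl_e m)" using 3 by (simp add: gt_map_def rmul_em_def)
      then show ?thesis unfolding o using LQ LX LP True by (simp add: cl_mult_add_left cl_mult_smul_left)
    next
      case False
      then have "Suc (t - 1) = t" using assms by simp
      moreover have "gt_map b m t l i P x = gt_op b m t l i P x" using 3 False by (simp add: gt_map_def)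
      ultimately show ?thesis unfolding o using LQ LX LP False by simp
    qed
  qed
qed

lemma dirac_gt_op: "dirac m (gt_op b m t l i P) x = 0"
proof (cases i)
  case 0
  have "pd m P = 0" by (rule pd_independent[OF Phom[OF m3 P]]) (use m3 in auto)
  then show ?thesis using 0 dirac_split[OF m1, of P x] dirN_P[OF m3 P, of x] by (simp add: gt_op_def)
next
  case (Suc j)
  let ?c1 = "complex_of_real (if odd i then 1 else real i)"
  let ?c2 = "complex_of_real (op_scale b m t l * (if odd i then 1 else real m - 1 + 2 * real l + real i))"
  let ?A = "Xp_mult m (l + 1) j (shifted_part b m t l P)" and ?B = "Xp_mult m l (Suc j) P"
  have hA: "hom_poly m (l + 1 + j) ?A" by (rule hom_poly_Xp_mult[OF m3 monog_below_shifted_part[OF m3 P]])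
  have hB: "hom_poly m (l + Suc j) ?B" by (rule hom_poly_Xp_mult[OF m3 monog_below_P[OF m3 P]])
  have e: "gt_op b m t l i P = (\<lambda>x. cl_smul ?c1 (?A x) + cl_smul ?c2 (?B x))"
    unfolding gt_op_def using Suc by simp
  have "dirac m (gt_op b m t l i P) x = cl_smul ?c1 (dirac m ?A x) + cl_smul ?c2 (dirac m ?B x)"
    unfolding e dirac_dirN dirN_add[OF hom_poly_dif[OF hom_poly_smul[OF hA]] hom_poly_dif[OF hom_poly_smul[OF hB]]]
      dirN_smul[OF hom_poly_dif[OF hA]] dirN_smul[OF hom_poly_dif[OF hB]] ..
  moreover have "dirac m ?A x = 0" by (rule Xp_mult_dirac[OF m3 monog_below_shifted_part[OF m3 P]])
  moreover have "dirac m ?B x = 0" by (rule Xp_mult_dirac[OF m3 monog_below_P[OF m3 P]])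
  ultimately show ?thesis by (simp only: cl_smul_zero add_0_left)
qed

lemma gt_map_monog:
  assumes "b \<or> 0 < t"
  shows "gt_map b m t l i P \<in> monog m (if b then Suc t else t) (l + i)"
  unfolding monog_iff
proof (intro conjI allI)
  show "hom_poly m (l + i) (gt_map b m t l i P)"
    unfolding gt_map_def using hom_gt_op[OF m3 P, of i b] hom_poly_rmul_em by auto
  show "gt_map b m t l i P x \<in> Lam m (if b then Suc t else t)" for x by (rule gt_map_Lam[OF assms])
  show "dirac m (gt_map b m t l i P) x = 0" for x
    unfolding gt_map_def using dirac_gt_op dirac_rmul_em[OF hom_gt_op[OF m3 P, of i b]] by auto
qed

lemma gt_map_pd:
  assumes "0 < i"
  shows "pd m (gt_map b m t l i P) x = cl_smul (complex_of_real (gt_coeff b m t l i)) (gt_map b m t l (i - 1) P x)"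
proof -
  have ev: "even (i - 1) \<longleftrightarrow> odd i" using assms by (cases i) auto
  have OC: "gt_op b m t l (i - 1) P x \<in> Cl m"
    unfolding gt_op_def Xp_mult_def using PC' by auto
  show ?thesis
  proof (cases "b = even i")
    case True
    then have h: "b \<noteq> even (i - 1)" using ev by auto
    have a: "gt_map b m t l (i - 1) P x = gt_op b m t l (i - 1) P x" unfolding gt_map_def if_not_P[OF h] ..
    have c: "gt_map b m t l i P = rmul_em m (gt_op b m t l i P)" "gt_coeff b m t l i = - op_coeff m t l b i"
      using True by (simp_all add: gt_map_def gt_coeff_def)
    show ?thesis
      unfolding a c pd_rmul_em[OF hom_gt_op[OF m3 P]] gt_op_pd[OF m3 P assms] cl_mult_smul_left mult_e_e[OF m1 OC] cl_smul_minus
      by simp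
  next
    case False
    then have h: "b = even (i - 1)" using ev by auto
    have a: "gt_map b m t l (i - 1) P x = cl_mult m (gt_op b m t l (i - 1) P x) (cl_e m)"
      unfolding gt_map_def rmul_em_def if_P[OF h] ..
    have c: "gt_map b m t l i P = gt_op b m t l i P" "gt_coeff b m t l i = op_coeff m t l b i"
      using False by (simp_all add: gt_map_def gt_coeff_def)
    show ?thesis unfolding a c gt_op_pd[OF m3 P assms] ..
  qed
qed

text \<open>On the axis \<open>vec_part\<close> vanishes, so the normal forms leave a multiple of P
  or of ebar P. For \<open>b\<close> the result is a multiple of P e_m, which satisfies the
  relation; otherwise l > 0, and P, which ignores x_m, is itself 0 there. The case of
  \<open>b\<close> false and l = 0 is the one component left out.\<close>

lemma gt_map_axis:
  assumes x0: "\<And>i. i \<in> {1..m-1} \<Longrightarrow> x i = 0" and b: "b \<or> 0 < l"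
  shows "cl_mult m (cl_e m) (gt_map b m t l i P x) = cl_smul (- ((-1) ^ (if b then Suc t else t))) (cl_mult m (gt_map b m t l i P x) (cl_e m))"
proof -
  have ul: "ulx m x = 0" unfolding ulx_def cl_vec_eq_sum by (intro sum.neutral) (auto simp: x0)
  have Q0: "vec_part b m P x = 0" unfolding vec_part_eq[of P x m t, OF PL'] ul by simp
  have form: "\<exists>a. gt_op b m t l i P x = cl_smul a (if odd i then cl_mult m (ebar m) (P x) else P x)"
  proof (cases "i = 0")
    case True
    then show ?thesis by (intro exI[of _ 1]) (simp add: gt_op_def)
  next
    case False
    show ?thesis
    proof (cases "odd i")
      case True
      then show ?thesis using gt_op_odd_form[OF m3 P True, of b x] unfolding Q0 by auto
    next
      case ev: False
      then show ?thesis using gt_op_even_form[OF m3 P _ False, of b x] unfolding Q0 by auto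
    qed
  qed
  then obtain a where a: "gt_op b m t l i P x = cl_smul a (if odd i then cl_mult m (ebar m) (P x) else P x)" by blast
  have ebP: "cl_mult m (ebar m) (P x) = cl_smul (- ((-1)^t)) (cl_mult m (P x) (cl_e m))"
    unfolding ebar_P[OF m3 P] by simp
  show ?thesis
  proof (cases b)
    case True
    obtain a' where TTx: "gt_map b m t l i P x = cl_smul a' (cl_mult m (P x) (cl_e m))"
      unfolding gt_map_def rmul_em_def using a True
      by (cases "odd i") (auto simp: ebP cl_mult_smul_left)
    show ?thesis unfolding TTx cl_mult_smul_left cl_mult_smul_right mult_e_e[OF m1 PC'] cl_mult_assoc[symmetric] e_P[OF m3 P]
      using True by (simp add: mult_e_e[OF m1 PC'] cl_smul_minus mult.commute)
  next
    case False
    then have l: "0 < l" using b by simp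
    have "P x = P (\<lambda>i. 0 * x i)" by (rule hom_poly_cong[OF Phom[OF m3 P]]) (simp add: x0)
    also have "\<dots> = 0" unfolding hom_poly_scale[OF Phom[OF m3 P]] using l by (simp add: power_0_left)
    finally have "gt_op b m t l i P x = 0" using a by simp
    then have "gt_map b m t l i P x = 0" by (simp only: gt_map_def rmul_em_def cl_mult_zero_left split: if_split) blast
    then show ?thesis by simp
  qed
qed

lemma H_act_lower:
  assumes "u \<in> unit_vecs (m - 1)"
  shows "H_act (m - 1) [u] P x = conjug m u (P (reflect m u x))"
proof -
  have N: "m - 1 \<le> m" by simp
  have "P (reflect m u x) = P (reflect (m - 1) u x)"
    by (rule hom_poly_cong[OF Phom[OF m3 P]]) (simp add: reflect_lower[OF assms N])
  then show ?thesis
    unfolding H_act_single[OF assms] using conjug_mono[OF assms N monogD(3)[OF P]] by simp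
qed

text \<open>Conjugation combined with the reflected argument fixes \<open>Xp\<close> and
  \<open>ulx\<close>, hence \<open>gt_op\<close> commutes with the action; the only sign is that of
  the final factor e_m.\<close>

lemma gt_map_equivariant:
  assumes u: "u \<in> unit_vecs (m - 1)"
  shows "H_act m [u] (gt_map b m t l i P) x = cl_smul (if b = even i then -1 else 1) (gt_map b m t l i (H_act (m - 1) [u] P) x)"
proof -
  have um: "u \<in> unit_vecs m" using u unit_vecs_mono[of "m - 1" m] by auto
  let ?P = "H_act (m - 1) [u] P"
  have P': "?P \<in> monog (m - 1) t l" by (rule monog_H_act[OF P u])
  have PL2: "?P x \<in> Lam (m - 1) t" for x using monogD(2)[OF P'] .
  note cjm = conjug_mult[OF um, symmetric]
  have XMc: "conjug m u (Xp_mult m k j M (reflect m u x)) = cl_mult m (Xp m k j x) (conjug m u (M (reflect m u x)))" for k j M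
    unfolding Xp_mult_def cjm conjug_Xp[OF m1 u] ..
  have Q: "conjug m u (vec_part b m P (reflect m u x)) = vec_part b m ?P x"
    unfolding vec_part_eq[of P _ m t, OF PL'] vec_part_eq[of ?P x m t, OF PL2] conjug_smul conjug_add cjm conjug_ulx[OF m1 u] H_act_lower[OF u] ..
  have M: "conjug m u (shifted_part b m t l P (reflect m u x)) = shifted_part b m t l ?P x"
    unfolding shifted_part_def conjug_diff conjug_smul cjm Q conjug_ulx[OF m1 u] H_act_lower[OF u] ..
  have O: "conjug m u (gt_op b m t l i P (reflect m u x)) = gt_op b m t l i ?P x"
  proof (cases "i = 0")
    case True
    then show ?thesis using H_act_lower[OF u, of x] by (simp add: gt_op_def)
  next
    case False
    have XA: "conjug m u (Xp_mult m (l + 1) (i - 1) (shifted_part b m t l P) (reflect m u x)) = Xp_mult m (l + 1) (i - 1) (shifted_part b m t l ?P) x"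
      unfolding XMc M unfolding Xp_mult_def ..
    have XB: "conjug m u (Xp_mult m l i P (reflect m u x)) = Xp_mult m l i ?P x"
      unfolding XMc unfolding Xp_mult_def H_act_lower[OF u] ..
    show ?thesis by (simp only: gt_op_def False if_False conjug_add conjug_smul XA XB)
  qed
  show ?thesis
  proof (cases "b = even i")
    case True
    have "conjug m u (cl_e m) = - cl_e m" by (rule conjug_e_new[OF u]) (use m3 in auto)
    then show ?thesis
      using True O unfolding H_act_single[OF um] gt_map_def by (simp add: rmul_em_def cjm cl_mult_minus_right)
  next
    case False
    then show ?thesis using O unfolding H_act_single[OF um] gt_map_def by simp
  qed
qed

end

lemma gt_map_add:
  assumes "3 \<le> m" "P \<in> monog (m - 1) t l" "Q \<in> monog (m - 1) t l" "(\<lambda>x. P x + Q x) \<in> monog (m - 1) t l"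
  shows "gt_map b m t l i (\<lambda>x. P x + Q x) x = gt_map b m t l i P x + gt_map b m t l i Q x"
proof -
  have q: "vec_part b m (\<lambda>x. P x + Q x) x = vec_part b m P x + vec_part b m Q x" for x
    unfolding vec_part_eq[of "\<lambda>x. P x + Q x" x m t, OF PL[OF assms(1,4)]] vec_part_eq[of P x m t, OF PL[OF assms(1,2)]] vec_part_eq[of Q x m t, OF PL[OF assms(1,3)]]
    by (rule ext) (simp add: cl_mult_distrib, simp add: cl_smul_def algebra_simps)
  have m: "shifted_part b m t l (\<lambda>x. P x + Q x) = (\<lambda>x. shifted_part b m t l P x + shifted_part b m t l Q x)"
    by (intro ext) (simp add: shifted_part_def q cl_mult_distrib, simp add: cl_smul_def algebra_simps)
  have o: "gt_op b m t l i (\<lambda>x. P x + Q x) x = gt_op b m t l i P x + gt_op b m t l i Q x" for x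
    unfolding gt_op_def m by (cases "i = 0") (auto simp: Xp_mult_add cl_smul_add)
  show ?thesis
  proof (cases "b = even i")
    case True
    then have "gt_map b m t l i F x = cl_mult m (gt_op b m t l i F x) (cl_e m)" for F x by (simp add: gt_map_def rmul_em_def)
    then show ?thesis by (simp only: o cl_mult_add_left)
  next
    case False
    then have "gt_map b m t l i F x = gt_op b m t l i F x" for F x by (simp add: gt_map_def)
    then show ?thesis by (simp only: o)
  qed
qed

lemma gt_map_smul:
  assumes "3 \<le> m" "P \<in> monog (m - 1) t l" "(\<lambda>x. cl_smul c (P x)) \<in> monog (m - 1) t l"
  shows "gt_map b m t l i (\<lambda>x. cl_smul c (P x)) x = cl_smul c (gt_map b m t l i P x)"
proof -
  have q: "vec_part b m (\<lambda>x. cl_smul c (P x)) x = cl_smul c (vec_part b m P x)" for x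
    unfolding vec_part_eq[of "\<lambda>x. cl_smul c (P x)" x m t, OF PL[OF assms(1,3)]] vec_part_eq[of P x m t, OF PL[OF assms(1,2)]]
    by (rule ext) (simp add: cl_mult_distrib, simp add: cl_smul_def algebra_simps)
  have m: "shifted_part b m t l (\<lambda>x. cl_smul c (P x)) = (\<lambda>x. cl_smul c (shifted_part b m t l P x))"
    by (intro ext) (simp add: shifted_part_def q cl_mult_distrib, simp add: cl_smul_def algebra_simps)
  have o: "gt_op b m t l i (\<lambda>x. cl_smul c (P x)) x = cl_smul c (gt_op b m t l i P x)" for x
    unfolding gt_op_def m by (cases "i = 0") (auto simp: Xp_mult_smul cl_smul_add mult_ac)
  show ?thesis
  proof (cases "b = even i")
    case True
    then have "gt_map b m t l i F x = cl_mult m (gt_op b m t l i F x) (cl_e m)" for F x by (simp add: gt_map_def rmul_em_def)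
    then show ?thesis by (simp only: o cl_mult_smul_left)
  next
    case False
    then have "gt_map b m t l i F x = gt_op b m t l i F x" for F x by (simp add: gt_map_def)
    then show ?thesis by (simp only: o)
  qed
qed

section \<open>The branching decomposition\<close>

lemma pds_commute: "spoly n k f \<Longrightarrow> pds i (pds j f) = pds j (pds i f)"
proof (induction rule: spoly.induct)
  case (spoly_const c)
  then show ?case using has_pds_pds[OF has_pds_const] by simp
next
  case (spoly_zero k)
  then show ?case using has_pds_pds[OF has_pds_const] by simp
next
  case (spoly_coord k f a)
  have p: "pds b (\<lambda>x. complex_of_real (x a) * f x) = (\<lambda>x. complex_of_real (x a) * pds b f x + (if a = b then 1 else 0) * f x)" for b
    by (rule has_pds_pds[OF has_pds_mult[OF has_pds_coord[of b a] spoly_has_pds[OF spoly_coord(1)]]])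
  have q: "pds c (\<lambda>x. complex_of_real (x a) * pds b f x + (if a = b then 1 else 0) * f x)
     = (\<lambda>x. (complex_of_real (x a) * pds c (pds b f) x + (if a = c then 1 else 0) * pds b f x) + (if a = b then 1 else 0) * pds c f x)" for b c
    by (rule has_pds_pds[OF has_pds_add[OF has_pds_mult[OF has_pds_coord[of c a] spoly_has_pds[OF spoly_pds[OF spoly_coord(1)]]] has_pds_cmult[OF spoly_has_pds[OF spoly_coord(1)]]]])
  show ?case unfolding p q spoly_coord(3) by (rule ext) simp
next
  case (spoly_add k f g)
  have p: "pds b (\<lambda>x. f x + g x) = (\<lambda>x. pds b f x + pds b g x)" for b
    by (rule has_pds_pds[OF has_pds_add[OF spoly_has_pds[OF spoly_add(1)] spoly_has_pds[OF spoly_add(2)]]])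
  have q: "pds c (\<lambda>x. pds b f x + pds b g x) = (\<lambda>x. pds c (pds b f) x + pds c (pds b g) x)" for b c
    by (rule has_pds_pds[OF has_pds_add[OF spoly_has_pds[OF spoly_pds[OF spoly_add(1)]] spoly_has_pds[OF spoly_pds[OF spoly_add(2)]]]])
  show ?case unfolding p q spoly_add(3,4) ..
qed

lemma pd_commute: "hom_poly n k P \<Longrightarrow> pd i (pd j P) = pd j (pd i P)"
proof (intro ext)
  fix x S assume "hom_poly n k P"
  have e: "(\<lambda>x. pd j P x S) = pds j (\<lambda>x. P x S)" for j by (rule ext) (rule pd_pds)
  show "pd i (pd j P) x S = pd j (pd i P) x S"
    unfolding pd_pds[of i "pd j P"] pd_pds[of j "pd i P"] e pds_commute[OF hom_polyD[OF \<open>hom_poly n k P\<close>], of i j] ..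
qed

lemma pd_in_Lam:
  assumes "\<And>x. P x \<in> Lam a s"
  shows "pd j P x \<in> Lam a s"
proof -
  have "pd j P x S = 0" if "\<not> (S \<subseteq> {1..a} \<and> card S = s)" for S
  proof -
    have "P x S = 0" for x using assms[of x] that unfolding Lam_def by blast
    then have "(\<lambda>x. P x S) = (\<lambda>x. 0)" by simp
    then show ?thesis unfolding pd_pds using has_pds_pds[OF has_pds_const] by simp
  qed
  then show ?thesis unfolding Lam_def by blast
qed

lemma monog_pd:
  assumes "F \<in> monog n s k"
  shows "pd j F \<in> monog n s (k - 1)"
  unfolding monog_iff
proof (intro conjI allI)
  note F = monogD[OF assms]
  show "hom_poly n (k - 1) (pd j F)" by (rule hom_poly_pd[OF F(1)])
  show "pd j F x \<in> Lam n s" for x by (rule pd_in_Lam) (rule F)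
  have "dif j (\<lambda>x. \<Sum>i\<in>{1..n}. cl_mult n (cl_e i) (pd i F x)) (\<lambda>x. \<Sum>i\<in>{1..n}. (cl_mult n (cl_e i) (pd j (pd i F) x) + cl_mult n 0 (pd i F x)))"
    by (intro dif_sum dif_cl_mult dif_const hom_poly_dif[OF hom_poly_pd[OF F(1)]])
  moreover have "(\<lambda>x. \<Sum>i\<in>{1..n}. cl_mult n (cl_e i) (pd i F x)) = (\<lambda>x. 0)"
    using F(4) unfolding dirac_eq_sum by blast
  ultimately have "dif j (\<lambda>x. 0) (\<lambda>x. \<Sum>i\<in>{1..n}. (cl_mult n (cl_e i) (pd j (pd i F) x) + cl_mult n 0 (pd i F x)))" by simp
  then have "pd j (\<lambda>x. 0) = (\<lambda>x. \<Sum>i\<in>{1..n}. (cl_mult n (cl_e i) (pd j (pd i F) x) + cl_mult n 0 (pd i F x)))" by (rule dif_pd)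
  moreover have "pd j (\<lambda>x. 0) = (\<lambda>x. 0)" by (rule dif_pd[OF dif_const])
  ultimately have "(\<Sum>i\<in>{1..n}. (cl_mult n (cl_e i) (pd j (pd i F) x) + cl_mult n 0 (pd i F x))) = 0" for x by metis
  then show "dirac n (pd j F) x = 0" for x
    unfolding dirac_eq_sum pd_commute[OF F(1), of _ j] by simp
qed

text \<open>A function with zero derivative in x_m is constant along x_m, so x_m may be replaced by
  0, and this substitution leaves a polynomial in the other variables.\<close>

lemma spoly_independent:
  assumes "1 \<le> m" "spoly m k f" "pds m f = (\<lambda>x. 0)"
  shows "spoly (m - 1) k f"
proof -
  have c: "f (x(m := 0)) = f x" for x
  proof -
    have "((\<lambda>s. f (x(m := s))) has_derivative (\<lambda>h. 0)) (at t)" for t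
    proof -
      have "((\<lambda>s. f ((x(m := t))(m := s))) has_vector_derivative pds m f (x(m := t))) (at ((x(m := t)) m))"
        using spoly_has_pds[OF assms(2), of m] unfolding has_pds_def by blast
      then show ?thesis unfolding assms(3) by (simp add: has_vector_derivative_def)
    qed
    then obtain c where "\<And>s. f (x(m := s)) = c"
      using has_derivative_zero_constant[of UNIV "\<lambda>s. f (x(m := s))"] by auto
    from this[of 0] this[of "x m"] show ?thesis by simp
  qed
  have "spoly (m - 1) k (\<lambda>x. f (x(m := 0)))"
  proof (rule spoly_compose[OF assms(2)])
    fix i assume i: "i \<in> {1..m}"
    show "spoly (m - 1) (Suc 0) (\<lambda>x. complex_of_real ((x(m := 0)) i))"
    proof (cases "i = m")
      case False
      then have "i \<in> {1..m-1}" using i by auto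
      then show ?thesis using False spoly_coordinate by simp
    qed (simp add: spoly_zero)
  qed
  then show ?thesis unfolding c .
qed

lemma Cl_e_independent:
  assumes m: "1 \<le> m" and A: "A \<in> Cl (m - 1)" and B: "B \<in> Cl (m - 1)"
    and z: "A + cl_mult m B (cl_e m) = 0"
  shows "A = 0" "B = 0"
proof -
  have mm: "m \<in> {1..m}" "m \<notin> {1..m-1}" using m by auto
  have "A T = 0" for T
  proof (cases "T \<subseteq> {1..m-1}")
    case True
    then have T: "T \<subseteq> {1..m}" by force
    have "m \<in> sym_diff {m} T" using True mm by auto
    then have "B (sym_diff {m} T) = 0" using B mm unfolding Cl_def by blast
    then have "cl_mult m B (cl_e m) T = 0" unfolding cl_mult_e_apply[OF mm(1) T] by simp
    then show ?thesis using fun_cong[OF z, of T] by simp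
  next
    case False
    then show ?thesis using A unfolding Cl_def by blast
  qed
  then show A0: "A = 0" by (intro ext) simp
  have "B \<in> Cl m" using B Cl_mono[of "m - 1" m] by auto
  from mult_e_e[OF m this] z A0 show "B = 0" by simp
qed

lemma monog_lower:
  assumes "1 \<le> m" "hom_poly (m - 1) k P" "\<And>x. P x \<in> Lam (m - 1) s" "\<And>x. dirN m (m - 1) P x = 0"
  shows "P \<in> monog (m - 1) s k"
proof -
  have C: "P x \<in> Cl (m - 1)" for x using assms(3) Lam_subset_Cl by blast
  have "dirN m (m - 1) P x = dirac (m - 1) P x" for x
    unfolding dirac_dirN dirN_def
  proof (rule sum.cong[OF refl])
    fix j assume "j \<in> {1..m-1}"
    then show "cl_mult m (cl_e j) (pd j P x) = cl_mult (m - 1) (cl_e j) (pd j P x)"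
      by (intro cl_mult_mono pd_in_Cl C cl_e_in_Cl) auto
  qed
  then show ?thesis unfolding monog_iff using assms by simp
qed

lemma dirN_in_Cl:
  assumes "1 \<le> m" "\<And>x. P x \<in> Cl (m - 1)"
  shows "dirN m (m - 1) P x \<in> Cl (m - 1)"
  unfolding dirN_def
proof (rule Cl_sum)
  fix j assume "j \<in> {1..m-1}"
  then have "cl_mult m (cl_e j) (pd j P x) = cl_mult (m - 1) (cl_e j) (pd j P x)"
    by (intro cl_mult_mono pd_in_Cl assms cl_e_in_Cl) auto
  then show "cl_mult m (cl_e j) (pd j P x) \<in> Cl (m - 1)" by simp
qed

text \<open>Blades without m form P, blades with m form Q e_m. Without a derivative in x_m the Dirac
  operator involves only the generators below m, so it acts on P and on Q separately.\<close>

lemma monog_independent_split: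
  assumes m: "1 \<le> m" and s: "1 \<le> s" and F: "F \<in> monog m s k" and d: "pd m F = 0"
  shows "\<exists>P\<in>monog (m - 1) s k. \<exists>Q\<in>monog (m - 1) (s - 1) k. F = (\<lambda>x. P x + cl_mult m (Q x) (cl_e m))"
proof -
  note FF = monogD[OF F]
  have mm: "m \<in> {1..m}" "m \<notin> {1..m-1}" using m by auto
  have hF: "spoly (m - 1) k (\<lambda>x. F x S)" for S
  proof (rule spoly_independent[OF m hom_polyD[OF FF(1)]])
    show "pds m (\<lambda>x. F x S) = (\<lambda>x. 0)"
    proof
      fix x show "pds m (\<lambda>x. F x S) x = 0" using pd_pds[of m F x S] unfolding d by simp
    qed
  qed
  define P where "P = (\<lambda>x S. if m \<in> S then 0 else F x S)"
  define R where "R = (\<lambda>x S. if m \<in> S then F x S else 0)"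
  \<comment> \<open>Since e_m e_m = -1, this sign gives Q e_m = R.\<close>
  define Q where "Q = (\<lambda>x. - cl_mult m (R x) (cl_e m))"
  have FPR: "F x = P x + R x" for x by (rule ext) (simp add: P_def R_def)
  have hP: "hom_poly (m - 1) k P"
    unfolding hom_poly_iff_spoly
  proof
    fix S show "spoly (m - 1) k (\<lambda>x. P x S)" using hF[of S] by (cases "m \<in> S") (simp_all add: P_def spoly_zero)
  qed
  have hR: "hom_poly (m - 1) k R"
    unfolding hom_poly_iff_spoly
  proof
    fix S show "spoly (m - 1) k (\<lambda>x. R x S)" using hF[of S] by (cases "m \<in> S") (simp_all add: R_def spoly_zero)
  qed
  have hQ: "hom_poly (m - 1) k Q"
    using hom_poly_smul[OF hom_poly_cl_mult[OF hR hom_poly_const[of "m - 1" "cl_e m"]], of "-1" m] unfolding Q_def by simp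
  have sub: "S \<subseteq> {1..m-1}" if "S \<subseteq> {1..m}" "m \<notin> S" for S
  proof
    fix i assume "i \<in> S"
    then have "i \<in> {1..m}" "i \<noteq> m" using that by auto
    then show "i \<in> {1..m-1}" by auto
  qed
  have LP: "P x \<in> Lam (m - 1) s" for x
    unfolding Lam_def
  proof (intro CollectI allI impI)
    fix S assume "P x S \<noteq> 0"
    then have "m \<notin> S" "F x S \<noteq> 0" unfolding P_def by (metis)+
    then show "S \<subseteq> {1..m-1} \<and> card S = s" using FF(2)[of x] sub[of S] unfolding Lam_def by blast
  qed
  have RC: "R x \<in> Cl m" for x
    unfolding Cl_def
  proof (intro CollectI allI impI)
    fix S assume "R x S \<noteq> 0"
    then have "F x S \<noteq> 0" unfolding R_def by metis
    then show "S \<subseteq> {1..m}" using FF(2)[of x] unfolding Lam_def by blast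
  qed
  have Qe: "cl_mult m (Q x) (cl_e m) = R x" for x
    unfolding Q_def cl_mult_minus_left mult_e_e[OF m RC] by simp
  have LQ: "Q x \<in> Lam (m - 1) (s - 1)" for x
    unfolding Lam_def
  proof (intro CollectI allI impI)
    fix T assume nz: "Q x T \<noteq> 0"
    then have T: "T \<subseteq> {1..m}" unfolding Q_def using cl_mult_outside[of T m "R x" "cl_e m"] by force
    have "R x (sym_diff {m} T) \<noteq> 0"
      using nz unfolding Q_def fun_Compl_def cl_mult_e_apply[OF mm(1) T] by auto
    then have b: "m \<in> sym_diff {m} T" "F x (sym_diff {m} T) \<noteq> 0" unfolding R_def by (metis)+
    then have mT: "m \<notin> T" by blast
    then have i: "sym_diff {m} T = insert m T" by auto
    have "card (insert m T) = s" using b(2) FF(2)[of x] unfolding i Lam_def by blast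
    moreover have "finite T" using T by (meson finite_atLeastAtMost finite_subset)
    ultimately have "card T = s - 1" using mT by simp
    then show "T \<subseteq> {1..m-1} \<and> card T = s - 1" using sub[OF T mT] by simp
  qed
  have CP: "P x \<in> Cl (m - 1)" and CQ: "Q x \<in> Cl (m - 1)" for x using LP LQ Lam_subset_Cl by blast+
  have FPQ: "F = (\<lambda>x. P x + cl_mult m (Q x) (cl_e m))" by (rule ext) (simp add: FPR Qe)
  have hQe: "hom_poly (m - 1) k (\<lambda>x. cl_mult m (Q x) (cl_e m))"
    using hom_poly_cl_mult[OF hQ hom_poly_const[of "m - 1" "cl_e m"], of m] by simp
  have dQe: "dirN m (m - 1) (\<lambda>x. cl_mult m (Q x) (cl_e m)) x = cl_mult m (dirN m (m - 1) Q x) (cl_e m)" for x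
  proof -
    have "pd j (\<lambda>x. cl_mult m (Q x) (cl_e m)) x = cl_mult m (pd j Q x) (cl_e m)" for j
      using dif_pd[OF dif_cl_mult[OF hom_poly_dif[OF hQ] dif_const], of j m "cl_e m"] by simp
    then show ?thesis unfolding dirN_def cl_mult_sum_left by (simp add: cl_mult_assoc)
  qed
  have "dirN m (m - 1) P x + cl_mult m (dirN m (m - 1) Q x) (cl_e m) = 0" for x
  proof -
    have "dirac m F x = dirN m (m - 1) F x" unfolding dirac_split[OF m] d by simp
    also have "\<dots> = dirN m (m - 1) P x + cl_mult m (dirN m (m - 1) Q x) (cl_e m)"
      unfolding FPQ dirN_add[OF hom_poly_dif[OF hP] hom_poly_dif[OF hQe]] dQe ..
    finally show ?thesis using FF(4) by simp
  qed
  from Cl_e_independent[OF m dirN_in_Cl[OF m CP] dirN_in_Cl[OF m CQ] this]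
  have "dirN m (m - 1) P x = 0" "dirN m (m - 1) Q x = 0" for x by blast+
  then have "P \<in> monog (m - 1) s k" "Q \<in> monog (m - 1) (s - 1) k"
    using monog_lower[OF m hP LP] monog_lower[OF m hQ LQ] by auto
  with FPQ show ?thesis by blast
qed

definition pscale :: "complex \<Rightarrow> pf \<Rightarrow> pf" where "pscale c P = (\<lambda>x. cl_smul c (P x))"

lemma pscale_eq: "(\<lambda>x S. c * P x S) = pscale c P" by (simp add: pscale_def cl_smul_def)

lemma monog_zero: "(\<lambda>x. 0) \<in> monog n s k"
proof -
  have "dirac n (\<lambda>x. 0) x = 0" for x unfolding dirac_eq_sum dif_pd[OF dif_const] by simp
  then show ?thesis unfolding monog_iff by (simp add: hom_poly_zero)
qed

lemma monog_add: "P \<in> monog n s k \<Longrightarrow> Q \<in> monog n s k \<Longrightarrow> (\<lambda>x. P x + Q x) \<in> monog n s k"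
  unfolding monog_iff
  by (auto intro: hom_poly_add simp: dirac_dirN dirN_add[OF hom_poly_dif hom_poly_dif])

lemma monog_smul: "P \<in> monog n s k \<Longrightarrow> (\<lambda>x. cl_smul c (P x)) \<in> monog n s k"
  unfolding monog_iff
  by (auto intro: hom_poly_smul simp: dirac_dirN dirN_smul[OF hom_poly_dif])

lemma monog_sum: "(\<And>i. i \<in> I \<Longrightarrow> P i \<in> monog n s k) \<Longrightarrow> (\<lambda>x. \<Sum>i\<in>I. P i x) \<in> monog n s k"
  by (induction I rule: infinite_finite_induct) (simp_all add: monog_zero monog_add)

lemma psubspace_monog: "psubspace (monog n s k)"
  unfolding psubspace_def pscale_eq plus_fun_def[where 'b = mv] zero_fun_def[where 'b = mv]
  using monog_zero monog_add monog_smul by (auto simp: pscale_def)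

definition gt_grade :: "bool \<Rightarrow> nat \<Rightarrow> nat" where "gt_grade b s = (if b then s - 1 else s)"

text \<open>The index \<open>(b, l)\<close> stands for the component coming from degree \<open>l\<close> and grade \<open>gt_grade b s\<close>.\<close>
definition gt_embed :: "nat \<Rightarrow> nat \<Rightarrow> nat \<Rightarrow> bool \<times> nat \<Rightarrow> pf \<Rightarrow> pf" where
  "gt_embed m s k i P = gt_map (fst i) m (gt_grade (fst i) s) (snd i) (k - snd i) P"

abbreviation gt_index :: "nat \<Rightarrow> (bool \<times> nat) set" where "gt_index k \<equiv> UNIV \<times> {..k}"
abbreviation gt_module :: "nat \<Rightarrow> nat \<Rightarrow> bool \<times> nat \<Rightarrow> pf set" where
  "gt_module m s i \<equiv> monog (m - 1) (gt_grade (fst i) s) (snd i)"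

lemma gt_index_Suc: "gt_index (Suc k) = gt_index k \<union> {(True, Suc k), (False, Suc k)}"
  by (auto simp: atMost_Suc)

lemma sum_gt_index_Suc: "sum f (gt_index (Suc k)) = sum f (gt_index k) + (f (True, Suc k) + f (False, Suc k))" for f :: "bool \<times> nat \<Rightarrow> mv"
  unfolding gt_index_Suc by (subst sum.union_disjoint) auto

lemma sum_gt_index_0: "sum f (gt_index 0) = f (True, 0) + f (False, 0)" for f :: "bool \<times> nat \<Rightarrow> mv"
proof -
  have "gt_index 0 = {(True, 0), (False, 0)}" by auto
  then show ?thesis by simp
qed

section \<open>The direct sum decomposition\<close>

context
  fixes m s :: nat
  assumes m3: "3 \<le> m" and s1: "1 \<le> s" and sm: "s \<le> m - 1"
begin

lemma gt_grade_ok: "b \<or> 0 < gt_grade b s" "(if b then Suc (gt_grade b s) else gt_grade b s) = s" "if b then gt_grade b s < m - 1 else 0 < gt_grade b s"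
  using s1 sm m3 by (auto simp: gt_grade_def)

lemma gt_embed_monog:
  assumes "i \<in> gt_index k" "P \<in> gt_module m s i"
  shows "gt_embed m s k i P \<in> monog m s k"
proof -
  have "snd i + (k - snd i) = k" using assms(1) by auto
  then show ?thesis using gt_map_monog[OF m3 assms(2), of "fst i" "k - snd i"] gt_grade_ok[of "fst i"] unfolding gt_embed_def by simp
qed

lemma gt_embed_pd:
  assumes "i \<in> gt_index k" "P \<in> gt_module m s i"
  shows "pd m (gt_embed m s (Suc k) i P) x = cl_smul (complex_of_real (gt_coeff (fst i) m (gt_grade (fst i) s) (snd i) (Suc k - snd i))) (gt_embed m s k i P x)"
proof -
  have "0 < Suc k - snd i" "Suc k - snd i - 1 = k - snd i" using assms(1) by auto
  then show ?thesis unfolding gt_embed_def using gt_map_pd[OF m3 assms(2), of "Suc k - snd i" "fst i" x] by simp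
qed

lemma gt_embed_op_coeff: "i \<in> gt_index k \<Longrightarrow> gt_coeff (fst i) m (gt_grade (fst i) s) (snd i) (Suc k - snd i) \<noteq> 0"
  by (rule gt_coeff_nonzero[OF m3 _ gt_grade_ok(3)]) auto

lemma gt_embed_top: "gt_embed m s k (True, k) P x = cl_mult m (P x) (cl_e m)" "gt_embed m s k (False, k) P x = P x"
  by (simp_all add: gt_embed_def gt_map_def gt_op_def rmul_em_def)

lemma gt_embed_pd_top:
  assumes "i = (b, k)" "P \<in> gt_module m s i"
  shows "pd m (gt_embed m s k i P) = 0"
proof -
  have m: "m \<notin> {1..m-1}" using m3 by auto
  note h = monogD(1)[OF assms(2)]
  have "hom_poly (m - 1) (snd i) (\<lambda>x. cl_mult m (P x) (cl_e m))"
    using hom_poly_cl_mult[OF h hom_poly_const[of "m - 1" "cl_e m"], of m] by simp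
  moreover have "gt_embed m s k (True, k) P = (\<lambda>x. cl_mult m (P x) (cl_e m))" "gt_embed m s k (False, k) P = P"
    by (rule ext, rule gt_embed_top)+
  ultimately show ?thesis using pd_independent[OF h m] pd_independent[OF _ m] assms(1) by (cases b) auto
qed

lemma gt_embed_add: "P \<in> gt_module m s i \<Longrightarrow> Q \<in> gt_module m s i \<Longrightarrow> gt_embed m s k i (\<lambda>x. P x + Q x) x = gt_embed m s k i P x + gt_embed m s k i Q x"
  unfolding gt_embed_def by (rule gt_map_add[OF m3]) (auto intro: monog_add)

lemma gt_embed_smul: "P \<in> gt_module m s i \<Longrightarrow> gt_embed m s k i (\<lambda>x. cl_smul c (P x)) x = cl_smul c (gt_embed m s k i P x)"
  unfolding gt_embed_def by (rule gt_map_smul[OF m3]) (auto intro: monog_smul)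

text \<open>The two components of degree Suc k do not depend on x_m and drop out; on the others
  differentiation lowers the target degree and multiplies by the constants
  \<open>gt_coeff\<close>.\<close>

lemma gt_embed_sum_pd:
  assumes "\<And>i. i \<in> gt_index (Suc k) \<Longrightarrow> p i \<in> gt_module m s i"
  shows "pd m (\<lambda>x. \<Sum>i\<in>gt_index (Suc k). gt_embed m s (Suc k) i (p i) x) x
     = (\<Sum>i\<in>gt_index k. gt_embed m s k i (\<lambda>x. cl_smul (complex_of_real (gt_coeff (fst i) m (gt_grade (fst i) s) (snd i) (Suc k - snd i))) (p i x)) x)"
proof -
  have "pd m (\<lambda>x. \<Sum>i\<in>gt_index (Suc k). gt_embed m s (Suc k) i (p i) x) = (\<lambda>x. \<Sum>i\<in>gt_index (Suc k). pd m (gt_embed m s (Suc k) i (p i)) x)"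
    by (rule dif_pd[OF dif_sum[OF hom_poly_dif[OF monogD(1)[OF gt_embed_monog]]]]) (use assms in auto)
  then have "pd m (\<lambda>x. \<Sum>i\<in>gt_index (Suc k). gt_embed m s (Suc k) i (p i) x) x = (\<Sum>i\<in>gt_index (Suc k). pd m (gt_embed m s (Suc k) i (p i)) x)" by simp
  also have "\<dots> = (\<Sum>i\<in>gt_index k. pd m (gt_embed m s (Suc k) i (p i)) x)"
    unfolding sum_gt_index_Suc using gt_embed_pd_top[OF refl assms, of True "Suc k"] gt_embed_pd_top[OF refl assms, of False "Suc k"] by simp
  also have "\<dots> = (\<Sum>i\<in>gt_index k. gt_embed m s k i (\<lambda>x. cl_smul (complex_of_real (gt_coeff (fst i) m (gt_grade (fst i) s) (snd i) (Suc k - snd i))) (p i x)) x)"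
  proof (rule sum.cong[OF refl])
    fix i assume i: "i \<in> gt_index k"
    then have "i \<in> gt_index (Suc k)" by auto
    then have "p i \<in> gt_module m s i" by (rule assms)
    then show "pd m (gt_embed m s (Suc k) i (p i)) x = gt_embed m s k i (\<lambda>x. cl_smul (complex_of_real (gt_coeff (fst i) m (gt_grade (fst i) s) (snd i) (Suc k - snd i))) (p i x)) x"
      unfolding gt_embed_pd[OF i \<open>p i \<in> gt_module m s i\<close>] gt_embed_smul[OF \<open>p i \<in> gt_module m s i\<close>] by blast
  qed
  finally show ?thesis .
qed

lemma decomposition_exists:
  "F \<in> monog m s k \<Longrightarrow> \<exists>p. (\<forall>i\<in>gt_index k. p i \<in> gt_module m s i) \<and> F = (\<lambda>x. \<Sum>i\<in>gt_index k. gt_embed m s k i (p i) x)"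
proof (induction k arbitrary: F)
  case 0
  have "pd m F = 0" by (rule hom_poly_0_pd[OF monogD(1)[OF 0]])
  then obtain P Q where PQ: "P \<in> monog (m - 1) s 0" "Q \<in> monog (m - 1) (s - 1) 0" "F = (\<lambda>x. P x + cl_mult m (Q x) (cl_e m))"
    using monog_independent_split[of m s F 0] m3 s1 0 by auto
  show ?case
  proof (intro exI[of _ "\<lambda>i. if fst i then Q else P"] conjI ballI)
    show "F = (\<lambda>x. \<Sum>i\<in>gt_index 0. gt_embed m s 0 i (if fst i then Q else P) x)"
      unfolding PQ(3) sum_gt_index_0 by (rule ext) (simp add: gt_embed_top add.commute)
  qed (use PQ in \<open>auto simp: gt_grade_def\<close>)
next
  case (Suc k)
  have "pd m F \<in> monog m s k" using monog_pd[OF Suc(2), of m] by simp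
  from Suc(1)[OF this] obtain q where q: "\<And>i. i \<in> gt_index k \<Longrightarrow> q i \<in> gt_module m s i" "pd m F = (\<lambda>x. \<Sum>i\<in>gt_index k. gt_embed m s k i (q i) x)" by blast
  let ?c = "\<lambda>i. complex_of_real (gt_coeff (fst i) m (gt_grade (fst i) s) (snd i) (Suc k - snd i))"
  \<comment> \<open>Dividing by the nonzero constants integrates each component. Degree Suc k is set
    to 0 here and filled below from the remainder.\<close>
  define p where "p = (\<lambda>i. if snd i \<le> k then (\<lambda>x. cl_smul (1 / ?c i) (q i x)) else (\<lambda>x. 0))"
  have p: "p i \<in> gt_module m s i" if "i \<in> gt_index (Suc k)" for i
    unfolding p_def using q(1)[of i] that by (cases "snd i \<le> k") (auto intro: monog_smul monog_zero)
  define S where "S = (\<lambda>x. \<Sum>i\<in>gt_index (Suc k). gt_embed m s (Suc k) i (p i) x)"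
  have S: "S \<in> monog m s (Suc k)" unfolding S_def by (intro monog_sum gt_embed_monog p)
  have pdS: "pd m S = pd m F"
  proof
    fix x
    have "pd m S x = (\<Sum>i\<in>gt_index k. gt_embed m s k i (\<lambda>x. cl_smul (?c i) (p i x)) x)"
      unfolding S_def by (rule gt_embed_sum_pd[OF p])
    also have "\<dots> = (\<Sum>i\<in>gt_index k. gt_embed m s k i (q i) x)"
    proof (rule sum.cong[OF refl])
      fix i assume i: "i \<in> gt_index k"
      then have "(\<lambda>x. cl_smul (?c i) (p i x)) = q i" using gt_embed_op_coeff[OF i] unfolding p_def by auto
      then show "gt_embed m s k i (\<lambda>x. cl_smul (?c i) (p i x)) x = gt_embed m s k i (q i) x" by simp
    qed
    finally show "pd m S x = pd m F x" using q(2) by simp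
  qed
  define R where "R = (\<lambda>x. F x + cl_smul (-1) (S x))"
  have R: "R \<in> monog m s (Suc k)" unfolding R_def by (intro monog_add monog_smul Suc(2) S)
  have "pd m R = 0"
    unfolding R_def dif_pd[OF dif_add[OF hom_poly_dif[OF monogD(1)[OF Suc(2)]] dif_smul[OF hom_poly_dif[OF monogD(1)[OF S]]]]] pdS
    by (rule ext) simp
  then obtain P Q where PQ: "P \<in> monog (m - 1) s (Suc k)" "Q \<in> monog (m - 1) (s - 1) (Suc k)" "R = (\<lambda>x. P x + cl_mult m (Q x) (cl_e m))"
    using monog_independent_split[of m s R "Suc k"] m3 s1 R by auto
  \<comment> \<open>The remainder, free of x_m, supplies exactly the two components of degree Suc k,
    whose embeddings are P and Q e_m.\<close>
  define p' where "p' = (\<lambda>i. if snd i \<le> k then p i else if fst i then Q else P)"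
  have S': "S x = (\<Sum>i\<in>gt_index k. gt_embed m s (Suc k) i (p i) x)" for x
  proof -
    have "p (True, Suc k) = (\<lambda>x. 0)" "p (False, Suc k) = (\<lambda>x. 0)" by (simp_all add: p_def)
    then show ?thesis unfolding S_def sum_gt_index_Suc gt_embed_top by simp
  qed
  show ?case
  proof (intro exI[of _ p'] conjI ballI)
    fix i assume "i \<in> gt_index (Suc k)"
    then show "p' i \<in> gt_module m s i" using p[of i] PQ unfolding p'_def
      by (cases "snd i \<le> k") (auto simp: gt_grade_def le_Suc_eq)
  next
    show "F = (\<lambda>x. \<Sum>i\<in>gt_index (Suc k). gt_embed m s (Suc k) i (p' i) x)"
    proof
      fix x
      have "(\<Sum>i\<in>gt_index k. gt_embed m s (Suc k) i (p' i) x) = S x" unfolding S' by (intro sum.cong refl) (auto simp: p'_def)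
      moreover have "F x = S x + R x" by (simp add: R_def)
      ultimately show "F x = (\<Sum>i\<in>gt_index (Suc k). gt_embed m s (Suc k) i (p' i) x)"
        unfolding sum_gt_index_Suc gt_embed_top using PQ(3) by (simp add: p'_def add.commute)
    qed
  qed
qed

text \<open>Differentiation in x_m reduces to degree k with nonzero constants and so forces all
  components to vanish but the two of top degree; these are separated by
  \<open>Cl_e_independent\<close>.\<close>

lemma decomposition_unique:
  "(\<And>i. i \<in> gt_index k \<Longrightarrow> p i \<in> gt_module m s i) \<Longrightarrow> (\<And>x. (\<Sum>i\<in>gt_index k. gt_embed m s k i (p i) x) = 0) \<Longrightarrow> i \<in> gt_index k \<Longrightarrow> p i = (\<lambda>x. 0)"
proof (induction k arbitrary: p i)
  case 0
  have "p (False, 0) x + cl_mult m (p (True, 0) x) (cl_e m) = 0" for x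
    using 0(2)[of x] unfolding sum_gt_index_0 gt_embed_top by (metis add.commute)
  then have "p (False, 0) x = 0 \<and> p (True, 0) x = 0" for x
    using Cl_e_independent[of m "p (False, 0) x" "p (True, 0) x"] m3 monogD(3)[OF 0(1)[of "(False, 0)"]] monogD(3)[OF 0(1)[of "(True, 0)"]] by simp
  moreover have "i = (False, 0) \<or> i = (True, 0)" using 0(3) by (cases i) auto
  ultimately show ?case by auto
next
  case (Suc k)
  let ?c = "\<lambda>i. complex_of_real (gt_coeff (fst i) m (gt_grade (fst i) s) (snd i) (Suc k - snd i))"
  have "pd m (\<lambda>x. \<Sum>i\<in>gt_index (Suc k). gt_embed m s (Suc k) i (p i) x) = (\<lambda>x. 0)"
    unfolding Suc(3) by (rule dif_pd[OF dif_const])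
  then have z: "(\<Sum>i\<in>gt_index k. gt_embed m s k i (\<lambda>x. cl_smul (?c i) (p i x)) x) = 0" for x
    using gt_embed_sum_pd[of k p x] Suc(2) by simp
  have low: "p i = (\<lambda>x. 0)" if i: "i \<in> gt_index k" for i
  proof -
    have "(\<lambda>x. cl_smul (?c i) (p i x)) = (\<lambda>x. 0)"
      by (rule Suc(1)[of "\<lambda>i. (\<lambda>x. cl_smul (?c i) (p i x))", OF _ z i]) (use Suc(2) in \<open>auto intro: monog_smul\<close>)
    then have "cl_smul (1 / ?c i) (cl_smul (?c i) (p i x)) = 0" for x using fun_cong[of _ _ x] by (metis cl_smul_zero)
    then show ?thesis using gt_embed_op_coeff[OF i] by auto
  qed
  have vz: "gt_embed m s (Suc k) i (p i) x = 0" if i: "i \<in> gt_index k" for i x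
  proof -
    have "(\<lambda>x. 0) \<in> gt_module m s i" by (rule monog_zero)
    from gt_embed_smul[where k = "Suc k" and c = 0 and x = x, OF this] show ?thesis unfolding low[OF i] by simp
  qed
  have "p (False, Suc k) x + cl_mult m (p (True, Suc k) x) (cl_e m) = 0" for x
  proof -
    have z0: "(\<Sum>i\<in>gt_index k. gt_embed m s (Suc k) i (p i) x) = 0" by (rule sum.neutral) (use vz in blast)
    show ?thesis using Suc(3)[of x] unfolding sum_gt_index_Suc gt_embed_top z0 add_0
      by (subst add.commute)
  qed
  then have "p (False, Suc k) x = 0 \<and> p (True, Suc k) x = 0" for x
    using Cl_e_independent[of m "p (False, Suc k) x" "p (True, Suc k) x"] m3 monogD(3)[OF Suc(2)[of "(False, Suc k)"]] monogD(3)[OF Suc(2)[of "(True, Suc k)"]] by simp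
  moreover have "i \<in> gt_index k \<or> i = (False, Suc k) \<or> i = (True, Suc k)" using Suc(4) unfolding gt_index_Suc by auto
  ultimately show ?case using low by auto
qed

lemma gt_embed_injective:
  assumes "i \<in> gt_index k" "P \<in> gt_module m s i" "gt_embed m s k i P = (\<lambda>x. 0)"
  shows "P = (\<lambda>x. 0)"
proof -
  define p where "p = (\<lambda>j. if j = i then P else (\<lambda>x. 0))"
  have v0: "gt_embed m s k j (\<lambda>x. 0) x = 0" for j x
    using gt_embed_smul[where i = j and k = k and c = 0 and x = x and P = "\<lambda>x. 0", OF monog_zero] by simp
  have "(\<Sum>j\<in>gt_index k. gt_embed m s k j (p j) x) = 0" for x
    by (rule sum.neutral) (use v0 assms(3) in \<open>auto simp: p_def\<close>)
  from decomposition_unique[of k p i, OF _ this assms(1)]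
  show ?thesis using assms(2) monog_zero unfolding p_def by (metis (mono_tags))
qed

end

section \<open>Multiplicity-free modules\<close>

lemma pscale_add: "pscale c (P + Q) = pscale c P + pscale c Q"
  by (intro ext) (simp add: pscale_def cl_smul_def algebra_simps)
lemma pscale_add_left: "pscale (c + d) P = pscale c P + pscale d P"
  by (intro ext) (simp add: pscale_def cl_smul_def algebra_simps)
lemma pscale_pscale: "pscale c (pscale d P) = pscale (c * d) P"
  by (intro ext) (simp add: pscale_def)
lemma pscale_1 [simp]: "pscale 1 P = P" by (intro ext) (simp add: pscale_def)
lemma pscale_0 [simp]: "pscale 0 P = 0" by (intro ext) (simp add: pscale_def)
lemma pscale_zero [simp]: "pscale c 0 = 0" by (intro ext) (simp add: pscale_def)
lemma pscale_minus1: "pscale (-1) P = - P" by (intro ext) (simp add: pscale_def)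
lemma pscale_apply: "pscale c P x = cl_smul c (P x)" by (simp add: pscale_def)

lemma sum_pf_apply: "sum (p :: 'i \<Rightarrow> pf) I x = (\<Sum>i\<in>I. p i x)"
  using sum_comp_morphism[of "\<lambda>P::pf. P x" p I] by (simp add: comp_def)

lemma pscale_sum: "pscale c (sum p I) = (\<Sum>i\<in>I. pscale c (p i))"
  using sum_comp_morphism[of "pscale c" p I] by (simp add: pscale_add comp_def)

interpretation pfvs: vector_space pscale
  by unfold_locales (simp_all only: pscale_add pscale_add_left pscale_pscale pscale_1)

lemma psubspace_iff_subspace: "psubspace W \<longleftrightarrow> pfvs.subspace W"
  unfolding psubspace_def pscale_eq pfvs.subspace_def by blast

lemma psubspaceD:
  assumes "psubspace W"
  shows "0 \<in> W" "P \<in> W \<Longrightarrow> Q \<in> W \<Longrightarrow> P + Q \<in> W" "P \<in> W \<Longrightarrow> pscale c P \<in> W"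
    "P \<in> W \<Longrightarrow> Q \<in> W \<Longrightarrow> P - Q \<in> W"
  using assms unfolding psubspace_iff_subspace
  by (auto intro: pfvs.subspace_0 pfvs.subspace_add pfvs.subspace_scale pfvs.subspace_diff)

lemma psubspace_sum: "psubspace W \<Longrightarrow> (\<And>i. i \<in> I \<Longrightarrow> p i \<in> W) \<Longrightarrow> sum p I \<in> W"
  unfolding psubspace_iff_subspace by (rule pfvs.subspace_sum)

lemma H_act_add: "u \<in> unit_vecs n \<Longrightarrow> H_act n [u] (P + Q) = H_act n [u] P + H_act n [u] Q"
  by (intro ext) (simp add: H_act_single conjug_add)
lemma H_act_pscale: "u \<in> unit_vecs n \<Longrightarrow> H_act n [u] (pscale c P) = pscale c (H_act n [u] P)"
  by (intro ext) (simp add: H_act_single pscale_apply conjug_smul)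
lemma H_act_sum: "u \<in> unit_vecs n \<Longrightarrow> H_act n [u] (sum p I) = (\<Sum>i\<in>I. H_act n [u] (p i))"
  using sum_comp_morphism[of "H_act n [u]" p I]
  by (simp add: H_act_add comp_def) (metis add.right_neutral add_left_imp_eq H_act_add)

text \<open>Invariance in terms of single unit vectors of the first N dimensions, inside the algebra
  on n generators. On subsets of \<open>monog\<close> it agrees with invariance under all lists, by
  \<open>invariant_iff_reflect_inv\<close>.\<close>

definition reflect_inv :: "nat \<Rightarrow> nat \<Rightarrow> pf set \<Rightarrow> bool" where
  "reflect_inv n N W \<longleftrightarrow> (\<forall>u\<in>unit_vecs N. \<forall>P\<in>W. H_act n [u] P \<in> W)"

lemma H_act_induct:
  assumes W: "W \<subseteq> monog n s k" and N: "N \<le> n"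
    and step: "\<And>u P. u \<in> unit_vecs N \<Longrightarrow> P \<in> W \<Longrightarrow> H_act n [u] P \<in> W"
  shows "us \<in> lists (unit_vecs N) \<Longrightarrow> P \<in> W \<Longrightarrow> H_act n us P \<in> W"
proof (induction us)
  case Nil
  then have "P \<in> monog n s k" using W by auto
  from H_act_Nil[OF monogD(1)[OF this] monogD(3)[OF this]] show ?case using Nil by simp
next
  case (Cons u us)
  have u: "u \<in> unit_vecs N" "us \<in> lists (unit_vecs N)" using Cons.prems(1) by simp_all
  have u2: "u \<in> unit_vecs n" using u(1) unit_vecs_mono[OF N] by blast
  show ?case by (subst H_act_Cons[OF u2]) (rule step[OF u(1) Cons.IH[OF u(2) Cons.prems(2)]])
qed

lemma invariant_iff_reflect_inv:
  assumes "W \<subseteq> monog n s k" "N \<le> n"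
  shows "invariant n (pin_lists N) W \<longleftrightarrow> reflect_inv n N W"
proof
  assume i: "invariant n (pin_lists N) W"
  show "reflect_inv n N W"
    unfolding reflect_inv_def
  proof (intro ballI)
    fix u P assume "u \<in> unit_vecs N" "P \<in> W"
    then show "H_act n [u] P \<in> W" using i unfolding invariant_def pin_lists_def by auto
  qed
next
  assume i: "reflect_inv n N W"
  show "invariant n (pin_lists N) W"
    unfolding invariant_def pin_lists_def
    using H_act_induct[OF assms] i unfolding reflect_inv_def by blast
qed

text \<open>Induction on the number of nonzero components. If some element of \<open>U\<close> supported on the components
  of \<open>p\<close> vanishes in one of them but not in all, it splits \<open>p\<close>; otherwise each component of such an
  element determines the others, and this gives an isomorphism between two summands.\<close>
lemma multiplicity_free_submodule:
  fixes W :: "'i \<Rightarrow> pf set" and G :: "(pf \<Rightarrow> pf) set"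
  assumes fin: "finite I"
    and sub: "\<And>i. i \<in> I \<Longrightarrow> psubspace (W i)"
    and dir: "\<And>p i. (\<And>i. i \<in> I \<Longrightarrow> p i \<in> W i) \<Longrightarrow> sum p I = 0 \<Longrightarrow> i \<in> I \<Longrightarrow> p i = 0"
    and inv: "\<And>g i w. g \<in> G \<Longrightarrow> i \<in> I \<Longrightarrow> w \<in> W i \<Longrightarrow> g w \<in> W i"
    and gsum: "\<And>g p. g \<in> G \<Longrightarrow> g (sum p I) = (\<Sum>i\<in>I. g (p i))"
    and g0: "\<And>g. g \<in> G \<Longrightarrow> g 0 = 0"
    and irr: "\<And>i X. i \<in> I \<Longrightarrow> psubspace X \<Longrightarrow> X \<subseteq> W i \<Longrightarrow> (\<And>g w. g \<in> G \<Longrightarrow> w \<in> X \<Longrightarrow> g w \<in> X) \<Longrightarrow> X = {0} \<or> X = W i"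
    and ineq: "\<And>i j f. i \<in> I \<Longrightarrow> j \<in> I \<Longrightarrow> i \<noteq> j \<Longrightarrow> W i \<noteq> {0} \<Longrightarrow> bij_betw f (W i) (W j)
      \<Longrightarrow> (\<And>a b. a \<in> W i \<Longrightarrow> b \<in> W i \<Longrightarrow> f (a + b) = f a + f b)
      \<Longrightarrow> (\<And>a c. a \<in> W i \<Longrightarrow> f (pscale c a) = pscale c (f a))
      \<Longrightarrow> (\<And>g a. g \<in> G \<Longrightarrow> a \<in> W i \<Longrightarrow> f (g a) = g (f a)) \<Longrightarrow> False"
    and U: "psubspace U" "\<And>g u. g \<in> G \<Longrightarrow> u \<in> U \<Longrightarrow> g u \<in> U"
  shows "(\<And>i. i \<in> I \<Longrightarrow> p i \<in> W i) \<Longrightarrow> sum p I \<in> U \<Longrightarrow> i \<in> I \<Longrightarrow> p i \<noteq> 0 \<Longrightarrow> W i \<subseteq> U"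
proof (induction "card {i\<in>I. p i \<noteq> 0}" arbitrary: p i rule: less_induct)
  case (less p i)
  define K where "K = {i\<in>I. p i \<noteq> 0}"
  have finK: "finite K" "K \<subseteq> I" using fin by (auto simp: K_def)
  have iK: "i \<in> K" using less by (simp add: K_def)
  \<comment> \<open>The families of components of elements of U whose support lies in that of p;
    they are closed under sums, scalars and G.\<close>
  define A where "A = {q. (\<forall>j\<in>I. q j \<in> W j) \<and> sum q I \<in> U \<and> (\<forall>j\<in>I. j \<notin> K \<longrightarrow> q j = 0)}"
  have pA: "p \<in> A" using less by (simp add: A_def K_def)
  have Aadd: "q + r \<in> A" if "q \<in> A" "r \<in> A" for q r
    using that psubspaceD(2)[OF sub] psubspaceD(2)[OF U(1)] unfolding A_def by (auto simp: sum.distrib)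
  have Apsm: "(\<lambda>j. pscale c (q j)) \<in> A" if "q \<in> A" for q c
    using that psubspaceD(3)[OF sub] psubspaceD(3)[OF U(1)] unfolding A_def by (auto simp: pscale_sum[symmetric])
  have Ag: "(\<lambda>j. g (q j)) \<in> A" if "q \<in> A" "g \<in> G" for q g
    unfolding A_def mem_Collect_eq
  proof (intro conjI ballI impI)
    show "sum (\<lambda>j. g (q j)) I \<in> U" using that U(2) unfolding A_def gsum[OF that(2), symmetric] by blast
  next
    fix j assume "j \<in> I"
    then show "g (q j) \<in> W j" using that inv unfolding A_def by blast
  next
    fix j assume "j \<in> I" "j \<notin> K"
    then have "q j = 0" using that unfolding A_def by blast
    then show "g (q j) = 0" using g0[OF that(2)] by (simp only:)
  qed
  have A0: "(\<lambda>j. 0) \<in> A" using psubspaceD(1)[OF sub] psubspaceD(1)[OF U(1)] unfolding A_def by auto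
  show ?case
  proof (cases "\<exists>q\<in>A. (\<exists>j\<in>K. q j \<noteq> 0) \<and> (\<exists>j\<in>K. q j = 0)")
    case True
    then obtain q a b where q: "q \<in> A" "a \<in> K" "q a \<noteq> 0" "b \<in> K" "q b = 0" by blast
    define L where "L = {j\<in>I. q j \<noteq> 0}"
    have LK: "L \<subseteq> K" "b \<notin> L" "a \<in> L" using q finK unfolding A_def L_def by auto
    have cL: "card L < card K" using LK q(4) finK(1) by (metis psubset_card_mono psubsetI)
    have WL: "W j \<subseteq> U" if "j \<in> L" for j
    proof (rule less(1)[of q j])
      show "card {i\<in>I. q i \<noteq> 0} < card {i\<in>I. p i \<noteq> 0}" using cL unfolding L_def K_def .
    qed (use q(1) that in \<open>auto simp: A_def L_def\<close>)
    \<comment> \<open>The components in L lie in U by the induction hypothesis. Without them p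
      leaves an element of U that has lost at least the component a.\<close>
    define r where "r = (\<lambda>j. if j \<in> L then 0 else p j)"
    have rW: "r j \<in> W j" if "j \<in> I" for j using less(2)[OF that] psubspaceD(1)[OF sub[OF that]] by (simp add: r_def)
    have LI: "L \<subseteq> I" using LK finK by auto
    have "sum p I = sum r I + sum p L"
    proof -
      have "sum p I = sum p (I - L) + sum p L" using LI fin by (metis sum.subset_diff)
      moreover have "sum r I = sum r (I - L) + sum r L" using LI fin by (metis sum.subset_diff)
      moreover have "sum r L = 0" by (rule sum.neutral) (simp add: r_def)
      moreover have "sum r (I - L) = sum p (I - L)" by (rule sum.cong) (auto simp: r_def)
      ultimately show ?thesis by simp
    qed
    moreover have "sum p L \<in> U" by (rule psubspace_sum[OF U(1)]) (use WL less(2) LI in blast)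
    ultimately have rU: "sum r I \<in> U" using psubspaceD(4)[OF U(1) less(3)] by (metis add_diff_cancel_right')
    show ?thesis
    proof (cases "i \<in> L")
      case False
      have cr: "card {i\<in>I. r i \<noteq> 0} < card {i\<in>I. p i \<noteq> 0}"
      proof (rule psubset_card_mono)
        show "finite {i\<in>I. p i \<noteq> 0}" using fin by simp
        have "a \<in> {i\<in>I. p i \<noteq> 0}" "a \<notin> {i\<in>I. r i \<noteq> 0}" using q(2) LK(3) by (auto simp: K_def r_def)
        moreover have "{i\<in>I. r i \<noteq> 0} \<subseteq> {i\<in>I. p i \<noteq> 0}" by (auto simp: r_def)
        ultimately show "{i\<in>I. r i \<noteq> 0} \<subset> {i\<in>I. p i \<noteq> 0}" by blast
      qed
      show ?thesis by (rule less(1)[OF cr rW rU less(4)]) (use False less(5) in \<open>simp_all add: r_def\<close>)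
    qed (rule WL)
  next
    case False
    then have full: "\<forall>j\<in>K. q j \<noteq> 0" if "q \<in> A" "j' \<in> K" "q j' \<noteq> 0" for q j' using that by blast
    \<comment> \<open>The projection of A to component j is a submodule of W j and contains p j,
      which is nonzero; irreducibility makes it everything.\<close>
    have X: "(\<lambda>q. q j) ` A = W j" if j: "j \<in> K" for j
    proof -
      have jI: "j \<in> I" using j finK by auto
      have "(\<lambda>q. q j) ` A = {0} \<or> (\<lambda>q. q j) ` A = W j"
      proof (rule irr[OF jI])
        show "psubspace ((\<lambda>q. q j) ` A)"
          unfolding psubspace_iff_subspace pfvs.subspace_def
        proof (intro conjI ballI allI)
          show "0 \<in> (\<lambda>q. q j) ` A" by (rule image_eqI[OF _ A0]) simp
        next
          fix x y assume "x \<in> (\<lambda>q. q j) ` A" "y \<in> (\<lambda>q. q j) ` A"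
          then obtain q r where "q \<in> A" "r \<in> A" "x = q j" "y = r j" by blast
          then show "x + y \<in> (\<lambda>q. q j) ` A" by (intro image_eqI[of _ _ "q + r"] Aadd) simp_all
        next
          fix c x assume "x \<in> (\<lambda>q. q j) ` A"
          then obtain q where "q \<in> A" "x = q j" by blast
          then show "pscale c x \<in> (\<lambda>q. q j) ` A" using Apsm[of q c] by (intro image_eqI[of _ _ "\<lambda>j. pscale c (q j)"]) simp_all
        qed
        show "(\<lambda>q. q j) ` A \<subseteq> W j" using jI unfolding A_def by blast
      next
        fix g w assume "g \<in> G" "w \<in> (\<lambda>q. q j) ` A"
        then obtain q where "q \<in> A" "w = q j" by blast
        moreover from this have "(\<lambda>j. g (q j)) \<in> A" using \<open>g \<in> G\<close> Ag by blast
        ultimately show "g w \<in> (\<lambda>q. q j) ` A" by (intro image_eqI[of _ _ "\<lambda>j. g (q j)"]) simp_all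
      qed
      moreover have "p j \<in> (\<lambda>q. q j) ` A" "p j \<noteq> 0" using pA j by (auto simp: K_def)
      ultimately show ?thesis by blast
    qed
    show ?thesis
    proof (cases "K = {i}")
      case True
      have "W i \<subseteq> U"
      proof
        fix w assume "w \<in> W i"
        then obtain q where q: "q \<in> A" "w = q i" using X[OF iK] by blast
        have "sum q I = sum q {i}"
          by (rule sum.mono_neutral_right) (use fin less(4) q(1) True in \<open>auto simp: A_def\<close>)
        then show "w \<in> U" using q unfolding A_def by simp
      qed
      then show ?thesis .
    next
      case False
      then obtain j where j: "j \<in> K" "j \<noteq> i" using iK by blast
      have uni: "q l = r l" if "q \<in> A" "r \<in> A" "l' \<in> K" "q l' = r l'" "l \<in> K" for q r l l'
      proof -
        have "q + (\<lambda>j. pscale (-1) (r j)) \<in> A" by (rule Aadd[OF that(1) Apsm[OF that(2)]])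
        then have "(q + (\<lambda>j. pscale (-1) (r j))) l = 0"
          using full[of "q + (\<lambda>j. pscale (-1) (r j))" l] that(3,4,5) by (auto simp: pscale_minus1)
        then show ?thesis by (simp add: pscale_minus1)
      qed
      \<comment> \<open>By \<open>uni\<close> each component of a family in A determines the others,
        so the pairs of its components i and j form the graph of a map f; the choice of q is
        immaterial.\<close>
      define f where "f = (\<lambda>a. (SOME q. q \<in> A \<and> q i = a) j)"
      have f: "f (q i) = q j" if "q \<in> A" for q
      proof -
        have "(SOME r. r \<in> A \<and> r i = q i) \<in> A \<and> (SOME r. r \<in> A \<and> r i = q i) i = q i"
          by (rule someI[of "\<lambda>r. r \<in> A \<and> r i = q i" q]) (use that in simp)
        then show ?thesis unfolding f_def using uni[of _ q i j] that iK j(1) by blast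
      qed
      have get: "\<exists>q\<in>A. q i = a" if "a \<in> W i" for a
      proof -
        have "a \<in> (\<lambda>q. q i) ` A" using X[OF iK] that by simp
        then show ?thesis by (elim imageE) metis
      qed
      have "bij_betw f (W i) (W j)"
      proof (rule bij_betw_imageI)
        show "inj_on f (W i)"
        proof (rule inj_onI)
          fix a b assume "a \<in> W i" "b \<in> W i" "f a = f b"
          moreover from this obtain q r where "q \<in> A" "r \<in> A" "q i = a" "r i = b" using get by meson
          ultimately show "a = b" using f[of q] f[of r] uni[of q r j i] iK j(1) by simp
        qed
        show "f ` W i = W j"
        proof -
          have "f ` W i = f ` ((\<lambda>q. q i) ` A)" using X[OF iK] by simp
          also have "\<dots> = (\<lambda>q. q j) ` A" unfolding image_image using f by (intro image_cong) auto
          finally show ?thesis using X[OF j(1)] by simp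
        qed
      qed
      moreover have "f (a + b) = f a + f b" if ab: "a \<in> W i" "b \<in> W i" for a b
      proof -
        obtain q r where "q \<in> A" "r \<in> A" "q i = a" "r i = b" using get ab by meson
        then show ?thesis using f[of q] f[of r] f[OF Aadd[of q r]] by simp
      qed
      moreover have "f (pscale c a) = pscale c (f a)" if a: "a \<in> W i" for a c
      proof -
        obtain q where "q \<in> A" "q i = a" using get a by meson
        then show ?thesis using f[of q] f[OF Apsm[of q c]] by simp
      qed
      moreover have "f (g a) = g (f a)" if a: "g \<in> G" "a \<in> W i" for a g
      proof -
        obtain q where "q \<in> A" "q i = a" using get a(2) by meson
        then show ?thesis using f[of q] f[OF Ag[of q g]] a(1) by simp
      qed
      moreover have "W i \<noteq> {0}" using less(2)[OF less(4)] less(5) by blast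
      ultimately have False using ineq[of i j f] less(4) j finK by blast
      then show ?thesis ..
    qed
  qed
qed

section \<open>Inequivalence of the components\<close>

text \<open>Trigonometric polynomials of degree at most \<open>d\<close>.\<close>
definition trig_deg :: "nat \<Rightarrow> (real \<Rightarrow> complex) \<Rightarrow> bool" where
  "trig_deg d f \<longleftrightarrow> (\<exists>p. degree p \<le> 2 * d \<and> (\<forall>\<alpha>. f \<alpha> * cis \<alpha> ^ d = poly p (cis \<alpha>)))"

lemma trig_deg_const: "trig_deg 0 (\<lambda>\<alpha>. c)"
  unfolding trig_deg_def by (intro exI[of _ "[:c:]"]) simp

lemma trig_deg_add: "trig_deg d f \<Longrightarrow> trig_deg d g \<Longrightarrow> trig_deg d (\<lambda>\<alpha>. f \<alpha> + g \<alpha>)"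
  unfolding trig_deg_def
proof (elim exE conjE)
  fix p q assume "degree p \<le> 2 * d" "\<forall>\<alpha>. f \<alpha> * cis \<alpha> ^ d = poly p (cis \<alpha>)" "degree q \<le> 2 * d" "\<forall>\<alpha>. g \<alpha> * cis \<alpha> ^ d = poly q (cis \<alpha>)"
  then show "\<exists>p. degree p \<le> 2 * d \<and> (\<forall>\<alpha>. (f \<alpha> + g \<alpha>) * cis \<alpha> ^ d = poly p (cis \<alpha>))"
    by (intro exI[of _ "p + q"]) (auto simp: distrib_right degree_add_le)
qed

lemma trig_deg_mult: "trig_deg d f \<Longrightarrow> trig_deg e g \<Longrightarrow> trig_deg (d + e) (\<lambda>\<alpha>. f \<alpha> * g \<alpha>)"
  unfolding trig_deg_def
proof (elim exE conjE)
  fix p q assume a: "degree p \<le> 2 * d" "\<forall>\<alpha>. f \<alpha> * cis \<alpha> ^ d = poly p (cis \<alpha>)" "degree q \<le> 2 * e" "\<forall>\<alpha>. g \<alpha> * cis \<alpha> ^ e = poly q (cis \<alpha>)"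
  have "f \<alpha> * g \<alpha> * cis \<alpha> ^ (d + e) = poly (p * q) (cis \<alpha>)" for \<alpha>
  proof -
    have "f \<alpha> * g \<alpha> * cis \<alpha> ^ (d + e) = (f \<alpha> * cis \<alpha> ^ d) * (g \<alpha> * cis \<alpha> ^ e)" by (simp add: power_add mult_ac)
    then show ?thesis using a by simp
  qed
  moreover have "degree (p * q) \<le> 2 * (d + e)" using degree_mult_le[of p q] a by simp
  ultimately show "\<exists>p. degree p \<le> 2 * (d + e) \<and> (\<forall>\<alpha>. f \<alpha> * g \<alpha> * cis \<alpha> ^ (d + e) = poly p (cis \<alpha>))" by blast
qed

lemma trig_deg_one: "trig_deg e (\<lambda>\<alpha>. 1)"
  unfolding trig_deg_def by (intro exI[of _ "monom 1 e"]) (auto simp: poly_monom intro: order.trans[OF degree_monom_le])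

lemma trig_deg_mono: "trig_deg d f \<Longrightarrow> d \<le> e \<Longrightarrow> trig_deg e f"
  using trig_deg_mult[of d f "e - d" "\<lambda>\<alpha>. 1"] trig_deg_one by simp

lemma trig_deg_cmult: "trig_deg d f \<Longrightarrow> trig_deg d (\<lambda>\<alpha>. c * f \<alpha>)"
  using trig_deg_mult[OF trig_deg_const, of d f c] by simp

lemma trig_deg_sum: "(\<And>i. i \<in> I \<Longrightarrow> trig_deg d (f i)) \<Longrightarrow> trig_deg d (\<lambda>\<alpha>. \<Sum>i\<in>I. f i \<alpha>)"
  by (induction I rule: infinite_finite_induct) (auto intro: trig_deg_add trig_deg_mono[OF trig_deg_const])

lemma cos_cis: "complex_of_real (cos \<alpha>) * cis \<alpha> = (cis \<alpha> ^ 2 + 1) / 2"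
  by (simp add: complex_eq_iff power2_eq_square sin_squared_eq[unfolded power2_eq_square] algebra_simps)

lemma sin_cis: "complex_of_real (sin \<alpha>) * cis \<alpha> = (- \<i> * cis \<alpha> ^ 2 + \<i>) / 2"
  by (simp add: complex_eq_iff power2_eq_square cos_squared_eq[unfolded power2_eq_square] algebra_simps)

lemma trig_deg_cos: "trig_deg 1 (\<lambda>\<alpha>. complex_of_real (cos \<alpha>))"
proof -
  have "complex_of_real (cos \<alpha>) * cis \<alpha> ^ 1 = poly [:1/2, 0, 1/2:] (cis \<alpha>)" for \<alpha>
    using cos_cis[of \<alpha>] by (simp add: power2_eq_square field_simps)
  then show ?thesis unfolding trig_deg_def by (intro exI[of _ "[:1/2, 0, 1/2:]"]) simp
qed

lemma trig_deg_sin: "trig_deg 1 (\<lambda>\<alpha>. complex_of_real (sin \<alpha>))"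
proof -
  have "complex_of_real (sin \<alpha>) * cis \<alpha> ^ 1 = poly [:\<i>/2, 0, -\<i>/2:] (cis \<alpha>)" for \<alpha>
    using sin_cis[of \<alpha>] by (simp add: power2_eq_square field_simps)
  then show ?thesis unfolding trig_deg_def by (intro exI[of _ "[:\<i>/2, 0, -\<i>/2:]"]) simp
qed

lemma infinite_range_cis: "infinite (range cis)"
proof -
  have "infinite {0<..<(1::real)}" by (rule infinite_Ioo) simp
  moreover have "inj_on cis {0<..<(1::real)}"
  proof (rule inj_onI)
    fix x y :: real assume xy: "x \<in> {0<..<1}" "y \<in> {0<..<1}" "cis x = cis y"
    then have "cos x = cos y" by (metis cis.sel(1))
    then show "x = y" using cos_inj_pi[of x y] xy pi_gt3 by simp
  qed
  ultimately have "infinite (cis ` {0<..<(1::real)})" by (metis finite_imageD)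
  then show ?thesis by (meson finite_subset image_mono subset_UNIV)
qed

text \<open>After multiplication by the d-th power of cis, a polynomial of degree at most 2 d agrees
  with c z^(w + d) at infinitely many points of the circle; for nonzero c this contradicts d <
  w.\<close>

lemma trig_deg_cis_high:
  assumes "trig_deg d (\<lambda>\<alpha>. c * cis \<alpha> ^ w)" "d < w"
  shows "c = 0"
proof (rule ccontr)
  assume c: "c \<noteq> 0"
  obtain p where p: "degree p \<le> 2 * d" "\<And>\<alpha>. c * cis \<alpha> ^ w * cis \<alpha> ^ d = poly p (cis \<alpha>)"
    using assms(1) unfolding trig_deg_def by blast
  have "poly (monom c (w + d) - p) (cis \<alpha>) = 0" for \<alpha> using p(2)[of \<alpha>] by (simp add: poly_monom power_add mult.assoc)
  then have "range cis \<subseteq> {z. poly (monom c (w + d) - p) z = 0}" by auto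
  then have "infinite {z. poly (monom c (w + d) - p) z = 0}" using infinite_range_cis finite_subset by blast
  then have "monom c (w + d) = p" using poly_roots_finite[of "monom c (w + d) - p"] by auto
  then have "degree p = w + d" using c by (metis degree_monom_eq)
  then show False using p(1) assms(2) by simp
qed

section \<open>Reflections in the plane of e_1 and e_2\<close>

definition circ_vec :: "real \<Rightarrow> nat \<Rightarrow> real" where
  "circ_vec \<alpha> = (\<lambda>i. if i = 1 then cos \<alpha> else if i = 2 then sin \<alpha> else 0)"

lemma sum_first_two: "2 \<le> n \<Longrightarrow> (\<And>i. i \<in> {1..n} \<Longrightarrow> i \<noteq> 1 \<Longrightarrow> i \<noteq> 2 \<Longrightarrow> f i = 0) \<Longrightarrow> sum f {1..n} = f 1 + f (2::nat)"
  for f :: "nat \<Rightarrow> 'a::comm_monoid_add"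
proof -
  assume a: "2 \<le> n" "\<And>i. i \<in> {1..n} \<Longrightarrow> i \<noteq> 1 \<Longrightarrow> i \<noteq> 2 \<Longrightarrow> f i = 0"
  have "sum f {1..n} = sum f {1,2}"
    by (rule sum.mono_neutral_right) (use a in auto)
  then show ?thesis by simp
qed

lemma circ_vec_unit:
  assumes "2 \<le> n"
  shows "circ_vec \<alpha> \<in> unit_vecs n"
proof -
  have "(\<Sum>j\<in>{1..n}. (circ_vec \<alpha> j)^2) = 1"
    by (subst sum_first_two[OF assms]) (simp_all add: circ_vec_def)
  then show ?thesis using assms unfolding unit_vecs_def circ_vec_def by auto
qed

lemma inner_up_circ_vec: "2 \<le> n \<Longrightarrow> inner_up n (circ_vec \<alpha>) x = cos \<alpha> * x 1 + sin \<alpha> * x 2"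
  unfolding inner_up_def by (subst sum_first_two) (auto simp: circ_vec_def)

lemma trig_deg_circ_vec: "trig_deg 1 (\<lambda>\<alpha>. complex_of_real (circ_vec \<alpha> i))"
  unfolding circ_vec_def using trig_deg_cos trig_deg_sin trig_deg_mono[OF trig_deg_const[of 0], of 1]
  by (cases "i = 1"; cases "i = 2") simp_all

lemma trig_deg_reflect: "2 \<le> n \<Longrightarrow> trig_deg 2 (\<lambda>\<alpha>. complex_of_real (reflect n (circ_vec \<alpha>) x i))"
proof (cases "i \<in> {1..n}")
  case True
  assume n: "2 \<le> n"
  have "trig_deg (1 + 1) (\<lambda>\<alpha>. (complex_of_real (x 1) * complex_of_real (cos \<alpha>) + complex_of_real (x 2) * complex_of_real (sin \<alpha>)) * complex_of_real (circ_vec \<alpha> i))"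
    by (intro trig_deg_mult trig_deg_add trig_deg_cmult trig_deg_cos trig_deg_sin trig_deg_circ_vec)
  then have "trig_deg 2 (\<lambda>\<alpha>. 2 * ((complex_of_real (x 1) * complex_of_real (cos \<alpha>) + complex_of_real (x 2) * complex_of_real (sin \<alpha>)) * complex_of_real (circ_vec \<alpha> i)) + (- complex_of_real (x i)))"
    by (intro trig_deg_add trig_deg_cmult trig_deg_mono[OF trig_deg_const]) (simp_all add: numeral_2_eq_2)
  then show ?thesis using True n by (simp add: reflect_def inner_up_circ_vec algebra_simps)
next
  case False
  then show ?thesis unfolding reflect_def by (simp only: if_False of_real_0) (auto intro: trig_deg_mono[OF trig_deg_const])
qed

lemma trig_deg_spoly: "spoly n l f \<Longrightarrow> 2 \<le> n \<Longrightarrow> trig_deg (2 * l) (\<lambda>\<alpha>. f (reflect n (circ_vec \<alpha>) x))"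
proof (induction rule: spoly.induct)
  case (spoly_coord k f i)
  then show ?case using trig_deg_mult[OF trig_deg_reflect[OF spoly_coord(4), of x i] spoly_coord(3)[OF spoly_coord(4)]] by simp
qed (auto intro: trig_deg_add trig_deg_mono[OF trig_deg_const])

lemma trig_deg_cl_mult:
  assumes "\<And>S. trig_deg d (\<lambda>\<alpha>. A \<alpha> S)" "\<And>S. trig_deg e (\<lambda>\<alpha>. B \<alpha> S)"
  shows "trig_deg (d + e) (\<lambda>\<alpha>. cl_mult n (A \<alpha>) (B \<alpha>) T)"
  unfolding cl_mult_def
proof (intro trig_deg_sum)
  fix S S'
  show "trig_deg (d + e) (\<lambda>\<alpha>. if sym_diff S S' = T then cl_sign S S' * A \<alpha> S * B \<alpha> S' else 0)"
  proof (cases "sym_diff S S' = T")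
    case True
    have "trig_deg (d + e) (\<lambda>\<alpha>. (cl_sign S S' * A \<alpha> S) * B \<alpha> S')" by (intro trig_deg_mult trig_deg_cmult assms)
    then show ?thesis by (simp only: True simp_thms if_True)
  next
    case False
    then show ?thesis by (simp only: if_False) (auto intro: trig_deg_mono[OF trig_deg_const])
  qed
qed

lemma trig_deg_cl_vec: "trig_deg 1 (\<lambda>\<alpha>. cl_vec n (circ_vec \<alpha>) S)"
proof (cases "card S = 1 \<and> S \<subseteq> {1..n}")
  case True
  show ?thesis unfolding cl_vec_def if_P[OF True] by (rule trig_deg_circ_vec)
next
  case False
  show ?thesis unfolding cl_vec_def if_not_P[OF False] by (rule trig_deg_mono[OF trig_deg_const[of 0]]) simp
qed

text \<open>The entries of the reflection are quadratic in cosine and sine, so a polynomial of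
  degree l contributes 2 l; each of the two vectors around the value adds 1.\<close>

lemma trig_deg_H_act:
  assumes "P \<in> monog n t l" "2 \<le> n"
  shows "trig_deg (2 * l + 2) (\<lambda>\<alpha>. H_act n [circ_vec \<alpha>] P x T)"
proof -
  have "trig_deg (1 + (2 * l + 1)) (\<lambda>\<alpha>. cl_mult n (cl_vec n (circ_vec \<alpha>)) (cl_mult n (P (reflect n (circ_vec \<alpha>) x)) (cl_vec n (circ_vec \<alpha>))) T)"
    by (intro trig_deg_cl_mult trig_deg_cl_vec trig_deg_spoly[OF hom_polyD[OF monogD(1)[OF assms(1)]] assms(2)])
  then have "trig_deg (2 * l + 2) (\<lambda>\<alpha>. (-1) * cl_mult n (cl_vec n (circ_vec \<alpha>)) (cl_mult n (P (reflect n (circ_vec \<alpha>) x)) (cl_vec n (circ_vec \<alpha>))) T)"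
    by (intro trig_deg_cmult) simp
  then show ?thesis using circ_vec_unit[OF assms(2)] by (simp add: H_act_single conjug_def)
qed

text \<open>Scalars commute with x, which is the hypothesis of \<open>monog_vanishing\<close> with c
  = 1; its constant is then 2 l.\<close>

lemma monog_0_vanish: "P \<in> monog n 0 l \<Longrightarrow> 0 < l \<Longrightarrow> P = 0"
proof (rule monog_vanishing[of P n 0 l 1])
  assume P: "P \<in> monog n 0 l" "0 < l"
  show "cl_mult n (cl_vec n x) (P x) = cl_smul (complex_of_real (1 * (-1)^0)) (cl_mult n (P x) (cl_vec n x))" for x
    using vec_dot_Lam(2)[OF monogD(2)[OF P(1)] order.refl refl, of x x] by simp
  show "real n + 2 * real l - 1 * (real n - 2 * real 0) \<noteq> 0" using P(2) by simp
qed

lemma top_wedge_zero: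
  assumes "A \<in> Lam n n"
  shows "cl_mult n (cl_vec n u) A = cl_smul (- ((-1)^n)) (cl_mult n A (cl_vec n u))"
proof -
  have "cl_mult n (cl_vec n u) A + cl_smul ((-1)^n) (cl_mult n A (cl_vec n u)) = 0"
    by (rule Lam_large[OF vec_wedge_Lam[OF assms order.refl]]) simp
  then show ?thesis by (simp only: cl_smul_neg_left eq_neg_iff_add_eq_0)
qed

text \<open>The wedge of x with the top grade is zero, which is the hypothesis of
  \<open>monog_vanishing\<close> with c = -1; again its constant is 2 l.\<close>

lemma monog_n_vanish: "P \<in> monog n n l \<Longrightarrow> 0 < l \<Longrightarrow> P = 0"
proof (rule monog_vanishing[of P n n l "-1"])
  assume P: "P \<in> monog n n l" "0 < l"
  show "cl_mult n (cl_vec n x) (P x) = cl_smul (complex_of_real (-1 * (-1)^n)) (cl_mult n (P x) (cl_vec n x))" for x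
    using top_wedge_zero[OF monogD(2)[OF P(1)], of x x] by simp
  show "real n + 2 * real l - -1 * (real n - 2 * real n) \<noteq> 0" using P(2) by simp
qed

lemma H_act_extreme:
  assumes P: "P \<in> monog n t l" and t: "t = 0 \<or> t = n"
  shows "\<exists>c. \<forall>u\<in>unit_vecs n. H_act n [u] P = pscale c P"
proof (cases "l = 0")
  case False
  then have "P = 0" using t P monog_0_vanish[of P n l] monog_n_vanish[of P n l] by auto
  then show ?thesis by (intro exI[of _ 0]) (auto simp: H_act_single intro!: ext)
next
  case True
  have const: "P x = P y" for x y
  proof -
    have "P (\<lambda>i. 0) = P x" for x using hom_poly_scale[OF monogD(1)[OF P], of 0 x] True by simp
    from this[of x] this[of y] show "P x = P y" by simp
  qed
  have sq: "cl_mult n (cl_vec n u) (cl_mult n (cl_vec n u) A) = - A" if "u \<in> unit_vecs n" "A \<in> Cl n" for u A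
    by (rule unit_vec_mult[OF that])
  from t show ?thesis
  proof
    assume t0: "t = 0"
    have c: "cl_mult n A (cl_vec n u) = cl_mult n (cl_vec n u) A" if "A \<in> Lam n 0" for A u
      using vec_dot_Lam(2)[OF that order.refl refl, of u] by simp
    have "H_act n [u] P x = pscale 1 P x" if u: "u \<in> unit_vecs n" for u x
    proof -
      have L: "P x \<in> Lam n 0" using monogD(2)[OF P] t0 by simp
      show ?thesis
        unfolding H_act_single[OF u] conjug_def const[of "reflect n u x" x] c[OF L] sq[OF u monogD(3)[OF P]] by simp
    qed
    then show ?thesis by (intro exI[of _ 1]) blast
  next
    assume tn: "t = n"
    have "H_act n [u] P x = pscale (- ((-1)^n)) P x" if u: "u \<in> unit_vecs n" for u x
    proof -
      have L: "P x \<in> Lam n n" using monogD(2)[OF P] tn by simp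
      have e: "cl_mult n (P x) (cl_vec n u) = cl_smul (- ((-1)^n)) (cl_mult n (cl_vec n u) (P x))"
        unfolding top_wedge_zero[OF L] by (simp flip: power_add)
      show ?thesis
        unfolding H_act_single[OF u] conjug_def const[of "reflect n u x" x]
        unfolding e cl_mult_smul_right sq[OF u monogD(3)[OF P]] pscale_apply
        by (simp add: cl_smul_minus cl_smul_neg_left)
    qed
    then show ?thesis by (intro exI[of _ "- ((-1)^n)"]) blast
  qed
qed

definition blade :: "nat set \<Rightarrow> mv" where "blade S = (\<lambda>T. if T = S then 1 else 0)"

definition isotropic :: "nat \<Rightarrow> complex \<Rightarrow> mv" where "isotropic n \<sigma> = cl_e 1 + cl_smul (\<sigma> * \<i>) (cl_e 2)"

text \<open>A power of z = x_1 + \<sigma> i x_2 times an isotropic vector times the blade of 3..t +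
  1. That range has t - 1 elements, so the grade is t. The values 1 and -1 of \<sigma> give opposite
  weights for the rotations of the first plane.\<close>

definition weight_vec :: "nat \<Rightarrow> nat \<Rightarrow> nat \<Rightarrow> complex \<Rightarrow> pf" where
  "weight_vec n t l \<sigma> x = cl_smul ((complex_of_real (x 1) + \<sigma> * \<i> * complex_of_real (x 2)) ^ l) (cl_mult n (isotropic n \<sigma>) (blade {3..t+1}))"

lemma blade_Lam: "S \<subseteq> {1..n} \<Longrightarrow> blade S \<in> Lam n (card S)" by (auto simp: blade_def Lam_def)

lemma e_blade:
  assumes "j \<in> {1..n}" "S \<subseteq> {1..n}" "j \<notin> S"
  shows "cl_mult n (cl_e j) (blade S) \<in> Lam n (Suc (card S))"
    "cl_mult n (blade S) (cl_e j) = cl_smul ((-1)^card S) (cl_mult n (cl_e j) (blade S))"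
    "cl_mult n (cl_e j) (blade S) (insert j S) \<noteq> 0"
proof -
  have j: "j \<in> T" if "cl_mult n (cl_e j) (blade S) T \<noteq> 0" for T
  proof (rule ccontr)
    assume jT: "j \<notin> T"
    have T: "T \<subseteq> {1..n}" using that cl_mult_outside by blast
    have "sym_diff {j} T = S" using that unfolding cl_e_mult_apply[OF assms(1) T] blade_def by (auto split: if_splits)
    then show False using jT assms(3) by auto
  qed
  show 1: "cl_mult n (cl_e j) (blade S) \<in> Lam n (Suc (card S))"
    unfolding Lam_def using e_mult_Lam_nonzero[OF blade_Lam[OF assms(2)] assms(1)] j by auto
  show "cl_mult n (blade S) (cl_e j) = cl_smul ((-1)^card S) (cl_mult n (cl_e j) (blade S))"
  proof
    fix T show "cl_mult n (blade S) (cl_e j) T = cl_smul ((-1)^card S) (cl_mult n (cl_e j) (blade S)) T"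
      unfolding mult_e_Lam[OF blade_Lam[OF assms(2)] assms(1)] cl_smul_def using j[of T] by auto
  qed
  have i: "insert j S \<subseteq> {1..n}" using assms by auto
  have d: "sym_diff {j} (insert j S) = S" using assms(3) by auto
  show "cl_mult n (cl_e j) (blade S) (insert j S) \<noteq> 0"
    unfolding cl_e_mult_apply[OF assms(1) i] d by (simp add: blade_def cl_sign_def)
qed

context
  fixes n t :: nat
  assumes n2: "2 \<le> n" and t1: "1 \<le> t" and tn: "t \<le> n - 1"
begin

lemma S_ok: "{3..t+1} \<subseteq> {1..n}" "card {3..t+1} = t - 1" "1 \<in> {1..n}" "2 \<in> {1..n}" "1 \<notin> {3..t+1}" "2 \<notin> {3..t+1}"
  using n2 t1 tn by auto

lemmas e1B = e_blade[OF S_ok(3) S_ok(1) S_ok(5), unfolded S_ok(2)]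
lemmas e2B = e_blade[OF S_ok(4) S_ok(1) S_ok(6), unfolded S_ok(2)]

lemma isotropic_vec: "cl_mult n (isotropic n \<sigma>) A = cl_mult n (cl_e 1) A + cl_smul (\<sigma> * \<i>) (cl_mult n (cl_e 2) A)"
  by (simp add: isotropic_def cl_mult_distrib)

lemma isotropic_sq: "\<sigma> * \<sigma> = 1 \<Longrightarrow> A \<in> Cl n \<Longrightarrow> cl_mult n (isotropic n \<sigma>) (cl_mult n (isotropic n \<sigma>) A) = 0"
proof -
  assume s: "\<sigma> * \<sigma> = 1" and A: "A \<in> Cl n"
  have a: "cl_mult n (cl_e 1) (cl_mult n (cl_e 2) A) = - cl_mult n (cl_e 2) (cl_mult n (cl_e 1) A)"
    unfolding cl_mult_assoc[symmetric] cl_e_anticommute[OF S_ok(3,4) _] using cl_e_anticommute[OF S_ok(3,4)] by (simp add: cl_mult_minus_left)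
  have i: "\<sigma> * \<i> * (\<sigma> * \<i>) = -1" using s by (simp add: mult.assoc mult.left_commute[of \<i>])
  show ?thesis
    unfolding isotropic_vec cl_mult_distrib cl_e_square[OF S_ok(3) A] cl_e_square[OF S_ok(4) A] a cl_smul_add cl_smul_smul i
    by (simp add: cl_smul_minus cl_smul_neg_left)
qed

lemma weight_vec_Lam: "weight_vec n t l \<sigma> x \<in> Lam n t"
  unfolding weight_vec_def isotropic_vec using e1B(1) e2B(1) t1 by simp

lemma spoly_z: "spoly n (Suc 0) (\<lambda>x. complex_of_real (x 1) + \<sigma> * \<i> * complex_of_real (x 2))"
  by (intro spoly_add spoly_smul spoly_coordinate S_ok)

lemma weight_vec_hom: "hom_poly n l (weight_vec n t l \<sigma>)"
proof -
  have "hom_poly n (Suc 0 * l + 0) (weight_vec n t l \<sigma>)"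
    unfolding weight_vec_def[abs_def] by (intro hom_poly_scal spoly_power spoly_z hom_poly_const)
  then show ?thesis by simp
qed

lemma has_pds_power: "has_pds j f f' \<Longrightarrow> has_pds j (\<lambda>x. f x ^ l) (\<lambda>x. of_nat l * f x ^ (l - 1) * f' x)"
proof (induction l)
  case 0
  then show ?case using has_pds_const[of j 1] by simp
next
  case (Suc l)
  have "has_pds j (\<lambda>x. f x * f x ^ l) (\<lambda>x. f x * (of_nat l * f x ^ (l - 1) * f' x) + f' x * f x ^ l)"
    by (rule has_pds_mult[OF Suc(2) Suc(1)[OF Suc(2)]])
  moreover have "f x * (of_nat l * f x ^ (l - 1) * f' x) + f' x * f x ^ l = of_nat (Suc l) * f x ^ (Suc l - 1) * f' x" for x
    by (cases l) (simp_all add: algebra_simps)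
  ultimately show ?case by simp
qed

text \<open>The gradient of z^l is l z^(l - 1) times the isotropic vector, and an isotropic vector
  squares to 0.\<close>

lemma weight_vec_monog:
  assumes "\<sigma> * \<sigma> = 1"
  shows "weight_vec n t l \<sigma> \<in> monog n t l"
proof -
  let ?z = "\<lambda>x. complex_of_real (x 1) + \<sigma> * \<i> * complex_of_real (x 2)"
  let ?B = "cl_mult n (isotropic n \<sigma>) (blade {3..t+1})"
  have d: "has_pds j ?z (\<lambda>x. (if 1 = j then 1 else 0) + \<sigma> * \<i> * (if 2 = j then 1 else 0))" for j
    by (intro has_pds_add has_pds_cmult has_pds_coord)
  have pd: "pd j (weight_vec n t l \<sigma>) x = cl_smul (of_nat l * ?z x ^ (l - 1) * ((if 1 = j then 1 else 0) + \<sigma> * \<i> * (if 2 = j then 1 else 0))) ?B" for j x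
    unfolding weight_vec_def[abs_def] dif_pd[OF dif_scal[OF has_pds_power[OF d] dif_const]] by simp
  have "dirac n (weight_vec n t l \<sigma>) x = 0" for x
  proof -
    have "dirac n (weight_vec n t l \<sigma>) x = cl_mult n (cl_e 1) (pd 1 (weight_vec n t l \<sigma>) x) + cl_mult n (cl_e 2) (pd 2 (weight_vec n t l \<sigma>) x)"
      unfolding dirac_eq_sum by (rule sum_first_two[OF n2]) (simp add: pd)
    also have "\<dots> = cl_smul (of_nat l * ?z x ^ (l - 1)) (cl_mult n (isotropic n \<sigma>) ?B)"
      unfolding pd isotropic_vec[of \<sigma> ?B] cl_mult_smul_right cl_smul_add cl_smul_smul by simp
    also have "\<dots> = 0" unfolding isotropic_sq[OF assms Lam_subset_Cl[THEN subsetD, OF blade_Lam[OF S_ok(1)]]] by simp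
    finally show ?thesis .
  qed
  then show ?thesis unfolding monog_iff using weight_vec_hom weight_vec_Lam by blast
qed

lemma weight_vec_nonzero: "weight_vec n t l \<sigma> \<noteq> 0"
proof
  assume z: "weight_vec n t l \<sigma> = 0"
  have i: "insert 1 {3..t+1} \<subseteq> {1..n}" using S_ok by auto
  have "cl_mult n (cl_e 2) (blade {3..t+1}) (insert 1 {3..t+1}) = 0"
  proof -
    have "2 \<in> sym_diff {2} (insert 1 {3..t+1})" by auto
    then have "sym_diff {2} (insert 1 {3..t+1}) \<noteq> {3..t+1}" using S_ok(6) by blast
    then show ?thesis unfolding cl_e_mult_apply[OF S_ok(4) i] by (simp only: blade_def if_False mult_zero_right)
  qed
  then have "weight_vec n t l \<sigma> (\<lambda>i. if i = 1 then 1 else 0) (insert 1 {3..t+1}) = cl_mult n (cl_e 1) (blade {3..t+1}) (insert 1 {3..t+1})"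
    unfolding weight_vec_def isotropic_vec by (simp add: cl_smul_def)
  then show False using z e1B(3) by simp
qed

lemma circ_vec_vec: "cl_vec n (circ_vec \<alpha>) = cl_smul (complex_of_real (cos \<alpha>)) (cl_e 1) + cl_smul (complex_of_real (sin \<alpha>)) (cl_e 2)"
  unfolding cl_vec_eq_sum by (subst sum_first_two[OF n2]) (auto simp: circ_vec_def)

text \<open>In the plane of e_1 and e_2 the map is complex conjugation followed by rotation through
  2 \<alpha>, so it exchanges the two isotropic lines.\<close>

lemma conjug_isotropic: "conjug n (circ_vec \<alpha>) (isotropic n 1) = cl_smul (cis (2 * \<alpha>)) (isotropic n (-1))"
proof -
  have u: "circ_vec \<alpha> \<in> unit_vecs n" by (rule circ_vec_unit[OF n2])
  have c: "conjug n (circ_vec \<alpha>) (cl_e l) = cl_smul (complex_of_real (reflect_mat (circ_vec \<alpha>) l 1)) (cl_e 1) + cl_smul (complex_of_real (reflect_mat (circ_vec \<alpha>) l 2)) (cl_e 2)"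
    if "l = 1 \<or> l = 2" for l
  proof -
    have l: "l \<in> {1..n}" using that n2 by auto
    show ?thesis unfolding conjug_e[OF u l] by (rule sum_first_two[OF n2]) (use that in \<open>auto simp: reflect_mat_def circ_vec_def\<close>)
  qed
  have C: "cos (2 * \<alpha>) = 2 * (cos \<alpha> * cos \<alpha>) - 1" "cos (2 * \<alpha>) = 1 - 2 * (sin \<alpha> * sin \<alpha>)"
    and S: "sin (2 * \<alpha>) = 2 * (sin \<alpha> * cos \<alpha>)"
    using cos_double_cos[of \<alpha>] cos_double_sin[of \<alpha>] sin_double[of \<alpha>] by (simp_all add: power2_eq_square mult_ac)
  have c1: "conjug n (circ_vec \<alpha>) (cl_e 1) = cl_smul (complex_of_real (cos (2 * \<alpha>))) (cl_e 1) + cl_smul (complex_of_real (sin (2 * \<alpha>))) (cl_e 2)"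
    unfolding C(1) S by (subst c) (simp_all add: reflect_mat_def circ_vec_def mult_ac)
  have c2: "conjug n (circ_vec \<alpha>) (cl_e 2) = cl_smul (complex_of_real (sin (2 * \<alpha>))) (cl_e 1) + cl_smul (complex_of_real (- cos (2 * \<alpha>))) (cl_e 2)"
    unfolding C(2) S by (subst c) (simp_all add: reflect_mat_def circ_vec_def mult_ac)
  have e: "cis (2 * \<alpha>) = complex_of_real (cos (2 * \<alpha>)) + \<i> * complex_of_real (sin (2 * \<alpha>))"
    by (simp add: complex_eq_iff)
  have "\<i> * (\<i> * z) = - z" for z by (simp add: mult.assoc[symmetric])
  then show ?thesis
    unfolding isotropic_def conjug_add conjug_smul c1 c2 e
    by (intro ext) (simp add: cl_smul_def algebra_simps)
qed

lemma conjug_blade: "conjug n (circ_vec \<alpha>) (blade {3..t+1}) = cl_smul ((-1)^(t - 1)) (blade {3..t+1})"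
proof -
  let ?B = "blade {3..t+1}"
  have B: "?B \<in> Cl n" using blade_Lam[OF S_ok(1)] Lam_subset_Cl by blast
  have "cl_mult n ?B (cl_vec n (circ_vec \<alpha>)) = cl_smul ((-1)^(t - 1)) (cl_mult n (cl_vec n (circ_vec \<alpha>)) ?B)"
    unfolding circ_vec_vec cl_mult_distrib e1B(2) e2B(2) cl_smul_add by (simp add: mult.commute)
  then show ?thesis
    unfolding conjug_def by (simp only: cl_mult_smul_right unit_vec_mult[OF circ_vec_unit[OF n2] B] cl_smul_minus cl_smul_neg_left minus_minus)
qed

text \<open>z goes to cis (2 \<alpha>) times its conjugate. The polynomial gives l such factors and
  the isotropic vector one more, hence the exponent 2 l + 2; the blade contributes a sign. The bound
  of \<open>trig_deg_H_act\<close> is attained.\<close>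

lemma H_weight_vec: "H_act n [circ_vec \<alpha>] (weight_vec n t l 1) = pscale ((-1)^(t - 1) * cis \<alpha> ^ (2 * l + 2)) (weight_vec n t l (-1))"
proof
  fix x
  have u: "circ_vec \<alpha> \<in> unit_vecs n" by (rule circ_vec_unit[OF n2])
  have r: "reflect n (circ_vec \<alpha>) x 1 = cos (2 * \<alpha>) * x 1 + sin (2 * \<alpha>) * x 2" "reflect n (circ_vec \<alpha>) x 2 = sin (2 * \<alpha>) * x 1 - cos (2 * \<alpha>) * x 2"
  proof -
    have C: "cos (2 * \<alpha>) = 2 * (cos \<alpha> * cos \<alpha>) - 1" "cos (2 * \<alpha>) = 1 - 2 * (sin \<alpha> * sin \<alpha>)"
      and S: "sin (2 * \<alpha>) = 2 * (sin \<alpha> * cos \<alpha>)"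
      using cos_double_cos[of \<alpha>] cos_double_sin[of \<alpha>] sin_double[of \<alpha>] by (simp_all add: power2_eq_square mult_ac)
    have v: "circ_vec \<alpha> 1 = cos \<alpha>" "circ_vec \<alpha> 2 = sin \<alpha>" by (simp_all add: circ_vec_def)
    show "reflect n (circ_vec \<alpha>) x 1 = cos (2 * \<alpha>) * x 1 + sin (2 * \<alpha>) * x 2"
      unfolding reflect_def inner_up_circ_vec[OF n2] C(1) S v if_P[OF S_ok(3)] by (simp add: algebra_simps)
    show "reflect n (circ_vec \<alpha>) x 2 = sin (2 * \<alpha>) * x 1 - cos (2 * \<alpha>) * x 2"
      unfolding reflect_def inner_up_circ_vec[OF n2] C(2) S v if_P[OF S_ok(4)] by (simp add: algebra_simps)
  qed
  have e: "cis (2 * \<alpha>) = complex_of_real (cos (2 * \<alpha>)) + \<i> * complex_of_real (sin (2 * \<alpha>))"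
    by (simp add: complex_eq_iff)
  have ii: "\<i> * (\<i> * z) = - z" for z by (simp add: mult.assoc[symmetric])
  have z: "complex_of_real (reflect n (circ_vec \<alpha>) x 1) + 1 * \<i> * complex_of_real (reflect n (circ_vec \<alpha>) x 2) = cis (2 * \<alpha>) * (complex_of_real (x 1) + (-1) * \<i> * complex_of_real (x 2))"
    unfolding r e by (simp add: algebra_simps ii)
  have c2: "cis (2 * \<alpha>) = cis \<alpha> ^ 2" by (simp add: power2_eq_square cis_mult)
  have "cis (2 * \<alpha>) ^ l * cis (2 * \<alpha>) = cis \<alpha> ^ (2 * l + 2)"
    unfolding c2 by (simp flip: power_mult power_add)
  then have p: "((cis (2 * \<alpha>) * q) ^ l) * ((-1)^(t - 1) * cis (2 * \<alpha>)) = (-1)^(t - 1) * cis \<alpha> ^ (2 * l + 2) * q ^ l" for q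
    by (simp add: power_mult_distrib mult_ac)
  show "H_act n [circ_vec \<alpha>] (weight_vec n t l 1) x = pscale ((-1)^(t - 1) * cis \<alpha> ^ (2 * l + 2)) (weight_vec n t l (-1)) x"
    unfolding H_act_single[OF u] weight_vec_def conjug_smul z conjug_mult[OF u, symmetric] conjug_isotropic conjug_blade pscale_apply cl_mult_smul_left cl_mult_smul_right cl_smul_smul p by (rule refl)
qed

end

text \<open>The reflected image of the first weight vector under f depends on \<alpha> through cis
  to the power 2 l' + 2. In degree l < l' such a power is too high, and in the extreme grades the
  action does not depend on \<alpha> at all. The factor \<epsilon> accommodates the signs of the
  components.\<close>

lemma no_intertwiner_weight:
  fixes f :: "pf \<Rightarrow> pf"
  assumes n2: "2 \<le> n" and t': "1 \<le> t'" "t' \<le> n - 1"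
    and f: "\<And>a. a \<in> monog n t' l' \<Longrightarrow> f a \<in> monog n t l"
    and inj: "inj_on f (monog n t' l')"
    and fs: "\<And>a c. a \<in> monog n t' l' \<Longrightarrow> f (pscale c a) = pscale c (f a)"
    and fH: "\<And>u a. u \<in> unit_vecs n \<Longrightarrow> a \<in> monog n t' l' \<Longrightarrow> f (H_act n [u] a) = pscale \<epsilon> (H_act n [u] (f a))"
    and eps: "\<epsilon> \<noteq> 0" and lt: "l < l' \<or> t = 0 \<or> t = n"
  shows False
proof -
  let ?Wp = "weight_vec n t' l' 1" and ?Wm = "weight_vec n t' l' (-1)"
  have W: "?Wp \<in> monog n t' l'" "?Wm \<in> monog n t' l'" by (auto intro!: weight_vec_monog[OF n2 t'])
  have f0: "f 0 = 0" using fs[OF W(2), of 0] by simp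
  have "(0::pf) \<in> monog n t' l'" using psubspaceD(1)[OF psubspace_monog] .
  then have nz: "f ?Wm \<noteq> 0" using inj W(2) weight_vec_nonzero[OF n2 t', of l' "-1"] f0 by (metis inj_onD)
  have eq: "H_act n [circ_vec \<alpha>] (f ?Wp) x T = ((-1)^(t' - 1) / \<epsilon> * f ?Wm x T) * cis \<alpha> ^ (2 * l' + 2)" for \<alpha> x T
  proof -
    have "pscale \<epsilon> (H_act n [circ_vec \<alpha>] (f ?Wp)) = pscale ((-1)^(t' - 1) * cis \<alpha> ^ (2 * l' + 2)) (f ?Wm)"
      using fH[OF circ_vec_unit[OF n2] W(1), of \<alpha>] H_weight_vec[OF n2 t', of \<alpha> l'] fs[OF W(2)] by simp
    then have "\<epsilon> * H_act n [circ_vec \<alpha>] (f ?Wp) x T = (-1)^(t' - 1) * cis \<alpha> ^ (2 * l' + 2) * f ?Wm x T"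
      by (metis pscale_apply cl_smul_def)
    then show ?thesis using eps by (simp add: field_simps)
  qed
  have "f ?Wm x T = 0" for x T
  proof -
    have "(-1)^(t' - 1) / \<epsilon> * f ?Wm x T = 0"
    proof (cases "t = 0 \<or> t = n")
      case True
      obtain c where "\<forall>u\<in>unit_vecs n. H_act n [u] (f ?Wp) = pscale c (f ?Wp)"
        using H_act_extreme[OF f[OF W(1)] True] by blast
      then have "(\<lambda>\<alpha>. H_act n [circ_vec \<alpha>] (f ?Wp) x T) = (\<lambda>\<alpha>. pscale c (f ?Wp) x T)" using circ_vec_unit[OF n2] by simp
      then have "trig_deg 0 (\<lambda>\<alpha>. H_act n [circ_vec \<alpha>] (f ?Wp) x T)" using trig_deg_const by simp
      from trig_deg_cis_high[OF this[unfolded eq]] show ?thesis by simp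
    next
      case False
      then have "2 * l + 2 < 2 * l' + 2" using lt by simp
      from trig_deg_cis_high[OF trig_deg_H_act[OF f[OF W(1)] n2, of x T, unfolded eq] this] show ?thesis .
    qed
    then show ?thesis using eps by simp
  qed
  then have "f ?Wm = 0" by (intro ext) simp
  then show False using nz by simp
qed

section \<open>The product of the axis reflections\<close>

definition axis_vec :: "nat \<Rightarrow> nat \<Rightarrow> real" where "axis_vec j = (\<lambda>i. if i = j then 1 else 0)"

lemma axis_vec_unit: "j \<in> {1..n} \<Longrightarrow> axis_vec j \<in> unit_vecs n"
proof -
  assume j: "j \<in> {1..n}"
  have "(\<Sum>i\<in>{1..n}. (axis_vec j i)^2) = (\<Sum>i\<in>{1..n}. if i = j then 1 else 0)" unfolding axis_vec_def by (rule sum.cong) auto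
  then show ?thesis using j unfolding unit_vecs_def axis_vec_def by auto
qed

fun axis_refls :: "nat \<Rightarrow> nat \<Rightarrow> pf \<Rightarrow> pf" where
  "axis_refls n 0 P = P"
| "axis_refls n (Suc k) P = H_act n [axis_vec (Suc k)] (axis_refls n k P)"

lemma H_axis_vec:
  assumes "P \<in> monog n t l" "j \<in> {1..n}" "T \<subseteq> {1..n}"
  shows "H_act n [axis_vec j] P x T = (-1)^t * (if j \<in> T then -1 else 1) * P (\<lambda>i. (if i = j then 1 else -1) * x i) T"
proof -
  have inner_up: "inner_up n (axis_vec j) x = x j"
  proof -
    have "inner_up n (axis_vec j) x = (\<Sum>i\<in>{1..n}. if i = j then x i else 0)" unfolding inner_up_def axis_vec_def by (rule sum.cong) auto
    then show ?thesis using assms(2) by simp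
  qed
  let ?y = "reflect n (axis_vec j) x"
  have y: "P ?y = P (\<lambda>i. (if i = j then 1 else -1) * x i)"
  proof (rule hom_poly_cong[OF monogD(1)[OF assms(1)]])
    fix i assume "i \<in> {1..n}"
    then show "?y i = (if i = j then 1 else -1) * x i" unfolding reflect_def inner_up by (simp add: axis_vec_def)
  qed
  have L: "P ?y \<in> Lam n t" "P ?y \<in> Cl n" using monogD[OF assms(1)] by auto
  have v: "cl_vec n (axis_vec j) = cl_e j" unfolding axis_vec_def cl_e_eq_vec[OF assms(2)] ..
  have jT: "j \<in> sym_diff {j} T \<longleftrightarrow> j \<notin> T" by auto
  have 1: "cl_mult n (cl_e j) (cl_mult n (cl_e j) (P ?y)) T = - P ?y T" using cl_e_square[OF assms(2) L(2)] by simp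
  have "conjug n (axis_vec j) (P ?y) T = (-1)^t * (if j \<in> T then -1 else 1) * P ?y T"
    unfolding conjug_def v fun_Compl_def
    using 1 unfolding cl_e_mult_apply[OF assms(2,3)] mult_e_Lam[OF L(1) assms(2)] jT
    by (auto simp: algebra_simps)
  then show ?thesis unfolding H_act_single[OF axis_vec_unit[OF assms(2)]] y .
qed

lemma axis_refls_apply:
  assumes "P \<in> monog n t l" "T \<subseteq> {1..n}"
  shows "k \<le> n \<Longrightarrow> axis_refls n k P \<in> monog n t l \<and>
    (\<forall>x. axis_refls n k P x T = (\<Prod>j\<in>{1..k}. (-1)^t * (if j \<in> T then -1 else 1)) * P (\<lambda>i. (\<Prod>j\<in>{1..k}. if i = j then 1 else -1) * x i) T)"
proof (induction k)
  case 0
  then show ?case using assms by simp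
next
  case (Suc k)
  have j: "Suc k \<in> {1..n}" using Suc(2) by simp
  from Suc have D: "axis_refls n k P \<in> monog n t l"
    and a: "\<And>x. axis_refls n k P x T = (\<Prod>j\<in>{1..k}. (-1)^t * (if j \<in> T then -1 else 1)) * P (\<lambda>i. (\<Prod>j\<in>{1..k}. if i = j then 1 else -1) * x i) T"
    by auto
  have "axis_refls n (Suc k) P \<in> monog n t l" using monog_H_act[OF D axis_vec_unit[OF j]] by simp
  moreover have "axis_refls n (Suc k) P x T = (\<Prod>j\<in>{1..Suc k}. (-1)^t * (if j \<in> T then -1 else 1)) * P (\<lambda>i. (\<Prod>j\<in>{1..Suc k}. if i = j then 1 else -1) * x i) T" for x
    unfolding axis_refls.simps H_axis_vec[OF D j assms(2)] a
    by (simp add: prod.nat_ivl_Suc' mult_ac)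
  ultimately show ?case by blast
qed

text \<open>Coordinate i is negated by every reflection but the i-th, which gives (-1)^((n - 1) l)
  in degree l. Each of the n reflections gives (-1)^t by \<open>H_axis_vec\<close>, and those with j
  in the blade another -1, t times in all.\<close>

lemma axis_refls_n:
  assumes "P \<in> monog n t l" "1 \<le> n"
  shows "axis_refls n n P = pscale ((-1)^(n * t + t + (n - 1) * l)) P"
proof (intro ext)
  fix x T
  show "axis_refls n n P x T = pscale ((-1)^(n * t + t + (n - 1) * l)) P x T"
  proof (cases "T \<subseteq> {1..n} \<and> P x T \<noteq> 0")
    case True
    then have T: "T \<subseteq> {1..n}" by simp
    have cT: "card T = t" using True monogD(2)[OF assms(1), of x] by (auto simp: Lam_def)
    have 1: "(\<Prod>j\<in>{1..n}. (-1)^t * (if j \<in> T then -1 else (1::complex))) = (-1)^(n * t + t)"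
    proof -
      have "{1..n} \<inter> {j. j \<in> T} = T" using T by auto
      then show ?thesis by (simp add: prod.distrib prod.If_cases cT power_add power_mult del: One_nat_def) (simp add: power_mult[symmetric] mult.commute)?
    qed
    have 2: "(\<Prod>j\<in>{1..n}. if i = j then 1 else (-1::real)) = (-1)^(n - 1)" if i: "i \<in> {1..n}" for i
    proof -
      have "(\<Prod>j\<in>{1..n}. if i = j then 1 else (-1::real)) = (\<Prod>j\<in>{1..n} - {i}. -1)"
        using i by (subst prod.remove[of _ i]) (auto intro!: prod.cong)
      then show ?thesis using i by (simp add: card_Diff_singleton del: One_nat_def)
    qed
    have "P (\<lambda>i. (\<Prod>j\<in>{1..n}. if i = j then 1 else -1) * x i) = P (\<lambda>i. (-1)^(n - 1) * x i)"
      by (rule hom_poly_cong[OF monogD(1)[OF assms(1)]]) (simp only: 2)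
    also have "\<dots> = cl_smul (complex_of_real ((-1)^(n - 1)) ^ l) (P x)"
      by (rule hom_poly_scale[OF monogD(1)[OF assms(1)]])
    finally show ?thesis
      using axis_refls_apply[OF assms(1) T order.refl] unfolding 1
      by (simp add: pscale_apply cl_smul_def power_add power_mult mult.assoc)
  next
    case False
    show ?thesis
    proof (cases "T \<subseteq> {1..n}")
      case T: True
      then have P0: "P x T = 0" using False by simp
      have "P (\<lambda>i. (-1)^(n - 1) * x i) T = 0"
        unfolding hom_poly_scale[OF monogD(1)[OF assms(1)]] cl_smul_def using P0 by simp
      moreover have "P (\<lambda>i. (\<Prod>j\<in>{1..n}. if i = j then 1 else -1) * x i) = P (\<lambda>i. (-1)^(n - 1) * x i)"
      proof (rule hom_poly_cong[OF monogD(1)[OF assms(1)]])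
        fix i assume i: "i \<in> {1..n}"
        have "(\<Prod>j\<in>{1..n}. if i = j then 1 else (-1::real)) = (\<Prod>j\<in>{1..n} - {i}. -1)"
          using i by (subst prod.remove[of _ i]) (auto intro!: prod.cong)
        then show "(\<Prod>j\<in>{1..n}. if i = j then 1 else -1) * x i = (-1)^(n - 1) * x i"
          using i by (simp add: card_Diff_singleton del: One_nat_def)
      qed
      ultimately show ?thesis using axis_refls_apply[OF assms(1) T order.refl] P0 by (simp add: pscale_apply cl_smul_def)
    next
      case T: False
      have D: "axis_refls n n P \<in> monog n t l" using axis_refls_apply[OF assms(1), of "{}" n] by simp
      have "axis_refls n n P x T = 0" "P x T = 0" using monogD(3)[OF D, of x] monogD(3)[OF assms(1), of x] T by (auto simp: Cl_def)
      then show ?thesis by (simp add: pscale_apply cl_smul_def)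
    qed
  qed
qed

text \<open>From a grade to a neighbouring one the scalar of \<open>axis_refls_n\<close> changes by
  (-1)^(n + 1), and carrying the n reflections through f costs (-1)^n. The two sides thus differ by
  -1 in every dimension, so f P = 0, against injectivity.\<close>

lemma no_intertwiner_parity:
  fixes f :: "pf \<Rightarrow> pf"
  assumes n1: "1 \<le> n" and t': "t' = Suc t \<or> t = Suc t'"
    and f: "\<And>a. a \<in> monog n t' l \<Longrightarrow> f a \<in> monog n t l"
    and inj: "inj_on f (monog n t' l)"
    and fs: "\<And>a c. a \<in> monog n t' l \<Longrightarrow> f (pscale c a) = pscale c (f a)"
    and fH: "\<And>u a. u \<in> unit_vecs n \<Longrightarrow> a \<in> monog n t' l \<Longrightarrow> f (H_act n [u] a) = pscale (-1) (H_act n [u] (f a))"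
    and nz: "P \<in> monog n t' l" "P \<noteq> 0"
  shows False
proof -
  have "k \<le> n \<Longrightarrow> axis_refls n k P \<in> monog n t' l \<and> f (axis_refls n k P) = pscale ((-1)^k) (axis_refls n k (f P))" for k
  proof (induction k)
    case 0
    then show ?case using nz by simp
  next
    case (Suc k)
    then have j: "Suc k \<in> {1..n}" by simp
    from Suc have D: "axis_refls n k P \<in> monog n t' l" "f (axis_refls n k P) = pscale ((-1)^k) (axis_refls n k (f P))" by auto
    show ?case
      using monog_H_act[OF D(1) axis_vec_unit[OF j]] fH[OF axis_vec_unit[OF j] D(1)] D(2)
      by (simp add: H_act_pscale[OF axis_vec_unit[OF j]] pscale_pscale)
  qed
  from this[OF order.refl] have "f (axis_refls n n P) = pscale ((-1)^n) (axis_refls n n (f P))" by blast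
  then have e: "pscale ((-1)^(n * t' + t' + (n - 1) * l)) (f P) = pscale ((-1)^n * (-1)^(n * t + t + (n - 1) * l)) (f P)"
    unfolding axis_refls_n[OF nz(1) n1] axis_refls_n[OF f[OF nz(1)] n1] fs[OF nz(1)] pscale_pscale .
  have sgn: "(-1::complex)^(n * t' + t' + (n - 1) * l) = - ((-1)^n * (-1)^(n * t + t + (n - 1) * l))"
    using t' by (elim disjE) (simp_all add: power_add mult_ac)
  have "f P = 0"
  proof (intro ext)
    fix x T
    define c where "c = (-1::complex)^n * (-1)^(n * t + t + (n - 1) * l)"
    have "c \<noteq> 0" by (simp add: c_def)
    moreover have "- c * f P x T = c * f P x T"
      using e unfolding sgn c_def[symmetric] by (metis pscale_apply cl_smul_def)
    ultimately show "f P x T = 0 x T" by simp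
  qed
  moreover have "f 0 = 0" using fs[OF nz(1), of 0] by simp
  moreover have "(0::pf) \<in> monog n t' l" using psubspaceD(1)[OF psubspace_monog] .
  ultimately show False using inj nz by (metis inj_onD)
qed

section \<open>The Fischer inner product\<close>

definition mv_inner :: "nat \<Rightarrow> mv \<Rightarrow> mv \<Rightarrow> complex" where
  "mv_inner n A B = (\<Sum>S\<in>Pow {1..n}. A S * cnj (B S))"

lemma mv_inner_add: "mv_inner n (A + B) C = mv_inner n A C + mv_inner n B C"
  by (simp add: mv_inner_def distrib_right sum.distrib)
lemma mv_inner_smul: "mv_inner n (cl_smul c A) C = c * mv_inner n A C"
  by (simp add: mv_inner_def cl_smul_def sum_distrib_left mult.assoc)
lemma mv_inner_cnj: "mv_inner n B A = cnj (mv_inner n A B)"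
  by (simp add: mv_inner_def mult.commute)
lemma mv_inner_zero [simp]: "mv_inner n 0 C = 0" by (simp add: mv_inner_def)
lemma mv_inner_minus: "mv_inner n (- A) C = - mv_inner n A C" "mv_inner n A (- C) = - mv_inner n A C"
  by (simp_all add: mv_inner_def sum_negf)
lemma mv_inner_sum: "mv_inner n (sum f I) C = (\<Sum>i\<in>I. mv_inner n (f i) C)"
  using sum_comp_morphism[of "\<lambda>A. mv_inner n A C" f I] by (simp add: mv_inner_add comp_def)
lemma mv_inner_smul_right: "mv_inner n A (cl_smul c C) = cnj c * mv_inner n A C"
  by (simp add: mv_inner_cnj[of n "A"] mv_inner_smul)
lemma mv_inner_sum_right: "mv_inner n C (sum f I) = (\<Sum>i\<in>I. mv_inner n C (f i))"
  by (simp add: mv_inner_cnj[of n C] mv_inner_sum)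

lemma mv_inner_self: "mv_inner n A A = complex_of_real (\<Sum>S\<in>Pow {1..n}. (cmod (A S))^2)"
  unfolding mv_inner_def of_real_sum complex_norm_square by (rule refl)

lemma mv_inner_definite:
  assumes "A \<in> Cl n" "mv_inner n A A = 0"
  shows "A = 0"
proof
  fix S
  have "(\<Sum>S\<in>Pow {1..n}. (cmod (A S))^2) = 0" using assms(2) unfolding mv_inner_self by (simp only: of_real_eq_0_iff)
  then have "\<forall>S\<in>Pow {1..n}. (cmod (A S))^2 = 0" by (subst (asm) sum_nonneg_eq_0_iff) auto
  then show "A S = 0 S" using assms(1) by (cases "S \<subseteq> {1..n}") (auto simp: Cl_def)
qed

lemma cnj_cl_sign [simp]: "cnj (cl_sign S S') = cl_sign S S'" by (simp add: cl_sign_def)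

text \<open>The sum is reindexed by the involution that inserts or removes j. Undoing the
  multiplication by e_j changes the sign, as e_j e_j = -1, so e_j is skew-adjoint on either
  side.\<close>

lemma
  assumes j: "j \<in> {1..n}"
  shows mv_inner_e_left: "mv_inner n (cl_mult n (cl_e j) A) B = - mv_inner n A (cl_mult n (cl_e j) B)"
    and mv_inner_e_right: "mv_inner n (cl_mult n A (cl_e j)) B = - mv_inner n A (cl_mult n B (cl_e j))"
proof -
  have fT: "finite T" if "T \<in> Pow {1..n}" for T using that finite_subset[of T "{1..n}"] by blast
  have inv: "sym_diff {j} (sym_diff {j} T) = T" for T by blast
  have dom: "sym_diff {j} T \<in> Pow {1..n}" if "T \<in> Pow {1..n}" for T using that j by blast
  have "mv_inner n (cl_mult n (cl_e j) A) B = (\<Sum>T\<in>Pow {1..n}. - (A T * cnj (cl_mult n (cl_e j) B T)))"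
    unfolding mv_inner_def
  proof (rule sum.reindex_bij_witness[of _ "\<lambda>T. sym_diff {j} T" "\<lambda>T. sym_diff {j} T"])
    fix T assume T: "T \<in> Pow {1..n}"
    have d: "sym_diff {j} T \<subseteq> {1..n}" using dom[OF T] by blast
    have t: "T \<subseteq> {1..n}" using T by blast
    have s: "cl_sign {j} (sym_diff {j} T) = - cl_sign {j} T"
      by (subst cl_sign_sym_diff_right) (use fT[OF T] in simp_all)
    show "- (A (sym_diff {j} T) * cnj (cl_mult n (cl_e j) B (sym_diff {j} T))) = cl_mult n (cl_e j) A T * cnj (B T)"
      unfolding cl_e_mult_apply[OF j d] cl_e_mult_apply[OF j t] inv s by simp
  qed (rule inv dom, assumption?)+
  then show "mv_inner n (cl_mult n (cl_e j) A) B = - mv_inner n A (cl_mult n (cl_e j) B)"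
    unfolding sum_negf mv_inner_def .
  have "mv_inner n (cl_mult n A (cl_e j)) B = (\<Sum>T\<in>Pow {1..n}. - (A T * cnj (cl_mult n B (cl_e j) T)))"
    unfolding mv_inner_def
  proof (rule sum.reindex_bij_witness[of _ "\<lambda>T. sym_diff {j} T" "\<lambda>T. sym_diff {j} T"])
    fix T assume T: "T \<in> Pow {1..n}"
    have d: "sym_diff {j} T \<subseteq> {1..n}" using dom[OF T] by blast
    have t: "T \<subseteq> {1..n}" using T by blast
    have s: "cl_sign (sym_diff {j} T) {j} = - cl_sign T {j}"
      by (subst cl_sign_sym_diff_left) (use fT[OF T] in simp_all)
    show "- (A (sym_diff {j} T) * cnj (cl_mult n B (cl_e j) (sym_diff {j} T))) = cl_mult n A (cl_e j) T * cnj (B T)"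
      unfolding cl_mult_e_apply[OF j d] cl_mult_e_apply[OF j t] inv s by simp
  qed (rule inv dom, assumption?)+
  then show "mv_inner n (cl_mult n A (cl_e j)) B = - mv_inner n A (cl_mult n B (cl_e j))"
    unfolding sum_negf mv_inner_def .
qed

lemma mv_inner_vec:
  "mv_inner n (cl_mult n (cl_vec n u) A) B = - mv_inner n A (cl_mult n (cl_vec n u) B)"
  "mv_inner n (cl_mult n A (cl_vec n u)) B = - mv_inner n A (cl_mult n B (cl_vec n u))"
  unfolding cl_vec_eq_sum cl_mult_sum_left cl_mult_sum_right cl_mult_smul_left cl_mult_smul_right
    mv_inner_sum mv_inner_sum_right mv_inner_smul mv_inner_smul_right sum_negf[symmetric]
  by (rule sum.cong; simp add: mv_inner_e_left mv_inner_e_right)+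

text \<open>Two skew-adjoint factors make \<open>conjug\<close> self-adjoint, and it is an
  involution; hence it is an isometry.\<close>

lemma mv_inner_conjug:
  assumes "u \<in> unit_vecs n" "B \<in> Cl n"
  shows "mv_inner n (conjug n u A) (conjug n u B) = mv_inner n A B"
proof -
  have "mv_inner n (conjug n u A) C = mv_inner n A (conjug n u C)" for C
    unfolding conjug_def mv_inner_minus by (simp only: mv_inner_vec minus_minus cl_mult_assoc)
  then show ?thesis using conjug_conjug[OF assms] by simp
qed

text \<open>Sums over all k-fold derivatives, which is k! times the usual Fischer product. The
  recursion on the degree allows invariance and definiteness to be proved by induction.\<close>

fun fischer :: "nat \<Rightarrow> nat \<Rightarrow> pf \<Rightarrow> pf \<Rightarrow> complex" where
  "fischer n 0 P Q = mv_inner n (P (\<lambda>i. 0)) (Q (\<lambda>i. 0))"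
| "fischer n (Suc k) P Q = (\<Sum>j\<in>{1..n}. fischer n k (pd j P) (pd j Q))"

definition cl_polys :: "nat \<Rightarrow> nat \<Rightarrow> pf set" where
  "cl_polys n k = {P. hom_poly n k P \<and> (\<forall>x. P x \<in> Cl n)}"

lemma monog_cl_polys: "P \<in> monog n s k \<Longrightarrow> P \<in> cl_polys n k"
  using monogD by (auto simp: cl_polys_def)

lemma cl_polys_pd: "P \<in> cl_polys n (Suc k) \<Longrightarrow> pd j P \<in> cl_polys n k"
  using hom_poly_pd[of n "Suc k" P j] pd_in_Cl[of P n j] by (auto simp: cl_polys_def)

lemma psubspace_cl_polys: "psubspace (cl_polys n k)"
  unfolding psubspace_def pscale_eq plus_fun_def[where 'b = mv] zero_fun_def[where 'b = mv]
  using hom_poly_zero hom_poly_add hom_poly_smul by (auto simp: pscale_def cl_polys_def)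

lemma pd_add: "P \<in> cl_polys n k \<Longrightarrow> Q \<in> cl_polys n k \<Longrightarrow> pd j (P + Q) = pd j P + pd j Q"
  using dif_pd[OF dif_add[OF hom_poly_dif hom_poly_dif], of n k P n k Q j]
  by (simp add: cl_polys_def plus_fun_def[where 'b = mv])

lemma pd_pscale: "P \<in> cl_polys n k \<Longrightarrow> pd j (pscale c P) = pscale c (pd j P)"
  using dif_pd[OF dif_smul[OF hom_poly_dif], of n k P j c] by (simp add: cl_polys_def pscale_def)

lemma fischer_add: "P \<in> cl_polys n k \<Longrightarrow> Q \<in> cl_polys n k \<Longrightarrow> fischer n k (P + Q) R = fischer n k P R + fischer n k Q R"
proof (induction k arbitrary: P Q R)
  case (Suc k)
  show ?case
    by (simp only: fischer.simps pd_add[OF Suc.prems] Suc.IH[OF cl_polys_pd[OF Suc.prems(1)] cl_polys_pd[OF Suc.prems(2)]] sum.distrib)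
qed (simp add: mv_inner_add)

lemma fischer_pscale: "P \<in> cl_polys n k \<Longrightarrow> fischer n k (pscale c P) R = c * fischer n k P R"
proof (induction k arbitrary: P R)
  case (Suc k)
  then show ?case by (simp add: pd_pscale[OF Suc.prems] Suc.IH[OF cl_polys_pd] sum_distrib_left)
qed (simp add: mv_inner_smul pscale_apply)

lemma fischer_cnj: "fischer n k Q P = cnj (fischer n k P Q)"
proof (induction k arbitrary: P Q)
  case 0
  show ?case unfolding fischer.simps by (rule mv_inner_cnj)
next
  case (Suc k)
  show ?case unfolding fischer.simps cnj_sum by (rule sum.cong[OF refl]) (rule Suc)
qed

lemma fischer_zero: "fischer n k 0 R = 0"
  using fischer_pscale[of 0 n k 0 R] psubspaceD(1)[OF psubspace_cl_polys] by simp

lemma fischer_zero_right: "fischer n k R 0 = 0"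
  unfolding fischer_cnj[of n k R 0] fischer_zero by simp

lemma fischer_diff: "P \<in> cl_polys n k \<Longrightarrow> Q \<in> cl_polys n k \<Longrightarrow> fischer n k (P - Q) R = fischer n k P R - fischer n k Q R"
  using fischer_add[OF psubspaceD(4)[OF psubspace_cl_polys], of P n k Q Q R] by simp

lemma fischer_sum:
  assumes "\<And>i. i \<in> I \<Longrightarrow> p i \<in> cl_polys n k"
  shows "fischer n k (sum p I) R = (\<Sum>i\<in>I. fischer n k (p i) R)"
  using assms
proof (induction I rule: infinite_finite_induct)
  case (insert i I)
  have "fischer n k (p i + sum p I) R = fischer n k (p i) R + fischer n k (sum p I) R"
    by (rule fischer_add[OF _ psubspace_sum[OF psubspace_cl_polys]]) (use insert.prems in simp_all)
  moreover have "fischer n k (sum p I) R = (\<Sum>i\<in>I. fischer n k (p i) R)" by (rule insert.IH) (use insert.prems in simp)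
  ultimately show ?case by (simp only: sum.insert[OF insert.hyps])
qed (simp_all add: fischer_zero)

lemma fischer_self: "\<exists>r\<ge>0. fischer n k P P = complex_of_real r"
proof (induction k arbitrary: P)
  case 0
  have "0 \<le> (\<Sum>S\<in>Pow {1..n}. (cmod (P (\<lambda>i. 0) S))^2)" by (rule sum_nonneg) simp
  then show ?case unfolding fischer.simps mv_inner_self by blast
next
  case (Suc k)
  then have "\<forall>j. \<exists>r\<ge>0. fischer n k (pd j P) (pd j P) = complex_of_real r" by blast
  then obtain r where "\<And>j. r j \<ge> 0 \<and> fischer n k (pd j P) (pd j P) = complex_of_real (r j)" by metis
  then show ?case by (intro exI[of _ "\<Sum>j\<in>{1..n}. r j"]) (simp add: sum_nonneg)
qed

text \<open>In positive degree Euler's identity recovers P from its first derivatives, which vanish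
  by induction; in degree 0 P equals its value at the origin.\<close>

lemma fischer_definite: "P \<in> cl_polys n k \<Longrightarrow> fischer n k P P = 0 \<Longrightarrow> P = 0"
proof (induction k arbitrary: P)
  case 0
  then have h: "hom_poly n 0 P" "P (\<lambda>i. 0) \<in> Cl n" by (auto simp: cl_polys_def)
  have "P (\<lambda>i. 0) = 0" using mv_inner_definite[OF h(2)] 0(2) by simp
  then show ?case using hom_poly_scale[OF h(1), of 0] by (intro ext) simp
next
  case (Suc k)
  have "\<forall>j. \<exists>r\<ge>0. fischer n k (pd j P) (pd j P) = complex_of_real r" using fischer_self by blast
  then obtain r where r: "\<And>j. r j \<ge> 0" "\<And>j. fischer n k (pd j P) (pd j P) = complex_of_real (r j)" by metis
  have "complex_of_real (\<Sum>j\<in>{1..n}. r j) = 0" using Suc.prems(2) unfolding fischer.simps r(2) of_real_sum .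
  then have "(\<Sum>j\<in>{1..n}. r j) = 0" by (simp only: of_real_eq_0_iff)
  then have "\<forall>j\<in>{1..n}. r j = 0" using r(1) by (subst (asm) sum_nonneg_eq_0_iff) auto
  moreover have "fischer n k (pd j P) (pd j P) = 0 \<Longrightarrow> pd j P = 0" for j by (rule Suc.IH[OF cl_polys_pd[OF Suc.prems(1)]])
  ultimately have p: "pd j P = 0" if "j \<in> {1..n}" for j using r(2) that by (metis of_real_0)
  show ?case
  proof
    fix x
    have "cl_smul (of_nat (Suc k)) (P x) = 0"
      using hom_poly_Euler[of n "Suc k" P x] Suc.prems(1) p by (simp add: cl_polys_def del: of_nat_Suc)
    then show "P x = 0 x" by (intro ext) (metis cl_smul_def mult_eq_0_iff of_nat_eq_0_iff nat.distinct(1) zero_fun_apply)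
  qed
qed

lemma cl_polys_H_act: "P \<in> cl_polys n k \<Longrightarrow> u \<in> unit_vecs n \<Longrightarrow> H_act n [u] P \<in> cl_polys n k"
  using hom_poly_H_act by (auto simp: cl_polys_def H_act_single)

lemma reflect_mat_orthogonal:
  assumes u: "u \<in> unit_vecs n" and l: "l \<in> {1..n}" "l' \<in> {1..n}"
  shows "(\<Sum>j\<in>{1..n}. reflect_mat u l j * reflect_mat u l' j) = (if l = l' then 1 else 0)"
proof -
  have "(\<Sum>j\<in>{1..n}. reflect_mat u l j * reflect_mat u l' j) = (\<Sum>j\<in>{1..n}. 4 * u l * u l' * (u j * u j)
      - (if j = l' then 2 * u l * u l' else 0) - (if j = l then 2 * u l * u l' else 0) + (if j = l then (if l = l' then 1 else 0) else 0))"
    by (rule sum.cong) (auto simp: reflect_mat_def algebra_simps)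
  also have "\<dots> = 4 * u l * u l' * inner_up n u u - 2 * u l * u l' - 2 * u l * u l' + (if l = l' then 1 else 0)"
    using l by (simp add: sum.distrib sum_subtractf inner_up_def sum_distrib_left del: One_nat_def)
  finally show ?thesis using unit_vecs_inner_up[OF u] by simp
qed

lemma fischer_sum_right:
  assumes "\<And>i. i \<in> I \<Longrightarrow> p i \<in> cl_polys n k"
  shows "fischer n k R (sum p I) = (\<Sum>i\<in>I. fischer n k R (p i))"
  unfolding fischer_cnj[of n k R] by (simp only: fischer_sum[OF assms] cnj_sum)

lemma fischer_pscale_right: "P \<in> cl_polys n k \<Longrightarrow> fischer n k R (pscale c P) = cnj c * fischer n k R P"
  unfolding fischer_cnj[of n k R] using fischer_pscale by simp

lemma fischer_add_right: "P \<in> cl_polys n k \<Longrightarrow> Q \<in> cl_polys n k \<Longrightarrow> fischer n k R (P + Q) = fischer n k R P + fischer n k R Q"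
  unfolding fischer_cnj[of n k R] using fischer_add by simp

text \<open>The derivatives of the transformed functions are mixed by \<open>reflect_mat\<close>.
  Its orthogonality collapses the triple sum to the diagonal.\<close>

lemma fischer_H_act:
  assumes u: "u \<in> unit_vecs n"
  shows "P \<in> cl_polys n k \<Longrightarrow> Q \<in> cl_polys n k \<Longrightarrow> fischer n k (H_act n [u] P) (H_act n [u] Q) = fischer n k P Q"
proof (induction k arbitrary: P Q)
  case 0
  have "reflect n u (\<lambda>i. 0) = (\<lambda>i. 0)" by (intro ext) (simp add: reflect_def inner_up_def)
  then show ?case using 0 mv_inner_conjug[OF u] by (simp add: H_act_single[OF u] cl_polys_def)
next
  case (Suc k)
  let ?H = "H_act n [u]"
  have pdH: "pd j (?H P) = (\<Sum>l\<in>{1..n}. pscale (complex_of_real (reflect_mat u l j)) (?H (pd l P)))"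
    if "P \<in> cl_polys n (Suc k)" "j \<in> {1..n}" for P j
    by (rule ext) (use pd_H_act[OF _ u that(2), of "Suc k" P] that(1) in \<open>simp add: sum_pf_apply pscale_apply cl_polys_def\<close>)
  have mem: "pscale c (?H (pd l P)) \<in> cl_polys n k" "?H (pd l P) \<in> cl_polys n k" if "P \<in> cl_polys n (Suc k)" for P l c
    using cl_polys_H_act[OF cl_polys_pd[OF that] u] psubspaceD(3)[OF psubspace_cl_polys] by blast+
  have "fischer n k (pd j (?H P)) (pd j (?H Q)) = (\<Sum>l\<in>{1..n}. \<Sum>l'\<in>{1..n}. complex_of_real (reflect_mat u l' j * reflect_mat u l j) * fischer n k (pd l P) (pd l' Q))"
    if j: "j \<in> {1..n}" for j
    unfolding pdH[OF Suc.prems(1) j] pdH[OF Suc.prems(2) j]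
    by (simp only: fischer_sum[OF mem(1)[OF Suc.prems(1)]] fischer_sum_right[OF mem(1)[OF Suc.prems(2)]]
        fischer_pscale[OF mem(2)[OF Suc.prems(1)]] fischer_pscale_right[OF mem(2)[OF Suc.prems(2)]]
        Suc.IH[OF cl_polys_pd[OF Suc.prems(1)] cl_polys_pd[OF Suc.prems(2)]] complex_cnj_complex_of_real of_real_mult mult.assoc sum_distrib_left) (rule sum.swap)
  then have "fischer n (Suc k) (?H P) (?H Q) = (\<Sum>j\<in>{1..n}. \<Sum>l\<in>{1..n}. \<Sum>l'\<in>{1..n}. complex_of_real (reflect_mat u l' j * reflect_mat u l j) * fischer n k (pd l P) (pd l' Q))"
    by simp
  also have "\<dots> = (\<Sum>l\<in>{1..n}. \<Sum>j\<in>{1..n}. \<Sum>l'\<in>{1..n}. complex_of_real (reflect_mat u l' j * reflect_mat u l j) * fischer n k (pd l P) (pd l' Q))"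
    by (rule sum.swap)
  also have "\<dots> = (\<Sum>l\<in>{1..n}. \<Sum>l'\<in>{1..n}. \<Sum>j\<in>{1..n}. complex_of_real (reflect_mat u l' j * reflect_mat u l j) * fischer n k (pd l P) (pd l' Q))"
    by (intro sum.cong refl sum.swap)
  also have "\<dots> = (\<Sum>l\<in>{1..n}. \<Sum>l'\<in>{1..n}. complex_of_real (\<Sum>j\<in>{1..n}. reflect_mat u l' j * reflect_mat u l j) * fischer n k (pd l P) (pd l' Q))"
    by (simp only: of_real_sum sum_distrib_right)
  also have "\<dots> = (\<Sum>l\<in>{1..n}. \<Sum>l'\<in>{1..n}. if l' = l then fischer n k (pd l P) (pd l' Q) else 0)"
  proof (intro sum.cong refl)
    fix l l' assume l: "l \<in> {1..n}" "l' \<in> {1..n}"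
    show "complex_of_real (\<Sum>j\<in>{1..n}. reflect_mat u l' j * reflect_mat u l j) * fischer n k (pd l P) (pd l' Q) = (if l' = l then fischer n k (pd l P) (pd l' Q) else 0)"
      unfolding reflect_mat_orthogonal[OF u l(2,1)] by simp
  qed
  also have "\<dots> = fischer n (Suc k) P Q" by simp
  finally show ?case .
qed

lemma H_act_involution:
  assumes "P \<in> cl_polys n k" "u \<in> unit_vecs n"
  shows "H_act n [u] (H_act n [u] P) = P"
proof
  fix x
  have "P (reflect n u (reflect n u x)) = P x"
    by (rule hom_poly_cong[of n k]) (use assms reflect_reflect[OF assms(2)] in \<open>simp_all add: cl_polys_def\<close>)
  then show "H_act n [u] (H_act n [u] P) x = P x"
    using conjug_conjug[OF assms(2)] assms(1) by (simp add: H_act_single[OF assms(2)] cl_polys_def)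
qed

lemma fischer_span:
  assumes v: "v \<in> cl_polys n k" and B: "B \<subseteq> cl_polys n k" and o: "\<And>b. b \<in> B \<Longrightarrow> fischer n k v b = 0"
  shows "b \<in> pfvs.span B \<Longrightarrow> fischer n k v b = 0"
proof -
  let ?S = "{b \<in> cl_polys n k. fischer n k v b = 0}"
  have "pfvs.subspace ?S"
    unfolding pfvs.subspace_def mem_Collect_eq
  proof (intro conjI ballI allI)
    show "fischer n k v 0 = 0" by (rule fischer_zero_right)
  qed (use psubspaceD[OF psubspace_cl_polys[of n k]] fischer_add_right fischer_pscale_right in \<open>simp_all only: mem_Collect_eq, simp_all\<close>)
  then have "pfvs.span B \<subseteq> ?S" by (intro pfvs.span_minimal) (use B o in auto)
  then show "b \<in> pfvs.span B \<Longrightarrow> fischer n k v b = 0" by blast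
qed

lemma span_cl_polys: "B \<subseteq> cl_polys n k \<Longrightarrow> pfvs.span B \<subseteq> cl_polys n k"
  using psubspace_cl_polys unfolding psubspace_iff_subspace by (metis pfvs.span_minimal)

text \<open>Gram-Schmidt: b is replaced by b minus its projection \<open>w0\<close> to the span of
  B, and the projection of v is corrected along this new direction.\<close>

lemma projection_exists:
  assumes "finite B"
  shows "B \<subseteq> cl_polys n k \<Longrightarrow> v \<in> cl_polys n k \<Longrightarrow> \<exists>w\<in>pfvs.span B. \<forall>b\<in>pfvs.span B. fischer n k (v - w) b = 0"
  using assms
proof (induction B arbitrary: v rule: finite_induct)
  case empty
  show ?case
  proof (intro bexI[of _ 0] ballI)
    fix b assume "b \<in> pfvs.span {}"
    then have "b = 0" by (simp only: pfvs.span_empty singleton_iff)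
    then show "fischer n k (v - 0) b = 0" by (simp only: fischer_zero_right)
  qed (rule pfvs.span_zero)
next
  case (insert b B)
  have B: "B \<subseteq> cl_polys n k" "b \<in> cl_polys n k" using insert.prems by auto
  note sub = psubspaceD[OF psubspace_cl_polys[of n k]]
  obtain w0 where w0: "w0 \<in> pfvs.span B" "\<And>s. s \<in> pfvs.span B \<Longrightarrow> fischer n k (b - w0) s = 0"
    using insert.IH[OF B] by blast
  obtain w where w: "w \<in> pfvs.span B" "\<And>s. s \<in> pfvs.span B \<Longrightarrow> fischer n k (v - w) s = 0"
    using insert.IH[OF B(1) insert.prems(2)] by blast
  have H: "w0 \<in> cl_polys n k" "w \<in> cl_polys n k" using w0(1) w(1) span_cl_polys[OF B(1)] by auto
  show ?case
  proof (cases "b - w0 = 0")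
    case True
    then have "b \<in> pfvs.span B" using w0(1) by simp
    then have "pfvs.span (insert b B) = pfvs.span B" by (rule pfvs.span_redundant)
    with w show ?thesis by metis
  next
    case False
    let ?b = "b - w0"
    have bH: "?b \<in> cl_polys n k" by (rule sub(4)[OF B(2) H(1)])
    have vw: "v - w \<in> cl_polys n k" by (rule sub(4)[OF insert.prems(2) H(2)])
    have nz: "fischer n k ?b ?b \<noteq> 0" using fischer_definite[OF bH] False by blast
    \<comment> \<open>The Fourier coefficient along the new direction \<open>?b\<close>: it makes
      the remainder orthogonal to \<open>?b\<close>, and orthogonality to the span of B is not
      disturbed.\<close>
    define c where "c = fischer n k (v - w) ?b / fischer n k ?b ?b"
    let ?w = "w + pscale c ?b"
    have mono: "pfvs.span B \<subseteq> pfvs.span (insert b B)" by (rule pfvs.span_mono) auto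
    have "?b \<in> pfvs.span (insert b B)"
      by (rule pfvs.span_diff[OF pfvs.span_base]) (use w0(1) mono in auto)
    then have wi: "?w \<in> pfvs.span (insert b B)"
      by (intro pfvs.span_add pfvs.span_scale) (use w(1) mono in auto)
    have eq: "v - ?w = (v - w) - pscale c ?b" by simp
    have f: "fischer n k (v - ?w) s = fischer n k (v - w) s - c * fischer n k ?b s" for s
      unfolding eq fischer_diff[OF vw sub(3)[OF bH]] fischer_pscale[OF bH] ..
    have wH: "v - ?w \<in> cl_polys n k" unfolding eq by (rule sub(4)[OF vw sub(3)[OF bH]])
    have oB: "fischer n k (v - ?w) s = 0" if "s \<in> pfvs.span B" for s
      unfolding f w(2)[OF that] w0(2)[OF that] by simp
    have ob: "fischer n k (v - ?w) b = 0"
    proof -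
      have "fischer n k (v - ?w) (?b + w0) = fischer n k (v - ?w) ?b + fischer n k (v - ?w) w0"
        by (rule fischer_add_right[OF bH H(1)])
      also have "\<dots> = fischer n k (v - w) ?b - c * fischer n k ?b ?b + 0" unfolding oB[OF w0(1)] by (simp only: f)
      also have "\<dots> = 0" unfolding iffD1[OF nonzero_eq_divide_eq[OF nz] c_def] by (simp only: diff_self add_0_right)
      finally show ?thesis by simp
    qed
    have "fischer n k (v - ?w) s = 0" if "s \<in> pfvs.span (insert b B)" for s
      by (rule fischer_span[OF wH _ _ that]) (use insert.prems ob oB pfvs.span_base in auto)
    then show ?thesis using wi by blast
  qed
qed

text \<open>Monomials times blades span. This supplies the finite dimension on which the orthogonal
  projection relies.\<close>

lemma cl_polys_span_finite: "\<exists>E. finite E \<and> cl_polys n k \<subseteq> pfvs.span E"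
proof -
  define E where "E = (\<lambda>(\<alpha>, S) x. cl_smul (complex_of_real (\<Prod>i\<in>{1..n}. x i ^ \<alpha> i)) (blade S)) ` (multi_idx n k \<times> Pow {1..n})"
  have fE: "finite E" unfolding E_def using finite_multi_idx by blast
  have "P \<in> pfvs.span E" if P: "P \<in> cl_polys n k" for P
  proof -
    obtain c where c: "P = (\<lambda>x S. \<Sum>\<alpha>\<in>multi_idx n k. c \<alpha> S * complex_of_real (\<Prod>i\<in>{1..n}. x i ^ \<alpha> i))"
      using P unfolding cl_polys_def hom_poly_def by blast
    let ?e = "\<lambda>\<alpha> S x. cl_smul (complex_of_real (\<Prod>i\<in>{1..n}. x i ^ \<alpha> i)) (blade S)"
    have "P = (\<Sum>S\<in>Pow {1..n}. \<Sum>\<alpha>\<in>multi_idx n k. pscale (c \<alpha> S) (?e \<alpha> S))"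
    proof (intro ext)
      fix x T
      have "(\<Sum>S\<in>Pow {1..n}. \<Sum>\<alpha>\<in>multi_idx n k. pscale (c \<alpha> S) (?e \<alpha> S)) x T
          = (\<Sum>S\<in>Pow {1..n}. if S = T then P x T else 0)"
        unfolding sum_pf_apply sum_mv_apply
      proof (rule sum.cong[OF refl])
        fix S
        show "(\<Sum>\<alpha>\<in>multi_idx n k. pscale (c \<alpha> S) (?e \<alpha> S) x T) = (if S = T then P x T else 0)"
          by (cases "S = T") (simp_all add: c pscale_apply cl_smul_def blade_def)
      qed
      also have "\<dots> = (if T \<in> Pow {1..n} then P x T else 0)" by (rule sum.delta) simp
      also have "\<dots> = P x T" using P by (auto simp: cl_polys_def Cl_def)
      finally show "P x T = (\<Sum>S\<in>Pow {1..n}. \<Sum>\<alpha>\<in>multi_idx n k. pscale (c \<alpha> S) (?e \<alpha> S)) x T" by simp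
    qed
    moreover have "pscale (c \<alpha> S) (?e \<alpha> S) \<in> pfvs.span E" if "\<alpha> \<in> multi_idx n k" "S \<in> Pow {1..n}" for \<alpha> S
    proof (rule pfvs.span_scale[OF pfvs.span_base])
      show "?e \<alpha> S \<in> E" unfolding E_def by (rule image_eqI[of _ _ "(\<alpha>, S)"]) (use that in simp_all)
    qed
    ultimately show ?thesis by (simp only:) (intro pfvs.span_sum)
  qed
  then show ?thesis using fE by blast
qed

lemma subspace_finite_basis:
  assumes "psubspace U" "U \<subseteq> cl_polys n k"
  shows "\<exists>B. finite B \<and> B \<subseteq> U \<and> pfvs.span B = U"
proof -
  obtain E where E: "finite E" "cl_polys n k \<subseteq> pfvs.span E" using cl_polys_span_finite by blast
  obtain B where B: "B \<subseteq> U" "pfvs.independent B" "U \<subseteq> pfvs.span B"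
    by (rule pfvs.maximal_independent_subset[of U])
  have "finite B" using pfvs.independent_span_bound[OF E(1) B(2)] B(1) assms(2) E(2) by blast
  moreover have "pfvs.span B = U"
    using B(1,3) pfvs.span_minimal[OF B(1)] assms(1)[unfolded psubspace_iff_subspace] by blast
  ultimately show ?thesis using B(1) by blast
qed

text \<open>A single unit vector acts as an isometric involution, hence as a self-adjoint map, so
  the complement of an invariant subspace is invariant.\<close>

lemma orthogonal_complement:
  assumes U: "psubspace U" "U \<subseteq> V" "U \<noteq> V" "reflect_inv n n U" and V: "V = monog n s k"
  shows "\<exists>W. psubspace W \<and> W \<subseteq> V \<and> W \<noteq> {0} \<and> reflect_inv n n W \<and> W \<inter> U \<subseteq> {0}"
proof -
  let ?W = "{q \<in> V. \<forall>p\<in>U. fischer n k q p = 0}"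
  have VH: "V \<subseteq> cl_polys n k" using monog_cl_polys V by blast
  have UH: "U \<subseteq> cl_polys n k" using U(2) VH by blast
  obtain B where B: "finite B" "B \<subseteq> U" "pfvs.span B = U" using subspace_finite_basis[OF U(1) UH] by blast
  obtain v where v: "v \<in> V" "v \<notin> U" using U(2,3) by blast
  have "\<exists>w\<in>pfvs.span B. \<forall>b\<in>pfvs.span B. fischer n k (v - w) b = 0"
    by (rule projection_exists[OF B(1)]) (use B(2) UH VH v in auto)
  then obtain w where w: "w \<in> U" "\<And>b. b \<in> U \<Longrightarrow> fischer n k (v - w) b = 0" unfolding B(3) by blast
  note pV = psubspaceD[OF psubspace_monog[of n s k], folded V]
  have "v - w \<in> ?W" using pV(4)[OF v(1)] w U(2) by blast
  moreover have "v - w \<noteq> 0" using v(2) w(1) by auto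
  ultimately have 1: "?W \<noteq> {0}" by blast
  have 2: "psubspace ?W"
    unfolding psubspace_iff_subspace pfvs.subspace_def
    using pV fischer_add fischer_pscale fischer_zero VH by (auto simp: subset_iff)
  have 3: "reflect_inv n n ?W"
    unfolding reflect_inv_def
  proof (intro ballI)
    fix u q assume u: "u \<in> unit_vecs n" and q: "q \<in> ?W"
    have "H_act n [u] q \<in> V" using q u monog_H_act V by blast
    moreover have "fischer n k (H_act n [u] q) p = 0" if p: "p \<in> U" for p
    proof -
      have Hp: "H_act n [u] p \<in> U" using U(4) u p unfolding reflect_inv_def by blast
      have pH: "p \<in> cl_polys n k" using p UH by blast
      have "fischer n k (H_act n [u] q) (H_act n [u] (H_act n [u] p)) = fischer n k q (H_act n [u] p)"
        by (rule fischer_H_act[OF u]) (use q VH Hp UH in auto)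
      then show ?thesis using q Hp unfolding H_act_involution[OF pH u] by simp
    qed
    ultimately show "H_act n [u] q \<in> ?W" by blast
  qed
  have 4: "?W \<inter> U \<subseteq> {0}" using fischer_definite UH by blast
  show ?thesis using 1 2 3 4 by (intro exI[of _ ?W]) blast
qed

section \<open>Irreducibility\<close>

text \<open>Unlike \<open>irred\<close> it admits the zero space, so the induction on the dimension
  can run over all grades and degrees without deciding which of the spaces vanish.\<close>

definition pin_irred :: "nat \<Rightarrow> nat \<Rightarrow> nat \<Rightarrow> bool" where
  "pin_irred n s k \<longleftrightarrow> (\<forall>U. psubspace U \<longrightarrow> U \<subseteq> monog n s k \<longrightarrow> reflect_inv n n U \<longrightarrow> U = {0} \<or> U = monog n s k)"

text \<open>The unit vector is the normalised sum of \<open>y\<close> and \<open>r e_m\<close>, which vanishes only if \<open>y\<close> is on the axis.\<close>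
lemma rotate_to_axis:
  assumes i: "i \<in> {1..m-1}" "y i \<noteq> 0"
  obtains u r where "u \<in> unit_vecs m" "\<And>j. j \<in> {1..m} \<Longrightarrow> reflect m u (\<lambda>j. if j = m then r else 0) j = y j"
proof -
  define r where "r = sqrt (inner_up m y y)"
  define x where "x = (\<lambda>j. if j = m then r else (0::real))"
  \<comment> \<open>Cut off outside 1..m, as \<open>unit_vecs\<close> demands.\<close>
  define z where "z = (\<lambda>j. if j \<in> {1..m} then y j + x j else 0)"
  define D where "D = inner_up m z z"
  have m: "m \<in> {1..m}" "i \<in> {1..m}" "i \<noteq> m" using i(1) by auto
  have pos: "0 \<le> inner_up m y y" unfolding inner_up_def by (rule sum_nonneg) simp
  then have rr: "r * r = inner_up m y y" by (simp add: r_def)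
  have zx: "inner_up m z x = (y m + r) * r"
  proof -
    have "inner_up m z x = (\<Sum>j\<in>{1..m}. if j = m then (y m + r) * r else 0)"
      unfolding inner_up_def by (rule sum.cong) (auto simp: z_def x_def)
    then show ?thesis using m(1) by (simp only: sum.delta[OF finite_atLeastAtMost] if_True)
  qed
  have zy: "inner_up m z y = r * r + y m * r"
  proof -
    have "inner_up m z y = (\<Sum>j\<in>{1..m}. y j * y j + (if j = m then y m * r else 0))"
      unfolding inner_up_def by (rule sum.cong) (auto simp: z_def x_def algebra_simps)
    then show ?thesis unfolding sum.distrib using m(1) rr by (simp only: sum.delta[OF finite_atLeastAtMost] if_True inner_up_def)
  qed
  have D2: "D = 2 * ((y m + r) * r)"
  proof -
    have "D = inner_up m z y + inner_up m z x"
      unfolding D_def inner_up_def sum.distrib[symmetric] by (rule sum.cong) (auto simp: z_def algebra_simps)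
    then show ?thesis unfolding zx zy by (simp add: algebra_simps)
  qed
  have "y i * y i \<le> D"
  proof -
    have "z i * z i \<le> (\<Sum>j\<in>{1..m}. z j * z j)" by (rule member_le_sum) (use m in auto)
    moreover have "z i = y i" using m by (simp add: z_def x_def)
    ultimately show ?thesis by (simp add: D_def inner_up_def)
  qed
  moreover have "0 < y i * y i" using i(2) by (metis not_real_square_gt_zero)
  ultimately have Dpos: "0 < D" by linarith
  define u where "u = (\<lambda>j. z j / sqrt D)"
  have sD: "sqrt D * sqrt D = D" using Dpos by simp
  have u: "u \<in> unit_vecs m"
  proof -
    have "(\<Sum>j\<in>{1..m}. (u j)^2) = (\<Sum>j\<in>{1..m}. z j * z j / D)"
      unfolding u_def by (rule sum.cong) (use Dpos in \<open>simp_all add: power2_eq_square\<close>)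
    also have "\<dots> = 1" unfolding sum_divide_distrib[symmetric] using Dpos by (simp only: D_def inner_up_def) simp
    finally show ?thesis unfolding unit_vecs_def by (auto simp: u_def z_def)
  qed
  have ux: "inner_up m u x = D / 2 / sqrt D"
  proof -
    have "inner_up m u x = inner_up m z x / sqrt D" unfolding inner_up_def u_def sum_divide_distrib by (rule sum.cong) simp_all
    then show ?thesis unfolding zx D2 by simp
  qed
  have "reflect m u x j = y j" if j: "j \<in> {1..m}" for j
  proof -
    have "reflect m u x j = 2 * (D / 2 / sqrt D) * (z j / sqrt D) - x j"
      unfolding reflect_def if_P[OF j] ux by (simp add: u_def)
    also have "\<dots> = D / (sqrt D * sqrt D) * z j - x j" by simp
    also have "\<dots> = z j - x j" unfolding sD using Dpos by simp
    finally show ?thesis using j by (simp add: z_def)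
  qed
  then show ?thesis using that[OF u] unfolding x_def by blast
qed

lemma axis_vanishing:
  assumes m3: "3 \<le> m" and s: "1 \<le> s" "s \<le> m - 1"
    and U: "U \<subseteq> monog m s k" "reflect_inv m m U"
    and ax: "\<And>F x. F \<in> U \<Longrightarrow> (\<And>i. i \<in> {1..m-1} \<Longrightarrow> x i = 0) \<Longrightarrow>
       cl_mult m (cl_e m) (F x) = cl_smul (- ((-1)^s)) (cl_mult m (F x) (cl_e m))"
    and F: "F \<in> U"
  shows "F = 0"
proof -
  have mm: "m \<in> {1..m}" using m3 by auto
  have axv: "cl_mult m (cl_vec m x) (G x) = cl_smul (- ((-1)^s)) (cl_mult m (G x) (cl_vec m x))"
    if G: "G \<in> U" and x: "\<And>i. i \<in> {1..m-1} \<Longrightarrow> x i = 0" for G x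
  proof -
    have "cl_vec m x = cl_vec m (\<lambda>j. x m * (if j = m then 1 else 0))"
    proof (rule cl_vec_cong)
      fix j assume "j \<in> {1..m}"
      then show "x j = x m * (if j = m then 1 else 0)" using x[of j] by (cases "j = m") auto
    qed
    also have "\<dots> = cl_smul (complex_of_real (x m)) (cl_e m)"
      unfolding cl_e_eq_vec[OF mm] by (intro ext) (simp add: cl_vec_def cl_smul_def)
    finally have v: "cl_vec m x = cl_smul (complex_of_real (x m)) (cl_e m)" .
    have "cl_mult m (cl_e m) (G x) = cl_smul (- ((-1)^s)) (cl_mult m (G x) (cl_e m))" by (rule ax[OF G]) (rule x)
    then show ?thesis unfolding v cl_mult_smul_left cl_mult_smul_right by (simp only: cl_smul_smul mult.commute)
  qed
  have all: "cl_mult m (cl_vec m y) (F y) = cl_smul (complex_of_real (- 1 * (-1)^s)) (cl_mult m (F y) (cl_vec m y))" for y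
  proof (cases "\<forall>i\<in>{1..m-1}. y i = 0")
    case True
    then show ?thesis using axv[OF F, of y] by simp
  next
    case False
    then obtain i where "i \<in> {1..m-1}" "y i \<noteq> 0" by blast
    then obtain u r where u: "u \<in> unit_vecs m" and yr: "\<And>j. j \<in> {1..m} \<Longrightarrow> reflect m u (\<lambda>j. if j = m then r else 0) j = y j"
      by (rule rotate_to_axis[of i m y]) blast
    let ?x = "\<lambda>j. if j = m then r else (0::real)"
    let ?G = "H_act m [u] F"
    have G: "?G \<in> U" using U(2) u F unfolding reflect_inv_def by blast
    have h: "hom_poly m k F" "\<And>x. F x \<in> Cl m" using U(1) F monogD by blast+
    have Fy: "F (reflect m u ?x) = F y" by (rule hom_poly_cong[OF h(1)]) (rule yr)
    have Gx: "?G ?x = conjug m u (F y)" unfolding H_act_single[OF u] Fy ..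
    have "cl_vec m (reflect m u ?x) = cl_vec m y" by (rule cl_vec_cong) (rule yr)
    then have "conjug m u (cl_vec m ?x) = cl_vec m y" unfolding conjug_vec[OF u] .
    then have vx: "cl_vec m ?x = conjug m u (cl_vec m y)" using conjug_conjug[OF u, of "cl_vec m ?x"] by simp
    have xi: "?x i = 0" if "i \<in> {1..m-1}" for i using that by auto
    have "cl_mult m (cl_vec m ?x) (?G ?x) = cl_smul (- ((-1)^s)) (cl_mult m (?G ?x) (cl_vec m ?x))"
      by (rule axv[OF G]) (rule xi)
    then have "conjug m u (cl_mult m (cl_vec m y) (F y)) = conjug m u (cl_smul (- ((-1)^s)) (cl_mult m (F y) (cl_vec m y)))"
      unfolding Gx vx conjug_mult[OF u] conjug_smul .
    then have "conjug m u (conjug m u (cl_mult m (cl_vec m y) (F y))) = conjug m u (conjug m u (cl_smul (- ((-1)^s)) (cl_mult m (F y) (cl_vec m y))))"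
      by (rule arg_cong)
    then show ?thesis by (simp add: conjug_conjug[OF u])
  qed
  \<comment> \<open>The constant of \<open>monog_vanishing\<close> for c = -1 is 2 (m + k - s),
    positive because s < m.\<close>
  have "real m + 2 * real k - - 1 * (real m - 2 * real s) \<noteq> 0"
  proof -
    have "s < m" using s m3 by linarith
    then have "real s < real m" "0 \<le> real k" by simp_all
    then have "0 < real m + 2 * real k - - 1 * (real m - 2 * real s)" by (simp only: mult_minus1 diff_minus_eq_add)
    then show ?thesis by (rule less_imp_neq[THEN not_sym])
  qed
  from monog_vanishing[OF _ all this] show ?thesis using U(1) F by blast
qed

text \<open>The equation says that h depends on x_1 + \<tau> x_2 alone. The derivative in x_1
  satisfies it too, one degree lower, and Euler's identity recovers h from that derivative.\<close>

lemma spoly_pde: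
  assumes t: "\<tau> * \<tau> = -1"
  shows "spoly 2 k h \<Longrightarrow> pds 2 h = (\<lambda>x. \<tau> * pds 1 h x) \<Longrightarrow> \<exists>c. \<forall>x. h x = c * (complex_of_real (x 1) + \<tau> * complex_of_real (x 2)) ^ k"
proof (induction k arbitrary: h)
  case 0
  have "h x = h (\<lambda>i. 0)" for x using spoly_scale[OF 0(1), of 0 x] by simp
  then show ?case by (intro exI[of _ "h (\<lambda>i. 0)"]) simp
next
  case (Suc k)
  have p1: "spoly 2 k (pds 1 h)" using spoly_pds[OF Suc.prems(1), of 1] by simp
  have "pds 2 (pds 1 h) = pds 1 (pds 2 h)" using pds_commute[OF Suc.prems(1), of 2 1] by simp
  also have "\<dots> = (\<lambda>x. \<tau> * pds 1 (pds 1 h) x)"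
    unfolding Suc.prems(2) by (rule has_pds_pds[OF has_pds_cmult[OF spoly_has_pds[OF p1]]])
  finally obtain c where c: "\<And>x. pds 1 h x = c * (complex_of_real (x 1) + \<tau> * complex_of_real (x 2)) ^ k"
    using Suc.IH[OF p1] by blast
  have "of_nat (Suc k) * h x = c * (complex_of_real (x 1) + \<tau> * complex_of_real (x 2)) ^ Suc k" for x
  proof -
    have I: "{1..2} = {1, 2::nat}" by auto
    have "of_nat (Suc k) * h x = complex_of_real (x 1) * pds 1 h x + complex_of_real (x 2) * pds 2 h x"
      unfolding spoly_Euler[OF Suc.prems(1), of x, symmetric] I by simp
    also have "\<dots> = c * (complex_of_real (x 1) + \<tau> * complex_of_real (x 2)) ^ Suc k"
      unfolding Suc.prems(2) c by (simp add: algebra_simps)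
    finally show ?thesis .
  qed
  then have "h x = c / of_nat (Suc k) * (complex_of_real (x 1) + \<tau> * complex_of_real (x 2)) ^ Suc k" for x
    by (simp add: field_simps del: of_nat_Suc power_Suc)
  then show ?case by blast
qed

text \<open>With F_1 and F_2 the coefficients of e_1 and e_2, the combinations F_1 - \<tau> F_2 for
  \<tau> = i and \<tau> = -i decouple the Dirac system into two equations solved by
  \<open>spoly_pde\<close>.\<close>

lemma monog_2_1:
  assumes F: "F \<in> monog 2 1 k"
  shows "\<exists>a b. F = pscale a (weight_vec 2 1 k 1) + pscale b (weight_vec 2 1 k (-1))"
proof -
  note FF = monogD[OF F]
  let ?f = "\<lambda>S x. F x S"
  have j: "(1::nat) \<in> {1..2}" "(2::nat) \<in> {1..2}" by auto
  have I: "{1..2} = {1, 2::nat}" by auto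
  have d: "cl_mult 2 (cl_e 1) (pd 1 F x) T + cl_mult 2 (cl_e 2) (pd 2 F x) T = 0" for x T
    using fun_cong[OF FF(4)[of x], of T] unfolding dirac_eq_sum I by simp
  have sets: "sym_diff {1} {} = {1::nat}" "sym_diff {2} {} = {2::nat}" "sym_diff {1} {1,2} = {2::nat}" "sym_diff {2} {1,2} = {1::nat}" by auto
  have s12: "cl_sign {1} {2} = 1" "cl_sign {2} {1} = -1" by (simp_all add: cl_sign_prod)
  have e1: "pds 1 (?f {1}) x + pds 2 (?f {2}) x = 0" for x
    using d[of x "{}"] unfolding cl_e_mult_apply[OF j(1) empty_subsetI] cl_e_mult_apply[OF j(2) empty_subsetI] sets
    by (simp add: pd_pds) (metis add.inverse_inverse add_eq_0_iff)?
  have sub: "{1,2} \<subseteq> {1..2::nat}" by auto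
  have e2: "pds 1 (?f {2}) x - pds 2 (?f {1}) x = 0" for x
    using d[of x "{1,2}"] unfolding cl_e_mult_apply[OF j(1) sub] cl_e_mult_apply[OF j(2) sub] sets s12
    by (simp add: pd_pds)
  have spoly: "spoly 2 k (?f S)" for S by (rule hom_polyD[OF FF(1)])
  have pa: "pds j (\<lambda>x. F x {1} + c * F x {2}) = (\<lambda>x. pds j (?f {1}) x + c * pds j (?f {2}) x)" for c j
    by (rule has_pds_pds[OF has_pds_add[OF spoly_has_pds[OF spoly] has_pds_cmult[OF spoly_has_pds[OF spoly]]]])
  have ex: "\<exists>a. \<forall>x. F x {1} + - \<tau> * F x {2} = a * (complex_of_real (x 1) + \<tau> * complex_of_real (x 2)) ^ k" if t: "\<tau> * \<tau> = -1" for \<tau>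
  proof (rule spoly_pde[OF t])
    show "spoly 2 k (\<lambda>x. F x {1} + - \<tau> * F x {2})" by (intro spoly_add spoly_smul spoly)
    show "pds 2 (\<lambda>x. F x {1} + - \<tau> * F x {2}) = (\<lambda>x. \<tau> * pds 1 (\<lambda>x. F x {1} + - \<tau> * F x {2}) x)"
    proof
      fix x
      have "\<tau> * (- \<tau> * q) = q" for q using t by (metis minus_mult_minus mult.assoc mult_1 mult_minus1 mult_minus_right)
      then have "\<tau> * (pds 1 (?f {1}) x + - \<tau> * pds 1 (?f {2}) x) = \<tau> * pds 1 (?f {1}) x + pds 1 (?f {2}) x"
        by (simp only: distrib_left)
      also have "\<dots> = pds 2 (?f {1}) x + - \<tau> * pds 2 (?f {2}) x"
      proof -
        have "pds 1 (?f {2}) x = pds 2 (?f {1}) x" "pds 1 (?f {1}) x = - pds 2 (?f {2}) x"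
          using e2[of x] e1[of x] by (simp_all add: eq_neg_iff_add_eq_0)
        then show ?thesis by simp
      qed
      finally show "pds 2 (\<lambda>x. F x {1} + - \<tau> * F x {2}) x = \<tau> * pds 1 (\<lambda>x. F x {1} + - \<tau> * F x {2}) x"
        unfolding pa by simp
    qed
  qed
  obtain a where a: "\<And>x. F x {1} + - \<i> * F x {2} = a * (complex_of_real (x 1) + \<i> * complex_of_real (x 2)) ^ k"
    using ex[of "\<i>"] by auto
  obtain b where b: "\<And>x. F x {1} + - (- \<i>) * F x {2} = b * (complex_of_real (x 1) + (- \<i>) * complex_of_real (x 2)) ^ k"
    using ex[of "- \<i>"] by auto
  have W: "weight_vec 2 1 k \<sigma> x = cl_smul ((complex_of_real (x 1) + \<sigma> * \<i> * complex_of_real (x 2)) ^ k) (isotropic 2 \<sigma>)" for \<sigma> x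
  proof -
    have b1: "blade {3..1+1} = cl_one" by (intro ext) (simp add: blade_def cl_one_def)
    have "isotropic 2 \<sigma> \<in> Cl 2" by (simp add: isotropic_def cl_e_in_Cl)
    then show ?thesis unfolding weight_vec_def b1 by (simp only: cl_mult_one_right)
  qed
  have "F x S = (pscale (a / 2) (weight_vec 2 1 k 1) + pscale (b / 2) (weight_vec 2 1 k (-1))) x S" for x S
  proof -
    have R: "(pscale (a / 2) (weight_vec 2 1 k 1) + pscale (b / 2) (weight_vec 2 1 k (-1))) x S
      = (F x {1} + - \<i> * F x {2}) / 2 * isotropic 2 1 S + (F x {1} + - (- \<i>) * F x {2}) / 2 * isotropic 2 (-1) S"
      unfolding a b by (simp only: plus_fun_apply pscale_apply W cl_smul_def) (simp add: mult.assoc)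
    have "(1::nat) \<noteq> 2" by simp
    then have "{1} \<noteq> {2::nat}" by blast
    consider "S = {1}" | "S = {2}" | "S \<noteq> {1}" "S \<noteq> {2}" by blast
    then show ?thesis
    proof cases
      case 1
      then show ?thesis unfolding R using \<open>{1} \<noteq> {2::nat}\<close> by (simp add: isotropic_def cl_e_def cl_smul_def field_simps)
    next
      case 2
      then show ?thesis unfolding R using \<open>{1} \<noteq> {2::nat}\<close> by (simp add: isotropic_def cl_e_def cl_smul_def field_simps)
    next
      case 3
      have "F x S = 0"
      proof (rule ccontr)
        assume "F x S \<noteq> 0"
        then have "S \<subseteq> {1..2}" "card S = 1" using FF(2)[of x] by (auto simp: Lam_def)
        then obtain q where "S = {q}" "q \<in> {1..2}" by (metis card_1_singletonE insert_subset)
        then show False using 3 unfolding I by blast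
      qed
      then show ?thesis unfolding R using 3 by (simp add: isotropic_def cl_e_def cl_smul_def)
    qed
  qed
  then show ?thesis by blast
qed

text \<open>The space is spanned by the two weight vectors. A product of two reflections acts on
  them by conjugate scalars, so a suitable one separates them inside U, and a single reflection
  exchanges them.\<close>

lemma pin_irred_2_1: "pin_irred 2 1 k"
  unfolding pin_irred_def
proof (intro allI impI)
  fix U assume U: "psubspace U" "U \<subseteq> monog 2 1 k" "reflect_inv 2 2 U"
  note sub = psubspaceD[OF U(1)]
  let ?P = "weight_vec 2 1 k 1" and ?M = "weight_vec 2 1 k (-1)"
  have n2: "(2::nat) \<le> 2" "(1::nat) \<le> 1" "(1::nat) \<le> 2 - 1" by auto
  have WM: "?P \<in> monog 2 1 k" "?M \<in> monog 2 1 k" by (rule weight_vec_monog[OF n2], simp)+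
  have u: "circ_vec \<alpha> \<in> unit_vecs 2" for \<alpha> by (rule circ_vec_unit) simp
  define w where "w = 2 * k + 2"
  have cl_polys: "H_act 2 [circ_vec \<alpha>] ?P = pscale (cis \<alpha> ^ w) ?M" for \<alpha> using H_weight_vec[OF n2, of \<alpha> k] by (simp add: w_def)
  have HM: "H_act 2 [circ_vec \<alpha>] ?M = pscale (inverse (cis \<alpha> ^ w)) ?P" for \<alpha>
  proof -
    have "?P = pscale (cis \<alpha> ^ w) (H_act 2 [circ_vec \<alpha>] ?M)"
      using H_act_involution[OF monog_cl_polys[OF WM(1)] u, of \<alpha>] unfolding cl_polys H_act_pscale[OF u] by simp
    then have "pscale (inverse (cis \<alpha> ^ w)) ?P = pscale (inverse (cis \<alpha> ^ w)) (pscale (cis \<alpha> ^ w) (H_act 2 [circ_vec \<alpha>] ?M))" by (rule arg_cong)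
    then show ?thesis unfolding pscale_pscale by simp
  qed
  have Hin: "H_act 2 [circ_vec \<alpha>] F \<in> U" if "F \<in> U" for F \<alpha> using U(3) u that unfolding reflect_inv_def by blast
  \<comment> \<open>This angle makes the w-th power of cis equal to i, so the reflections at the
    angles 0 and \<beta>, composed, multiply the weight vectors by -i and i: two different
    eigenvalues.\<close>
  define \<beta> where "\<beta> = pi / 2 / real w"
  have cb: "cis \<beta> ^ w = \<i>"
  proof -
    have "real w \<noteq> 0" by (simp add: w_def)
    then have b: "real w * \<beta> = pi / 2" by (simp add: \<beta>_def)
    show ?thesis unfolding Complex.DeMoivre b by (simp add: complex_eq_iff)
  qed
  have c0: "cis 0 ^ w = 1" by simp
  have split: "pscale (2 * a) ?P \<in> U \<and> pscale (2 * b) ?M \<in> U" if F: "pscale a ?P + pscale b ?M \<in> U" for a b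
  proof -
    let ?F = "pscale a ?P + pscale b ?M"
    have "H_act 2 [circ_vec \<beta>] (H_act 2 [circ_vec 0] ?F) = pscale (- \<i> * a) ?P + pscale (\<i> * b) ?M"
      unfolding H_act_add[OF u] H_act_pscale[OF u] cl_polys HM pscale_pscale c0 cb by (simp add: mult.commute)
    then have G: "pscale (- \<i> * a) ?P + pscale (\<i> * b) ?M \<in> U" using Hin[OF Hin[OF F], of \<beta> 0] by simp
    have "?F + pscale \<i> (pscale (- \<i> * a) ?P + pscale (\<i> * b) ?M) = pscale (2 * a) ?P"
      unfolding pscale_add pscale_pscale by (intro ext) (simp add: pscale_apply cl_smul_def)
    moreover have "?F - pscale \<i> (pscale (- \<i> * a) ?P + pscale (\<i> * b) ?M) = pscale (2 * b) ?M"
      unfolding pscale_add pscale_pscale by (intro ext) (simp add: pscale_apply cl_smul_def)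
    ultimately show ?thesis using sub(2)[OF F sub(3)[OF G, of \<i>]] sub(4)[OF F sub(3)[OF G, of \<i>]] by simp
  qed
  have unscale: "Q \<in> U" if "pscale c Q \<in> U" "c \<noteq> 0" for c Q
    using sub(3)[OF that(1), of "inverse c"] that(2) by (simp add: pscale_pscale)
  show "U = {0} \<or> U = monog 2 1 k"
  proof (cases "U \<subseteq> {0}")
    case True
    then show ?thesis using sub(1) by blast
  next
    case False
    then obtain F where F: "F \<in> U" "F \<noteq> 0" by blast
    obtain a b where ab: "F = pscale a ?P + pscale b ?M" using monog_2_1[of F k] F(1) U(2) by blast
    have "?P \<in> U \<or> ?M \<in> U"
    proof (rule ccontr)
      assume n: "\<not> ?thesis"
      have "pscale (2 * a) ?P \<in> U" "pscale (2 * b) ?M \<in> U" using split[of a b] F(1) unfolding ab by blast+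
      then have "2 * a = 0" "2 * b = 0" using unscale n by blast+
      then have "F = 0" unfolding ab by simp
      then show False using F(2) by blast
    qed
    then have "?P \<in> U \<and> ?M \<in> U"
    proof
      assume p: "?P \<in> U"
      have "?M \<in> U" using Hin[OF p, of 0] unfolding cl_polys c0 by simp
      with p show ?thesis by blast
    next
      assume p: "?M \<in> U"
      have "?P \<in> U" using Hin[OF p, of 0] unfolding HM c0 by simp
      with p show ?thesis by blast
    qed
    then have "monog 2 1 k \<subseteq> U" using monog_2_1 sub(2,3) by (metis subsetI)
    then show ?thesis using U(2) by blast
  qed
qed

lemma line_irreducible:
  assumes U: "psubspace U" "U \<subseteq> V" and V: "\<And>P. P \<in> V \<Longrightarrow> \<exists>c. P = pscale c Q"
  shows "U = {0} \<or> U = V"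
proof (cases "U \<subseteq> {0}")
  case True
  then show ?thesis using psubspaceD(1)[OF U(1)] by blast
next
  case False
  then obtain P where P: "P \<in> U" "P \<noteq> 0" by blast
  then obtain c where c: "P = pscale c Q" using V U(2) by blast
  then have c0: "c \<noteq> 0" using P(2) by auto
  have Q: "Q \<in> U" using psubspaceD(3)[OF U(1) P(1), of "inverse c"] c0 unfolding c pscale_pscale by simp
  have "V \<subseteq> U" using V psubspaceD(3)[OF U(1) Q] by (metis subsetI)
  then show ?thesis using U(2) by blast
qed

text \<open>In positive degree these grades are zero; in degree 0 every element is a multiple of one
  constant blade.\<close>

lemma pin_irred_extreme:
  assumes s: "s = 0 \<or> s = n"
  shows "pin_irred n s k"
  unfolding pin_irred_def
proof (intro allI impI)
  fix U assume U: "psubspace U" "U \<subseteq> monog n s k" "reflect_inv n n U"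
  show "U = {0} \<or> U = monog n s k"
  proof (rule line_irreducible[OF U(1,2)])
    let ?S = "if s = 0 then {} else {1..n}"
    fix P assume P: "P \<in> monog n s k"
    show "\<exists>c. P = pscale c (\<lambda>x. blade ?S)"
    proof (cases "k = 0")
      case False
      then have "P = 0" using s P monog_0_vanish[of P n k] monog_n_vanish[of P n k] by auto
      then show ?thesis by (intro exI[of _ 0]) simp
    next
      case True
      have const: "P x = P (\<lambda>i. 0)" for x using hom_poly_scale[OF monogD(1)[OF P], of 0 x] True by simp
      have "P x T = pscale (P (\<lambda>i. 0) ?S) (\<lambda>x. blade ?S) x T" for x T
      proof (cases "T = ?S")
        case True
        then show ?thesis unfolding const[of x] by (simp only: pscale_apply cl_smul_def blade_def) simp
      next
        case False
        have "P x T = 0"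
        proof (rule ccontr)
          assume "P x T \<noteq> 0"
          then have T: "T \<subseteq> {1..n}" "card T = s" using monogD(2)[OF P, of x] by (auto simp: Lam_def)
          have fT: "finite T" using T(1) finite_subset by blast
          from s have "T = ?S"
          proof
            assume "s = 0"
            then show ?thesis using T fT by simp
          next
            assume "s = n"
            moreover from this have "T = {1..n}" using T card_subset_eq[of "{1..n}" T] by simp
            ultimately show ?thesis by simp
          qed
          then show False using False by blast
        qed
        then show ?thesis using False by (simp only: pscale_apply cl_smul_def blade_def if_False mult_zero_right)
      qed
      then show ?thesis by blast
    qed
  qed
qed

text \<open>Conjugation by a unit vector orthogonal to \<open>e_m\<close> maps \<open>e_m\<close> to \<open>- e_m\<close>; hence the sign.\<close>
definition twist :: "nat \<Rightarrow> bool \<times> nat \<Rightarrow> complex" where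
  "twist k i = (if fst i = even (k - snd i) then -1 else 1)"

lemma twist_sq [simp]: "twist k i * twist k i = 1" by (simp add: twist_def)
lemma twist_nz [simp]: "twist k i \<noteq> 0" by (simp add: twist_def)

section \<open>One restriction step, from m to m - 1\<close>

locale restriction =
  fixes m s k :: nat
  assumes m3: "3 \<le> m" and s1: "1 \<le> s" and sm: "s \<le> m - 1"
begin

abbreviation "V \<equiv> gt_embed m s k"
abbreviation "M \<equiv> gt_module m s"
abbreviation "W i \<equiv> V i ` M i"

lemma V_add: "P \<in> M i \<Longrightarrow> Q \<in> M i \<Longrightarrow> V i (P + Q) = V i P + V i Q"
  using gt_embed_add[OF m3 s1 sm, of P i Q k] by (intro ext) (simp add: plus_fun_def[where 'b = mv])

lemma V_pscale: "P \<in> M i \<Longrightarrow> V i (pscale c P) = pscale c (V i P)"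
  by (rule ext) (simp only: pscale_def gt_embed_smul[OF m3 s1 sm])

lemma M_sub: "psubspace (M i)" by (rule psubspace_monog)
lemmas M_subD = psubspaceD[OF M_sub]

lemma V_zero: "V i 0 = 0"
  using V_pscale[OF M_subD(1), of i 0] by simp

lemma V_diff: "P \<in> M i \<Longrightarrow> Q \<in> M i \<Longrightarrow> V i (P - Q) = V i P - V i Q"
  using V_add[OF M_subD(4), of P i Q Q] by simp

lemma V_inj: "i \<in> gt_index k \<Longrightarrow> inj_on (V i) (M i)"
proof (rule inj_onI)
  fix P Q assume i: "i \<in> gt_index k" and PQ: "P \<in> M i" "Q \<in> M i" "V i P = V i Q"
  have "V i (P - Q) = (\<lambda>x. 0)" unfolding V_diff[OF PQ(1,2)] PQ(3) by (intro ext) simp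
  from gt_embed_injective[OF m3 s1 sm i M_subD(4)[OF PQ(1,2)] this]
  have "(P - Q) x = 0" for x by (rule fun_cong)
  then show "P = Q" by (intro ext) (metis minus_apply eq_iff_diff_eq_0 zero_fun_apply)
qed

lemma V_H:
  assumes "P \<in> M i" "u \<in> unit_vecs (m - 1)"
  shows "H_act m [u] (V i P) = pscale (twist k i) (V i (H_act (m - 1) [u] P))"
  by (rule ext) (simp only: pscale_apply gt_embed_def twist_def gt_map_equivariant[OF m3 assms])

lemma W_sub: "psubspace (W i)"
  unfolding psubspace_iff_subspace pfvs.subspace_def
proof (intro conjI ballI allI)
  have "V i 0 \<in> W i" by (rule imageI) (rule M_subD(1))
  then show "0 \<in> W i" unfolding V_zero .
next
  fix x y assume "x \<in> W i" "y \<in> W i"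
  then obtain P Q where P: "P \<in> M i" "Q \<in> M i" "x = V i P" "y = V i Q" by blast
  have "V i (P + Q) \<in> W i" by (rule imageI) (rule M_subD(2)[OF P(1,2)])
  then show "x + y \<in> W i" unfolding V_add[OF P(1,2)] P(3,4) .
next
  fix c x assume "x \<in> W i"
  then obtain P where P: "P \<in> M i" "x = V i P" by blast
  have "V i (pscale c P) \<in> W i" by (rule imageI) (rule M_subD(3)[OF P(1)])
  then show "pscale c x \<in> W i" unfolding V_pscale[OF P(1)] P(2) .
qed

lemma W_monog: "i \<in> gt_index k \<Longrightarrow> W i \<subseteq> monog m s k"
  using gt_embed_monog[OF m3 s1 sm] by blast

lemma H_M: "P \<in> M i \<Longrightarrow> u \<in> unit_vecs (m - 1) \<Longrightarrow> H_act (m - 1) [u] P \<in> M i"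
  by (rule monog_H_act)

lemma W_inv: "reflect_inv m (m - 1) (W i)"
  unfolding reflect_inv_def
proof (intro ballI)
  fix u x assume u: "u \<in> unit_vecs (m - 1)" and "x \<in> W i"
  then obtain P where P: "P \<in> M i" "x = V i P" by blast
  show "H_act m [u] x \<in> W i"
    unfolding P(2) V_H[OF P(1) u] by (rule psubspaceD(3)[OF W_sub imageI[OF H_M[OF P(1) u]]])
qed

lemma W_direct:
  assumes "\<And>i. i \<in> gt_index k \<Longrightarrow> p i \<in> W i" "sum p (gt_index k) = 0" "i \<in> gt_index k"
  shows "p i = 0"
proof -
  have "\<forall>i\<in>gt_index k. \<exists>P\<in>M i. p i = V i P" using assms(1) by blast
  then obtain q where q: "\<And>i. i \<in> gt_index k \<Longrightarrow> q i \<in> M i" "\<And>i. i \<in> gt_index k \<Longrightarrow> p i = V i (q i)" by metis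
  have z: "(\<Sum>i\<in>gt_index k. V i (q i) x) = 0" for x
  proof -
    have "(\<Sum>i\<in>gt_index k. V i (q i) x) = sum p (gt_index k) x"
      unfolding sum_pf_apply by (rule sum.cong[OF refl]) (simp only: q(2))
    then show ?thesis unfolding assms(2) by simp
  qed
  have "q i = (\<lambda>x. 0)" by (rule decomposition_unique[OF m3 s1 sm q(1) z assms(3)])
  then have "q i = 0" by (intro ext) simp
  then show ?thesis using q(2)[OF assms(3)] V_zero by simp
qed

lemma W_decompose:
  assumes "F \<in> monog m s k"
  obtains p where "\<And>i. i \<in> gt_index k \<Longrightarrow> p i \<in> W i" "F = sum p (gt_index k)"
proof -
  obtain q where q: "\<And>i. i \<in> gt_index k \<Longrightarrow> q i \<in> M i" "F = (\<lambda>x. \<Sum>i\<in>gt_index k. V i (q i) x)"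
    using decomposition_exists[OF m3 s1 sm assms] by blast
  show ?thesis
  proof (rule that[of "\<lambda>i. V i (q i)"])
    show "V i (q i) \<in> W i" if "i \<in> gt_index k" for i using q(1)[OF that] by blast
    show "F = (\<Sum>i\<in>gt_index k. V i (q i))" unfolding q(2) by (rule ext) (simp only: sum_pf_apply)
  qed
qed

text \<open>Invariant subspaces are pulled back along V to the module below; the sign
  \<open>twist\<close> is a scalar and does not affect them.\<close>

lemma W_irreducible:
  assumes irr: "pin_irred (m - 1) (gt_grade (fst i) s) (snd i)" and i: "i \<in> gt_index k"
    and X: "psubspace X" "X \<subseteq> W i" "reflect_inv m (m - 1) X"
  shows "X = {0} \<or> X = W i"
proof -
  let ?Y = "{P \<in> M i. V i P \<in> X}"
  note sX = psubspaceD[OF X(1)]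
  have "psubspace ?Y"
    unfolding psubspace_iff_subspace pfvs.subspace_def
  proof (intro conjI ballI allI)
    show "0 \<in> ?Y" using M_subD(1) sX(1) by (simp only: mem_Collect_eq V_zero simp_thms)
  next
    fix P Q assume "P \<in> ?Y" "Q \<in> ?Y"
    then have P: "P \<in> M i" "Q \<in> M i" "V i P \<in> X" "V i Q \<in> X" by blast+
    show "P + Q \<in> ?Y" unfolding mem_Collect_eq V_add[OF P(1,2)] by (rule conjI[OF M_subD(2)[OF P(1,2)] sX(2)[OF P(3,4)]])
  next
    fix c P assume "P \<in> ?Y"
    then have P: "P \<in> M i" "V i P \<in> X" by blast+
    show "pscale c P \<in> ?Y" unfolding mem_Collect_eq V_pscale[OF P(1)] by (rule conjI[OF M_subD(3)[OF P(1)] sX(3)[OF P(2)]])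
  qed
  moreover have "reflect_inv (m - 1) (m - 1) ?Y"
    unfolding reflect_inv_def
  proof (intro ballI)
    fix u P assume u: "u \<in> unit_vecs (m - 1)" and P: "P \<in> ?Y"
    then have PM: "P \<in> M i" by blast
    have "pscale (twist k i) (H_act m [u] (V i P)) \<in> X" using sX(3) X(3) u P unfolding reflect_inv_def by blast
    then have "V i (H_act (m - 1) [u] P) \<in> X" unfolding V_H[OF PM u] pscale_pscale by simp
    then show "H_act (m - 1) [u] P \<in> ?Y" using H_M[OF PM u] by blast
  qed
  ultimately have Y: "?Y = {0} \<or> ?Y = M i" using irr unfolding pin_irred_def by blast
  have XY: "X = V i ` ?Y" using X(2) by blast
  from Y show ?thesis
  proof
    assume e: "?Y = {0}"
    have "X = V i ` {0}" using XY unfolding e .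
    then have "X = {0}" by (simp only: image_insert image_empty V_zero)
    then show ?thesis by (rule disjI1)
  next
    assume e: "?Y = M i"
    show ?thesis using XY unfolding e by blast
  qed
qed

text \<open>f induces a map g between the modules below that commutes with the action up to the
  product of the two signs. For equal degrees the grades are neighbours and the product is -1, so
  parity excludes g; otherwise g goes from the larger degree to the smaller, and the weights exclude
  it.\<close>

lemma W_inequivalent_le:
  assumes i: "i \<in> gt_index k" and j: "j \<in> gt_index k" and ij: "i \<noteq> j" "snd j \<le> snd i" and nz: "W i \<noteq> {0}"
    and f: "bij_betw f (W i) (W j)"
    and fc: "\<And>a c. a \<in> W i \<Longrightarrow> f (pscale c a) = pscale c (f a)"
    and fH: "\<And>u a. u \<in> unit_vecs (m - 1) \<Longrightarrow> a \<in> W i \<Longrightarrow> f (H_act m [u] a) = H_act m [u] (f a)"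
  shows False
proof -
  define g where "g = (\<lambda>a. inv_into (M j) (V j) (f (V i a)))"
  have fW: "f (V i a) \<in> W j" if "a \<in> M i" for a using bij_betwE[OF f] that by blast
  have g: "g a \<in> M j" "V j (g a) = f (V i a)" if "a \<in> M i" for a
    unfolding g_def by (rule inv_into_into[OF fW[OF that]], rule f_inv_into_f[OF fW[OF that]])
  have V_eqI: "a = b" if "a \<in> M j" "b \<in> M j" "V j a = V j b" for a b using inj_onD[OF V_inj[OF j]] that by blast
  have ginj: "inj_on g (M i)"
  proof (rule inj_onI)
    fix a b assume ab: "a \<in> M i" "b \<in> M i" "g a = g b"
    then have "f (V i a) = f (V i b)" using g(2) by metis
    then have "V i a = V i b" using bij_betw_imp_inj_on[OF f] ab by (metis imageI inj_onD)
    then show "a = b" using inj_onD[OF V_inj[OF i]] ab by blast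
  qed
  have gc: "g (pscale c a) = pscale c (g a)" if a: "a \<in> M i" for a c
  proof (rule V_eqI)
    show "g (pscale c a) \<in> M j" by (rule g(1)[OF M_subD(3)[OF a]])
    show "pscale c (g a) \<in> M j" by (rule M_subD(3)[OF g(1)[OF a]])
    show "V j (g (pscale c a)) = V j (pscale c (g a))"
      unfolding g(2)[OF M_subD(3)[OF a]] V_pscale[OF a] V_pscale[OF g(1)[OF a]] g(2)[OF a] by (rule fc[OF imageI[OF a]])
  qed
  have gH: "g (H_act (m - 1) [u] a) = pscale (twist k i * twist k j) (H_act (m - 1) [u] (g a))"
    if u: "u \<in> unit_vecs (m - 1)" and a: "a \<in> M i" for u a
  proof (rule V_eqI)
    note Ha = H_M[OF a u] and Hg = H_M[OF g(1)[OF a] u]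
    show "g (H_act (m - 1) [u] a) \<in> M j" by (rule g(1)[OF Ha])
    show "pscale (twist k i * twist k j) (H_act (m - 1) [u] (g a)) \<in> M j" by (rule M_subD(3)[OF Hg])
    have "pscale (twist k j) (V j (H_act (m - 1) [u] (g a))) = H_act m [u] (f (V i a))"
      unfolding V_H[OF g(1)[OF a] u, symmetric] g(2)[OF a] ..
    also have "\<dots> = f (pscale (twist k i) (V i (H_act (m - 1) [u] a)))"
      unfolding fH[OF u imageI[OF a], symmetric] V_H[OF a u] ..
    also have "\<dots> = pscale (twist k i) (V j (g (H_act (m - 1) [u] a)))"
      unfolding fc[OF imageI[OF Ha]] g(2)[OF Ha] ..
    finally have "pscale (twist k i) (pscale (twist k j) (V j (H_act (m - 1) [u] (g a)))) = pscale (twist k i) (pscale (twist k i) (V j (g (H_act (m - 1) [u] a))))"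
      by (rule arg_cong)
    then show "V j (g (H_act (m - 1) [u] a)) = V j (pscale (twist k i * twist k j) (H_act (m - 1) [u] (g a)))"
      unfolding V_pscale[OF Hg] pscale_pscale by simp
  qed
  have "\<exists>P\<in>M i. P \<noteq> 0"
  proof (rule ccontr)
    assume "\<not> ?thesis"
    then have "M i = {0}" using M_subD(1) by blast
    then have "W i = {0}" using V_zero by simp
    then show False using nz by blast
  qed
  then obtain P where P: "P \<in> M i" "P \<noteq> 0" by blast
  show False
  proof (cases "snd i = snd j")
    case True
    then have ne: "fst i = (\<not> fst j)" using ij(1) True by (cases i; cases j) auto
    then have e: "twist k i * twist k j = -1" using True by (cases "fst j") (auto simp: twist_def)
    have t: "gt_grade (fst i) s = Suc (gt_grade (fst j) s) \<or> gt_grade (fst j) s = Suc (gt_grade (fst i) s)"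
      using ne s1 by (cases "fst j") (auto simp: gt_grade_def)
    have n1: "1 \<le> m - 1" using m3 by simp
    show False
      by (rule no_intertwiner_parity[OF n1 t, of "snd j" g P])
        (use g(1) ginj gc gH P in \<open>simp_all only: True e simp_thms\<close>)
  next
    case False
    then have lt: "snd j < snd i" using ij(2) by simp
    \<comment> \<open>In positive degree the grades 0 and m - 1 have only the zero function, against
      P \<noteq> 0; so the weight vectors of this grade are available.\<close>
    have t: "1 \<le> gt_grade (fst i) s \<and> gt_grade (fst i) s \<le> (m - 1) - 1"
    proof -
      have "gt_grade (fst i) s \<noteq> 0" using monog_0_vanish[of P "m - 1" "snd i"] P lt by (metis gr_zeroI not_less0)
      moreover have "gt_grade (fst i) s \<noteq> m - 1" using monog_n_vanish[of P "m - 1" "snd i"] P lt by (metis gr_zeroI not_less0)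
      moreover have "gt_grade (fst i) s \<le> m - 1" using sm by (auto simp: gt_grade_def)
      ultimately show ?thesis by linarith
    qed
    have n2: "2 \<le> m - 1" using m3 by simp
    have e: "twist k i * twist k j \<noteq> 0" by simp
    show False
      by (rule no_intertwiner_weight[OF n2 _ _ g(1) ginj gc gH e]) (use t lt in simp_all)
  qed
qed

text \<open>If the degree of j exceeds that of i, the inverse of f goes from the larger degree to
  the smaller.\<close>

lemma W_inequivalent:
  assumes i: "i \<in> gt_index k" and j: "j \<in> gt_index k" and ij: "i \<noteq> j" and nz: "W i \<noteq> {0}"
    and f: "bij_betw f (W i) (W j)"
    and fc: "\<And>a c. a \<in> W i \<Longrightarrow> f (pscale c a) = pscale c (f a)"
    and fH: "\<And>u a. u \<in> unit_vecs (m - 1) \<Longrightarrow> a \<in> W i \<Longrightarrow> f (H_act m [u] a) = H_act m [u] (f a)"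
  shows False
proof (cases "snd j \<le> snd i")
  case True
  show False by (rule W_inequivalent_le[OF i j ij True nz f fc fH])
next
  case False
  let ?h = "inv_into (W i) f"
  have hb: "bij_betw ?h (W j) (W i)" by (rule bij_betw_inv_into[OF f])
  have hf: "?h (f a) = a" if "a \<in> W i" for a by (rule inv_into_f_f[OF bij_betw_imp_inj_on[OF f] that])
  have ex: "\<exists>a\<in>W i. b = f a" if "b \<in> W j" for b using bij_betw_imp_surj_on[OF f] that by blast
  have f0: "f 0 = 0" using fc[OF psubspaceD(1)[OF W_sub], of 0] by simp
  show False
  proof (rule W_inequivalent_le[OF j i ij[symmetric] _ _ hb])
    show "snd i \<le> snd j" using False by simp
    show "W j \<noteq> {0}"
    proof
      assume "W j = {0}"
      then have "f a = 0" if "a \<in> W i" for a using bij_betwE[OF f] that by blast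
      then have "W i \<subseteq> {0}" using hf f0 psubspaceD(1)[OF W_sub] by (metis singletonI subsetI)
      then show False using nz psubspaceD(1)[OF W_sub] by blast
    qed
  next
    fix b c assume "b \<in> W j"
    then obtain a where a: "a \<in> W i" "b = f a" using ex by blast
    show "?h (pscale c b) = pscale c (?h b)"
      unfolding a(2) fc[OF a(1), symmetric] hf[OF a(1)] hf[OF psubspaceD(3)[OF W_sub a(1)]] ..
  next
    fix u b assume u: "u \<in> unit_vecs (m - 1)" and "b \<in> W j"
    then obtain a where a: "a \<in> W i" "b = f a" using ex by blast
    have Ha: "H_act m [u] a \<in> W i" using W_inv[of i] u a(1) unfolding reflect_inv_def by blast
    show "?h (H_act m [u] b) = H_act m [u] (?h b)"
      unfolding a(2) fH[OF u a(1), symmetric] hf[OF a(1)] hf[OF Ha] ..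
  qed
qed

lemma component_contained:
  assumes irr: "\<And>i. i \<in> gt_index k \<Longrightarrow> pin_irred (m - 1) (gt_grade (fst i) s) (snd i)"
    and U: "psubspace U" "reflect_inv m (m - 1) U"
    and p: "\<And>i. i \<in> gt_index k \<Longrightarrow> p i \<in> W i" "sum p (gt_index k) \<in> U" "i \<in> gt_index k" "p i \<noteq> 0"
  shows "W i \<subseteq> U"
proof -
  let ?G = "(\<lambda>u. H_act m [u]) ` unit_vecs (m - 1)"
  have um: "u \<in> unit_vecs m" if "u \<in> unit_vecs (m - 1)" for u using that unit_vecs_mono[of "m - 1" m] by auto
  show ?thesis
  proof (rule multiplicity_free_submodule[of "gt_index k" W ?G U p i])
    show "finite (gt_index k)" by simp
    show "psubspace (W i)" for i by (rule W_sub)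
    show "q i = 0" if "\<And>i. i \<in> gt_index k \<Longrightarrow> q i \<in> W i" "sum q (gt_index k) = 0" "i \<in> gt_index k" for q i
      by (rule W_direct[OF that])
    show "g w \<in> W i" if "g \<in> ?G" "w \<in> W i" for g i w using that W_inv[of i] unfolding reflect_inv_def by blast
    show "g (sum q (gt_index k)) = (\<Sum>i\<in>gt_index k. g (q i))" if "g \<in> ?G" for g and q :: "bool \<times> nat \<Rightarrow> pf"
      using that H_act_sum[OF um] by blast
    show "g 0 = 0" if "g \<in> ?G" for g
    proof -
      from that obtain u where u: "u \<in> unit_vecs (m - 1)" "g = H_act m [u]" by blast
      show ?thesis unfolding u(2) using H_act_pscale[OF um[OF u(1)], of 0 0] by simp
    qed
    show "X = {0} \<or> X = W i" if "i \<in> gt_index k" "psubspace X" "X \<subseteq> W i" "\<And>g w. g \<in> ?G \<Longrightarrow> w \<in> X \<Longrightarrow> g w \<in> X" for i X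
      by (rule W_irreducible[OF irr[OF that(1)] that(1,2,3)]) (use that(4) in \<open>auto simp: reflect_inv_def\<close>)
    show False if "i \<in> gt_index k" "j \<in> gt_index k" "i \<noteq> j" "W i \<noteq> {0}" "bij_betw f (W i) (W j)"
      "\<And>a b. a \<in> W i \<Longrightarrow> b \<in> W i \<Longrightarrow> f (a + b) = f a + f b"
      "\<And>a c. a \<in> W i \<Longrightarrow> f (pscale c a) = pscale c (f a)"
      "\<And>g a. g \<in> ?G \<Longrightarrow> a \<in> W i \<Longrightarrow> f (g a) = g (f a)" for i j f
      by (rule W_inequivalent[OF that(1-5) that(7)]) (use that(8) in auto)
    show "psubspace U" by (rule U(1))
    show "g u \<in> U" if "g \<in> ?G" "u \<in> U" for g u using that U(2) unfolding reflect_inv_def by blast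
  qed (use p in auto)
qed

lemma contains_bottom:
  assumes irr: "\<And>i. i \<in> gt_index k \<Longrightarrow> pin_irred (m - 1) (gt_grade (fst i) s) (snd i)"
    and U: "psubspace U" "U \<subseteq> monog m s k" "U \<noteq> {0}" "reflect_inv m m U"
  shows "W (False, 0) \<subseteq> U \<and> W (False, 0) \<noteq> {0}"
proof -
  have U': "reflect_inv m (m - 1) U" using U(4) unit_vecs_mono[of "m - 1" m] unfolding reflect_inv_def by auto
  let ?i0 = "(False, 0)"
  have i0: "?i0 \<in> gt_index k" by simp
  show ?thesis
  proof (rule ccontr)
    assume n: "\<not> ?thesis"
    have ax: "cl_mult m (cl_e m) (F x) = cl_smul (- ((-1)^s)) (cl_mult m (F x) (cl_e m))"
      if F: "F \<in> U" and x: "\<And>i. i \<in> {1..m-1} \<Longrightarrow> x i = 0" for F x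
    proof -
      obtain p where p: "\<And>i. i \<in> gt_index k \<Longrightarrow> p i \<in> W i" "F = sum p (gt_index k)"
        using W_decompose[of F] F U(2) by blast
      \<comment> \<open>By \<open>component_contained\<close> a nonzero component here would put the
        whole of this nonzero W into U.\<close>
      have p0: "p ?i0 = 0"
      proof (rule ccontr)
        assume nz: "p ?i0 \<noteq> 0"
        have "sum p (gt_index k) \<in> U" using F p(2) by blast
        from component_contained[OF irr U(1) U' p(1) this i0 nz] have "W ?i0 \<subseteq> U" .
        moreover have "W ?i0 \<noteq> {0}" using p(1)[OF i0] nz by blast
        ultimately show False using n by blast
      qed
      have pi: "cl_mult m (cl_e m) (p i x) = cl_smul (- ((-1)^s)) (cl_mult m (p i x) (cl_e m))" if i: "i \<in> gt_index k" for i
      proof (cases "i = ?i0")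
        case True
        show ?thesis unfolding True p0 by simp
      next
        case False
        obtain P where P: "P \<in> M i" "p i = V i P" using p(1)[OF i] by blast
        have b: "fst i \<or> 0 < snd i" using False by (cases i) auto
        show ?thesis
          unfolding P(2) gt_embed_def using gt_map_axis[OF m3 P(1) x b] gt_grade_ok(2)[OF m3 s1 sm, of "fst i"] by simp
      qed
      show ?thesis
        unfolding p(2) sum_pf_apply cl_mult_sum_left cl_mult_sum_right cl_smul_sum
        by (rule sum.cong[OF refl]) (rule pi)
    qed
    have "F = 0" if "F \<in> U" for F by (rule axis_vanishing[OF m3 s1 sm U(2,4) _ that]) (rule ax; blast)
    then show False using U(1,3) psubspaceD(1)[OF U(1)] by blast
  qed
qed

lemma pin_irred_step:
  assumes irr: "\<And>i. i \<in> gt_index k \<Longrightarrow> pin_irred (m - 1) (gt_grade (fst i) s) (snd i)"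
  shows "pin_irred m s k"
  unfolding pin_irred_def
proof (intro allI impI)
  fix U assume U: "psubspace U" "U \<subseteq> monog m s k" "reflect_inv m m U"
  show "U = {0} \<or> U = monog m s k"
  proof (rule ccontr)
    assume n: "\<not> ?thesis"
    obtain Z where Z: "psubspace Z" "Z \<subseteq> monog m s k" "Z \<noteq> {0}" "reflect_inv m m Z" "Z \<inter> U \<subseteq> {0}"
      using orthogonal_complement[OF U(1,2) _ U(3) refl] n by blast
    have "W (False, 0) \<subseteq> Z" using contains_bottom[OF irr Z(1-4)] by blast
    moreover have "W (False, 0) \<subseteq> U" "W (False, 0) \<noteq> {0}" using contains_bottom[OF irr U(1,2) _ U(3)] n by blast+
    moreover have "0 \<in> W (False, 0)" by (rule psubspaceD(1)[OF W_sub])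
    ultimately show False using Z(5) by blast
  qed
qed

end

text \<open>The restriction step needs a grade strictly between 0 and n. The two extreme grades,
  which occur among the components below, are therefore treated directly in every dimension; for n =
  2 only grade 1 remains.\<close>

lemma pin_irred_all: "2 \<le> n \<Longrightarrow> s \<le> n \<Longrightarrow> pin_irred n s k"
proof (induction n arbitrary: s k rule: less_induct)
  case (less n)
  show ?case
  proof (cases "s = 0 \<or> s = n")
    case True
    then show ?thesis by (rule pin_irred_extreme)
  next
    case False
    show ?thesis
    proof (cases "n = 2")
      case True
      then have "s = 1" using False less.prems by simp
      then show ?thesis using pin_irred_2_1 True by simp
    next
      case n2: False
      have n: "3 \<le> n" "1 \<le> s" "s \<le> n - 1" using n2 False less.prems by auto
      show ?thesis
      proof (rule restriction.pin_irred_step[OF restriction.intro[OF n]])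
        fix i
        show "pin_irred (n - 1) (gt_grade (fst i) s) (snd i)"
          by (rule less.IH) (use n in \<open>auto simp: gt_grade_def\<close>)
      qed
    qed
  qed
qed

section \<open>Gelfand--Tsetlin pieces\<close>

lemma pspan1_eq: "pspan1 v = range (\<lambda>c. pscale c v)"
  unfolding pspan1_def pscale_eq by blast

lemma pspan1_self: "v \<in> pspan1 v"
  unfolding pspan1_eq by (rule range_eqI[of _ _ 1]) simp

lemma pline_pscale: "pline L \<Longrightarrow> P \<in> L \<Longrightarrow> pscale c P \<in> L"
  unfolding pline_def pspan1_eq by (auto simp: pscale_pscale)

lemma psubspace_pscale: "psubspace X \<Longrightarrow> P \<in> X \<Longrightarrow> pscale c P \<in> X"
  by (rule psubspaceD(3))

lemma gt_pieces_lines: "L \<in> gt_pieces n i W \<Longrightarrow> pline L \<and> L \<subseteq> W"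
proof (induction n i W arbitrary: L rule: gt_pieces.induct)
  case (3 n W)
  then show ?case by (auto split: if_splits)
next
  case (4 n i W)
  then show ?case unfolding gt_pieces.simps by blast
qed simp_all

text \<open>Some of the modules vanish. As the zero module has no pieces, unions may run over all
  indices nevertheless.\<close>

lemma gt_pieces_zero: "gt_pieces n i {0} = {}"
proof -
  have "L \<notin> gt_pieces n i {0}" for L
  proof
    assume "L \<in> gt_pieces n i {0}"
    from gt_pieces_lines[OF this] obtain v where "v \<noteq> 0" "L = pspan1 v" "L \<subseteq> {0}" unfolding pline_def by blast
    then show False using pspan1_self[of v] by blast
  qed
  then show ?thesis by blast
qed

section \<open>Transport of the pieces along the embeddings\<close>

context restriction
begin

lemma V_eqI: "i \<in> gt_index k \<Longrightarrow> P \<in> M i \<Longrightarrow> Q \<in> M i \<Longrightarrow> V i P = V i Q \<Longrightarrow> P = Q"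
  using inj_onD[OF V_inj] by blast

lemma V_mem_image: "i \<in> gt_index k \<Longrightarrow> X \<subseteq> M i \<Longrightarrow> P \<in> M i \<Longrightarrow> V i P \<in> V i ` X \<longleftrightarrow> P \<in> X"
  using V_eqI by blast

lemma V_image_eq: "i \<in> gt_index k \<Longrightarrow> X \<subseteq> M i \<Longrightarrow> Y \<subseteq> M i \<Longrightarrow> V i ` X = V i ` Y \<longleftrightarrow> X = Y"
  by (rule inj_on_image_eq_iff[OF V_inj])

lemma V_pspan1:
  assumes "v \<in> M i"
  shows "V i ` pspan1 v = pspan1 (V i v)"
  unfolding pspan1_eq image_image V_pscale[OF assms] ..

lemma pspan1_M: "v \<in> M i \<Longrightarrow> pspan1 v \<subseteq> M i"
  unfolding pspan1_eq using M_subD(3) by blast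

lemma V_eq_zero: "i \<in> gt_index k \<Longrightarrow> P \<in> M i \<Longrightarrow> V i P = 0 \<longleftrightarrow> P = 0"
  using V_eqI[of i P 0] M_subD(1) V_zero by auto

lemma V_pline:
  assumes i: "i \<in> gt_index k" and X: "X \<subseteq> M i"
  shows "pline (V i ` X) \<longleftrightarrow> pline X"
proof
  assume "pline (V i ` X)"
  then obtain w where w: "w \<noteq> 0" "V i ` X = pspan1 w" unfolding pline_def by blast
  then obtain v where v: "v \<in> X" "w = V i v" using pspan1_self[of w] by blast
  have vM: "v \<in> M i" using v(1) X by blast
  have "V i ` X = V i ` pspan1 v" unfolding V_pspan1[OF vM] w(2) v(2) ..
  then have "X = pspan1 v" using V_image_eq[OF i X pspan1_M[OF vM]] by blast
  moreover have "v \<noteq> 0" using w(1) v(2) V_zero by metis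
  ultimately show "pline X" unfolding pline_def by blast
next
  assume "pline X"
  then obtain v where v: "v \<noteq> 0" "X = pspan1 v" unfolding pline_def by blast
  have vM: "v \<in> M i" using X pspan1_self[of v] v(2) by blast
  have "V i v \<noteq> 0" using V_eq_zero[OF i vM] v(1) by blast
  then show "pline (V i ` X)" unfolding pline_def v(2) V_pspan1[OF vM] by blast
qed

lemma V_psubspace:
  assumes i: "i \<in> gt_index k" and X: "X \<subseteq> M i"
  shows "psubspace (V i ` X) \<longleftrightarrow> psubspace X"
proof -
  have m: "P \<in> X \<longleftrightarrow> V i P \<in> V i ` X" if "P \<in> M i" for P using V_mem_image[OF i X that] by blast
  have 1: "0 \<in> V i ` X \<longleftrightarrow> 0 \<in> X" using m[OF M_subD(1)] unfolding V_zero by blast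
  have 2: "(\<forall>x\<in>V i ` X. \<forall>y\<in>V i ` X. x + y \<in> V i ` X) \<longleftrightarrow> (\<forall>P\<in>X. \<forall>Q\<in>X. P + Q \<in> X)"
    unfolding ball_simps
  proof (intro iffI ballI)
    fix P Q assume h: "\<forall>x\<in>X. \<forall>y\<in>X. V i x + V i y \<in> V i ` X" and P: "P \<in> X" "Q \<in> X"
    then have M: "P \<in> M i" "Q \<in> M i" using X by auto
    have "V i (P + Q) \<in> V i ` X" unfolding V_add[OF M] using h P by blast
    then show "P + Q \<in> X" using m[OF M_subD(2)[OF M]] by blast
  next
    fix P Q assume h: "\<forall>P\<in>X. \<forall>Q\<in>X. P + Q \<in> X" and P: "P \<in> X" "Q \<in> X"
    then have M: "P \<in> M i" "Q \<in> M i" using X by auto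
    show "V i P + V i Q \<in> V i ` X" unfolding V_add[OF M, symmetric] using h P by blast
  qed
  have 3: "(\<forall>c. \<forall>x\<in>V i ` X. pscale c x \<in> V i ` X) \<longleftrightarrow> (\<forall>c. \<forall>P\<in>X. pscale c P \<in> X)"
    unfolding ball_simps
  proof (intro iffI ballI allI)
    fix c P assume h: "\<forall>c. \<forall>x\<in>X. pscale c (V i x) \<in> V i ` X" and P: "P \<in> X"
    then have M: "P \<in> M i" using X by auto
    have "V i (pscale c P) \<in> V i ` X" unfolding V_pscale[OF M] using h P by blast
    then show "pscale c P \<in> X" using m[OF M_subD(3)[OF M]] by blast
  next
    fix c P assume h: "\<forall>c. \<forall>P\<in>X. pscale c P \<in> X" and P: "P \<in> X"
    then have M: "P \<in> M i" using X by auto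
    show "pscale c (V i P) \<in> V i ` X" unfolding V_pscale[OF M, symmetric] using h P by blast
  qed
  show ?thesis unfolding psubspace_def pscale_eq 1 2 3 ..
qed

lemma V_H_list:
  "us \<in> lists (unit_vecs (m - 1)) \<Longrightarrow> P \<in> M i \<Longrightarrow>
    H_act (m - 1) us P \<in> M i \<and> (i \<in> gt_index k \<longrightarrow> H_act m us (V i P) = pscale (twist k i ^ length us) (V i (H_act (m - 1) us P)))"
proof (induction us)
  case Nil
  have "H_act (m - 1) [] P = P" by (rule H_act_Nil[OF monogD(1)[OF Nil(2)] monogD(3)[OF Nil(2)]])
  moreover have "H_act m [] (V i P) = V i P" if i: "i \<in> gt_index k"
  proof -
    have "V i P \<in> monog m s k" using W_monog[OF i] Nil(2) by blast
    from H_act_Nil[OF monogD(1)[OF this] monogD(3)[OF this]] show ?thesis .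
  qed
  ultimately show ?case using Nil(2) by simp
next
  case (Cons u us)
  have u: "u \<in> unit_vecs (m - 1)" "us \<in> lists (unit_vecs (m - 1))" using Cons.prems(1) by simp_all
  have um: "u \<in> unit_vecs m" using u(1) unit_vecs_mono[of "m - 1" m] by auto
  let ?Q = "H_act (m - 1) us P"
  have Q: "?Q \<in> M i" using Cons.IH[OF u(2) Cons.prems(2)] by blast
  have c1: "H_act (m - 1) (u # us) P = H_act (m - 1) [u] ?Q" by (rule H_act_Cons[OF u(1)])
  have "H_act m (u # us) (V i P) = pscale (twist k i ^ length (u # us)) (V i (H_act (m - 1) (u # us) P))" if i: "i \<in> gt_index k"
  proof -
    have "H_act m (u # us) (V i P) = H_act m [u] (H_act m us (V i P))" by (rule H_act_Cons[OF um])
    also have "H_act m us (V i P) = pscale (twist k i ^ length us) (V i ?Q)" using Cons.IH[OF u(2) Cons.prems(2)] i by blast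
    also have "H_act m [u] \<dots> = pscale (twist k i ^ length us) (pscale (twist k i) (V i (H_act (m - 1) [u] ?Q)))"
      by (simp only: H_act_pscale[OF um] V_H[OF Q u(1)])
    finally show ?thesis unfolding c1 pscale_pscale by (simp add: mult.commute)
  qed
  then show ?case using H_M[OF Q u(1)] unfolding c1 by blast
qed

text \<open>A list of unit vectors passes through V up to the sign to the power of its length, and
  closure under scalars absorbs this sign.\<close>

lemma V_invariant:
  assumes i: "i \<in> gt_index k" and X: "X \<subseteq> M i" "\<And>c P. P \<in> X \<Longrightarrow> pscale c P \<in> X" and G: "G \<subseteq> lists (unit_vecs (m - 1))"
  shows "invariant m G (V i ` X) \<longleftrightarrow> invariant (m - 1) G X"
proof -
  have "H_act m us (V i P) \<in> V i ` X \<longleftrightarrow> H_act (m - 1) us P \<in> X" if us: "us \<in> G" and P: "P \<in> X" for us P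
  proof -
    have us': "us \<in> lists (unit_vecs (m - 1))" and PM: "P \<in> M i" using us P G X(1) by auto
    let ?c = "twist k i ^ length us" and ?Q = "H_act (m - 1) us P"
    have Q: "?Q \<in> M i" and e: "H_act m us (V i P) = V i (pscale ?c ?Q)"
      using V_H_list[OF us' PM] i V_pscale by simp_all
    have cc: "pscale ?c (pscale ?c ?Q) = ?Q" unfolding pscale_pscale by (simp flip: power_mult_distrib)
    have "V i (pscale ?c ?Q) \<in> V i ` X \<longleftrightarrow> pscale ?c ?Q \<in> X" by (rule V_mem_image[OF i X(1) M_subD(3)[OF Q]])
    also have "\<dots> \<longleftrightarrow> ?Q \<in> X" using X(2)[of "pscale ?c ?Q" ?c] X(2)[of ?Q ?c] unfolding cc by blast
    finally show ?thesis unfolding e .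
  qed
  then show ?thesis unfolding invariant_def by blast
qed

lemma sub_image:
  assumes "U \<subseteq> V i ` X"
  obtains Y where "Y \<subseteq> X" "U = V i ` Y"
  using assms by (metis subset_imageE)

lemma V_irred:
  assumes i: "i \<in> gt_index k" and X: "X \<subseteq> M i" and G: "G \<subseteq> lists (unit_vecs (m - 1))"
  shows "irred m G (V i ` X) \<longleftrightarrow> irred (m - 1) G X"
proof -
  have z: "V i ` Y = {0} \<longleftrightarrow> Y = {0}" if "Y \<subseteq> M i" for Y
  proof -
    have "V i ` {0} = {0}" by (simp only: image_insert image_empty V_zero)
    then show ?thesis using V_image_eq[OF i that, of "{0}"] M_subD(1) by auto
  qed
  have pi: "psubspace (V i ` Y) \<and> invariant m G (V i ` Y) \<longleftrightarrow> psubspace Y \<and> invariant (m - 1) G Y"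
    if Y: "Y \<subseteq> M i" for Y
    using V_psubspace[OF i Y] V_invariant[OF i Y psubspace_pscale G] by blast
  have all: "(\<forall>U. psubspace U \<and> invariant m G U \<and> U \<subseteq> V i ` X \<longrightarrow> U = {0} \<or> U = V i ` X)
    \<longleftrightarrow> (\<forall>Y. psubspace Y \<and> invariant (m - 1) G Y \<and> Y \<subseteq> X \<longrightarrow> Y = {0} \<or> Y = X)"
  proof (intro iffI allI impI)
    fix Y assume h: "\<forall>U. psubspace U \<and> invariant m G U \<and> U \<subseteq> V i ` X \<longrightarrow> U = {0} \<or> U = V i ` X"
      and Y: "psubspace Y \<and> invariant (m - 1) G Y \<and> Y \<subseteq> X"
    have YM: "Y \<subseteq> M i" using Y X by blast
    have "psubspace (V i ` Y) \<and> invariant m G (V i ` Y)" using pi[OF YM] Y by blast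
    then have "V i ` Y = {0} \<or> V i ` Y = V i ` X" using h Y by blast
    then show "Y = {0} \<or> Y = X" using z[OF YM] V_image_eq[OF i YM X] by blast
  next
    fix U assume h: "\<forall>Y. psubspace Y \<and> invariant (m - 1) G Y \<and> Y \<subseteq> X \<longrightarrow> Y = {0} \<or> Y = X"
      and U: "psubspace U \<and> invariant m G U \<and> U \<subseteq> V i ` X"
    obtain Y where Y: "Y \<subseteq> X" "U = V i ` Y" using sub_image[of U i X] U by blast
    have YM: "Y \<subseteq> M i" using Y X by blast
    have "psubspace Y \<and> invariant (m - 1) G Y" using pi[OF YM] U unfolding Y(2) by blast
    then have "Y = {0} \<or> Y = X" using h Y(1) by blast
    then show "U = {0} \<or> U = V i ` X" unfolding Y(2) z[OF YM] by (rule disj_forward) (simp_all only:)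
  qed
  have conj: "a \<and> p \<and> b \<and> q \<longleftrightarrow> c \<and> p \<and> d \<and> q" if "a \<and> b \<longleftrightarrow> c \<and> d" for a b c d p q
    using that by blast
  show ?thesis unfolding irred_def all z[OF X] by (rule conj[OF pi[OF X]])
qed

text \<open>V preserves and reflects lines, invariance and irreducibility for every smaller group,
  so it carries the whole chain of restrictions along.\<close>

lemma V_gt_pieces:
  assumes i: "i \<in> gt_index k"
  shows "j \<le> m - 1 \<Longrightarrow> X \<subseteq> M i \<Longrightarrow> gt_pieces m j (V i ` X) = (\<lambda>L. V i ` L) ` gt_pieces (m - 1) j X"
proof (induction "m - 1" j X rule: gt_pieces.induct)
  case (3 X)
  have "2 \<le> m - 1" using m3 by simp
  then have G: "spin_lists 2 \<subseteq> lists (unit_vecs (m - 1))"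
    using lists_mono[OF unit_vecs_mono] unfolding spin_lists_def by blast
  have line: "pline L \<and> invariant m (spin_lists 2) (V i ` L) \<longleftrightarrow> pline L \<and> invariant (m - 1) (spin_lists 2) L" if "L \<subseteq> M i" for L
    using V_invariant[OF i that pline_pscale G] by blast
  show ?case
  proof (cases "pline X")
    case True
    then show ?thesis using V_pline[OF i 3(2)] by simp
  next
    case False
    have "{L. pline L \<and> L \<subseteq> V i ` X \<and> invariant m (spin_lists 2) L}
      = (\<lambda>L. V i ` L) ` {L. pline L \<and> L \<subseteq> X \<and> invariant (m - 1) (spin_lists 2) L}"
    proof (intro set_eqI iffI)
      fix L assume "L \<in> {L. pline L \<and> L \<subseteq> V i ` X \<and> invariant m (spin_lists 2) L}"
      then have L: "pline L" "L \<subseteq> V i ` X" "invariant m (spin_lists 2) L" by blast+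
      obtain Y where Y: "Y \<subseteq> X" "L = V i ` Y" using sub_image[OF L(2)] .
      have YM: "Y \<subseteq> M i" using Y 3(2) by blast
      have "pline Y" using V_pline[OF i YM] L(1) unfolding Y(2) by blast
      moreover from this have "invariant (m - 1) (spin_lists 2) Y" using line[OF YM] L(3) unfolding Y(2) by blast
      ultimately show "L \<in> (\<lambda>L. V i ` L) ` {L. pline L \<and> L \<subseteq> X \<and> invariant (m - 1) (spin_lists 2) L}"
        using Y by blast
    next
      fix L assume "L \<in> (\<lambda>L. V i ` L) ` {L. pline L \<and> L \<subseteq> X \<and> invariant (m - 1) (spin_lists 2) L}"
      then obtain Y where Y: "L = V i ` Y" "pline Y" "Y \<subseteq> X" "invariant (m - 1) (spin_lists 2) Y" by blast
      have YM: "Y \<subseteq> M i" using Y 3(2) by blast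
      show "L \<in> {L. pline L \<and> L \<subseteq> V i ` X \<and> invariant m (spin_lists 2) L}"
        using V_pline[OF i YM] line[OF YM] Y by blast
    qed
    then show ?thesis using V_pline[OF i 3(2)] False by (simp only: gt_pieces.simps if_False)
  qed
next
  case (4 j X)
  let ?G = "pin_lists (Suc (Suc j))"
  have G: "?G \<subseteq> lists (unit_vecs (m - 1))"
    unfolding pin_lists_def by (rule lists_mono[OF unit_vecs_mono]) (use 4(2) in simp)
  have IH: "gt_pieces m (Suc (Suc j)) (V i ` Y) = (\<lambda>L. V i ` L) ` gt_pieces (m - 1) (Suc (Suc j)) Y" if "Y \<subseteq> M i" for Y
  proof -
    have "Suc (Suc j) \<le> m - 1" using 4(2) by simp
    then show ?thesis using 4(1) that by blast
  qed
  show ?case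
  proof (intro set_eqI iffI)
    fix L assume "L \<in> gt_pieces m (Suc (Suc (Suc j))) (V i ` X)"
    then obtain W' where W': "L \<in> gt_pieces m (Suc (Suc j)) W'" "irred m ?G W'" "W' \<subseteq> V i ` X"
      unfolding gt_pieces.simps by blast
    obtain Y where Y: "Y \<subseteq> X" "W' = V i ` Y" using sub_image[OF W'(3)] .
    have YM: "Y \<subseteq> M i" using Y 4(3) by blast
    have "irred (m - 1) ?G Y" using V_irred[OF i YM G] W'(2) unfolding Y(2) by blast
    then show "L \<in> (\<lambda>L. V i ` L) ` gt_pieces (m - 1) (Suc (Suc (Suc j))) X"
      using W'(1) Y(1) unfolding Y(2) IH[OF YM] gt_pieces.simps by blast
  next
    fix L assume "L \<in> (\<lambda>L. V i ` L) ` gt_pieces (m - 1) (Suc (Suc (Suc j))) X"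
    then obtain L' Y where Y: "L = V i ` L'" "L' \<in> gt_pieces (m - 1) (Suc (Suc j)) Y" "irred (m - 1) ?G Y" "Y \<subseteq> X"
      unfolding gt_pieces.simps by blast
    have YM: "Y \<subseteq> M i" using Y(4) 4(3) by blast
    have "irred m ?G (V i ` Y)" using V_irred[OF i YM G] Y(3) by blast
    moreover have "L \<in> gt_pieces m (Suc (Suc j)) (V i ` Y)" unfolding IH[OF YM] Y(1) using Y(2) by blast
    ultimately show "L \<in> gt_pieces m (Suc (Suc (Suc j))) (V i ` X)"
      unfolding gt_pieces.simps using Y(4) by blast
  qed
qed simp_all

lemma M_pin_irred: "pin_irred (m - 1) (gt_grade (fst i) s) (snd i)"
  by (rule pin_irred_all) (use m3 sm in \<open>auto simp: gt_grade_def\<close>)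

text \<open>A nonzero X has an element with a nonzero component; \<open>component_contained\<close>
  puts the corresponding W into X, and irreducibility of X gives equality.\<close>

lemma irreducible_pieces:
  "irred m (pin_lists (m - 1)) X \<and> X \<subseteq> monog m s k \<longleftrightarrow> (\<exists>i\<in>gt_index k. X = W i \<and> W i \<noteq> {0})"
proof
  assume X: "irred m (pin_lists (m - 1)) X \<and> X \<subseteq> monog m s k"
  have inv: "reflect_inv m (m - 1) X" using X invariant_iff_reflect_inv[of X m s k "m - 1"] unfolding irred_def by simp
  have X': "psubspace X" "X \<noteq> {0}" using X unfolding irred_def by blast+
  obtain F where F: "F \<in> X" "F \<noteq> 0" using X'(2) psubspaceD(1)[OF X'(1)] by blast
  obtain p where p: "\<And>i. i \<in> gt_index k \<Longrightarrow> p i \<in> W i" "F = sum p (gt_index k)" using W_decompose[of F] F(1) X by blast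
  obtain i where i: "i \<in> gt_index k" "p i \<noteq> 0"
  proof (rule ccontr)
    assume "\<not> thesis"
    then have "F = 0" using that unfolding p(2) by (metis sum.neutral)
    then show False using F(2) by blast
  qed
  have "sum p (gt_index k) \<in> X" using F(1) p(2) by blast
  from component_contained[OF M_pin_irred X'(1) inv p(1) this i] have sub: "W i \<subseteq> X" .
  have nz: "W i \<noteq> {0}" using p(1)[OF i(1)] i(2) by blast
  have "invariant m (pin_lists (m - 1)) (W i)" using W_inv invariant_iff_reflect_inv[OF W_monog[OF i(1)]] by simp
  then have "W i = X" using X W_sub sub nz unfolding irred_def by blast
  then show "\<exists>i\<in>gt_index k. X = W i \<and> W i \<noteq> {0}" using i(1) nz by blast
next
  assume "\<exists>i\<in>gt_index k. X = W i \<and> W i \<noteq> {0}"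
  then obtain i where i: "i \<in> gt_index k" "X = W i" "W i \<noteq> {0}" by blast
  have inv: "invariant m (pin_lists (m - 1)) Y \<longleftrightarrow> reflect_inv m (m - 1) Y" if "Y \<subseteq> W i" for Y
    by (rule invariant_iff_reflect_inv) (use that W_monog[OF i(1)] in auto)
  have "irred m (pin_lists (m - 1)) (W i)"
    unfolding irred_def
  proof (intro conjI allI impI)
    show "psubspace (W i)" by (rule W_sub)
    show "W i \<noteq> {0}" by (rule i(3))
    show "invariant m (pin_lists (m - 1)) (W i)" using W_inv inv[OF order.refl] by blast
  next
    fix U assume U: "psubspace U \<and> invariant m (pin_lists (m - 1)) U \<and> U \<subseteq> W i"
    then show "U = {0} \<or> U = W i" using W_irreducible[OF M_pin_irred i(1), of U] inv[of U] by blast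
  qed
  then show "irred m (pin_lists (m - 1)) X \<and> X \<subseteq> monog m s k" using W_monog[OF i(1)] unfolding i(2) by blast
qed

lemma gt_pieces_monog:
  "gt_pieces m m (monog m s k) = (\<Union>i\<in>gt_index k. (\<lambda>L. V i ` L) ` gt_pieces (m - 1) (m - 1) (M i))"
proof -
  \<comment> \<open>m is written with three successors to match the last equation of
    \<open>gt_pieces\<close>.\<close>
  define j where "j = m - 3"
  have j: "m = Suc (Suc (Suc j))" using m3 unfolding j_def by linarith
  have j': "m - 1 = Suc (Suc j)" using j by simp
  have "gt_pieces m m (monog m s k) = gt_pieces m (Suc (Suc (Suc j))) (monog m s k)" using j by simp
  also have "\<dots> = \<Union> {gt_pieces m (m - 1) X | X. irred m (pin_lists (m - 1)) X \<and> X \<subseteq> monog m s k}"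
    unfolding gt_pieces.simps j' ..
  also have "\<dots> = (\<Union>i\<in>gt_index k. gt_pieces m (m - 1) (W i))"
    unfolding irreducible_pieces
  proof (intro set_eqI iffI)
    fix L assume "L \<in> \<Union> {gt_pieces m (m - 1) X | X. \<exists>i\<in>gt_index k. X = W i \<and> W i \<noteq> {0}}"
    then show "L \<in> (\<Union>i\<in>gt_index k. gt_pieces m (m - 1) (W i))" by blast
  next
    fix L assume "L \<in> (\<Union>i\<in>gt_index k. gt_pieces m (m - 1) (W i))"
    then obtain i where i: "i \<in> gt_index k" "L \<in> gt_pieces m (m - 1) (W i)" by blast
    have "W i \<noteq> {0}" using i(2) gt_pieces_zero[of m "m - 1"] by (metis empty_iff)
    then show "L \<in> \<Union> {gt_pieces m (m - 1) X | X. \<exists>i\<in>gt_index k. X = W i \<and> W i \<noteq> {0}}" using i by blast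
  qed
  also have "\<dots> = (\<Union>i\<in>gt_index k. (\<lambda>L. V i ` L) ` gt_pieces (m - 1) (m - 1) (M i))"
    by (intro SUP_cong refl V_gt_pieces) simp_all
  finally show ?thesis .
qed

lemma W_disjoint:
  assumes "i \<in> gt_index k" "j \<in> gt_index k" "i \<noteq> j" "w \<in> W i" "w \<in> W j"
  shows "w = 0"
proof -
  \<comment> \<open>w in component i and - w in component j add up to 0, so directness forces w =
    0.\<close>
  define p where "p = (\<lambda>x. if x = i then w else if x = j then - w else 0)"
  have pW: "p x \<in> W x" for x
    using assms(4,5) psubspaceD(1)[OF W_sub] psubspaceD(3)[OF W_sub assms(5), of "-1"] unfolding p_def pscale_minus1 by presburger
  have "sum p (gt_index k) = sum p {i, j}"
    by (rule sum.mono_neutral_right) (use assms(1,2) in \<open>auto simp: p_def\<close>)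
  also have "\<dots> = w + - w" using assms(3) not_sym[OF assms(3)] by (simp only: sum.insert finite.intros p_def sum.empty insert_iff empty_iff if_True if_False simp_thms add_0_right)
  also have "\<dots> = 0" by (rule add.right_inverse)
  finally have "p i = 0" by (intro W_direct[OF pW _ assms(1)])
  then show ?thesis unfolding p_def if_P[OF refl] .
qed

text \<open>A nonzero element lies in only one component, so a line in the image of one module meets
  no basis element coming from another; uniqueness is thus inherited from below.\<close>

lemma gt_basis_union:
  assumes B: "\<And>i. i \<in> gt_index k \<Longrightarrow> gt_basis (m - 1) (M i) (C i)"
  shows "gt_basis m (monog m s k) (\<Union>i\<in>gt_index k. V i ` C i)"
proof -
  have C: "b \<noteq> 0" "pspan1 b \<in> gt_pieces (m - 1) (m - 1) (M i)" "b \<in> M i" if "i \<in> gt_index k" "b \<in> C i" for i b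
  proof -
    show "b \<noteq> 0" and p: "pspan1 b \<in> gt_pieces (m - 1) (m - 1) (M i)" using B[OF that(1)] that(2) unfolding gt_basis_def by blast+
    show "b \<in> M i" using gt_pieces_lines[OF p] pspan1_self[of b] by blast
  qed
  show ?thesis
    unfolding gt_basis_def gt_pieces_monog
  proof (intro conjI ballI)
    fix b assume "b \<in> (\<Union>i\<in>gt_index k. V i ` C i)"
    then obtain i c where c: "i \<in> gt_index k" "c \<in> C i" "b = V i c" by blast
    note cM = C[OF c(1,2)]
    show "b \<noteq> 0" unfolding c(3) using V_eq_zero[OF c(1) cM(3)] cM(1) by blast
    show "pspan1 b \<in> (\<Union>i\<in>gt_index k. (\<lambda>L. V i ` L) ` gt_pieces (m - 1) (m - 1) (M i))"
      unfolding c(3) V_pspan1[OF cM(3), symmetric] by (rule UN_I[OF c(1)]) (rule imageI[OF cM(2)])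
  next
    fix L assume "L \<in> (\<Union>i\<in>gt_index k. (\<lambda>L. V i ` L) ` gt_pieces (m - 1) (m - 1) (M i))"
    then obtain i L' where i: "i \<in> gt_index k" and L': "L' \<in> gt_pieces (m - 1) (m - 1) (M i)" "L = V i ` L'" by blast
    have L'M: "L' \<subseteq> M i" using gt_pieces_lines[OF L'(1)] by blast
    have "\<exists>!b. b \<in> C i \<and> b \<in> L'" using B[OF i] L'(1) unfolding gt_basis_def by blast
    then obtain b where b: "b \<in> C i" "b \<in> L'" and bu: "\<And>c. c \<in> C i \<Longrightarrow> c \<in> L' \<Longrightarrow> c = b" by blast
    show "\<exists>!b. b \<in> (\<Union>i\<in>gt_index k. V i ` C i) \<and> b \<in> L"
    proof (rule ex1I[of _ "V i b"])
      show "V i b \<in> (\<Union>i\<in>gt_index k. V i ` C i) \<and> V i b \<in> L" unfolding L'(2) using b i by blast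
    next
      fix c assume c: "c \<in> (\<Union>i\<in>gt_index k. V i ` C i) \<and> c \<in> L"
      then obtain j c' where j: "j \<in> gt_index k" "c' \<in> C j" "c = V j c'" by blast
      note cM = C[OF j(1,2)]
      have c0: "c \<noteq> 0" unfolding j(3) using V_eq_zero[OF j(1) cM(3)] cM(1) by blast
      have "c \<in> W i" "c \<in> W j" using c L'M cM(3) unfolding L'(2) j(3) by blast+
      then have ji: "j = i" using W_disjoint[OF i j(1)] c0 by blast
      have "V i c' \<in> V i ` L'" using conjunct2[OF c] unfolding L'(2) j(3) ji .
      then have "c' \<in> L'" using V_mem_image[OF i L'M] cM(3) unfolding ji by blast
      then have "c' = b" using bu j(2) unfolding ji by blast
      then show "c = V i b" unfolding j(3) ji by simp
    qed
  qed
qed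

end

text \<open>The three parts are k - l zero, odd, and even positive. The conditions 2 j + 1 \<le> k
  and 2 j + 2 \<le> k stand for the floors in the bounds of the unions; they keep the truncated
  subtractions exact and leave the unions empty for small k.\<close>

lemma UN_parity_split:
  "(\<Union>l\<in>{..k}. f l) = f k \<union> (\<Union>j\<in>{j. 2*j+1 \<le> k}. f (k-2*j-1)) \<union> (\<Union>j\<in>{j. 2*j+2 \<le> k}. f (k-2*j-2))" for k :: nat
proof (intro equalityI subsetI)
  fix x assume "x \<in> (\<Union>l\<in>{..k}. f l)"
  then obtain l where l: "l \<le> k" "x \<in> f l" by blast
  consider "l = k" | j where "k - l = 2*j+1" | j where "k - l = 2*j+2"
  proof -
    have "k - l = 0 \<or> (\<exists>j. k - l = 2*j+1) \<or> (\<exists>j. k - l = 2*j+2)" by presburger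
    then show ?thesis using that l(1) by fastforce
  qed
  then show "x \<in> f k \<union> (\<Union>j\<in>{j. 2*j+1 \<le> k}. f (k-2*j-1)) \<union> (\<Union>j\<in>{j. 2*j+2 \<le> k}. f (k-2*j-2))"
  proof cases
    case 1
    then show ?thesis using l by blast
  next
    case (2 j)
    then have "2*j+1 \<le> k" "l = k-2*j-1" using l(1) by linarith+
    then show ?thesis using l(2) by blast
  next
    case (3 j)
    then have "2*j+2 \<le> k" "l = k-2*j-2" using l(1) by linarith+
    then show ?thesis using l(2) by blast
  qed
next
  fix x assume "x \<in> f k \<union> (\<Union>j\<in>{j. 2*j+1 \<le> k}. f (k-2*j-1)) \<union> (\<Union>j\<in>{j. 2*j+2 \<le> k}. f (k-2*j-2))"
  moreover have "k \<le> k" "k-2*j-1 \<le> k" "k-2*j-2 \<le> k" for j by simp_all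
  ultimately show "x \<in> (\<Union>l\<in>{..k}. f l)" by blast
qed

lemma gt_embed_True:
  "gt_embed m s k (True, k) P = rmul_em m P"
  "2*j+1 \<le> k \<Longrightarrow> gt_embed m s k (True, k-2*j-1) P = hatX m (s-1) (k-2*j-1) (2*j+1) P"
  "3 \<le> m \<Longrightarrow> 2*j+2 \<le> k \<Longrightarrow> gt_embed m s k (True, k-2*j-2) P = rmul_em m (hatY m (s-1) (k-2*j-2) (2*j+2) P)"
proof -
  show "gt_embed m s k (True, k) P = rmul_em m P" by (intro ext) (simp add: gt_embed_def gt_map_def gt_op_def gt_grade_def)
  show "gt_embed m s k (True, k-2*j-1) P = hatX m (s-1) (k-2*j-1) (2*j+1) P" if "2*j+1 \<le> k"
  proof -
    have d: "k - (k-2*j-1) = 2*j+1" using that by linarith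
    have o: "odd (2*j+1)" by simp
    show ?thesis unfolding gt_embed_def fst_conv snd_conv gt_grade_def if_True d hatX_eq_gt_op[OF o] gt_map_def using o by simp
  qed
  show "gt_embed m s k (True, k-2*j-2) P = rmul_em m (hatY m (s-1) (k-2*j-2) (2*j+2) P)" if m: "3 \<le> m" and "2*j+2 \<le> k"
  proof -
    have d: "k - (k-2*j-2) = 2*j+2" using that by linarith
    have e: "even (2*j+2)" "2*j+2 \<noteq> 0" by simp_all
    show ?thesis unfolding gt_embed_def fst_conv snd_conv gt_grade_def if_True d hatY_eq_gt_op[OF m e] gt_map_def using e(1) by simp
  qed
qed

lemma gt_embed_False:
  "gt_embed m s k (False, k) P = P"
  "2*j+1 \<le> k \<Longrightarrow> gt_embed m s k (False, k-2*j-1) P = rmul_em m (dotX m s (k-2*j-1) (2*j+1) P)"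
  "3 \<le> m \<Longrightarrow> 2*j+2 \<le> k \<Longrightarrow> gt_embed m s k (False, k-2*j-2) P = dotY m s (k-2*j-2) (2*j+2) P"
proof -
  show "gt_embed m s k (False, k) P = P" by (intro ext) (simp add: gt_embed_def gt_map_def gt_op_def gt_grade_def)
  show "gt_embed m s k (False, k-2*j-1) P = rmul_em m (dotX m s (k-2*j-1) (2*j+1) P)" if "2*j+1 \<le> k"
  proof -
    have d: "k - (k-2*j-1) = 2*j+1" using that by linarith
    have o: "odd (2*j+1)" by simp
    show ?thesis unfolding gt_embed_def fst_conv snd_conv gt_grade_def if_False d dotX_eq_gt_op[OF o] gt_map_def using o by simp
  qed
  show "gt_embed m s k (False, k-2*j-2) P = dotY m s (k-2*j-2) (2*j+2) P" if m: "3 \<le> m" and "2*j+2 \<le> k"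
  proof -
    have d: "k - (k-2*j-2) = 2*j+2" using that by linarith
    have e: "even (2*j+2)" "2*j+2 \<noteq> 0" by simp_all
    show ?thesis unfolding gt_embed_def fst_conv snd_conv gt_grade_def if_False d dotY_eq_gt_op[OF m e] gt_map_def using e(1) by simp
  qed
qed

theorem theorem4:
  fixes m s k :: nat and B :: "nat \<Rightarrow> nat \<Rightarrow> pf set"
  assumes "3 \<le> m" and "1 \<le> s" and "s \<le> m - 1"
    and "\<And>t l. t \<in> {s - 1, s} \<Longrightarrow> l \<le> k \<Longrightarrow> gt_basis (m - 1) (monog (m - 1) t l) (B t l)"
  shows "gt_basis m (monog m s k)
    ((B s k
      \<union> (\<Union>j\<in>{j. 2*j+1 \<le> k}. hatX m (s-1) (k-2*j-1) (2*j+1) ` B (s-1) (k-2*j-1))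
      \<union> (\<Union>j\<in>{j. 2*j+2 \<le> k}. dotY m s (k-2*j-2) (2*j+2) ` B s (k-2*j-2)))
     \<union> (rmul_em m ` B (s-1) k
      \<union> (\<Union>j\<in>{j. 2*j+1 \<le> k}. rmul_em m ` dotX m s (k-2*j-1) (2*j+1) ` B s (k-2*j-1))
      \<union> (\<Union>j\<in>{j. 2*j+2 \<le> k}. rmul_em m ` hatY m (s-1) (k-2*j-2) (2*j+2) ` B (s-1) (k-2*j-2))))"
    (is "gt_basis m _ ?R")
proof -
  interpret restriction m s k by unfold_locales (rule assms)+
  let ?C = "\<lambda>i. B (gt_grade (fst i) s) (snd i)"
  have "gt_basis m (monog m s k) (\<Union>i\<in>gt_index k. gt_embed m s k i ` ?C i)"
  proof (rule gt_basis_union)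
    fix i assume i: "i \<in> gt_index k"
    show "gt_basis (m - 1) (gt_module m s i) (?C i)"
      by (rule assms(4)) (use i in \<open>auto simp: gt_grade_def\<close>)
  qed
  \<comment> \<open>Both families are split by the parity of k - l. The parts without a factor e_m
    make up the set B+ and those with it B-, so what remains is a rearrangement of the
    unions.\<close>
  moreover have "(\<Union>i\<in>gt_index k. gt_embed m s k i ` ?C i) = ?R"
  proof -
    have T: "(\<Union>l\<in>{..k}. gt_embed m s k (True, l) ` B (s-1) l) = rmul_em m ` B (s-1) k
      \<union> (\<Union>j\<in>{j. 2*j+1 \<le> k}. hatX m (s-1) (k-2*j-1) (2*j+1) ` B (s-1) (k-2*j-1))
      \<union> (\<Union>j\<in>{j. 2*j+2 \<le> k}. rmul_em m ` hatY m (s-1) (k-2*j-2) (2*j+2) ` B (s-1) (k-2*j-2))"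
      unfolding UN_parity_split image_image
      by (intro arg_cong2[where f = "(\<union>)"] SUP_cong image_cong refl) (simp_all only: gt_embed_True assms(1) mem_Collect_eq)
    have F: "(\<Union>l\<in>{..k}. gt_embed m s k (False, l) ` B s l) = B s k
      \<union> (\<Union>j\<in>{j. 2*j+1 \<le> k}. rmul_em m ` dotX m s (k-2*j-1) (2*j+1) ` B s (k-2*j-1))
      \<union> (\<Union>j\<in>{j. 2*j+2 \<le> k}. dotY m s (k-2*j-2) (2*j+2) ` B s (k-2*j-2))"
    proof -
      have "gt_embed m s k (False, k) = (\<lambda>P. P)" by (rule ext) (rule gt_embed_False(1))
      then have "gt_embed m s k (False, k) ` B s k = B s k" by simp
      then show ?thesis
        unfolding UN_parity_split image_image
        by (intro arg_cong2[where f = "(\<union>)"] SUP_cong image_cong refl) (simp_all only: gt_embed_False assms(1) mem_Collect_eq)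
    qed
    have "(\<Union>i\<in>gt_index k. gt_embed m s k i ` ?C i) = (\<Union>l\<in>{..k}. gt_embed m s k (True, l) ` B (s-1) l) \<union> (\<Union>l\<in>{..k}. gt_embed m s k (False, l) ` B s l)"
    proof -
      have "gt_index k = Pair True ` {..k} \<union> Pair False ` {..k}" by (auto simp: image_iff)
      then show ?thesis by (simp only: UN_Un UN_simps(10) fst_conv snd_conv gt_grade_def if_True if_False) (simp add: image_image gt_grade_def)?
    qed
    then show ?thesis unfolding T F by (simp only: Un_ac)
  qed
  ultimately show ?thesis by simp
qed

end
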